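(* Let $n\ge3$ and let $\varphi$ be a locally integrable function on $\mathbb{S}^{n-1}\times\mathbb{R}$ satisfying $$\varphi(\theta,t)=\varphi(\theta,-t)=\varphi(-\theta,t)\qquad\text{for all }(\theta,t)\in\mathbb{S}^{n-1}\times\mathbb{R}.$$ Let $$\Phi(\omega,r)=\frac{r^{n-3}\,\pi^{1/2}}{\Gamma((n-1)/2)}\,(\mathcal{M}_\omega R^*\varphi)(r),\qquad \omega\in\mathbb{S}^{n-1},\ r>0,$$ where $R^*$ is the hyperplane-to-line dual Radon transform and $\mathcal{M}_\omega$ is the mean value operator over line clusters. Then for $t>0$ (for almost all $(\theta,t)$) $$\varphi(\theta,t)=\bigl([F^{-1}\otimes t\,\mathcal{D}^{n/2-1}_{+,2}]\Phi\bigr)(\theta,t),$$ where $t$ denotes multiplication by $t$, applied after $\mathcal{D}^{n/2-1}_{+,2}$; the Erdélyi–Kober derivative $\mathcal{D}^{n/2-1}_{+,2}$ acts on the $r$-argument of $\Phi$ and is defined, with $D=\frac{1}{2r}\frac{d}{dr}$, by $$\mathcal{D}^{n/2-1}_{+,2}\chi=D^{n/2-1}\chi\ \ (n\text{ even}),\qquad \mathcal{D}^{n/2-1}_{+,2}\chi=D^{(n-1)/2}I^{1/2}_{+,2}\chi\ \ (n\text{ odd});$$ and the inverse Funk transform $F^{-1}$ acts on the $\omega$-argument of $\Phi$ by the formula $$(F^{-1}\psi)(\omega)=\lim_{t\to1}\left(\frac{1}{2t}\frac{\partial}{\partial t}\right)^{n-2}\left[\frac{2^{n-2}}{(n-3)!}\int_0^t(t^2-s^2)^{n/2-2}\,\Phi^{\psi}_\omega(s)\,s^{n-2}\,ds\right],$$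 $$\Phi^{\psi}_\omega(s)=\int_{\mathbb{S}^{n-1}\cap\omega^\perp}\psi\bigl(s\,\xi+\sqrt{1-s^2}\,\omega\bigr)\,d_\omega\xi,\qquad -1\le s\le1,$$ the limit being understood in the $L^1(\mathbb{S}^{n-1})$-norm.
   Context: Lines in $\mathbb{R}^n$ are parametrized by pairs $(\omega,u)$ with $\omega\in\mathbb{S}^{n-1}$, $u\in\omega^\perp$ (the line is $\mathbb{R}\omega+u$). Hyperplanes are parametrized by $(\theta,t)\in\mathbb{S}^{n-1}\times\mathbb{R}$ (the hyperplane is $\{x:x\cdot\theta=t\}$), with $(\theta,t)$ and $(-\theta,-t)$ giving the same hyperplane. The dual Radon transform from hyperplanes to lines is $$(R^*\varphi)(\omega,u)=\int_{\mathbb{S}^{n-1}\cap\omega^\perp}\varphi(\theta,\theta\cdot u)\,d_\omega\theta,$$ where $d_\omega\theta$ is the probability measure on $\mathbb{S}^{n-1}\cap\omega^\perp$ invariant under orthogonal transformations fixing $\omega$. Let $O(\omega^\perp)\subset O(n)$ be the stabilizer of the vector $\omega$. For a function $f(\omega,u)$ on lines, the mean value operator is $$(\mathcal{M}_\omega f)(r)=\int_{O(\omega^\perp)}f(\omega,r\rho\tilde u)\,d\rho,\qquad r>0,$$ where $d\rho$ is normalized Haar measure and $\tilde u$ is any unit vector in $\omega^\perp$. The Funk transform is $(F\psi)(\theta)=\int_{\mathbb{S}^{n-1}\cap\theta^\perp}\psi(\omega)\,d_\theta\omega$ (with the invariant probability measure), injective on even functions. The left-sided Erdélyi–Kober integral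 is $$(I^\alpha_{+,2}\chi)(r)=\frac{2}{\Gamma(\alpha)}\int_0^r(r^2-t^2)^{\alpha-1}\chi(t)\,t\,dt,\qquad r>0,\ \alpha>0.$$ *)

theory Defs
  imports "HOL-Probability.Probability_Measure"
begin

text \<open>Invariant probability measures are characterised on the Borel sets and then completed, so that
  integrands only have to be measurable in the sense of Lebesgue.\<close>

definition is_invariant_prob ::
  "'a::topological_space set \<Rightarrow> ('a \<Rightarrow> 'a) set \<Rightarrow> 'a measure \<Rightarrow> bool" where
  "is_invariant_prob X G M \<longleftrightarrow>
     prob_space M \<and> sets M = sets (restrict_space borel X) \<and> (\<forall>g\<in>G. distr M M g = M)"

definition invariant_prob :: "'a::topological_space set \<Rightarrow> ('a \<Rightarrow> 'a) set \<Rightarrow> 'a measure" where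
  "invariant_prob X G = completion (THE M. is_invariant_prob X G M)"

definition sphere_measure :: "(real^'n) measure" where
  "sphere_measure = invariant_prob (sphere 0 1) {\<lambda>x. A *v x |A. orthogonal_matrix A}"

definition stabilizer :: "real^'n \<Rightarrow> (real^'n^'n) set" where
  "stabilizer \<omega> = {A. orthogonal_matrix A \<and> A *v \<omega> = \<omega>}"

definition perp_sphere_measure :: "real^'n \<Rightarrow> (real^'n) measure" where
  "perp_sphere_measure \<omega> =
     invariant_prob {\<theta> \<in> sphere 0 1. \<theta> \<bullet> \<omega> = 0} {\<lambda>x. A *v x |A. A \<in> stabilizer \<omega>}"

definition haar_measure :: "real^'n \<Rightarrow> (real^'n^'n) measure" where
  "haar_measure \<omega> = invariant_prob (stabilizer \<omega>) {\<lambda>A. B ** A |B. B \<in> stabilizer \<omega>}"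

definition locally_integrable :: "((real^'n) \<times> real \<Rightarrow> real) \<Rightarrow> bool" where
  "locally_integrable \<phi> \<longleftrightarrow>
     (\<forall>K. compact K \<and> K \<subseteq> sphere 0 1 \<times> UNIV \<longrightarrow>
        set_integrable (completion (sphere_measure \<Otimes>\<^sub>M lborel)) K \<phi>)"

definition dual_Radon :: "((real^'n) \<times> real \<Rightarrow> real) \<Rightarrow> real^'n \<Rightarrow> real^'n \<Rightarrow> real" where
  "dual_Radon \<phi> \<omega> u = (\<integral>\<theta>. \<phi> (\<theta>, \<theta> \<bullet> u) \<partial>perp_sphere_measure \<omega>)"

text \<open>By invariance of Haar measure the choice of the unit vector is irrelevant.\<close>

definition mean_value :: "real^'n \<Rightarrow> (real^'n \<Rightarrow> real^'n \<Rightarrow> real) \<Rightarrow> real \<Rightarrow> real" where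
  "mean_value \<omega> f r =
     (let u = (SOME u. norm u = 1 \<and> u \<bullet> \<omega> = 0)
      in \<integral>\<rho>. f \<omega> (r *\<^sub>R (\<rho> *v u)) \<partial>haar_measure \<omega>)"

definition EK_integral :: "real \<Rightarrow> (real \<Rightarrow> real) \<Rightarrow> real \<Rightarrow> real" where
  "EK_integral \<alpha> g r =
     2 / Gamma \<alpha> * (LINT t:{0<..<r}|lebesgue. (r\<^sup>2 - t\<^sup>2) powr (\<alpha> - 1) * g t * t)"

definition sq_deriv :: "(real \<Rightarrow> real) \<Rightarrow> real \<Rightarrow> real" where
  "sq_deriv f r = 1 / (2 * r) * deriv f r"

text \<open>As \<^const>\<open>deriv\<close> is total, existence of the derivatives in
  \<^term>\<open>(sq_deriv ^^ k) f r\<close> is expressed separately: the first \<^term>\<open>k - 1\<close> of them exist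
  near \<^term>\<open>r\<close>, the last one at \<^term>\<open>r\<close>.\<close>

primrec sq_differentiable :: "nat \<Rightarrow> (real \<Rightarrow> real) \<Rightarrow> real \<Rightarrow> bool" where
  "sq_differentiable 0 f r \<longleftrightarrow> True"
| "sq_differentiable (Suc k) f r \<longleftrightarrow>
     (\<forall>\<^sub>F s in nhds r. sq_differentiable k f s) \<and> (sq_deriv ^^ k) f differentiable (at r)"

text \<open>For dimension \<open>n\<close>: the Erdelyi-Kober derivative of order \<open>n/2 - 1\<close>, and its existence.\<close>

definition EK_deriv :: "nat \<Rightarrow> (real \<Rightarrow> real) \<Rightarrow> real \<Rightarrow> real" where
  "EK_deriv n g =
     (if even n then (sq_deriv ^^ (n div 2 - 1)) g
      else (sq_deriv ^^ ((n - 1) div 2)) (EK_integral (1/2) g))"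

definition EK_differentiable :: "nat \<Rightarrow> (real \<Rightarrow> real) \<Rightarrow> real \<Rightarrow> bool" where
  "EK_differentiable n g =
     (if even n then sq_differentiable (n div 2 - 1) g
      else sq_differentiable ((n - 1) div 2) (EK_integral (1/2) g))"

definition Funk_mean :: "(real^'n \<Rightarrow> real) \<Rightarrow> real^'n \<Rightarrow> real \<Rightarrow> real" where
  "Funk_mean \<psi> \<omega> s =
     (\<integral>\<xi>. \<psi> (s *\<^sub>R \<xi> + sqrt (1 - s\<^sup>2) *\<^sub>R \<omega>) \<partial>perp_sphere_measure \<omega>)"

definition Funk_bracket :: "(real^'n \<Rightarrow> real) \<Rightarrow> real^'n \<Rightarrow> real \<Rightarrow> real" where
  "Funk_bracket \<psi> \<omega> t =
     2 ^ (CARD('n) - 2) / fact (CARD('n) - 3) *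
     (LINT s:{0<..<t}|lebesgue.
        (t\<^sup>2 - s\<^sup>2) powr (real CARD('n) / 2 - 2) * Funk_mean \<psi> \<omega> s * s ^ (CARD('n) - 2))"

text \<open>\<open>F\<^sup>-\<^sup>1 \<psi>\<close> is a limit in the norm of \<open>L\<^sup>1\<close> and hence only an almost-everywhere class, so it is
  rendered as a relation between \<open>\<psi>\<close> and the representatives \<open>g\<close> of that class.\<close>

definition has_inverse_Funk :: "(real^'n \<Rightarrow> real) \<Rightarrow> (real^'n \<Rightarrow> real) \<Rightarrow> bool" where
  "has_inverse_Funk \<psi> g \<longleftrightarrow>
     (let A = (\<lambda>t \<omega>. (sq_deriv ^^ (CARD('n) - 2)) (Funk_bracket \<psi> \<omega>) t) in
      integrable sphere_measure g \<and>
      (\<forall>\<^sub>F t in at_left 1.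
         (AE \<omega> in sphere_measure. sq_differentiable (CARD('n) - 2) (Funk_bracket \<psi> \<omega>) t) \<and>
         integrable sphere_measure (A t)) \<and>
      ((\<lambda>t. \<integral>\<omega>. \<bar>A t \<omega> - g \<omega>\<bar> \<partial>sphere_measure) \<longlongrightarrow> 0) (at_left 1))"

text \<open>\<open>G\<close> represents \<open>[F\<^sup>-\<^sup>1 \<otimes> t D] \<Phi>\<close>, where \<open>D\<close> is the Erdelyi-Kober derivative of order
  \<open>n/2 - 1\<close> in the radial variable.\<close>

definition has_inverse_Funk_EK ::
  "(real^'n \<Rightarrow> real \<Rightarrow> real) \<Rightarrow> ((real^'n) \<times> real \<Rightarrow> real) \<Rightarrow> bool" where
  "has_inverse_Funk_EK \<Phi> G \<longleftrightarrow>
     (AE t in lborel. 0 < t \<longrightarrow>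
        (AE \<omega> in sphere_measure. EK_differentiable CARD('n) (\<Phi> \<omega>) t) \<and>
        has_inverse_Funk (\<lambda>\<omega>. t * EK_deriv CARD('n) (\<Phi> \<omega>) t) (\<lambda>\<theta>. G (\<theta>, t)))"

end

theory Submission
  imports Defs "HOL-Probability.Probability"
begin

text \<open>
  For independent uniform \<open>\<theta>, y\<close> on the unit sphere of \<open>\<omega>\<^sup>\<bottom>\<close>, the pair \<open>(\<theta>, \<theta> \<bullet> y)\<close> is distributed like
  \<open>(\<theta>, v)\<close> with \<open>v\<close> independent of \<open>\<theta>\<close> and of density proportional to \<open>(1 - v\<^sup>2)\<close> to the power \<open>n/2 - 2\<close>. So \<open>\<Phi>(\<omega>, r)\<close> is
  the Erdelyi-Kober integral of order \<open>n/2 - 1\<close> of \<open>\<psi>(\<omega>, t) / t\<close>, where \<open>\<psi>(\<omega>, t)\<close> is the Funk transform of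
  \<open>\<phi>(\<cdot>, t)\<close> at \<open>\<omega>\<close>. By the semigroup property and Lebesgue differentiation, the Erdelyi-Kober derivative
  times \<open>t\<close> gives back \<open>\<psi>(\<omega>, t)\<close> for almost all \<open>(\<omega>, t)\<close>.

  To invert the Funk transform of \<open>f = \<phi>(\<cdot>, t)\<close>, let \<open>m(v, \<omega>)\<close> be the mean of \<open>f\<close> over \<open>{x. x \<bullet> \<omega> = v}\<close>. The mean
  of \<open>m(0, \<cdot>)\<close> over the points with inner product \<open>sqrt (1 - s\<^sup>2)\<close> with \<open>\<omega>\<close> is the average of \<open>m(s v, \<omega>)\<close> against the
  same density, so the bracket is the Erdelyi-Kober integral of order \<open>n - 2\<close> of \<open>m(v, \<omega>) / v\<close> and its
  derivative is \<open>m(t, \<omega>) / t\<close>, which converges to \<open>f\<close> in \<open>L\<^sup>1\<close> by density of the continuous functions. That it exists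
  for every \<open>t < 1\<close> and almost every \<open>\<omega>\<close>, and not only for almost every \<open>t\<close>, follows from a maximal
  inequality of weak type for the averages of \<open>f\<close> over the shells \<open>\<bar>x \<bullet> \<omega> - t\<bar> < h\<close>.
\<close>

text \<open>The two existence claims for derivatives differ in kind. The Erdelyi-Kober derivative is
  wanted for almost every \<open>t\<close> only: Lebesgue differentiation for each direction and an
  exchange of null sets suffice, the measurability needed for the exchange coming from rational
  increments. The inverse Funk transform is a limit along all \<open>t\<close> near 1, so for each
  single \<open>t\<close> almost every direction must be good. Shell averages reduce to ball
  averages of \<open>cap_nn t\<close>: if \<eta> lies in a shell about \<omega>, the sphere of level
  \<open>t\<close> about \<eta> passes close to \<omega>. Dimension 3 is delicate because the kernel
  exponent n/2 - 2 is negative: identities with a single kernel are obtained for almost every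
  radius, and for all radii only after a second integration, of total order at least 1. The measures
  in the definitions are completions of uniquely determined measures on subsets, and \<phi> is
  measurable only up to null sets. The work is done with Borel measures on the full space and an
  everywhere symmetric Borel representative of \<phi>.\<close>

declare transpose_matrix_vector [simp del]

section \<open>Haar measure on stabilizers\<close>

text \<open>The reflection in the hyperplane orthogonal to \<open>x - e\<close>. Its entries are
  rational functions of \<open>x\<close>, so that it is a Borel choice of an orthogonal matrix
  taking \<open>e\<close> to a given \<open>x\<close> of the same norm. For \<open>x = e\<close> the
  division by zero yields the identity, which is the right value.\<close>

definition householder :: "real^'n \<Rightarrow> real^'n \<Rightarrow> real^'n^'n" where
  "householder e x = mat 1 - (2 / ((x - e) \<bullet> (x - e))) *\<^sub>R (\<chi> i j. (x - e) $ i * (x - e) $ j)"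

lemma householder_mult:
  "householder e x *v y = y - (2 * ((x - e) \<bullet> y) / ((x - e) \<bullet> (x - e))) *\<^sub>R (x - e)"
proof -
  have "(\<chi> i j. (x - e) $ i * (x - e) $ j) *v y = ((x - e) \<bullet> y) *\<^sub>R (x - e)"
    by (simp add: vec_eq_iff matrix_vector_mult_def inner_vec_def sum_distrib_left mult_ac)
  then show ?thesis
    unfolding householder_def matrix_vector_mult_diff_rdistrib scaleR_matrix_vector_assoc[symmetric] by simp
qed

lemma householder_transpose: "transpose (householder e x) = householder e x"
  by (simp add: householder_def transpose_def vec_eq_iff mat_def mult_ac)

lemma householder_hh: "householder e x *v (householder e x *v y) = y"
proof (cases "x = e")
  case False
  then have "(x - e) \<bullet> (x - e) \<noteq> 0" by simp
  then show ?thesis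
    unfolding householder_mult by (simp add: inner_diff_right[of _ y])
qed (simp add: householder_mult)

lemma householder_orthogonal: "orthogonal_matrix (householder e x)"
  unfolding orthogonal_matrix householder_transpose
  by (metis householder_hh matrix_eq matrix_vector_mul_assoc matrix_vector_mul_lid)

text \<open>For equal norms \<open>(x - e) \<bullet> (x - e) = - 2 * ((x - e) \<bullet> e)\<close>,
  so the reflection adds exactly \<open>x - e\<close> to \<open>e\<close>.\<close>

lemma householder_swap:
  assumes "norm x = norm e" shows "householder e x *v e = x" "householder e x *v x = e"
proof -
  show 1: "householder e x *v e = x"
  proof (cases "x = e")
    case False
    have "x \<bullet> x = e \<bullet> e" using assms by (simp add: norm_eq)
    then have "(x - e) \<bullet> (x - e) = - 2 * ((x - e) \<bullet> e)" by (simp add: inner_diff_left inner_diff_right inner_commute)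
    moreover have "(x - e) \<bullet> (x - e) \<noteq> 0" using False by simp
    ultimately have "2 * ((x - e) \<bullet> e) / ((x - e) \<bullet> (x - e)) = -1" by (simp add: field_simps)
    then show ?thesis unfolding householder_mult by simp
  qed (simp add: householder_mult)
  then show "householder e x *v x = e" using householder_hh[of e x e] by simp
qed

lemma householder_fix: "w \<bullet> x = w \<bullet> e \<Longrightarrow> householder e x *v w = w"
  by (simp add: householder_mult inner_diff_left inner_diff_right inner_commute[of _ w])

section \<open>Measurability of the matrix operations\<close>

lemma borel_measurable_matrix_mult[measurable]:
  fixes f g :: "'a \<Rightarrow> real^'n^'n"
  assumes [measurable]: "f \<in> borel_measurable M" "g \<in> borel_measurable M"
  shows "(\<lambda>x. f x ** g x) \<in> borel_measurable M"
proof -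
  have "(\<lambda>z. fst z ** snd z) \<in> borel_measurable (borel :: ((real^'n^'n) \<times> (real^'n^'n)) measure)"
    unfolding matrix_matrix_mult_def
    by (intro borel_measurable_continuous_onI continuous_intros)
  from measurable_compose[OF _ this, of "\<lambda>x. (f x, g x)" M] show ?thesis
    by (simp add: borel_prod[symmetric])
qed

lemma borel_measurable_matrix_mult_left: "(**) (B::real^'n^'n) \<in> borel_measurable borel"
proof -
  have "continuous_on UNIV (\<lambda>A. B ** A)"
    unfolding matrix_matrix_mult_def by (intro continuous_intros)
  then show ?thesis by (rule borel_measurable_continuous_onI)
qed

lemma borel_measurable_matrix_vector_mult[measurable]:
  fixes f :: "'a \<Rightarrow> real^'n^'n" and g :: "'a \<Rightarrow> real^'n"
  assumes [measurable]: "f \<in> borel_measurable M" "g \<in> borel_measurable M"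
  shows "(\<lambda>x. f x *v g x) \<in> borel_measurable M"
proof -
  have "(\<lambda>z. fst z *v snd z) \<in> borel_measurable (borel :: ((real^'n^'n) \<times> (real^'n)) measure)"
    unfolding matrix_vector_mult_def
    by (intro borel_measurable_continuous_onI continuous_intros)
  from measurable_compose[OF _ this, of "\<lambda>x. (f x, g x)" M] show ?thesis
    by (simp add: borel_prod[symmetric])
qed

lemma borel_measurable_transpose[measurable]:
  fixes f :: "'a \<Rightarrow> real^'n^'n"
  assumes [measurable]: "f \<in> borel_measurable M"
  shows "(\<lambda>x. transpose (f x)) \<in> borel_measurable M"
proof -
  have "transpose \<in> borel_measurable (borel :: (real^'n^'n) measure)"
    unfolding transpose_def
    by (intro borel_measurable_continuous_onI continuous_intros)
  from measurable_compose[OF assms this] show ?thesis .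
qed

lemma borel_measurable_hh[measurable]:
  fixes f g :: "'a \<Rightarrow> real^'n"
  assumes [measurable]: "f \<in> borel_measurable M" "g \<in> borel_measurable M"
  shows "(\<lambda>x. householder (f x) (g x)) \<in> borel_measurable M"
proof -
  have "(\<lambda>d::real^'n. \<chi> i j. d $ i * d $ j) \<in> borel_measurable borel"
    by (intro borel_measurable_continuous_onI continuous_intros)
  from measurable_compose[OF _ this, of "\<lambda>x. g x - f x" M]
  have [measurable]: "(\<lambda>x. (\<chi> i j. (g x - f x) $ i * (g x - f x) $ j) :: real^'n^'n) \<in> borel_measurable M"
    by simp
  show ?thesis unfolding householder_def by measurable
qed

section \<open>Orthogonal matrices and pointwise stabilizers\<close>

lemma orthogonal_matrix_inner:
  "orthogonal_matrix A \<Longrightarrow> (A *v x) \<bullet> (A *v y) = x \<bullet> (y::real^'n)"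
  using orthogonal_transformation_matrix[of "(*v) A"] by (simp add: orthogonal_transformation_def)

lemma orthogonal_matrix_norm:
  "orthogonal_matrix A \<Longrightarrow> norm (A *v x) = norm (x::real^'n)"
  by (simp add: norm_eq_sqrt_inner orthogonal_matrix_inner)

lemma orthogonal_matrix_transpose_mult:
  assumes "orthogonal_matrix A"
  shows "transpose A *v (A *v x) = (x::real^'n)" "A *v (transpose A *v x) = x"
    "transpose A ** (A ** C) = C" "A ** (transpose A ** C) = C"
  using assms by (simp_all add: orthogonal_matrix_def matrix_vector_mul_assoc matrix_mul_assoc)

text \<open>A whole set of fixed vectors is allowed, because Haar measure is constructed by an
  induction over that set. \<open>W = {}\<close> gives the full orthogonal group.\<close>

definition fixing :: "(real^'n) set \<Rightarrow> (real^'n^'n) set" where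
  "fixing W = {A. orthogonal_matrix A \<and> (\<forall>w\<in>W. A *v w = w)}"

lemma fixing_mult: "A \<in> fixing W \<Longrightarrow> B \<in> fixing W \<Longrightarrow> A ** B \<in> fixing W"
  by (auto simp: fixing_def orthogonal_matrix_mul simp flip: matrix_vector_mul_assoc)

lemma fixing_transpose: "A \<in> fixing W \<Longrightarrow> transpose A \<in> fixing W"
  unfolding fixing_def using orthogonal_matrix_transpose_mult(1)[of A]
  by (auto simp: orthogonal_matrix_transpose) metis

lemma closed_fixing: "closed (fixing W)"
proof -
  have "fixing W = {A. transpose A ** A = mat 1} \<inter> (\<Inter>w\<in>W. {A. A *v w = w})"
    by (auto simp: fixing_def orthogonal_matrix)
  moreover have "closed {A::real^'n^'n. transpose A ** A = mat 1}"
    unfolding transpose_def matrix_matrix_mult_def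
    by (intro closed_Collect_eq continuous_intros)
  moreover have "closed {A::real^'n^'n. A *v w = w}" for w
    unfolding matrix_vector_mult_def
    by (intro closed_Collect_eq continuous_intros)
  ultimately show ?thesis by (auto intro!: closed_Int closed_INT)
qed

lemma sets_fixing[measurable]: "fixing W \<in> sets borel"
  using closed_fixing by (rule borel_closed)

text \<open>Translation invariance determines \<^term>\<open>distr lborel borel ((*v) B)\<close> up to a factor, and the unit
  ball shows that the factor is 1.\<close>

lemma nn_integral_lborel_translation:
  fixes f :: "'a::euclidean_space \<Rightarrow> ennreal"
  assumes [measurable]: "f \<in> borel_measurable borel"
  shows "(\<integral>\<^sup>+x. f (c + x) \<partial>lborel) = (\<integral>\<^sup>+x. f x \<partial>lborel)"
proof -
  have "(\<integral>\<^sup>+x. f x \<partial>lborel) = (\<integral>\<^sup>+x. f x \<partial>distr lborel borel ((+) c))"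
    by (simp only: lborel_distr_plus)
  also have "\<dots> = (\<integral>\<^sup>+x. f (c + x) \<partial>lborel)"
    by (subst nn_integral_distr) auto
  finally show ?thesis ..
qed

lemma nn_integral_lborel_orthogonal:
  assumes B: "orthogonal_matrix (B::real^'n^'n)" and [measurable]: "f \<in> borel_measurable borel"
  shows "(\<integral>\<^sup>+x. f (B *v x) \<partial>lborel) = (\<integral>\<^sup>+x. f x \<partial>lborel)"
proof -
  define g where "g = (indicator (ball 0 1) :: real^'n \<Rightarrow> ennreal)"
  define v where "v = emeasure lborel (ball (0::real^'n) 1)"
  have [measurable]: "g \<in> borel_measurable borel" unfolding g_def by (rule borel_measurable_indicator) auto
  have gB: "g (B *v x) = g x" "g (- x) = g x" for x
    using B by (auto simp: g_def indicator_def orthogonal_matrix_norm)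
  have gv: "(\<integral>\<^sup>+x. g x \<partial>lborel) = v" by (simp add: g_def v_def)
  have v: "v \<noteq> 0" "v \<noteq> \<infinity>"
    unfolding v_def using content_ball_pos[of 1 "0::real^'n"] emeasure_bounded_finite[of "ball (0::real^'n) 1"]
    by (auto simp: measure_def)
  \<comment> \<open>The ball supplies a finite mass to integrate against. After a shift by
    \<open>x\<close> and an exchange of the integrals the translated ball is recentred; its
    invariance under \<open>B\<close> and under negation gives back the factor \<open>v\<close>, now
    in front of the integral of \<open>f\<close> itself.\<close>
  have "v * (\<integral>\<^sup>+x. f (B *v x) \<partial>lborel) = (\<integral>\<^sup>+x. (\<integral>\<^sup>+y. g x * f (B *v y) \<partial>lborel) \<partial>lborel)"
    by (simp add: nn_integral_cmult nn_integral_multc gv)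
  also have "\<dots> = (\<integral>\<^sup>+x. (\<integral>\<^sup>+y. g x * f (x + B *v y) \<partial>lborel) \<partial>lborel)"
  proof (rule nn_integral_cong)
    fix x
    show "(\<integral>\<^sup>+y. g x * f (B *v y) \<partial>lborel) = (\<integral>\<^sup>+y. g x * f (x + B *v y) \<partial>lborel)"
      using nn_integral_lborel_translation[of "\<lambda>y. g x * f (B *v y)" "transpose B *v x"]
      by (simp add: matrix_vector_right_distrib orthogonal_matrix_transpose_mult(2)[OF B])
  qed
  also have "\<dots> = (\<integral>\<^sup>+y. (\<integral>\<^sup>+x. g x * f (x + B *v y) \<partial>lborel) \<partial>lborel)"
    by (rule lborel_pair.Fubini') measurable
  also have "\<dots> = (\<integral>\<^sup>+y. (\<integral>\<^sup>+x. g (x - B *v y) * f x \<partial>lborel) \<partial>lborel)"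
  proof (rule nn_integral_cong)
    fix y
    show "(\<integral>\<^sup>+x. g x * f (x + B *v y) \<partial>lborel) = (\<integral>\<^sup>+x. g (x - B *v y) * f x \<partial>lborel)"
      using nn_integral_lborel_translation[of "\<lambda>x. g (x - B *v y) * f x" "B *v y"] by (simp add: add.commute)
  qed
  also have "\<dots> = (\<integral>\<^sup>+x. (\<integral>\<^sup>+y. g (x - B *v y) * f x \<partial>lborel) \<partial>lborel)"
    by (rule lborel_pair.Fubini') measurable
  also have "\<dots> = (\<integral>\<^sup>+x. v * f x \<partial>lborel)"
  proof (rule nn_integral_cong)
    fix x
    have "g (x - B *v y) = g (- (transpose B *v x) + y)" for y
    proof -
      have "g (x - B *v y) = g (B *v (- (- (transpose B *v x) + y)))"
        by (simp add: matrix_vector_mult_diff_distrib orthogonal_matrix_transpose_mult(2)[OF B])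
      then show ?thesis by (simp only: gB)
    qed
    then show "(\<integral>\<^sup>+y. g (x - B *v y) * f x \<partial>lborel) = v * f x"
      using nn_integral_lborel_translation[of g "- (transpose B *v x)"] by (simp add: nn_integral_multc gv)
  qed
  also have "\<dots> = v * (\<integral>\<^sup>+x. f x \<partial>lborel)" by (simp add: nn_integral_cmult)
  finally show ?thesis using v by (metis ennreal_mult_cancel_left infinity_ennreal_def)
qed

section \<open>Uniform distribution on the unit sphere orthogonal to an orthonormal set\<close>

definition orthonormal :: "(real^'n) set \<Rightarrow> bool" where
  "orthonormal W \<longleftrightarrow> (\<forall>w\<in>W. norm w = 1) \<and> pairwise orthogonal W"

lemma orthonormal_finite_card:
  assumes "orthonormal (W :: (real^'n) set)" shows "finite W" "card W \<le> CARD('n)"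
proof -
  have "0 \<notin> W" using assms by (auto simp: orthonormal_def)
  then have "independent W"
    using assms pairwise_orthogonal_independent[of W] by (auto simp: orthonormal_def)
  from independent_bound[OF this] show "finite W" "card W \<le> CARD('n)" by auto
qed

definition perp_proj :: "(real^'n) set \<Rightarrow> real^'n \<Rightarrow> real^'n" where
  "perp_proj W x = x - (\<Sum>w\<in>W. (x \<bullet> w) *\<^sub>R w)"

lemma borel_measurable_perp_proj[measurable]: "perp_proj W \<in> borel_measurable borel"
  unfolding perp_proj_def[abs_def] by measurable

lemma perp_proj_inner:
  assumes "orthonormal W" "w \<in> W" shows "perp_proj W x \<bullet> w = 0"
proof -
  have "(\<Sum>v\<in>W. (x \<bullet> v) * (v \<bullet> w)) = (\<Sum>v\<in>W. if v = w then x \<bullet> w else 0)"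
    using assms by (intro sum.cong) (auto simp: orthonormal_def pairwise_def orthogonal_def norm_eq_1)
  then show ?thesis
    using assms orthonormal_finite_card[OF assms(1)]
    by (simp add: perp_proj_def inner_diff_left inner_sum_left)
qed

lemma perp_proj_mult:
  assumes "B \<in> fixing W" shows "perp_proj W (B *v x) = B *v perp_proj W x"
proof -
  have B: "orthogonal_matrix B" "\<And>w. w \<in> W \<Longrightarrow> B *v w = w" using assms by (auto simp: fixing_def)
  have *: "(B *v x) \<bullet> w = x \<bullet> w" if "w \<in> W" for w
    using orthogonal_matrix_inner[OF B(1), of x w] B(2)[OF that] by simp
  have "B *v (\<Sum>w\<in>W. (x \<bullet> w) *\<^sub>R w) = (\<Sum>w\<in>W. (x \<bullet> w) *\<^sub>R w)"
    using B(2) by (simp add: matrix_vector_mult_scaleR vec.linear_sum[OF matrix_vector_mul_linear_gen])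
  then show ?thesis using * by (simp add: perp_proj_def matrix_vector_mult_diff_distrib)
qed

text \<open>The law of the normalised projection of a uniform point of the unit ball to the
  complement of \<open>W\<close>. Starting from the ball keeps everything within Lebesgue measure,
  whose invariance under orthogonal matrices is available. The default \<open>sgn 0 = 0\<close> is
  harmless, since the projection vanishes only on a null set as soon as some unit vector is
  orthogonal to \<open>W\<close>.\<close>

definition uniform_sphere :: "(real^'n) set \<Rightarrow> (real^'n) measure" where
  "uniform_sphere W = distr (uniform_measure lborel (ball 0 1)) borel (\<lambda>x. sgn (perp_proj W x))"

text \<open>A matrix that fixes \<open>W\<close> commutes with the projection and with normalisation
  and preserves the ball, so invariance is inherited from Lebesgue measure.\<close>

lemma uniform_sphere:
  assumes W: "orthonormal (W :: (real^'n) set)" and e: "norm e = 1" "\<And>w. w \<in> W \<Longrightarrow> orthogonal e w"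
  defines "U \<equiv> uniform_sphere W"
  shows "prob_space U \<and> sets U = sets borel \<and> (AE x in U. norm x = 1 \<and> (\<forall>w\<in>W. x \<bullet> w = 0)) \<and>
    (\<forall>B\<in>fixing W. \<forall>f\<in>borel_measurable borel. (\<integral>\<^sup>+x. f (B *v x) \<partial>U) = (\<integral>\<^sup>+x. f x \<partial>U))"
proof -
  have [measurable]: "ball (0::real^'n) 1 \<in> sets borel" by simp
  define v where "v = emeasure lborel (ball (0::real^'n) 1)"
  have v: "v \<noteq> 0" "v \<noteq> \<infinity>"
    unfolding v_def using content_ball_pos[of 1 "0::real^'n"] emeasure_bounded_finite[of "ball (0::real^'n) 1"]
    by (auto simp: measure_def)
  define N where "N = uniform_measure lborel (ball (0::real^'n) 1)"
  have N[measurable_cong]: "sets N = sets borel" by (simp add: N_def)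
  interpret N: prob_space N
    unfolding N_def using v by (intro prob_space_uniform_measure) (auto simp: v_def)
  have [measurable]: "ball (0::real^'n) 1 \<in> sets borel" by simp
  note U_def = U_def[unfolded uniform_sphere_def, folded N_def]
  have [measurable]: "(\<lambda>x. sgn (perp_proj W x)) \<in> borel_measurable N"
    unfolding sgn_div_norm by measurable
  \<comment> \<open>A vanishing projection puts \<open>x\<close> into the span of \<open>W\<close>,
    hence into the hyperplane orthogonal to \<open>e\<close>, which is a null set.\<close>
  have nz: "AE x in lborel. perp_proj W x \<noteq> 0"
  proof -
    have "e \<noteq> 0" using e by auto
    then have "{x. e \<bullet> x = 0} \<in> null_sets lebesgue"
      using negligible_hyperplane[of e 0] by (simp add: negligible_iff_null_sets)
    then have "AE x in lborel. e \<bullet> x \<noteq> 0"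
      using AE_not_in[of "{x. e \<bullet> x = 0}" lebesgue] by (auto simp: AE_completion_iff)
    moreover have "e \<bullet> x = 0" if "perp_proj W x = 0" for x
    proof -
      have "x = (\<Sum>w\<in>W. (x \<bullet> w) *\<^sub>R w)" using that by (simp add: perp_proj_def)
      then have "e \<bullet> x = e \<bullet> (\<Sum>w\<in>W. (x \<bullet> w) *\<^sub>R w)" by simp
      also have "\<dots> = 0" using e by (simp add: inner_sum_right orthogonal_def)
      finally show ?thesis .
    qed
    ultimately show ?thesis by (elim AE_mp) auto
  qed
  have "AE x in N. perp_proj W x \<noteq> 0"
    unfolding N_def uniform_measure_def by (subst AE_density) (use nz in auto)
  then have "AE x in U. norm x = 1 \<and> (\<forall>w\<in>W. x \<bullet> w = 0)"
    unfolding U_def using orthonormal_finite_card[OF W]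
    by (subst AE_distr_iff) (auto simp: sgn_div_norm perp_proj_inner[OF W])
  moreover have "prob_space U" unfolding U_def by (rule N.prob_space_distr) simp
  moreover have "(\<integral>\<^sup>+x. f (B *v x) \<partial>U) = (\<integral>\<^sup>+x. f x \<partial>U)"
    if B: "B \<in> fixing W" and [measurable]: "f \<in> borel_measurable borel" for B f
  proof -
    have oB: "orthogonal_matrix B" using B by (simp add: fixing_def)
    have *: "(\<integral>\<^sup>+x. h x \<partial>N) = (\<integral>\<^sup>+x. (indicator (ball 0 1) x / v) * h x \<partial>lborel)"
      if [measurable]: "h \<in> borel_measurable borel" for h
      unfolding N_def uniform_measure_def by (subst nn_integral_density) (auto simp: v_def)
    have [measurable]: "(\<lambda>x. f (sgn (perp_proj W x))) \<in> borel_measurable borel"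
      unfolding sgn_div_norm by measurable
    have "(\<integral>\<^sup>+x. f (B *v x) \<partial>U) = (\<integral>\<^sup>+x. f (B *v sgn (perp_proj W x)) \<partial>N)"
      unfolding U_def by (subst nn_integral_distr) auto
    also have "\<dots> = (\<integral>\<^sup>+x. f (sgn (perp_proj W (B *v x))) \<partial>N)"
      by (simp add: perp_proj_mult[OF B] sgn_div_norm matrix_vector_mult_scaleR orthogonal_matrix_norm[OF oB])
    also have "\<dots> = (\<integral>\<^sup>+x. (indicator (ball 0 1) (B *v x) / v) * f (sgn (perp_proj W (B *v x))) \<partial>lborel)"
      by (subst *) (auto simp: indicator_def orthogonal_matrix_norm[OF oB] sgn_div_norm)
    also have "\<dots> = (\<integral>\<^sup>+x. (indicator (ball 0 1) x / v) * f (sgn (perp_proj W x)) \<partial>lborel)"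
      by (rule nn_integral_lborel_orthogonal[OF oB, of "\<lambda>x. (indicator (ball 0 1) x / v) * f (sgn (perp_proj W x))"])
         measurable
    also have "\<dots> = (\<integral>\<^sup>+x. f x \<partial>U)"
      unfolding U_def by (subst nn_integral_distr) (auto simp: *)
    finally show ?thesis .
  qed
  moreover have "sets U = sets borel" by (simp add: U_def)
  ultimately show ?thesis by blast
qed

text \<open>The Haar measure on the group fixing an orthonormal set \<open>W\<close> is built by downward induction on \<open>W\<close>:
  a random element is a random element fixing \<open>W\<close> and one further vector \<open>e\<close>, followed by the
  reflection that takes \<open>e\<close> to a uniform point of the unit sphere orthogonal to \<open>W\<close>.\<close>

lemma haar_exists:
  assumes "orthonormal (W :: (real^'n) set)"
  shows "\<exists>M. prob_space M \<and> sets M = sets borel \<and> (AE A in M. A \<in> fixing W) \<and>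
    (\<forall>B\<in>fixing W. \<forall>f\<in>borel_measurable borel. (\<integral>\<^sup>+A. f (B ** A) \<partial>M) = (\<integral>\<^sup>+A. f A \<partial>M))"
  using assms
proof (induction "CARD('n) - card W" arbitrary: W rule: less_induct)
  case less
  show ?case
  proof (cases "\<exists>e. norm e = 1 \<and> (\<forall>w\<in>W. orthogonal e w)")
    case False
    \<comment> \<open>No unit vector is orthogonal to \<open>W\<close>, so \<open>W\<close> is an
      orthonormal basis, the group is trivial, and Haar measure is the point mass at the
      identity.\<close>
    have id: "A = mat 1" if "A \<in> fixing W" for A
    proof -
      have "A *v x = mat 1 *v x" for x
      proof -
        have "perp_proj W x = 0"
        proof (rule ccontr)
          assume "perp_proj W x \<noteq> 0"
          then have "norm (sgn (perp_proj W x)) = 1 \<and> (\<forall>w\<in>W. orthogonal (sgn (perp_proj W x)) w)"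
            by (auto simp: sgn_div_norm orthogonal_def perp_proj_inner[OF less.prems])
          then show False using False by blast
        qed
        moreover have "A *v perp_proj W x = A *v x - (\<Sum>w\<in>W. (x \<bullet> w) *\<^sub>R w)"
          using that by (simp add: perp_proj_def matrix_vector_mult_diff_distrib fixing_def
              matrix_vector_mult_scaleR vec.linear_sum[OF matrix_vector_mul_linear_gen])
        ultimately show ?thesis by (simp add: perp_proj_def)
      qed
      then show ?thesis by (simp add: matrix_eq)
    qed
    have "mat 1 \<in> fixing W" by (auto simp: fixing_def orthogonal_matrix_id)
    then show ?thesis
      by (intro exI[of _ "return borel (mat 1)"])
         (auto simp: AE_return nn_integral_return intro!: prob_space_return dest: id)
  next
    case True
    then obtain e where e: "norm e = 1" "\<And>w. w \<in> W \<Longrightarrow> orthogonal e w" by blast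
    have "e \<notin> W" using e(1) e(2)[of e] by (auto simp: orthogonal_def)
    have W': "orthonormal (insert e W)"
      using less.prems e by (auto simp: orthonormal_def pairwise_insert orthogonal_commute)
    have "CARD('n) - card (insert e W) < CARD('n) - card W"
      using orthonormal_finite_card[OF W'] orthonormal_finite_card[OF less.prems] \<open>e \<notin> W\<close> by simp
    from less.hyps[OF this W'] obtain M' :: "(real^'n^'n) measure" where
      M': "prob_space M'" and M'_sets[measurable_cong]: "sets M' = sets borel" and M'_AE: "AE A in M'. A \<in> fixing (insert e W)"
      and M'_inv: "\<And>B f. B\<in>fixing (insert e W) \<Longrightarrow> f\<in>borel_measurable borel \<Longrightarrow> (\<integral>\<^sup>+A. f (B ** A) \<partial>M') = (\<integral>\<^sup>+A. f A \<partial>M')"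
      by blast
    from uniform_sphere[OF less.prems e] obtain U :: "(real^'n) measure" where
      U: "prob_space U" and U_sets[measurable_cong]: "sets U = sets borel" and U_AE: "AE x in U. norm x = 1 \<and> (\<forall>w\<in>W. x \<bullet> w = 0)"
      and U_inv: "\<And>B f. B\<in>fixing W \<Longrightarrow> f\<in>borel_measurable borel \<Longrightarrow> (\<integral>\<^sup>+x. f (B *v x) \<partial>U) = (\<integral>\<^sup>+x. f x \<partial>U)"
      by blast
    interpret M': prob_space M' by fact
    interpret U: prob_space U by fact
    interpret P: pair_prob_space U M' ..
    define M where "M = distr (U \<Otimes>\<^sub>M M') borel (\<lambda>(x, k). householder e x ** k)"
    have int: "(\<integral>\<^sup>+A. f A \<partial>M) = (\<integral>\<^sup>+x. \<integral>\<^sup>+k. f (householder e x ** k) \<partial>M' \<partial>U)" if [measurable]: "f \<in> borel_measurable borel" for f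
    proof -
      have "(\<integral>\<^sup>+A. f A \<partial>M) = (\<integral>\<^sup>+z. f (case z of (x, k) \<Rightarrow> householder e x ** k) \<partial>(U \<Otimes>\<^sub>M M'))"
        unfolding M_def by (subst nn_integral_distr) auto
      also have "\<dots> = (\<integral>\<^sup>+x. \<integral>\<^sup>+k. f (householder e x ** k) \<partial>M' \<partial>U)"
        by (subst M'.nn_integral_fst[symmetric]) auto
      finally show ?thesis .
    qed
    have hhW: "householder e x \<in> fixing W" if "\<forall>w\<in>W. x \<bullet> w = 0" for x
      using that e(2) by (auto simp: fixing_def householder_orthogonal orthogonal_def inner_commute intro!: householder_fix)
    have M'_W: "k \<in> fixing W" if "k \<in> fixing (insert e W)" for k using that by (auto simp: fixing_def)
    have "AE z in U \<Otimes>\<^sub>M M'. (case z of (x, k) \<Rightarrow> householder e x ** k) \<in> fixing W"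
    proof -
      have "AE x in U. AE k in M'. householder e x ** k \<in> fixing W"
      proof (use U_AE in eventually_elim)
        fix x assume x: "norm x = 1 \<and> (\<forall>w\<in>W. x \<bullet> w = 0)"
        show "AE k in M'. householder e x ** k \<in> fixing W"
          using M'_AE
        proof eventually_elim
          fix k assume "k \<in> fixing (insert e W)"
          then show "householder e x ** k \<in> fixing W" by (intro fixing_mult hhW) (use x M'_W in auto)
        qed
      qed
      then have "AE x in U. AE k in M'. (case (x, k) of (x, k) \<Rightarrow> householder e x ** k) \<in> fixing W" by simp
      moreover have "Measurable.pred (U \<Otimes>\<^sub>M M') (\<lambda>z. (case z of (x, k) \<Rightarrow> householder e x ** k) \<in> fixing W)"
        by measurable
      ultimately show ?thesis by (intro P.AE_pair_measure) (simp_all add: pred_def)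
    qed
    then have "AE A in M. A \<in> fixing W"
      unfolding M_def by (subst AE_distr_iff) (simp_all add: sets_fixing)
    moreover have "prob_space M" unfolding M_def by (rule P.prob_space_distr) simp
    moreover have "(\<integral>\<^sup>+A. f (B ** A) \<partial>M) = (\<integral>\<^sup>+A. f A \<partial>M)"
      if B: "B \<in> fixing W" and [measurable]: "f \<in> borel_measurable borel" for B f
    proof -
      have "(\<integral>\<^sup>+A. f (B ** A) \<partial>M) = (\<integral>\<^sup>+x. \<integral>\<^sup>+k. f (B ** (householder e x ** k)) \<partial>M' \<partial>U)"
        by (rule int) measurable
      also have "\<dots> = (\<integral>\<^sup>+x. \<integral>\<^sup>+k. f (householder e (B *v x) ** k) \<partial>M' \<partial>U)"
      proof (rule nn_integral_cong_AE, use U_AE in eventually_elim)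
        fix x assume x: "norm x = 1 \<and> (\<forall>w\<in>W. x \<bullet> w = 0)"
        \<comment> \<open>Both \<open>B ** householder e x\<close> and
          \<open>householder e (B *v x)\<close> send \<open>e\<close> to \<open>B *v x\<close>. The
          first is the second times a matrix \<open>C\<close> that fixes \<open>e\<close> and
          \<open>W\<close>, and the invariance of \<open>M'\<close> absorbs
          \<open>C\<close>.\<close>
        define C where "C = transpose (householder e (B *v x)) ** (B ** householder e x)"
        have oB: "orthogonal_matrix B" and BW: "\<And>w. w \<in> W \<Longrightarrow> B *v w = w" using B by (auto simp: fixing_def)
        have Bx: "norm (B *v x) = norm e" "\<forall>w\<in>W. (B *v x) \<bullet> w = 0"
        proof -
          show "norm (B *v x) = norm e" using x e(1) by (simp add: orthogonal_matrix_norm[OF oB])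
          show "\<forall>w\<in>W. (B *v x) \<bullet> w = 0"
          proof
            fix w assume "w \<in> W"
            then show "(B *v x) \<bullet> w = 0" using x orthogonal_matrix_inner[OF oB, of x w] BW by simp
          qed
        qed
        have "C *v e = e"
          using householder_swap[OF Bx(1)] householder_swap[of x e] x e(1)
          by (simp add: C_def matrix_vector_mul_assoc[symmetric] householder_transpose)
        moreover have "C \<in> fixing W"
          unfolding C_def using x by (intro fixing_mult fixing_transpose B hhW Bx(2)) auto
        ultimately have C: "C \<in> fixing (insert e W)" by (auto simp: fixing_def)
        have *: "B ** (householder e x ** k) = householder e (B *v x) ** (C ** k)" for k
          by (simp add: C_def matrix_mul_assoc[symmetric] orthogonal_matrix_transpose_mult(4)[OF householder_orthogonal])
        show "(\<integral>\<^sup>+k. f (B ** (householder e x ** k)) \<partial>M') = (\<integral>\<^sup>+k. f (householder e (B *v x) ** k) \<partial>M')"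
          unfolding * by (rule M'_inv[OF C, of "\<lambda>k. f (householder e (B *v x) ** k)"]) measurable
      qed
      also have "\<dots> = (\<integral>\<^sup>+x. \<integral>\<^sup>+k. f (householder e x ** k) \<partial>M' \<partial>U)"
        by (rule U_inv[OF B, of "\<lambda>x. \<integral>\<^sup>+k. f (householder e x ** k) \<partial>M'"]) measurable
      also have "\<dots> = (\<integral>\<^sup>+A. f A \<partial>M)" by (rule int[symmetric]) measurable
      finally show ?thesis .
    qed
    moreover have "sets M = sets borel" by (simp add: M_def)
    ultimately show ?thesis by (intro exI[of _ M] conjI ballI) assumption+
  qed
qed

text \<open>Below \<open>\<omega>\<close> is a unit vector or \<open>0\<close>; in the latter case the stabilizer is the full orthogonal
  group and the sphere orthogonal to \<open>\<omega>\<close> is the full unit sphere.\<close>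

definition haar :: "real^'n \<Rightarrow> (real^'n^'n) measure" where
  "haar \<omega> = (SOME M. prob_space M \<and> sets M = sets borel \<and> (AE A in M. A \<in> stabilizer \<omega>) \<and>
    (\<forall>B\<in>stabilizer \<omega>. \<forall>f\<in>borel_measurable borel. (\<integral>\<^sup>+A. f (B ** A) \<partial>M) = (\<integral>\<^sup>+A. f A \<partial>M)))"

text \<open>The same choice term as in \<open>mean_value\<close>, so that the two unit vectors
  coincide by definition.\<close>

definition unit_perp :: "real^'n \<Rightarrow> real^'n" where
  "unit_perp \<omega> = (SOME u. norm u = 1 \<and> u \<bullet> \<omega> = 0)"

text \<open>The orbit measure of one unit vector orthogonal to \<omega>, hence the invariant measure
  on that subsphere. It is defined on all Borel sets and concentrated on the subsphere; the
  restriction and completion that occur in \<open>perp_sphere_measure\<close> are dealt with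
  separately, once and for all.\<close>

definition perp_measure :: "real^'n \<Rightarrow> (real^'n) measure" where
  "perp_measure \<omega> = distr (haar \<omega>) borel (\<lambda>A. A *v unit_perp \<omega>)"

lemma stabilizer_fixing: "stabilizer \<omega> = fixing (if \<omega> = 0 then {} else {\<omega>})"
  by (auto simp: stabilizer_def fixing_def)

lemma sets_stabilizer[measurable]: "stabilizer \<omega> \<in> sets borel"
  unfolding stabilizer_fixing by (rule sets_fixing)

lemma stabilizer_mult: "A \<in> stabilizer \<omega> \<Longrightarrow> B \<in> stabilizer \<omega> \<Longrightarrow> A ** B \<in> stabilizer \<omega>"
  unfolding stabilizer_fixing by (rule fixing_mult)

lemma stabilizer_transpose: "A \<in> stabilizer \<omega> \<Longrightarrow> transpose A \<in> stabilizer \<omega>"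
  unfolding stabilizer_fixing by (rule fixing_transpose)

lemma stabilizer_0: "stabilizer 0 = {A. orthogonal_matrix A}"
  by (auto simp: stabilizer_def)

lemma stabilizerD: "A \<in> stabilizer \<omega> \<Longrightarrow> orthogonal_matrix A" "A \<in> stabilizer \<omega> \<Longrightarrow> A *v \<omega> = \<omega>"
  by (auto simp: stabilizer_def)

locale axis_vec =
  fixes \<omega> :: "real^'n"
  assumes unit_or_0: "\<omega> = 0 \<or> norm \<omega> = 1"
begin

lemma haar_spec:
  "prob_space (haar \<omega>) \<and> sets (haar \<omega>) = sets borel \<and> (AE A in haar \<omega>. A \<in> stabilizer \<omega>) \<and>
    (\<forall>B\<in>stabilizer \<omega>. \<forall>f\<in>borel_measurable borel. (\<integral>\<^sup>+A. f (B ** A) \<partial>haar \<omega>) = (\<integral>\<^sup>+A. f A \<partial>haar \<omega>))"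
  unfolding haar_def
proof (rule someI_ex)
  have "orthonormal (if \<omega> = 0 then {} else {\<omega>})" using unit_or_0 by (auto simp: orthonormal_def)
  from haar_exists[OF this] show "\<exists>M. prob_space M \<and> sets M = sets borel \<and> (AE A in M. A \<in> stabilizer \<omega>) \<and>
    (\<forall>B\<in>stabilizer \<omega>. \<forall>f\<in>borel_measurable borel. (\<integral>\<^sup>+A. f (B ** A) \<partial>M) = (\<integral>\<^sup>+A. f A \<partial>M))"
    unfolding stabilizer_fixing .
qed

sublocale haar: prob_space "haar \<omega>" using haar_spec by simp

lemma sets_haar[measurable_cong, simp]: "sets (haar \<omega>) = sets borel" using haar_spec by simp
lemma space_haar[simp]: "space (haar \<omega>) = UNIV" using sets_eq_imp_space_eq[OF sets_haar] by simp
lemma AE_haar: "AE A in haar \<omega>. A \<in> stabilizer \<omega>" using haar_spec by simp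
lemma haar_left: "B \<in> stabilizer \<omega> \<Longrightarrow> f \<in> borel_measurable borel \<Longrightarrow>
    (\<integral>\<^sup>+A. f (B ** A) \<partial>haar \<omega>) = (\<integral>\<^sup>+A. f A \<partial>haar \<omega>)" using haar_spec by simp

sublocale haar2: pair_prob_space "haar \<omega>" "haar \<omega>" ..

text \<open>Compact groups are unimodular: in the double integral of
  \<open>f (transpose B ** A)\<close>, left invariance removes \<open>B\<close> when
  \<open>A\<close> is integrated first and removes \<open>A\<close> when \<open>B\<close> is
  integrated first.\<close>

lemma haar_transpose:
  assumes [measurable]: "f \<in> borel_measurable borel"
  shows "(\<integral>\<^sup>+A. f (transpose A) \<partial>haar \<omega>) = (\<integral>\<^sup>+A. f A \<partial>haar \<omega>)"
proof -
  have "(\<integral>\<^sup>+A. f A \<partial>haar \<omega>) = (\<integral>\<^sup>+B. (\<integral>\<^sup>+A. f A \<partial>haar \<omega>) \<partial>haar \<omega>)"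
    by (simp add: haar.emeasure_space_1[simplified])
  also have "\<dots> = (\<integral>\<^sup>+B. (\<integral>\<^sup>+A. f (transpose B ** A) \<partial>haar \<omega>) \<partial>haar \<omega>)"
    by (rule nn_integral_cong_AE, use AE_haar in eventually_elim)
       (simp add: haar_left[OF stabilizer_transpose])
  also have "\<dots> = (\<integral>\<^sup>+A. (\<integral>\<^sup>+B. f (transpose B ** A) \<partial>haar \<omega>) \<partial>haar \<omega>)"
    by (rule haar2.Fubini') measurable
  also have "\<dots> = (\<integral>\<^sup>+A. (\<integral>\<^sup>+B. f (transpose B) \<partial>haar \<omega>) \<partial>haar \<omega>)"
  proof (rule nn_integral_cong_AE, use AE_haar in eventually_elim)
    fix A assume "A \<in> stabilizer \<omega>"
    from haar_left[OF stabilizer_transpose[OF this], of "\<lambda>B. f (transpose B)"]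
    show "(\<integral>\<^sup>+B. f (transpose B ** A) \<partial>haar \<omega>) = (\<integral>\<^sup>+B. f (transpose B) \<partial>haar \<omega>)"
      by (simp add: matrix_transpose_mul)
  qed
  also have "\<dots> = (\<integral>\<^sup>+B. f (transpose B) \<partial>haar \<omega>)"
    by (simp add: haar.emeasure_space_1[simplified])
  finally show ?thesis ..
qed

lemma haar_right:
  assumes B: "B \<in> stabilizer \<omega>" and [measurable]: "f \<in> borel_measurable borel"
  shows "(\<integral>\<^sup>+A. f (A ** B) \<partial>haar \<omega>) = (\<integral>\<^sup>+A. f A \<partial>haar \<omega>)"
proof -
  have "(\<integral>\<^sup>+A. f (A ** B) \<partial>haar \<omega>) = (\<integral>\<^sup>+A. f (transpose A ** B) \<partial>haar \<omega>)"
    by (rule haar_transpose[of "\<lambda>A. f (A ** B)", symmetric]) measurable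
  also have "\<dots> = (\<integral>\<^sup>+A. f (transpose (transpose B ** A)) \<partial>haar \<omega>)"
    by (simp add: matrix_transpose_mul)
  also have "\<dots> = (\<integral>\<^sup>+A. f (transpose A) \<partial>haar \<omega>)"
    by (rule haar_left[OF stabilizer_transpose[OF B], of "\<lambda>A. f (transpose A)"]) measurable
  also have "\<dots> = (\<integral>\<^sup>+A. f A \<partial>haar \<omega>)"
    by (rule haar_transpose) measurable
  finally show ?thesis .
qed

text \<open>In the double integral of \<open>f (B ** A)\<close>, left invariance of \<open>M\<close>
  leaves the integral against \<open>M\<close>, and right invariance of the constructed measure
  leaves the integral against \<open>haar \<omega>\<close>.\<close>

lemma haar_unique:
  assumes M: "prob_space M" and [measurable_cong]: "sets M = sets borel"
    and st: "AE A in M. A \<in> stabilizer \<omega>"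
    and inv: "\<And>B f. B \<in> stabilizer \<omega> \<Longrightarrow> f \<in> borel_measurable borel \<Longrightarrow> (\<integral>\<^sup>+A. f (B ** A) \<partial>M) = (\<integral>\<^sup>+A. f A \<partial>M)"
  shows "M = haar \<omega>"
proof (rule measure_eqI)
  interpret M: prob_space M by fact
  interpret P: pair_prob_space "haar \<omega>" M ..
  show "sets M = sets (haar \<omega>)" using assms by simp
  fix X assume "X \<in> sets M"
  then have [measurable]: "X \<in> sets borel" using assms by simp
  define f :: "_ \<Rightarrow> ennreal" where "f = indicator X"
  have [measurable]: "f \<in> borel_measurable borel" unfolding f_def by measurable
  have 1: "(\<integral>\<^sup>+A. c \<partial>M) = c" "(\<integral>\<^sup>+A. c \<partial>haar \<omega>) = c" for c
    using M.emeasure_space_1 haar.emeasure_space_1 by simp_all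
  have "(\<integral>\<^sup>+A. f A \<partial>M) = (\<integral>\<^sup>+B. (\<integral>\<^sup>+A. f (B ** A) \<partial>M) \<partial>haar \<omega>)"
  proof -
    have "(\<integral>\<^sup>+B. (\<integral>\<^sup>+A. f (B ** A) \<partial>M) \<partial>haar \<omega>) = (\<integral>\<^sup>+B. (\<integral>\<^sup>+A. f A \<partial>M) \<partial>haar \<omega>)"
      by (rule nn_integral_cong_AE, use AE_haar in eventually_elim) (simp add: inv)
    then show ?thesis by (simp only: 1)
  qed
  also have "\<dots> = (\<integral>\<^sup>+A. (\<integral>\<^sup>+B. f (B ** A) \<partial>haar \<omega>) \<partial>M)"
    by (rule P.Fubini'[symmetric]) measurable
  also have "\<dots> = (\<integral>\<^sup>+A. (\<integral>\<^sup>+B. f B \<partial>haar \<omega>) \<partial>M)"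
    by (rule nn_integral_cong_AE, use st in eventually_elim) (simp add: haar_right)
  also have "\<dots> = (\<integral>\<^sup>+B. f B \<partial>haar \<omega>)" by (simp only: 1)
  finally show "emeasure M X = emeasure (haar \<omega>) X" by (simp add: f_def)
qed

lemma stabilizer_transitive:
  assumes "norm u = 1" "u \<bullet> \<omega> = 0" "norm v = 1" "v \<bullet> \<omega> = 0"
  obtains B where "B \<in> stabilizer \<omega>" "B *v u = v"
  using that[of "householder u v"] assms by (simp add: stabilizer_def householder_orthogonal householder_swap householder_fix inner_commute)

lemma haar_orbit_eq:
  assumes "norm u = 1" "u \<bullet> \<omega> = 0" "norm v = 1" "v \<bullet> \<omega> = 0" and [measurable]: "f \<in> borel_measurable borel"
  shows "(\<integral>\<^sup>+A. f (A *v u) \<partial>haar \<omega>) = (\<integral>\<^sup>+A. f (A *v v) \<partial>haar \<omega>)"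
proof -
  obtain B where B: "B \<in> stabilizer \<omega>" "B *v u = v" using stabilizer_transitive[OF assms(1-4)] by blast
  have "(\<integral>\<^sup>+A. f (A *v u) \<partial>haar \<omega>) = (\<integral>\<^sup>+A. f ((A ** B) *v u) \<partial>haar \<omega>)"
    by (rule haar_right[OF B(1), of "\<lambda>A. f (A *v u)", symmetric]) measurable
  then show ?thesis using B by (simp flip: matrix_vector_mul_assoc)
qed

end

section \<open>The invariant measure on the unit sphere orthogonal to \<omega>\<close>

locale axis_vec2 = axis_vec \<omega> for \<omega> :: "real^'n" +
  assumes card_ge_2: "CARD('n) \<ge> 2"
begin

lemma unit_perp: "norm (unit_perp \<omega>) = 1" "unit_perp \<omega> \<bullet> \<omega> = 0"
proof -
  obtain x where "x \<noteq> 0" "orthogonal \<omega> x"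
    using orthogonal_to_vector_exists[of \<omega>] card_ge_2 by auto
  then have "\<exists>u. norm u = 1 \<and> u \<bullet> \<omega> = 0"
    by (intro exI[of _ "sgn x"]) (simp add: norm_sgn orthogonal_def sgn_div_norm inner_commute)
  from someI_ex[OF this] show "norm (unit_perp \<omega>) = 1" "unit_perp \<omega> \<bullet> \<omega> = 0"
    by (auto simp: unit_perp_def)
qed

sublocale perp: prob_space "perp_measure \<omega>"
  unfolding perp_measure_def by (rule haar.prob_space_distr) measurable

lemma sets_perp[measurable_cong, simp]: "sets (perp_measure \<omega>) = sets borel" by (simp add: perp_measure_def)
lemma space_perp[simp]: "space (perp_measure \<omega>) = UNIV" by (simp add: perp_measure_def)

lemma nn_integral_perp:
  assumes "norm u = 1" "u \<bullet> \<omega> = 0" and [measurable]: "f \<in> borel_measurable borel"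
  shows "(\<integral>\<^sup>+x. f x \<partial>perp_measure \<omega>) = (\<integral>\<^sup>+A. f (A *v u) \<partial>haar \<omega>)"
proof -
  have "(\<integral>\<^sup>+x. f x \<partial>perp_measure \<omega>) = (\<integral>\<^sup>+A. f (A *v unit_perp \<omega>) \<partial>haar \<omega>)"
    unfolding perp_measure_def by (subst nn_integral_distr) measurable
  then show ?thesis using haar_orbit_eq[OF unit_perp assms] by simp
qed

lemma AE_perp: "AE x in perp_measure \<omega>. norm x = 1 \<and> x \<bullet> \<omega> = 0"
  unfolding perp_measure_def
proof (subst AE_distr_iff)
  show "AE A in haar \<omega>. norm (A *v unit_perp \<omega>) = 1 \<and> (A *v unit_perp \<omega>) \<bullet> \<omega> = 0"
  proof (use AE_haar in eventually_elim)
    fix A assume A: "A \<in> stabilizer \<omega>"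
    have "(A *v unit_perp \<omega>) \<bullet> (A *v \<omega>) = unit_perp \<omega> \<bullet> \<omega>"
      by (rule orthogonal_matrix_inner[OF stabilizerD(1)[OF A]])
    then show "norm (A *v unit_perp \<omega>) = 1 \<and> (A *v unit_perp \<omega>) \<bullet> \<omega> = 0"
      using unit_perp by (simp add: orthogonal_matrix_norm[OF stabilizerD(1)[OF A]] stabilizerD(2)[OF A])
  qed
qed measurable

lemma perp_inv:
  assumes B: "B \<in> stabilizer \<omega>" and [measurable]: "f \<in> borel_measurable borel"
  shows "(\<integral>\<^sup>+x. f (B *v x) \<partial>perp_measure \<omega>) = (\<integral>\<^sup>+x. f x \<partial>perp_measure \<omega>)"
  using haar_left[OF B, of "\<lambda>A. f (A *v unit_perp \<omega>)"]
  by (simp add: nn_integral_perp[OF unit_perp] matrix_vector_mul_assoc)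

text \<open>Averaging an invariant \<open>M\<close> over the group replaces every point of the
  subsphere by the full orbit measure, because the action is transitive.\<close>

lemma perp_unique:
  assumes M: "prob_space M" and sM[measurable_cong]: "sets M = sets borel"
    and st: "AE x in M. norm x = 1 \<and> x \<bullet> \<omega> = 0"
    and inv: "\<And>B f. B \<in> stabilizer \<omega> \<Longrightarrow> f \<in> borel_measurable borel \<Longrightarrow> (\<integral>\<^sup>+x. f (B *v x) \<partial>M) = (\<integral>\<^sup>+x. f x \<partial>M)"
  shows "M = perp_measure \<omega>"
proof (rule measure_eqI)
  interpret M: prob_space M by fact
  interpret P: pair_prob_space "haar \<omega>" M ..
  show "sets M = sets (perp_measure \<omega>)" using assms by simp
  fix X assume "X \<in> sets M"
  then have [measurable]: "X \<in> sets borel" using assms by simp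
  define f :: "_ \<Rightarrow> ennreal" where "f = indicator X"
  have [measurable]: "f \<in> borel_measurable borel" unfolding f_def by measurable
  have 1: "(\<integral>\<^sup>+A. c \<partial>M) = c" "(\<integral>\<^sup>+A. c \<partial>haar \<omega>) = c" for c
    using M.emeasure_space_1 haar.emeasure_space_1 by simp_all
  have "(\<integral>\<^sup>+x. f x \<partial>M) = (\<integral>\<^sup>+B. (\<integral>\<^sup>+x. f (B *v x) \<partial>M) \<partial>haar \<omega>)"
  proof -
    have "(\<integral>\<^sup>+B. (\<integral>\<^sup>+x. f (B *v x) \<partial>M) \<partial>haar \<omega>) = (\<integral>\<^sup>+B. (\<integral>\<^sup>+x. f x \<partial>M) \<partial>haar \<omega>)"
      by (rule nn_integral_cong_AE, use AE_haar in eventually_elim) (simp add: inv)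
    then show ?thesis by (simp only: 1)
  qed
  also have "\<dots> = (\<integral>\<^sup>+x. (\<integral>\<^sup>+B. f (B *v x) \<partial>haar \<omega>) \<partial>M)"
    by (rule P.Fubini'[symmetric]) measurable
  also have "\<dots> = (\<integral>\<^sup>+x. (\<integral>\<^sup>+x. f x \<partial>perp_measure \<omega>) \<partial>M)"
    by (rule nn_integral_cong_AE, use st in eventually_elim) (auto intro!: nn_integral_perp[symmetric])
  also have "\<dots> = (\<integral>\<^sup>+x. f x \<partial>perp_measure \<omega>)" by (simp only: 1)
  finally show "emeasure M X = emeasure (perp_measure \<omega>) X" by (simp add: f_def)
qed

end

section \<open>Identification of the completed invariant measures\<close>

text \<open>The definite description in \<open>invariant_prob\<close> ranges over measures on the
  subspace \<open>X\<close>, while \<open>P\<close> and the competitors \<open>Q\<close> of the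
  hypothesis live on the full Borel algebra. A competitor on \<open>X\<close> is pushed forward
  along the inclusion, identified with \<open>P\<close> there, and compared with the restriction of
  \<open>P\<close>.\<close>

lemma invariant_prob_eq:
  fixes P :: "'a::{second_countable_topology, t2_space} measure"
  assumes X[measurable]: "X \<in> sets borel" and P: "prob_space P" and sP[measurable_cong]: "sets P = sets borel" and AE: "AE x in P. x \<in> X"
    and g: "\<And>g. g \<in> G \<Longrightarrow> g \<in> borel_measurable borel" "\<And>g x. g \<in> G \<Longrightarrow> x \<in> X \<Longrightarrow> g x \<in> X"
    and inv: "\<And>g. g \<in> G \<Longrightarrow> distr P borel g = P"
    and uniq: "\<And>Q. prob_space Q \<Longrightarrow> sets Q = sets borel \<Longrightarrow> AE x in Q. x \<in> X \<Longrightarrow> (\<And>g. g \<in> G \<Longrightarrow> distr Q borel g = Q) \<Longrightarrow> Q = P"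
  shows "invariant_prob X G = completion (restrict_space P X)"
proof -
  interpret P: prob_space P by fact
  have spP: "space P = UNIV" using sets_eq_imp_space_eq[OF sP] by simp
  have gm: "g \<in> restrict_space borel X \<rightarrow>\<^sub>M restrict_space borel X" if "g \<in> G" for g
    using g that by (intro measurable_restrict_space3) auto
  have PX: "emeasure P X = 1"
    using AE P.emeasure_space_1 by (subst P.emeasure_eq_1_AE) auto
  define R where "R = restrict_space P X"
  have sR[measurable_cong]: "sets R = sets (restrict_space borel X)"
    unfolding R_def by (rule sets_restrict_space_cong) (simp add: sP)
  have R: "is_invariant_prob X G R" unfolding is_invariant_prob_def
  proof (intro conjI ballI)
    show "prob_space R"
      by (rule prob_spaceI) (simp add: R_def space_restrict_space spP emeasure_restrict_space sP PX)
    fix h assume h: "h \<in> G"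
    note [measurable] = g(1)[OF h] gm[OF h]
    show "distr R R h = R"
    proof (rule measure_eqI)
      fix A assume "A \<in> sets (distr R R h)"
      then have "A \<in> sets (restrict_space borel X)" by (simp add: sR)
      then have A: "A \<in> sets borel" "A \<subseteq> X" by (auto simp: sets_restrict_space_iff)
      have "emeasure (distr R R h) A = emeasure R (h -` A \<inter> X)"
        using \<open>A \<in> sets (distr R R h)\<close> gm[OF h]
        by (subst emeasure_distr) (auto simp: sR space_restrict_space R_def spP cong: measurable_cong_sets)
      also have "\<dots> = emeasure P (h -` A \<inter> X)"
        unfolding R_def by (rule emeasure_restrict_space) (auto simp: sP)
      also have "\<dots> = emeasure P (h -` A)"
        by (rule emeasure_eq_AE) (use AE measurable_sets_borel[OF g(1)[OF h] A(1)] in \<open>auto simp: sP elim: AE_mp\<close>)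
      also have "\<dots> = emeasure (distr P borel h) A"
        using A by (subst emeasure_distr) (auto simp: spP sP)
      also have "\<dots> = emeasure R A"
        using A by (simp add: inv[OF h] R_def emeasure_restrict_space sP)
      finally show "emeasure (distr R R h) A = emeasure R A" .
    qed simp
  qed (fact sR)
  have "N = R" if N: "is_invariant_prob X G N" for N
  proof -
    have N': "prob_space N" and sN[measurable_cong]: "sets N = sets (restrict_space borel X)" and Ninv: "\<And>h. h \<in> G \<Longrightarrow> distr N N h = N"
      using N by (auto simp: is_invariant_prob_def)
    interpret N: prob_space N by fact
    have spN: "space N = X" using sets_eq_imp_space_eq[OF sN] by (simp add: space_restrict_space)
    have idm[measurable]: "(\<lambda>x. x) \<in> N \<rightarrow>\<^sub>M borel"
      by (simp add: measurable_cong_sets[OF sN refl] measurable_restrict_space1)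
    define Q where "Q = distr N borel (\<lambda>x. x)"
    have "Q = P"
    proof (rule uniq)
      show "prob_space Q" unfolding Q_def by (rule N.prob_space_distr) simp
      show "sets Q = sets borel" by (simp add: Q_def)
      show "AE x in Q. x \<in> X" unfolding Q_def using X by (subst AE_distr_iff) (auto intro!: AE_I2 simp: spN)
      fix h assume h: "h \<in> G"
      have [measurable]: "h \<in> N \<rightarrow>\<^sub>M N" using gm[OF h] by (simp add: measurable_cong_sets[OF sN sN])
      note [measurable] = g(1)[OF h]
      have "distr Q borel h = distr N borel h" unfolding Q_def by (subst distr_distr) (auto simp: comp_def)
      also have "\<dots> = distr (distr N N h) borel (\<lambda>x. x)" by (subst distr_distr) (auto simp: comp_def)
      also have "\<dots> = Q" by (simp add: Ninv[OF h] Q_def)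
      finally show "distr Q borel h = Q" .
    qed
    show "N = R"
    proof (rule measure_eqI)
      show "sets N = sets R" by (simp add: sN sR)
      fix A assume "A \<in> sets N"
      then have A: "A \<in> sets borel" "A \<subseteq> X" by (auto simp: sets_restrict_space_iff sN)
      have "emeasure R A = emeasure Q A" unfolding R_def \<open>Q = P\<close> using A by (simp add: emeasure_restrict_space sP)
      also have "\<dots> = emeasure N A" unfolding Q_def using A by (subst emeasure_distr) (auto simp: spN Int_absorb2)
      finally show "emeasure N A = emeasure R A" ..
    qed
  qed
  with R have "(THE M. is_invariant_prob X G M) = R" by blast
  then show ?thesis by (simp add: invariant_prob_def R_def)
qed

lemma distr_eqI_nn_integral:
  assumes "g \<in> measurable M N"
    and "\<And>f. f \<in> borel_measurable N \<Longrightarrow> (\<integral>\<^sup>+x. f (g x) \<partial>M) = (\<integral>\<^sup>+x. f x \<partial>L)"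
    and "sets L = sets N"
  shows "distr M N g = L"
proof (rule measure_eqI)
  fix A assume "A \<in> sets (distr M N g)"
  then have A: "A \<in> sets N" by simp
  have "emeasure (distr M N g) A = (\<integral>\<^sup>+x. indicator A x \<partial>distr M N g)" using A by simp
  also have "\<dots> = (\<integral>\<^sup>+x. indicator A (g x) \<partial>M)" using A assms(1) by (subst nn_integral_distr) auto
  also have "\<dots> = emeasure L A" using assms(2)[of "indicator A"] A assms(3) by simp
  finally show "emeasure (distr M N g) A = emeasure L A" .
qed (simp add: assms)

lemma nn_integral_distr_inv:
  assumes "distr M borel g = M" "sets M = sets borel" and [measurable]: "g \<in> borel_measurable borel" "f \<in> borel_measurable borel"
  shows "(\<integral>\<^sup>+x. f (g x) \<partial>M) = (\<integral>\<^sup>+x. f x \<partial>M)"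
proof -
  note [measurable_cong] = assms(2)
  have "(\<integral>\<^sup>+x. f x \<partial>M) = (\<integral>\<^sup>+x. f x \<partial>distr M borel g)" using assms by simp
  also have "\<dots> = (\<integral>\<^sup>+x. f (g x) \<partial>M)" by (subst nn_integral_distr) measurable
  finally show ?thesis ..
qed

context axis_vec
begin

lemma haar_measure_eq: "haar_measure \<omega> = completion (restrict_space (haar \<omega>) (stabilizer \<omega>))"
  unfolding haar_measure_def
proof (rule invariant_prob_eq)
  fix g :: "real^'n^'n \<Rightarrow> real^'n^'n" and x assume "g \<in> {(**) B |B. B \<in> stabilizer \<omega>}"
  then obtain B where B: "g = (**) B" "B \<in> stabilizer \<omega>" by blast
  have m: "(\<lambda>A. B ** A) \<in> borel_measurable borel" by (rule borel_measurable_matrix_mult_left)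
  then show "g \<in> borel_measurable borel" unfolding B .
  show "g x \<in> stabilizer \<omega>" if "x \<in> stabilizer \<omega>" using that B by (simp add: stabilizer_mult)
  show "distr (haar \<omega>) borel g = haar \<omega>" unfolding B
    by (rule distr_eqI_nn_integral) (auto simp: haar_left[OF B(2)] m)
next
  fix Q :: "(real^'n^'n) measure"
  assume Q: "prob_space Q" "sets Q = sets borel" "AE x in Q. x \<in> stabilizer \<omega>"
    "\<And>g. g \<in> {(**) B |B. B \<in> stabilizer \<omega>} \<Longrightarrow> distr Q borel g = Q"
  show "Q = haar \<omega>"
  proof (rule haar_unique[OF Q(1-3)])
    fix B and f :: "real^'n^'n \<Rightarrow> ennreal" assume B: "B \<in> stabilizer \<omega>" and f: "f \<in> borel_measurable borel"
    have m: "(\<lambda>A. B ** A) \<in> borel_measurable borel" by (rule borel_measurable_matrix_mult_left)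
    show "(\<integral>\<^sup>+A. f (B ** A) \<partial>Q) = (\<integral>\<^sup>+A. f A \<partial>Q)"
      using B by (intro nn_integral_distr_inv[OF Q(4) Q(2) m f] CollectI exI[of _ B] conjI refl)
  qed
qed (auto simp: AE_haar haar.prob_space_axioms)

end

context axis_vec2
begin

lemma perp_sphere_measure_eq:
  "perp_sphere_measure \<omega> = completion (restrict_space (perp_measure \<omega>) {\<theta> \<in> sphere 0 1. \<theta> \<bullet> \<omega> = 0})"
  unfolding perp_sphere_measure_def
proof (rule invariant_prob_eq)
  fix g :: "real^'n \<Rightarrow> real^'n" and x assume "g \<in> {(*v) A |A. A \<in> stabilizer \<omega>}"
  then obtain B where B: "g = (*v) B" "B \<in> stabilizer \<omega>" by blast
  have "(\<lambda>A. B *v A) \<in> borel_measurable borel" by measurable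
  then show "g \<in> borel_measurable borel" unfolding B .
  show "g x \<in> {\<theta> \<in> sphere 0 1. \<theta> \<bullet> \<omega> = 0}" if "x \<in> {\<theta> \<in> sphere 0 1. \<theta> \<bullet> \<omega> = 0}"
    using that B(2) orthogonal_matrix_inner[OF stabilizerD(1)[OF B(2)], of x \<omega>]
    by (simp add: B(1) orthogonal_matrix_norm stabilizerD)
  show "distr (perp_measure \<omega>) borel g = perp_measure \<omega>" unfolding B
    by (rule distr_eqI_nn_integral) (auto simp: perp_inv[OF B(2)])
next
  fix Q :: "(real^'n) measure"
  assume Q: "prob_space Q" "sets Q = sets borel" "AE x in Q. x \<in> {\<theta> \<in> sphere 0 1. \<theta> \<bullet> \<omega> = 0}"
    "\<And>g. g \<in> {(*v) B |B. B \<in> stabilizer \<omega>} \<Longrightarrow> distr Q borel g = Q"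
  show "Q = perp_measure \<omega>"
  proof (rule perp_unique[OF Q(1,2)])
    show "AE x in Q. norm x = 1 \<and> x \<bullet> \<omega> = 0" using Q(3) by simp
    fix B and f :: "real^'n \<Rightarrow> ennreal" assume B: "B \<in> stabilizer \<omega>" and f: "f \<in> borel_measurable borel"
    have m: "(\<lambda>x. B *v x) \<in> borel_measurable borel" by measurable
    show "(\<integral>\<^sup>+x. f (B *v x) \<partial>Q) = (\<integral>\<^sup>+x. f x \<partial>Q)"
      using B by (intro nn_integral_distr_inv[OF Q(4) Q(2) m f] CollectI exI[of _ B] conjI refl)
  qed
next
  have "{\<theta>::real^'n. norm \<theta> = 1 \<and> \<theta> \<bullet> \<omega> = 0} \<in> sets borel" by measurable
  then show "{\<theta> \<in> sphere 0 1. \<theta> \<bullet> \<omega> = 0} \<in> sets borel" by simp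
qed (use AE_perp in \<open>auto simp: perp.prob_space_axioms\<close>)

text \<open>Conjugation by \<open>Q\<close> carries the stabilizer of \<open>Q *v \<omega>\<close>
  into that of \<omega>, so the image measure satisfies the characterisation of
  \<open>perp_measure (Q *v \<omega>)\<close>.\<close>

lemma nn_integral_perp_rotate:
  assumes Q: "orthogonal_matrix Q" and [measurable]: "f \<in> borel_measurable borel"
  shows "(\<integral>\<^sup>+x. f x \<partial>perp_measure (Q *v \<omega>)) = (\<integral>\<^sup>+x. f (Q *v x) \<partial>perp_measure \<omega>)"
proof -
  interpret Q: axis_vec2 "Q *v \<omega>"
    using unit_or_0 card_ge_2 by unfold_locales (auto simp: orthogonal_matrix_norm[OF Q])
  have "distr (perp_measure \<omega>) borel ((*v) Q) = perp_measure (Q *v \<omega>)"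
  proof (rule Q.perp_unique)
    show "prob_space (distr (perp_measure \<omega>) borel ((*v) Q))" by (rule perp.prob_space_distr) measurable
    show "AE x in distr (perp_measure \<omega>) borel ((*v) Q). norm x = 1 \<and> x \<bullet> (Q *v \<omega>) = 0"
      by (subst AE_distr_iff) (use AE_perp in \<open>auto simp: orthogonal_matrix_norm[OF Q] orthogonal_matrix_inner[OF Q]\<close>)
    fix B and f :: "real^'n \<Rightarrow> ennreal" assume B: "B \<in> stabilizer (Q *v \<omega>)" and [measurable]: "f \<in> borel_measurable (borel::(real^'n) measure)"
    have "transpose Q ** (B ** Q) \<in> stabilizer \<omega>"
      using B Q by (simp add: stabilizer_def orthogonal_matrix_mul orthogonal_matrix_transpose_mult flip: matrix_vector_mul_assoc)
    from perp_inv[OF this, of "\<lambda>x. f (Q *v x)"]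
    show "(\<integral>\<^sup>+x. f (B *v x) \<partial>distr (perp_measure \<omega>) borel ((*v) Q)) = (\<integral>\<^sup>+x. f x \<partial>distr (perp_measure \<omega>) borel ((*v) Q))"
      by (simp add: nn_integral_distr matrix_vector_mul_assoc orthogonal_matrix_transpose_mult(4)[OF Q])
  qed simp
  then show ?thesis using nn_integral_distr[of "(*v) Q" "perp_measure \<omega>" borel f] by simp
qed

end

section \<open>One-dimensional marginals of the spherical measures\<close>

interpretation lborel_prod: product_sigma_finite "\<lambda>_::'i. lborel :: real measure" ..

text \<open>Half lines generate the Borel sets. On the left their measure is the volume of a ball,
  on the right the density integrates to the same multiple of the k-th power of the radius.\<close>

lemma radial_law:
  assumes A: "finite A" "A \<noteq> {}"
  shows "distr (Pi\<^sub>M A (\<lambda>_. lborel)) borel (\<lambda>f. sqrt (\<Sum>i\<in>A. (f i)\<^sup>2)) =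
    density lborel (\<lambda>r. ennreal (unit_ball_vol (card A) * real (card A) * r ^ (card A - 1)) * indicator {0..} r)"
    (is "?M = ?N")
proof (rule measure_eqI_generator_eq[where E = "range atMost" and A = "\<lambda>n::nat. {..real n}" and \<Omega> = UNIV])
  define k where "k = card A"
  have k: "k \<ge> 1" using A unfolding k_def by (simp add: Suc_le_eq card_gt_0_iff)
  have m[measurable]: "(\<lambda>f. sqrt (\<Sum>i\<in>A. (f i)\<^sup>2)) \<in> borel_measurable (Pi\<^sub>M A (\<lambda>_. lborel :: real measure))" by measurable
  have eM: "emeasure ?M {..r} = emeasure (Pi\<^sub>M A (\<lambda>_. lborel)) ({f. sqrt (\<Sum>i\<in>A. (f i)\<^sup>2) \<le> r} \<inter> space (Pi\<^sub>M A (\<lambda>_. lborel)))" for r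
    by (subst emeasure_distr) (auto intro!: arg_cong2[of _ _ _ _ emeasure])
  have M: "emeasure ?M {..r} = ennreal (unit_ball_vol k * r ^ k)" if "r > 0" for r
    unfolding eM using emeasure_cball_aux[OF A(1) that] by (simp add: k_def)
  have N: "emeasure ?N {..r} = ennreal (unit_ball_vol k * r ^ k)" if "r \<ge> 0" for r
  proof -
    have "emeasure ?N {..r} = (\<integral>\<^sup>+x. ennreal (unit_ball_vol k * real k * x ^ (k - 1)) * indicator {0..r} x \<partial>lborel)"
      unfolding k_def by (subst emeasure_density) (auto intro!: nn_integral_cong simp: indicator_def)
    also have "\<dots> = ennreal (unit_ball_vol k * r ^ k - unit_ball_vol k * 0 ^ k)"
      using that k by (intro nn_integral_FTC_Icc) (auto intro!: derivative_eq_intros)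
    finally show ?thesis using k by (simp add: power_0_left)
  qed
  show eq: "emeasure ?M X = emeasure ?N X" if "X \<in> range atMost" for X
  proof -
    from that obtain r where X: "X = {..r}" by auto
    show ?thesis
    proof (cases "r > 0")
      case True
      then show ?thesis using M N X by simp
    next
      case False
      \<comment> \<open>The volume formula needs a positive radius; for \<open>r \<le> 0\<close> the
        measure is squeezed by that of small balls.\<close>
      have "emeasure ?M {..r} \<le> 0"
      proof (rule ennreal_le_epsilon)
        fix e :: real assume "e > 0"
        define \<epsilon> where "\<epsilon> = min 1 (e / unit_ball_vol k)"
        have \<epsilon>: "\<epsilon> > 0" "\<epsilon> \<le> 1" "unit_ball_vol k * \<epsilon> \<le> e"
          using \<open>e > 0\<close> unit_ball_vol_pos[of k] by (auto simp: \<epsilon>_def min_def field_simps)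
        have "emeasure ?M {..r} \<le> emeasure ?M {..\<epsilon>}" using False \<epsilon> by (intro emeasure_mono) auto
        also have "\<dots> = ennreal (unit_ball_vol k * \<epsilon> ^ k)" by (rule M) fact
        also have "unit_ball_vol k * \<epsilon> ^ k \<le> unit_ball_vol k * \<epsilon> ^ 1"
          using \<epsilon> k by (intro mult_left_mono power_decreasing) auto
        finally show "emeasure ?M {..r} \<le> 0 + ennreal e" using \<epsilon> by (simp add: ennreal_leI order_trans)
      qed
      moreover have "emeasure ?N {..r} \<le> emeasure ?N {..0}" using False by (intro emeasure_mono) auto
      then have "emeasure ?N {..r} = 0" using N[of 0] k by (simp add: power_0_left)
      ultimately show ?thesis using X by simp
    qed
  qed
  show "emeasure ?M {..real n} \<noteq> \<infinity>" for n using eq[of "{..real n}"] N[of "real n"] by simp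
  show "(\<Union>i. {..real i}) = UNIV" using real_arch_simple by auto
qed (auto simp: Int_stable_def borel_eq_atMost)

text \<open>Substituting \<open>x = r \<sigma>\<close> and then \<open>r = \<rho> / sqrt (1 + \<sigma>\<^sup>2)\<close> decouples the direction from the weight.\<close>

lemma nn_integral_PiM_direction:
  assumes A: "finite A" "A \<noteq> {}" "b \<notin> A"
    and [measurable]: "W \<in> borel_measurable borel" "g \<in> borel_measurable borel"
  defines "k \<equiv> card A"
  shows "(\<integral>\<^sup>+f. g (f b / sqrt ((f b)\<^sup>2 + (\<Sum>i\<in>A. (f i)\<^sup>2))) * W ((f b)\<^sup>2 + (\<Sum>i\<in>A. (f i)\<^sup>2)) \<partial>Pi\<^sub>M (insert b A) (\<lambda>_. lborel)) =
    (\<integral>\<^sup>+\<rho>. W (\<rho>\<^sup>2) * (ennreal (unit_ball_vol k * real k * \<rho> ^ k) * indicator {0..} \<rho>) \<partial>lborel) *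
    (\<integral>\<^sup>+\<sigma>. g (\<sigma> / sqrt (1 + \<sigma>\<^sup>2)) * ennreal ((1 + \<sigma>\<^sup>2) powr (- (real k + 1) / 2)) \<partial>lborel)"
proof -
  define G where "G r = (\<integral>\<^sup>+x. g (x / sqrt (x\<^sup>2 + r\<^sup>2)) * W (x\<^sup>2 + r\<^sup>2) \<partial>lborel)" for r
  define d where "d r = ennreal (unit_ball_vol k * real k * r ^ (k - 1)) * indicator {0..} r" for r :: real
  have k: "k \<ge> 1" using A unfolding k_def by (simp add: Suc_le_eq card_gt_0_iff)
  have [measurable]: "G \<in> borel_measurable borel" "d \<in> borel_measurable borel" unfolding G_def[abs_def] d_def[abs_def] by measurable
  have "(\<integral>\<^sup>+f. g (f b / sqrt ((f b)\<^sup>2 + (\<Sum>i\<in>A. (f i)\<^sup>2))) * W ((f b)\<^sup>2 + (\<Sum>i\<in>A. (f i)\<^sup>2)) \<partial>Pi\<^sub>M (insert b A) (\<lambda>_. lborel)) =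
     (\<integral>\<^sup>+y. \<integral>\<^sup>+x. g (x / sqrt (x\<^sup>2 + (\<Sum>i\<in>A. (y i)\<^sup>2))) * W (x\<^sup>2 + (\<Sum>i\<in>A. (y i)\<^sup>2)) \<partial>lborel \<partial>Pi\<^sub>M A (\<lambda>_. lborel))"
  proof (subst lborel_prod.product_nn_integral_insert[OF A(1,3)])
    have *: "(\<Sum>i\<in>A. ((y(b := x)) i)\<^sup>2) = (\<Sum>i\<in>A. (y i)\<^sup>2)" for x :: real and y
      using A(3) by (intro sum.cong) auto
    show "(\<integral>\<^sup>+y. \<integral>\<^sup>+x. g ((y(b := x)) b / sqrt (((y(b := x)) b)\<^sup>2 + (\<Sum>i\<in>A. ((y(b := x)) i)\<^sup>2))) *
              W (((y(b := x)) b)\<^sup>2 + (\<Sum>i\<in>A. ((y(b := x)) i)\<^sup>2)) \<partial>lborel \<partial>Pi\<^sub>M A (\<lambda>_. lborel)) =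
     (\<integral>\<^sup>+y. \<integral>\<^sup>+x. g (x / sqrt (x\<^sup>2 + (\<Sum>i\<in>A. (y i)\<^sup>2))) * W (x\<^sup>2 + (\<Sum>i\<in>A. (y i)\<^sup>2)) \<partial>lborel \<partial>Pi\<^sub>M A (\<lambda>_. lborel))"
      unfolding * by simp
  qed measurable
  also have "\<dots> = (\<integral>\<^sup>+y. G (sqrt (\<Sum>i\<in>A. (y i)\<^sup>2)) \<partial>Pi\<^sub>M A (\<lambda>_. lborel))"
    unfolding G_def by (simp add: sum_nonneg)
  also have "\<dots> = (\<integral>\<^sup>+r. G r \<partial>distr (Pi\<^sub>M A (\<lambda>_. lborel)) borel (\<lambda>f. sqrt (\<Sum>i\<in>A. (f i)\<^sup>2)))"
    by (subst nn_integral_distr) measurable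
  also have "\<dots> = (\<integral>\<^sup>+r. d r * G r \<partial>lborel)"
    unfolding radial_law[OF A(1,2)] k_def[symmetric] d_def[symmetric] by (subst nn_integral_density) measurable
  also have "\<dots> = (\<integral>\<^sup>+r. \<integral>\<^sup>+\<sigma>. g (\<sigma> / sqrt (1 + \<sigma>\<^sup>2)) * W (r\<^sup>2 * (1 + \<sigma>\<^sup>2)) * (ennreal (unit_ball_vol k * real k * r ^ k) * indicator {0..} r) \<partial>lborel \<partial>lborel)"
  proof (rule nn_integral_cong_AE)
    have "AE r in lborel. r \<noteq> (0::real)" by (rule AE_lborel_singleton)
    then show "AE r in lborel. d r * G r = (\<integral>\<^sup>+\<sigma>. g (\<sigma> / sqrt (1 + \<sigma>\<^sup>2)) * W (r\<^sup>2 * (1 + \<sigma>\<^sup>2)) * (ennreal (unit_ball_vol k * real k * r ^ k) * indicator {0..} r) \<partial>lborel)"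
    proof eventually_elim
      fix r :: real assume "r \<noteq> 0"
      show "d r * G r = (\<integral>\<^sup>+\<sigma>. g (\<sigma> / sqrt (1 + \<sigma>\<^sup>2)) * W (r\<^sup>2 * (1 + \<sigma>\<^sup>2)) * (ennreal (unit_ball_vol k * real k * r ^ k) * indicator {0..} r) \<partial>lborel)"
      proof (cases "r > 0")
        case True
        have sq: "(r * \<sigma>)\<^sup>2 + r\<^sup>2 = r\<^sup>2 * (1 + \<sigma>\<^sup>2)" "(r * \<sigma>) / sqrt (r\<^sup>2 * (1 + \<sigma>\<^sup>2)) = \<sigma> / sqrt (1 + \<sigma>\<^sup>2)" for \<sigma>
        proof -
          show "(r * \<sigma>)\<^sup>2 + r\<^sup>2 = r\<^sup>2 * (1 + \<sigma>\<^sup>2)" by (simp add: algebra_simps)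
          have "sqrt (r\<^sup>2 * (1 + \<sigma>\<^sup>2)) = r * sqrt (1 + \<sigma>\<^sup>2)" using True by (simp only: real_sqrt_mult real_sqrt_abs abs_of_pos)
          then show "(r * \<sigma>) / sqrt (r\<^sup>2 * (1 + \<sigma>\<^sup>2)) = \<sigma> / sqrt (1 + \<sigma>\<^sup>2)" using True by simp
        qed
        have G: "G r = ennreal r * (\<integral>\<^sup>+\<sigma>. g (\<sigma> / sqrt (1 + \<sigma>\<^sup>2)) * W (r\<^sup>2 * (1 + \<sigma>\<^sup>2)) \<partial>lborel)"
          unfolding G_def using True
          by (subst nn_integral_real_affine[where c = r and t = 0]) (auto simp: sq)
        \<comment> \<open>The Jacobian \<open>r\<close> of \<open>x = r \<sigma>\<close> raises the
          radial power from \<open>k - 1\<close> to \<open>k\<close>; with the Jacobian of the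
          rescaling below this yields \<open>k + 1\<close> factors \<open>c\<close>, the source of
          the exponent -(k + 1)/2.\<close>
        have d: "d r * ennreal r = ennreal (unit_ball_vol k * real k * r ^ k) * indicator {0..} r"
          using True k by (cases k) (auto simp: d_def ennreal_mult[symmetric] mult_ac)
        have c: "(\<integral>\<^sup>+\<sigma>. g (\<sigma> / sqrt (1 + \<sigma>\<^sup>2)) * W (r\<^sup>2 * (1 + \<sigma>\<^sup>2)) * c \<partial>lborel) =
          (\<integral>\<^sup>+\<sigma>. g (\<sigma> / sqrt (1 + \<sigma>\<^sup>2)) * W (r\<^sup>2 * (1 + \<sigma>\<^sup>2)) \<partial>lborel) * c" for c
          by (subst nn_integral_multc) simp_all
        show ?thesis unfolding c d[symmetric] G by (simp only: mult_ac)
      qed (use \<open>r \<noteq> 0\<close> in \<open>auto simp: d_def\<close>)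
    qed
  qed
  also have "\<dots> = (\<integral>\<^sup>+\<sigma>. \<integral>\<^sup>+r. g (\<sigma> / sqrt (1 + \<sigma>\<^sup>2)) * W (r\<^sup>2 * (1 + \<sigma>\<^sup>2)) * (ennreal (unit_ball_vol k * real k * r ^ k) * indicator {0..} r) \<partial>lborel \<partial>lborel)"
    by (rule lborel_pair.Fubini') measurable
  also have "\<dots> = (\<integral>\<^sup>+\<sigma>. (g (\<sigma> / sqrt (1 + \<sigma>\<^sup>2)) * ennreal ((1 + \<sigma>\<^sup>2) powr (- (real k + 1) / 2))) *
       (\<integral>\<^sup>+\<rho>. W (\<rho>\<^sup>2) * (ennreal (unit_ball_vol k * real k * \<rho> ^ k) * indicator {0..} \<rho>) \<partial>lborel) \<partial>lborel)"
  proof (rule nn_integral_cong)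
    fix \<sigma> :: real
    define c where "c = 1 / sqrt (1 + \<sigma>\<^sup>2)"
    have s: "1 + \<sigma>\<^sup>2 > 0" by (smt (verit) zero_le_power2)
    have c: "c > 0" using s by (simp add: c_def)
    have c2: "(c * \<rho>)\<^sup>2 * (1 + \<sigma>\<^sup>2) = \<rho>\<^sup>2" for \<rho> using s by (simp add: c_def power_mult_distrib power_divide)
    have "(\<integral>\<^sup>+r. W (r\<^sup>2 * (1 + \<sigma>\<^sup>2)) * (ennreal (unit_ball_vol k * real k * r ^ k) * indicator {0..} r) \<partial>lborel)
      = ennreal c * (\<integral>\<^sup>+\<rho>. W (\<rho>\<^sup>2) * (ennreal (unit_ball_vol k * real k * (c * \<rho>) ^ k) * indicator {0..} (c * \<rho>)) \<partial>lborel)"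
      using c by (subst nn_integral_real_affine[where c = c and t = 0]) (auto simp: c2)
    also have "(\<integral>\<^sup>+\<rho>. W (\<rho>\<^sup>2) * (ennreal (unit_ball_vol k * real k * (c * \<rho>) ^ k) * indicator {0..} (c * \<rho>)) \<partial>lborel) =
      (\<integral>\<^sup>+\<rho>. ennreal (c ^ k) * (W (\<rho>\<^sup>2) * (ennreal (unit_ball_vol k * real k * \<rho> ^ k) * indicator {0..} \<rho>)) \<partial>lborel)"
    proof (rule nn_integral_cong)
      fix \<rho> :: real
      show "W (\<rho>\<^sup>2) * (ennreal (unit_ball_vol k * real k * (c * \<rho>) ^ k) * indicator {0..} (c * \<rho>)) =
        ennreal (c ^ k) * (W (\<rho>\<^sup>2) * (ennreal (unit_ball_vol k * real k * \<rho> ^ k) * indicator {0..} \<rho>))"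
      proof (cases "\<rho> \<ge> 0")
        case True
        then have "ennreal (unit_ball_vol k * real k * (c * \<rho>) ^ k) = ennreal (c ^ k) * ennreal (unit_ball_vol k * real k * \<rho> ^ k)"
          using c by (subst ennreal_mult[symmetric]) (auto simp: power_mult_distrib mult_ac)
        then show ?thesis using True c by (simp add: mult_ac indicator_def)
      qed (use c in \<open>auto simp: indicator_def zero_le_mult_iff\<close>)
    qed
    also have "\<dots> = ennreal (c ^ k) * (\<integral>\<^sup>+\<rho>. W (\<rho>\<^sup>2) * (ennreal (unit_ball_vol k * real k * \<rho> ^ k) * indicator {0..} \<rho>) \<partial>lborel)"
      by (rule nn_integral_cmult) measurable
    finally have *: "(\<integral>\<^sup>+r. W (r\<^sup>2 * (1 + \<sigma>\<^sup>2)) * (ennreal (unit_ball_vol k * real k * r ^ k) * indicator {0..} r) \<partial>lborel) =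
       ennreal (c ^ Suc k) * (\<integral>\<^sup>+\<rho>. W (\<rho>\<^sup>2) * (ennreal (unit_ball_vol k * real k * \<rho> ^ k) * indicator {0..} \<rho>) \<partial>lborel)"
      using c by (simp add: ennreal_mult mult_ac)
    have "c = (1 + \<sigma>\<^sup>2) powr (-1/2)"
    proof -
      have "(1 + \<sigma>\<^sup>2) powr (-1/2) = inverse ((1 + \<sigma>\<^sup>2) powr (1/2))" by (simp add: powr_minus[symmetric])
      also have "(1 + \<sigma>\<^sup>2) powr (1/2) = sqrt (1 + \<sigma>\<^sup>2)" by (rule powr_half_sqrt) (use s in simp)
      finally show ?thesis by (simp add: c_def inverse_eq_divide)
    qed
    then have "c powr real (Suc k) = (1 + \<sigma>\<^sup>2) powr (-1/2 * real (Suc k))" by (simp only: powr_powr)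
    also have "-1/2 * real (Suc k) = - (real k + 1) / 2" by (simp add: field_simps)
    finally have "c ^ Suc k = (1 + \<sigma>\<^sup>2) powr (- (real k + 1) / 2)"
      using c by (simp only: powr_realpow)
    with * show "(\<integral>\<^sup>+r. g (\<sigma> / sqrt (1 + \<sigma>\<^sup>2)) * W (r\<^sup>2 * (1 + \<sigma>\<^sup>2)) * (ennreal (unit_ball_vol k * real k * r ^ k) * indicator {0..} r) \<partial>lborel) =
      (g (\<sigma> / sqrt (1 + \<sigma>\<^sup>2)) * ennreal ((1 + \<sigma>\<^sup>2) powr (- (real k + 1) / 2))) *
       (\<integral>\<^sup>+\<rho>. W (\<rho>\<^sup>2) * (ennreal (unit_ball_vol k * real k * \<rho> ^ k) * indicator {0..} \<rho>) \<partial>lborel)"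
      by (simp add: mult.assoc nn_integral_cmult)
  qed
  also have "\<dots> = (\<integral>\<^sup>+\<rho>. W (\<rho>\<^sup>2) * (ennreal (unit_ball_vol k * real k * \<rho> ^ k) * indicator {0..} \<rho>) \<partial>lborel) *
    (\<integral>\<^sup>+\<sigma>. g (\<sigma> / sqrt (1 + \<sigma>\<^sup>2)) * ennreal ((1 + \<sigma>\<^sup>2) powr (- (real k + 1) / 2)) \<partial>lborel)"
    by (subst nn_integral_multc) (auto simp: mult.commute)
  finally show ?thesis .
qed

lemma inverse_powr: "a > 0 \<Longrightarrow> (1 / a) powr p = a powr (- p :: real)"
  by (simp add: powr_divide powr_minus inverse_eq_divide)

text \<open>For s = \<sigma> / sqrt (1 + \<sigma>^2) one has 1 - s^2 = 1 / (1 + \<sigma>^2), and the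
  derivative is (1 + \<sigma>^2) to the power -3/2; this accounts for the exponent (m - 3)/2. The
  substitution is made on compact intervals and extended by monotone convergence. Indicators are
  enough, since the result serves to compare laws.\<close>

lemma direction_substitution:
  assumes [measurable]: "S \<in> sets borel"
  shows "(\<integral>\<^sup>+\<sigma>. indicator S (\<sigma> / sqrt (1 + \<sigma>\<^sup>2)) * ennreal ((1 + \<sigma>\<^sup>2) powr (- real m / 2)) \<partial>lborel) =
    (\<integral>\<^sup>+s. indicator S s * (ennreal ((1 - s\<^sup>2) powr ((real m - 3) / 2)) * indicator {-1<..<1} s) \<partial>lborel)"
proof -
  define g where "g \<sigma> = \<sigma> / sqrt (1 + \<sigma>\<^sup>2)" for \<sigma> :: real
  have [measurable]: "g \<in> borel_measurable borel" unfolding g_def[abs_def] by measurable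
  define g' where "g' \<sigma> = (1 + \<sigma>\<^sup>2) powr (-3/2)" for \<sigma> :: real
  define F where "F s = indicator S s * ((1 - s\<^sup>2) powr ((real m - 3) / 2))" for s :: real
  have [measurable]: "F \<in> borel_measurable borel" unfolding F_def[abs_def] by measurable
  have pos: "1 + \<sigma>\<^sup>2 > 0" for \<sigma> :: real by (smt (verit) zero_le_power2)
  have deriv: "(g has_real_derivative g' \<sigma>) (at \<sigma>)" for \<sigma>
  proof -
    have "g' \<sigma> = (sqrt (1 + \<sigma>\<^sup>2) - \<sigma> * (\<sigma> / sqrt (1 + \<sigma>\<^sup>2))) / (1 + \<sigma>\<^sup>2)"
    proof -
      have "(1 + \<sigma>\<^sup>2) powr (3/2) = (1 + \<sigma>\<^sup>2) powr (1 + 1/2)" by simp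
      also have "\<dots> = (1 + \<sigma>\<^sup>2) * sqrt (1 + \<sigma>\<^sup>2)" using pos[of \<sigma>] by (subst powr_add) (simp add: powr_half_sqrt)
      finally have "g' \<sigma> = 1 / ((1 + \<sigma>\<^sup>2) * sqrt (1 + \<sigma>\<^sup>2))" by (simp add: g'_def powr_minus inverse_eq_divide)
      moreover have "sqrt (1 + \<sigma>\<^sup>2) - \<sigma> * (\<sigma> / sqrt (1 + \<sigma>\<^sup>2)) = 1 / sqrt (1 + \<sigma>\<^sup>2)"
        using pos[of \<sigma>] by (simp add: field_simps power2_eq_square[symmetric])
      ultimately show ?thesis by (simp only: divide_divide_eq_left mult.commute)
    qed
    then show ?thesis unfolding g_def[abs_def] using pos[of \<sigma>]
      by (auto intro!: derivative_eq_intros simp: power2_eq_square[symmetric] field_simps)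
  qed
  have g'_nonneg: "0 \<le> g' x" for x by (simp add: g'_def)
  have neg: "g (- x) = - g x" for x by (simp add: g_def)
  have gsq: "1 - (g \<sigma>)\<^sup>2 = 1 / (1 + \<sigma>\<^sup>2)" for \<sigma> using pos[of \<sigma>] by (simp add: g_def power_divide field_simps)
  have g1: "\<bar>g \<sigma>\<bar> < 1" for \<sigma>
  proof -
    have "(g \<sigma>)\<^sup>2 < 1" using gsq[of \<sigma>] pos[of \<sigma>] by (smt (verit) zero_less_divide_iff)
    then show ?thesis by (simp add: abs_square_less_1)
  qed
  have mono: "g x \<le> g y" if "x \<le> y" for x y
  proof (rule DERIV_nonneg_imp_nondecreasing[OF that])
    fix z show "\<exists>y. (g has_real_derivative y) (at z) \<and> 0 \<le> y"
      using deriv[of z] by (intro exI[of _ "g' z"]) (simp add: g'_def)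
  qed
  have Fg: "F (g \<sigma>) * g' \<sigma> = indicator S (g \<sigma>) * (1 + \<sigma>\<^sup>2) powr (- real m / 2)" for \<sigma>
  proof -
    have "(1 / (1 + \<sigma>\<^sup>2)) powr ((real m - 3) / 2) * (1 + \<sigma>\<^sup>2) powr (-3/2) = (1 + \<sigma>\<^sup>2) powr (- ((real m - 3) / 2) + -3/2)"
      by (simp only: powr_add inverse_powr[OF pos])
    also have "- ((real m - 3) / 2) + -3/2 = - real m / 2" by (simp add: field_simps)
    finally show ?thesis by (simp add: F_def gsq g'_def)
  qed
  have step: "(\<integral>\<^sup>+s. ennreal (F s) * indicator {- g (real n)..g (real n)} s \<partial>lborel) =
    (\<integral>\<^sup>+\<sigma>. ennreal (indicator S (g \<sigma>) * (1 + \<sigma>\<^sup>2) powr (- real m / 2)) * indicator {- real n..real n} \<sigma> \<partial>lborel)" for n :: nat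
  proof -
    have "(\<integral>\<^sup>+s. ennreal (F s) * indicator {- g (real n)..g (real n)} s \<partial>lborel) =
      (\<integral>\<^sup>+x. ennreal (F x * indicator {g (- real n)..g (real n)} x) \<partial>lborel)"
      by (intro nn_integral_cong) (auto simp: neg indicator_def)
    also have "\<dots> = (\<integral>\<^sup>+x. ennreal (F (g x) * g' x * indicator {- real n..real n} x) \<partial>lborel)"
    proof (rule nn_integral_substitution)
      show "continuous_on {- real n..real n} g'" unfolding g'_def[abs_def]
        using pos by (intro continuous_intros) (auto simp: less_imp_neq[symmetric])
    qed (use deriv g'_nonneg in \<open>auto simp: set_borel_measurable_def\<close>)
    also have "\<dots> = (\<integral>\<^sup>+\<sigma>. ennreal (indicator S (g \<sigma>) * (1 + \<sigma>\<^sup>2) powr (- real m / 2)) * indicator {- real n..real n} \<sigma> \<partial>lborel)"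
      unfolding Fg by (intro nn_integral_cong) (auto simp: indicator_def)
    finally show ?thesis .
  qed
  have inc: "incseq (\<lambda>n s. ennreal (F s) * indicator {- g (real n)..g (real n)} s)"
    "incseq (\<lambda>n \<sigma>. ennreal (indicator S (g \<sigma>) * (1 + \<sigma>\<^sup>2) powr (- real m / 2)) * indicator {- real n..real n} \<sigma>)"
  proof -
    have le: "g (real n) \<le> g (real (Suc n))" for n by (rule mono) simp
    show "incseq (\<lambda>n s. ennreal (F s) * indicator {- g (real n)..g (real n)} s)"
    proof (rule incseq_SucI, rule le_funI)
      fix n s
      show "ennreal (F s) * indicator {- g (real n)..g (real n)} s \<le> ennreal (F s) * indicator {- g (real (Suc n))..g (real (Suc n))} s"
        using le[of n] by (auto simp: indicator_def simp del: of_nat_Suc)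
    qed
    show "incseq (\<lambda>n \<sigma>. ennreal (indicator S (g \<sigma>) * (1 + \<sigma>\<^sup>2) powr (- real m / 2)) * indicator {- real n..real n} \<sigma>)"
      by (intro incseq_SucI le_funI mult_left_mono) (auto simp: indicator_def)
  qed
  have "(\<integral>\<^sup>+s. ennreal (F s) * indicator {-1<..<1} s \<partial>lborel) = (\<integral>\<^sup>+s. (SUP n. ennreal (F s) * indicator {- g (real n)..g (real n)} s) \<partial>lborel)"
  proof (rule nn_integral_cong)
    fix s :: real
    show "ennreal (F s) * indicator {-1<..<1} s = (SUP n. ennreal (F s) * indicator {- g (real n)..g (real n)} s)"
    proof (cases "\<bar>s\<bar> < 1")
      case True
      \<comment> \<open>The preimage of \<open>\<bar>s\<bar>\<close> under \<open>g\<close>, so that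
        every \<open>s\<close> in (-1, 1) is reached by some interval of the exhaustion.\<close>
      define \<tau> where "\<tau> = \<bar>s\<bar> / sqrt (1 - s\<^sup>2)"
      have s: "1 - s\<^sup>2 > 0" using True by (simp add: abs_square_less_1)
      have "1 + \<tau>\<^sup>2 = 1 / (1 - s\<^sup>2)" using s by (simp add: \<tau>_def power_divide field_simps)
      then have "g \<tau> = \<bar>s\<bar>" using s by (simp add: g_def \<tau>_def real_sqrt_divide)
      moreover obtain n :: nat where "\<tau> \<le> real n" using real_arch_simple by blast
      ultimately have "\<bar>s\<bar> \<le> g (real n)" using mono[of \<tau> "real n"] by simp
      then have "ennreal (F s) * indicator {-1<..<1} s = ennreal (F s) * indicator {- g (real n)..g (real n)} s"
        using True by (auto simp: indicator_def)
      also have "\<dots> \<le> (SUP n. ennreal (F s) * indicator {- g (real n)..g (real n)} s)"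
        by (rule SUP_upper) simp
      finally have "ennreal (F s) * indicator {-1<..<1} s \<le> (SUP n. ennreal (F s) * indicator {- g (real n)..g (real n)} s)" .
      moreover have "(SUP n. ennreal (F s) * indicator {- g (real n)..g (real n)} s) \<le> ennreal (F s) * indicator {-1<..<1} s"
        using True by (intro SUP_least) (auto simp: indicator_def)
      ultimately show ?thesis by (rule antisym)
    next
      case False
      have *: "indicator {- g (real n)..g (real n)} s = (0::ennreal)" for n
        using False g1[of "real n"] by (auto simp: indicator_def)
      show ?thesis unfolding * using False by (auto simp: indicator_def)
    qed
  qed
  also have "\<dots> = (SUP n. \<integral>\<^sup>+s. ennreal (F s) * indicator {- g (real n)..g (real n)} s \<partial>lborel)"
    by (rule nn_integral_monotone_convergence_SUP[OF inc(1)]) measurable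
  also have "\<dots> = (SUP n. \<integral>\<^sup>+\<sigma>. ennreal (indicator S (g \<sigma>) * (1 + \<sigma>\<^sup>2) powr (- real m / 2)) * indicator {- real n..real n} \<sigma> \<partial>lborel)"
    unfolding step ..
  also have "\<dots> = (\<integral>\<^sup>+\<sigma>. (SUP n. ennreal (indicator S (g \<sigma>) * (1 + \<sigma>\<^sup>2) powr (- real m / 2)) * indicator {- real n..real n} \<sigma>) \<partial>lborel)"
    by (rule nn_integral_monotone_convergence_SUP[OF inc(2), symmetric]) measurable
  also have "\<dots> = (\<integral>\<^sup>+\<sigma>. ennreal (indicator S (g \<sigma>) * (1 + \<sigma>\<^sup>2) powr (- real m / 2)) \<partial>lborel)"
  proof (rule nn_integral_cong)
    fix \<sigma> :: real
    obtain n :: nat where n: "\<bar>\<sigma>\<bar> \<le> real n" using real_arch_simple by blast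
    show "(SUP n. ennreal (indicator S (g \<sigma>) * (1 + \<sigma>\<^sup>2) powr (- real m / 2)) * indicator {- real n..real n} \<sigma>) =
      ennreal (indicator S (g \<sigma>) * (1 + \<sigma>\<^sup>2) powr (- real m / 2))"
    proof (rule antisym)
      have "ennreal (indicator S (g \<sigma>) * (1 + \<sigma>\<^sup>2) powr (- real m / 2)) =
        ennreal (indicator S (g \<sigma>) * (1 + \<sigma>\<^sup>2) powr (- real m / 2)) * indicator {- real n..real n} \<sigma>"
        using n by (auto simp: indicator_def)
      also have "\<dots> \<le> (SUP n. ennreal (indicator S (g \<sigma>) * (1 + \<sigma>\<^sup>2) powr (- real m / 2)) * indicator {- real n..real n} \<sigma>)"
        by (rule SUP_upper) simp
      finally show "ennreal (indicator S (g \<sigma>) * (1 + \<sigma>\<^sup>2) powr (- real m / 2)) \<le> \<dots>" .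
    qed (auto intro!: SUP_least simp: indicator_def)
  qed
  moreover have "ennreal (F s) * indicator {-1<..<1} s = indicator S s * (ennreal ((1 - s\<^sup>2) powr ((real m - 3) / 2)) * indicator {-1<..<1} s)" for s
    by (simp add: F_def indicator_def)
  moreover have "ennreal (indicator S (g \<sigma>) * (1 + \<sigma>\<^sup>2) powr (- real m / 2)) = indicator S (\<sigma> / sqrt (1 + \<sigma>\<^sup>2)) * ennreal ((1 + \<sigma>\<^sup>2) powr (- real m / 2))" for \<sigma>
    by (simp add: g_def indicator_def)
  ultimately show ?thesis by (simp only:)
qed

section \<open>The law of one coordinate of a uniform point\<close>

text \<open>The reciprocal of \<open>Beta (1/2) ((m - 1) / 2)\<close>, the mass of the unnormalised
  density below.\<close>

definition proj_const :: "nat \<Rightarrow> real" where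
  "proj_const m = Gamma (real m / 2) / (sqrt pi * Gamma ((real m - 1) / 2))"

text \<open>The density of one coordinate of a uniform point of the unit sphere in dimension
  \<open>m\<close>. It is unbounded at the endpoints precisely for \<open>m = 2\<close> among the
  dimensions \<open>m \<ge> 2\<close>; this is the case of great subspheres in dimension 3.\<close>

definition proj_density :: "nat \<Rightarrow> real \<Rightarrow> real" where
  "proj_density m s = proj_const m * (1 - s\<^sup>2) powr ((real m - 3) / 2) * indicator {-1<..<1} s"

lemma proj_const_pos: "m \<ge> 2 \<Longrightarrow> proj_const m > 0"
  by (simp add: proj_const_def Gamma_real_pos)

lemma proj_density_nonneg: "m \<ge> 2 \<Longrightarrow> 0 \<le> proj_density m s"
  using proj_const_pos[of m] by (simp add: proj_density_def)

lemma borel_measurable_proj_density[measurable]: "proj_density m \<in> borel_measurable borel"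
  unfolding proj_density_def[abs_def] by measurable

text \<open>By symmetry this is twice the integral over (0, 1), and t = s^2 turns that into a Beta
  integral.\<close>

lemma nn_integral_proj_density:
  assumes m: "m \<ge> 2"
  shows "(\<integral>\<^sup>+s. ennreal ((1 - s\<^sup>2) powr ((real m - 3) / 2)) * indicator {-1<..<1} s \<partial>lborel) = ennreal (1 / proj_const m)"
proof -
  define p where "p = (real m - 3) / 2"
  define h where "h s = ennreal ((1 - s\<^sup>2) powr p) * indicator {0..1} s" for s :: real
  have p: "p + 1 > 0" using m by (simp add: p_def field_simps)
  have [measurable]: "h \<in> borel_measurable borel" unfolding h_def[abs_def] by measurable
  define F where "F t = t powr (1/2 - 1) * (1 - t) powr (p + 1 - 1)" for t :: real
  have [measurable]: "F \<in> borel_measurable borel" unfolding F_def[abs_def] by measurable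
  have "(F has_integral Beta (1/2) (p + 1)) {0..1}"
    unfolding F_def[abs_def] using p by (intro has_integral_Beta_real) auto
  then have "ennreal (Beta (1/2) (p + 1)) = (\<integral>\<^sup>+t. ennreal (F t) * indicator {0..1} t \<partial>lborel)"
    by (rule nn_integral_has_integral_lebesgue'[symmetric, rotated]) (simp add: F_def)
  also have "\<dots> = (\<integral>\<^sup>+t. ennreal (F t * indicator {0\<^sup>2..1\<^sup>2} t) \<partial>lborel)"
    by (intro nn_integral_cong) (auto simp: indicator_def)
  also have "\<dots> = (\<integral>\<^sup>+s. ennreal (F (s\<^sup>2) * (2 * s) * indicator {0..1} s) \<partial>lborel)"
    by (rule nn_integral_substitution)
       (auto simp: set_borel_measurable_def intro!: derivative_eq_intros continuous_intros)
  also have "\<dots> = (\<integral>\<^sup>+s. 2 * h s \<partial>lborel)"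
  proof (rule nn_integral_cong_AE)
    have "AE s in lborel. s \<noteq> (0::real)" by (rule AE_lborel_singleton)
    then show "AE s in lborel. ennreal (F (s\<^sup>2) * (2 * s) * indicator {0..1} s) = 2 * h s"
    proof eventually_elim
      fix s :: real assume "s \<noteq> 0"
      show "ennreal (F (s\<^sup>2) * (2 * s) * indicator {0..1} s) = 2 * h s"
      proof (cases "0 < s \<and> s \<le> 1")
        case True
        have "(s\<^sup>2) powr (1/2 - 1) = 1 / s"
        proof -
          have "(s\<^sup>2) powr (1/2 - 1) = (s powr 2) powr (-1/2)" using True by (simp add: powr_numeral)
          also have "\<dots> = s powr (-1)" by (simp add: powr_powr)
          also have "\<dots> = 1 / s" using True by (simp add: powr_minus inverse_eq_divide)
          finally show ?thesis .
        qed
        then have F: "F (s\<^sup>2) * (2 * s) = 2 * (1 - s\<^sup>2) powr p" using True by (simp add: F_def)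
        have i: "indicator {0..1} s = (1::real)" "indicator {0..1} s = (1::ennreal)" using True by auto
        show ?thesis unfolding h_def i mult_1_right F by (simp add: ennreal_mult)
      qed (use \<open>s \<noteq> 0\<close> in \<open>auto simp: h_def indicator_def\<close>)
    qed
  qed
  also have "\<dots> = 2 * (\<integral>\<^sup>+s. h s \<partial>lborel)" by (rule nn_integral_cmult) measurable
  finally have B: "2 * (\<integral>\<^sup>+s. h s \<partial>lborel) = ennreal (Beta (1/2) (p + 1))" ..
  have "(\<integral>\<^sup>+s. ennreal ((1 - s\<^sup>2) powr ((real m - 3) / 2)) * indicator {-1<..<1} s \<partial>lborel) = (\<integral>\<^sup>+s. h s + h (- s) \<partial>lborel)"
  proof (rule nn_integral_cong_AE)
    have "AE s in lborel. s \<noteq> (0::real) \<and> s \<noteq> 1 \<and> s \<noteq> -1"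
      using AE_lborel_singleton[of "0::real"] AE_lborel_singleton[of "1::real"] AE_lborel_singleton[of "-1::real"] by auto
    then show "AE s in lborel. ennreal ((1 - s\<^sup>2) powr ((real m - 3) / 2)) * indicator {-1<..<1} s = h s + h (- s)"
      by eventually_elim (auto simp: h_def p_def indicator_def)
  qed
  also have "\<dots> = (\<integral>\<^sup>+s. h s \<partial>lborel) + (\<integral>\<^sup>+s. h (- s) \<partial>lborel)" by (rule nn_integral_add) measurable
  also have "(\<integral>\<^sup>+s. h (- s) \<partial>lborel) = (\<integral>\<^sup>+s. h s \<partial>lborel)"
    using nn_integral_real_affine[of h "-1" 0] by simp
  also have "(\<integral>\<^sup>+s. h s \<partial>lborel) + (\<integral>\<^sup>+s. h s \<partial>lborel) = ennreal (Beta (1/2) (p + 1))"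
    using B by (simp only: mult_2)
  also have "Beta (1/2) (p + 1) = 1 / proj_const m"
  proof -
    have 1: "1/2 + (p + 1) = real m / 2" and 2: "p + 1 = (real m - 1) / 2" by (auto simp: p_def field_simps)
    show ?thesis unfolding Beta_def 1 unfolding 2 proj_const_def by (simp add: Gamma_one_half_real)
  qed
  finally show ?thesis .
qed

context axis_vec2
begin

text \<open>The dimension of the orthogonal complement of \<omega>. Admitting \<omega> = 0 lets one
  law cover both the full sphere and its great subspheres.\<close>

definition perp_dim :: nat where "perp_dim = CARD('n) - (if \<omega> = 0 then 0 else 1)"

text \<open>Haar measure came from an abstract choice; uniqueness replaces its orbit measure by an
  explicit image of Lebesgue measure, in which coordinates can be computed.\<close>

lemma perp_measure_uniform: "perp_measure \<omega> = uniform_sphere (if \<omega> = 0 then {} else {\<omega>})"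
proof -
  let ?W = "if \<omega> = 0 then {} else {\<omega>}"
  have W: "orthonormal ?W" using unit_or_0 by (auto simp: orthonormal_def)
  have e: "norm (unit_perp \<omega>) = 1" "\<And>w. w \<in> ?W \<Longrightarrow> orthogonal (unit_perp \<omega>) w"
    using unit_perp by (auto simp: orthogonal_def split: if_splits)
  have U: "prob_space (uniform_sphere ?W)" "sets (uniform_sphere ?W) = sets borel"
    "AE x in uniform_sphere ?W. norm x = 1 \<and> (\<forall>w\<in>?W. x \<bullet> w = 0)"
    "\<And>B f. B \<in> fixing ?W \<Longrightarrow> f \<in> borel_measurable borel \<Longrightarrow> (\<integral>\<^sup>+x. f (B *v x) \<partial>uniform_sphere ?W) = (\<integral>\<^sup>+x. f x \<partial>uniform_sphere ?W)"
    using uniform_sphere[OF W e(1)] e(2) by simp_all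
  show ?thesis
  proof (rule perp_unique[symmetric])
    show "AE x in uniform_sphere ?W. norm x = 1 \<and> x \<bullet> \<omega> = 0"
      using U(3) by eventually_elim (auto split: if_splits)
  next
    fix B and f :: "real^'n \<Rightarrow> ennreal" assume "B \<in> stabilizer \<omega>" "f \<in> borel_measurable borel"
    then show "(\<integral>\<^sup>+x. f (B *v x) \<partial>uniform_sphere ?W) = (\<integral>\<^sup>+x. f x \<partial>uniform_sphere ?W)"
      using U(4) by (simp add: stabilizer_fixing)
  qed (fact U)+
qed

text \<open>For basis vectors Lebesgue measure is a product measure from which single coordinates
  can be split off. The constant \<open>C\<close> stays unspecified here, because the total mass
  determines it afterwards.\<close>

lemma proj_law_Basis:
  assumes b: "b \<in> Basis" and \<omega>: "\<omega> = 0 \<or> \<omega> \<in> Basis" "\<omega> \<noteq> b" and m: "perp_dim \<ge> 2"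
  obtains C where "\<And>g. g \<in> borel_measurable borel \<Longrightarrow> (\<integral>\<^sup>+x. g (x \<bullet> b) \<partial>perp_measure \<omega>) =
    C * (\<integral>\<^sup>+\<sigma>. g (\<sigma> / sqrt (1 + \<sigma>\<^sup>2)) * ennreal ((1 + \<sigma>\<^sup>2) powr (- real perp_dim / 2)) \<partial>lborel)"
proof -
  define A where "A = (Basis :: (real^'n) set) - {b, \<omega>}"
  define v where "v = emeasure lborel (ball (0::real^'n) 1)"
  have "ball (0::real^'n) 1 \<in> sets borel" by simp
  note [measurable] = this
  have A: "finite A" "b \<notin> A" "\<omega> \<notin> A" by (auto simp: A_def)
  have nz: "0 \<notin> (Basis :: (real^'n) set)" using nonzero_Basis by blast
  have cardB: "card (Basis :: (real^'n) set) = CARD('n)" using DIM_cart[where 'a=real and 'b='n] by simp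
  have Basis_eq: "Basis = (if \<omega> = 0 then insert b A else insert \<omega> (insert b A))"
    using b \<omega> nz by (auto simp: A_def)
  have card: "card A + 1 = perp_dim"
    using cardB A \<omega> by (simp add: Basis_eq perp_dim_def split: if_splits)
  have "A \<noteq> {}" using card m by auto
  let ?W = "if \<omega> = 0 then {} else {\<omega>}"
  let ?x = "\<lambda>f. \<Sum>d\<in>Basis. f d *\<^sub>R d :: real^'n"
  have proj: "perp_proj ?W (?x f) \<bullet> d = (if d = \<omega> then 0 else f d)" if "d \<in> Basis" for f d
  proof -
    have x: "?x f \<bullet> d = f d" if "d \<in> Basis" for d
      using that by (simp add: inner_sum_left inner_Basis if_distrib cong: if_cong)
    show ?thesis
    proof (cases "\<omega> = 0")
      case True
      then show ?thesis using x[OF that] that nz by (auto simp: perp_proj_def)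
    next
      case False
      then have "\<omega> \<in> Basis" using \<omega> by auto
      then show ?thesis using x[OF that] x[of \<omega>] that False by (simp add: perp_proj_def inner_diff_left inner_Basis)
    qed
  qed
  have norm_proj: "norm (perp_proj ?W (?x f)) = sqrt ((f b)\<^sup>2 + (\<Sum>d\<in>A. (f d)\<^sup>2))" for f
  proof -
    have "(norm (perp_proj ?W (?x f)))\<^sup>2 = (\<Sum>d\<in>Basis. (if d = \<omega> then 0 else f d)\<^sup>2)"
      unfolding norm_le_square power2_norm_eq_inner
      by (subst euclidean_inner) (simp add: proj power2_eq_square)
    also have "\<dots> = (\<Sum>d\<in>insert b A. (f d)\<^sup>2)"
      using A \<omega> by (auto simp: Basis_eq intro!: sum.cong)
    also have "\<dots> = (f b)\<^sup>2 + (\<Sum>d\<in>A. (f d)\<^sup>2)" using A by simp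
    finally show ?thesis by (intro real_sqrt_unique[symmetric]) simp_all
  qed
  have norm_x: "(norm (?x f))\<^sup>2 = (\<Sum>d\<in>Basis. (f d)\<^sup>2)" for f
    unfolding power2_norm_eq_inner
    by (subst euclidean_inner) (simp add: inner_sum_left inner_Basis if_distrib power2_eq_square cong: if_cong)
  have ball: "?x f \<in> ball 0 1 \<longleftrightarrow> (\<Sum>d\<in>Basis. (f d)\<^sup>2) < 1" for f
    unfolding norm_x[symmetric] by (simp add: power_less_one_iff abs_square_less_1)
  \<comment> \<open>The weight that remains for squared length \<open>q\<close> of the projected
    point: the normalised indicator of the ball if \<omega> = 0, and otherwise the same indicator
    with the coordinate \<open>z\<close> along \<omega> integrated out.\<close>
  define W where "W q = (if \<omega> = 0 then indicator {..<1} q / v else (\<integral>\<^sup>+z. indicator {..<1} (q + z\<^sup>2) / v \<partial>lborel))" for q :: real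
  have [measurable]: "W \<in> borel_measurable borel" unfolding W_def[abs_def] by (cases "\<omega> = 0") simp_all
  let ?M = "\<lambda>_::real^'n. lborel :: real measure"
  have main: "(\<integral>\<^sup>+x. g (x \<bullet> b) \<partial>perp_measure \<omega>) =
    (\<integral>\<^sup>+f. g (f b / sqrt ((f b)\<^sup>2 + (\<Sum>i\<in>A. (f i)\<^sup>2))) * W ((f b)\<^sup>2 + (\<Sum>i\<in>A. (f i)\<^sup>2)) \<partial>Pi\<^sub>M (insert b A) ?M)"
    if [measurable]: "g \<in> borel_measurable borel" for g :: "real \<Rightarrow> ennreal"
  proof -
    let ?h = "\<lambda>f. g (f b / sqrt ((f b)\<^sup>2 + (\<Sum>i\<in>A. (f i)\<^sup>2)))"
    have [measurable]: "(\<lambda>x. sgn (perp_proj ?W x)) \<in> borel_measurable borel"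
      unfolding sgn_div_norm by measurable
    have "(\<integral>\<^sup>+x. g (x \<bullet> b) \<partial>perp_measure \<omega>) = (\<integral>\<^sup>+x. g (sgn (perp_proj ?W x) \<bullet> b) \<partial>uniform_measure lborel (ball 0 1))"
      unfolding perp_measure_uniform uniform_sphere_def by (subst nn_integral_distr) auto
    also have "\<dots> = (\<integral>\<^sup>+x. (indicator (ball 0 1) x / v) * g (sgn (perp_proj ?W x) \<bullet> b) \<partial>lborel)"
      unfolding uniform_measure_def v_def by (subst nn_integral_density) auto
    also have "\<dots> = (\<integral>\<^sup>+f. (indicator (ball 0 1) (?x f) / v) * g (sgn (perp_proj ?W (?x f)) \<bullet> b) \<partial>Pi\<^sub>M Basis ?M)"
      by (subst lborel_eq, subst nn_integral_distr) auto
    also have "\<dots> = (\<integral>\<^sup>+f. (indicator {..<1} (\<Sum>d\<in>Basis. (f d)\<^sup>2) / v) * ?h f \<partial>Pi\<^sub>M Basis ?M)"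
    proof (rule nn_integral_cong)
      fix f :: "real^'n \<Rightarrow> real"
      have "sgn (perp_proj ?W (?x f)) \<bullet> b = f b / sqrt ((f b)\<^sup>2 + (\<Sum>i\<in>A. (f i)\<^sup>2))"
        unfolding sgn_div_norm norm_proj inner_scaleR_left proj[OF b] using \<omega> by (simp add: divide_inverse mult.commute)
      moreover have "indicator (ball 0 1) (?x f) = (indicator {..<1} (\<Sum>d\<in>Basis. (f d)\<^sup>2) :: ennreal)"
        using ball[of f] by (simp add: indicator_def)
      ultimately show "(indicator (ball 0 1) (?x f) / v) * g (sgn (perp_proj ?W (?x f)) \<bullet> b) = (indicator {..<1} (\<Sum>d\<in>Basis. (f d)\<^sup>2) / v) * ?h f"
        by (simp only:)
    qed
    also have "\<dots> = (\<integral>\<^sup>+f. ?h f * W ((f b)\<^sup>2 + (\<Sum>i\<in>A. (f i)\<^sup>2)) \<partial>Pi\<^sub>M (insert b A) ?M)"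
    proof (cases "\<omega> = 0")
      case True
      then show ?thesis using A by (simp add: Basis_eq W_def mult.commute)
    next
      case False
      then have B: "Basis = insert \<omega> (insert b A)" by (simp add: Basis_eq)
      have n: "\<omega> \<notin> insert b A" using A \<omega> by auto
      have upd: "(\<Sum>d\<in>insert \<omega> (insert b A). ((f(\<omega> := z)) d)\<^sup>2) = (f b)\<^sup>2 + (\<Sum>i\<in>A. (f i)\<^sup>2) + z\<^sup>2"
          "(\<Sum>i\<in>A. ((f(\<omega> := z)) i)\<^sup>2) = (\<Sum>i\<in>A. (f i)\<^sup>2)" "(f(\<omega> := z)) b = f b" for f :: "real^'n \<Rightarrow> real" and z
      proof -
        show 1: "(\<Sum>i\<in>A. ((f(\<omega> := z)) i)\<^sup>2) = (\<Sum>i\<in>A. (f i)\<^sup>2)" using A by (intro sum.cong) auto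
        show 2: "(f(\<omega> := z)) b = f b" using \<omega> by auto
        show "(\<Sum>d\<in>insert \<omega> (insert b A). ((f(\<omega> := z)) d)\<^sup>2) = (f b)\<^sup>2 + (\<Sum>i\<in>A. (f i)\<^sup>2) + z\<^sup>2"
          using A n 1 2 by simp
      qed
      have "(\<integral>\<^sup>+f. (indicator {..<1} (\<Sum>d\<in>Basis. (f d)\<^sup>2) / v) * ?h f \<partial>Pi\<^sub>M Basis ?M) =
        (\<integral>\<^sup>+f. \<integral>\<^sup>+z. (indicator {..<1} ((f b)\<^sup>2 + (\<Sum>i\<in>A. (f i)\<^sup>2) + z\<^sup>2) / v) * ?h f \<partial>lborel \<partial>Pi\<^sub>M (insert b A) ?M)"
        unfolding B by (subst lborel_prod.product_nn_integral_insert) (use A n in \<open>simp_all only: upd finite_insert\<close>, measurable)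
      also have "\<dots> = (\<integral>\<^sup>+f. ?h f * W ((f b)\<^sup>2 + (\<Sum>i\<in>A. (f i)\<^sup>2)) \<partial>Pi\<^sub>M (insert b A) ?M)"
      proof (rule nn_integral_cong)
        fix f :: "real^'n \<Rightarrow> real"
        show "(\<integral>\<^sup>+z. (indicator {..<1} ((f b)\<^sup>2 + (\<Sum>i\<in>A. (f i)\<^sup>2) + z\<^sup>2) / v) * ?h f \<partial>lborel) = ?h f * W ((f b)\<^sup>2 + (\<Sum>i\<in>A. (f i)\<^sup>2))"
          using False by (subst nn_integral_multc) (auto simp: W_def mult.commute)
      qed
      finally show ?thesis .
    qed
    finally show ?thesis .
  qed
  show ?thesis
  proof (rule that)
    fix g :: "real \<Rightarrow> ennreal" assume g: "g \<in> borel_measurable borel"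
    have "- (real (card A) + 1) / 2 = - real perp_dim / 2" using card by (simp flip: card)
    then show "(\<integral>\<^sup>+x. g (x \<bullet> b) \<partial>perp_measure \<omega>) =
      (\<integral>\<^sup>+\<rho>. W (\<rho>\<^sup>2) * (ennreal (unit_ball_vol (card A) * real (card A) * \<rho> ^ card A) * indicator {0..} \<rho>) \<partial>lborel) *
      (\<integral>\<^sup>+\<sigma>. g (\<sigma> / sqrt (1 + \<sigma>\<^sup>2)) * ennreal ((1 + \<sigma>\<^sup>2) powr (- real perp_dim / 2)) \<partial>lborel)"
      unfolding main[OF g] using nn_integral_PiM_direction[OF A(1) \<open>A \<noteq> {}\<close> A(2) _ g, of W] by simp
  qed
qed

text \<open>A product \<open>Q\<close> of two reflections moves \<open>u\<close> to a basis vector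
  and \<omega> to another basis vector or to 0, where the law is known up to a constant.\<close>

lemma proj_law:
  assumes u: "norm u = 1" "u \<bullet> \<omega> = 0" and m: "perp_dim \<ge> 2"
  shows "distr (perp_measure \<omega>) borel (\<lambda>x. x \<bullet> u) = density lborel (\<lambda>s. ennreal (proj_density perp_dim s))"
proof -
  have "2 \<le> card (Basis :: (real^'n) set)" using card_ge_2 by simp
  then have "\<not> (\<forall>x\<in>Basis. \<forall>y\<in>Basis. x = (y::real^'n))"
    using card_le_Suc0_iff_eq[of "Basis :: (real^'n) set"] by simp
  then obtain b c :: "real^'n" where bc: "b \<in> Basis" "c \<in> Basis" "c \<noteq> b" by auto
  define c' where "c' = (if \<omega> = 0 then 0 else c)"
  define Q1 where "Q1 = householder \<omega> c'"
  \<comment> \<open>The second reflection takes the image of \<open>u\<close> to \<open>b\<close>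
    and leaves \<open>c'\<close> alone, since both of these vectors are orthogonal to
    \<open>c'\<close>.\<close>
  define Q where "Q = householder (Q1 *v u) b ** Q1"
  have nc: "norm c' = norm \<omega>" using unit_or_0 bc by (auto simp: c'_def)
  have Q1: "Q1 *v \<omega> = c'" "orthogonal_matrix Q1" unfolding Q1_def using householder_swap[OF nc] by (auto simp: householder_orthogonal)
  have nb: "norm b = norm (Q1 *v u)" using bc u by (simp add: orthogonal_matrix_norm[OF Q1(2)])
  have "(Q1 *v u) \<bullet> c' = 0" using orthogonal_matrix_inner[OF Q1(2), of u \<omega>] u Q1 by simp
  moreover have "b \<bullet> c' = 0" using bc by (simp add: c'_def inner_Basis)
  ultimately have "householder (Q1 *v u) b *v c' = c'" by (intro householder_fix) (simp add: inner_commute)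
  then have Q: "Q *v \<omega> = c'" "Q *v u = b" "orthogonal_matrix Q"
    using Q1 householder_swap[OF nb] by (auto simp: Q_def orthogonal_matrix_mul householder_orthogonal simp flip: matrix_vector_mul_assoc)
  interpret Q: axis_vec2 c'
    using unit_or_0 card_ge_2 nc by unfold_locales auto
  have dim: "Q.perp_dim = perp_dim" unfolding perp_dim_def Q.perp_dim_def using nc by auto
  have "c' = 0 \<or> c' \<in> Basis" "c' \<noteq> b" using bc nonzero_Basis[of b] by (auto simp: c'_def)
  from Q.proj_law_Basis[OF bc(1) this] m dim obtain C where
    C: "\<And>g. g \<in> borel_measurable borel \<Longrightarrow> (\<integral>\<^sup>+x. g (x \<bullet> b) \<partial>perp_measure c') =
      C * (\<integral>\<^sup>+\<sigma>. g (\<sigma> / sqrt (1 + \<sigma>\<^sup>2)) * ennreal ((1 + \<sigma>\<^sup>2) powr (- real perp_dim / 2)) \<partial>lborel)"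
    by auto
  have law: "emeasure (perp_measure \<omega>) ((\<lambda>x. x \<bullet> u) -` S) =
     C * (\<integral>\<^sup>+s. indicator S s * (ennreal ((1 - s\<^sup>2) powr ((real perp_dim - 3) / 2)) * indicator {-1<..<1} s) \<partial>lborel)"
     if [measurable]: "S \<in> sets borel" for S
  proof -
    have [measurable]: "(\<lambda>x. x \<bullet> u) -` S \<in> sets borel" by (rule measurable_sets_borel[of _ borel]) auto
    have "emeasure (perp_measure \<omega>) ((\<lambda>x. x \<bullet> u) -` S) = (\<integral>\<^sup>+x. indicator S (x \<bullet> u) \<partial>perp_measure \<omega>)"
    proof -
      have "(\<lambda>x. indicator S (x \<bullet> u)) = (indicator ((\<lambda>x. x \<bullet> u) -` S) :: _ \<Rightarrow> ennreal)"
        by (auto simp: fun_eq_iff indicator_def)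
      then show ?thesis by simp
    qed
    also have "\<dots> = (\<integral>\<^sup>+x. indicator S ((Q *v x) \<bullet> b) \<partial>perp_measure \<omega>)"
      unfolding Q(2)[symmetric] orthogonal_matrix_inner[OF Q(3)] ..
    also have "\<dots> = (\<integral>\<^sup>+x. indicator S (x \<bullet> b) \<partial>perp_measure c')"
      unfolding Q(1)[symmetric] by (rule nn_integral_perp_rotate[OF Q(3), symmetric]) measurable
    also have "\<dots> = C * (\<integral>\<^sup>+s. indicator S s * (ennreal ((1 - s\<^sup>2) powr ((real perp_dim - 3) / 2)) * indicator {-1<..<1} s) \<partial>lborel)"
      unfolding direction_substitution[OF that, symmetric] by (rule C) measurable
    finally show ?thesis .
  qed
  \<comment> \<open>The total mass, tested with the whole line, determines the constant.\<close>
  have "1 = C * ennreal (1 / proj_const perp_dim)"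
    using law[of UNIV] perp.emeasure_space_1 by (simp add: nn_integral_proj_density[OF m])
  then have "C = ennreal (proj_const perp_dim)"
  proof -
    have "ennreal (proj_const perp_dim) = ennreal (proj_const perp_dim) * (C * ennreal (1 / proj_const perp_dim))"
      using \<open>1 = C * _\<close> by simp
    also have "\<dots> = C * (ennreal (proj_const perp_dim) * ennreal (1 / proj_const perp_dim))" by (simp only: mult_ac)
    also have "\<dots> = C" using proj_const_pos[OF m] by (subst ennreal_mult[symmetric]) auto
    finally show ?thesis ..
  qed
  show ?thesis
  proof (rule measure_eqI)
    fix S assume "S \<in> sets (distr (perp_measure \<omega>) borel (\<lambda>x. x \<bullet> u))"
    then have [measurable]: "S \<in> sets borel" by simp
    have "emeasure (distr (perp_measure \<omega>) borel (\<lambda>x. x \<bullet> u)) S = emeasure (perp_measure \<omega>) ((\<lambda>x. x \<bullet> u) -` S)"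
      by (subst emeasure_distr) auto
    also have "\<dots> = (\<integral>\<^sup>+s. C * (indicator S s * (ennreal ((1 - s\<^sup>2) powr ((real perp_dim - 3) / 2)) * indicator {-1<..<1} s)) \<partial>lborel)"
      unfolding law[OF \<open>S \<in> sets borel\<close>] by (rule nn_integral_cmult[symmetric]) measurable
    also have "\<dots> = (\<integral>\<^sup>+s. ennreal (proj_density perp_dim s) * indicator S s \<partial>lborel)"
      unfolding \<open>C = _\<close> using proj_const_pos[OF m]
      by (intro nn_integral_cong) (auto simp: proj_density_def indicator_def ennreal_mult)
    also have "\<dots> = emeasure (density lborel (\<lambda>s. ennreal (proj_density perp_dim s))) S"
      by (subst emeasure_density) auto
    finally show "emeasure (distr (perp_measure \<omega>) borel (\<lambda>x. x \<bullet> u)) S = emeasure (density lborel (\<lambda>s. ennreal (proj_density perp_dim s))) S" .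
  qed simp
qed

end

section \<open>Means over subspheres\<close>

text \<open>The index is arbitrary; any coordinate vector can serve as base point of the
  reflections.\<close>

definition e0 :: "real^'n" where "e0 = axis undefined 1"

lemma norm_e0: "norm (e0 :: real^'n) = 1" by (simp add: e0_def)

text \<open>A unit vector at level \<open>v\<close> over \<omega>, if
  \<open>\<bar>v\<bar> \<le> 1\<close>, \<omega> is a unit vector and \<zeta> lies on the unit
  sphere orthogonal to \<open>e0\<close>. The range of \<zeta> does not depend on \<omega>, which
  makes product measures and Fubini applicable.\<close>

definition cap_point :: "real \<Rightarrow> real^'n \<Rightarrow> real^'n \<Rightarrow> real^'n" where
  "cap_point v \<omega> \<zeta> = v *\<^sub>R \<omega> + sqrt (1 - v\<^sup>2) *\<^sub>R (householder e0 \<omega> *v \<zeta>)"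

text \<open>For a unit vector \<open>\<omega>\<close> the reflection \<^term>\<open>householder e0 \<omega>\<close> carries \<^term>\<open>perp_measure e0\<close> to
  \<^term>\<open>perp_measure \<omega>\<close>, so \<^term>\<open>cap_mean v f \<omega>\<close> is the mean of \<open>f\<close> over the unit vectors whose inner
  product with \<open>\<omega>\<close> is \<open>v\<close>; this form is visibly measurable in \<open>(v, \<omega>)\<close>.\<close>

definition cap_mean :: "real \<Rightarrow> (real^'n \<Rightarrow> real) \<Rightarrow> real^'n \<Rightarrow> real" where
  "cap_mean v f \<omega> = (\<integral>\<zeta>. f (cap_point v \<omega> \<zeta>) \<partial>perp_measure e0)"

definition cap_nn :: "real \<Rightarrow> (real^'n \<Rightarrow> ennreal) \<Rightarrow> real^'n \<Rightarrow> ennreal" where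
  "cap_nn v f \<omega> = (\<integral>\<^sup>+\<zeta>. f (cap_point v \<omega> \<zeta>) \<partial>perp_measure e0)"

lemma borel_measurable_cap_point[measurable]:
  assumes [measurable]: "f \<in> borel_measurable M" "g \<in> borel_measurable M" "h \<in> borel_measurable M"
  shows "(\<lambda>x. cap_point (f x) (g x) (h x)) \<in> borel_measurable M"
  unfolding cap_point_def by measurable

locale sphere_dim =
  fixes dummy :: "'n::finite itself"
  assumes card_ge_3: "CARD('n) \<ge> 3"
begin

lemma axis_vec2I: "\<omega> = 0 \<or> norm \<omega> = 1 \<Longrightarrow> axis_vec2 (\<omega>::real^'n)"
  using card_ge_3 by unfold_locales auto

sublocale zero: axis_vec2 "0::real^'n" by (rule axis_vec2I) simp
sublocale base: axis_vec2 "e0::real^'n" by (rule axis_vec2I) (simp add: norm_e0)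
sublocale zb: pair_prob_space "perp_measure (0::real^'n)" "perp_measure (e0::real^'n)" ..
sublocale hb: pair_prob_space "haar (0::real^'n)" "perp_measure (e0::real^'n)" ..
sublocale bb: pair_prob_space "perp_measure (e0::real^'n)" "perp_measure (e0::real^'n)" ..

abbreviation "\<sigma> \<equiv> perp_measure (0::real^'n)"
abbreviation "\<rho> \<equiv> perp_measure (e0::real^'n)"

lemma borel_measurable_cap_nn[measurable]:
  assumes [measurable]: "f \<in> borel_measurable borel" "u \<in> borel_measurable M" "w \<in> borel_measurable M"
  shows "(\<lambda>x. cap_nn (u x) f (w x :: real^'n)) \<in> borel_measurable M"
  unfolding cap_nn_def by measurable

lemma borel_measurable_cap_mean[measurable]:
  assumes [measurable]: "f \<in> borel_measurable borel" "u \<in> borel_measurable M" "w \<in> borel_measurable M"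
  shows "(\<lambda>x. cap_mean (u x) f (w x :: real^'n)) \<in> borel_measurable M"
  unfolding cap_mean_def by measurable

lemma nn_integral_perp_base:
  fixes \<omega> :: "real^'n"
  assumes \<omega>: "norm \<omega> = 1" and [measurable]: "f \<in> borel_measurable borel"
  shows "(\<integral>\<^sup>+x. f x \<partial>perp_measure \<omega>) = (\<integral>\<^sup>+\<zeta>. f (householder e0 \<omega> *v \<zeta>) \<partial>\<rho>)"
proof -
  have "householder e0 \<omega> *v e0 = \<omega>" using \<omega> by (simp add: householder_swap norm_e0)
  then show ?thesis using base.nn_integral_perp_rotate[OF householder_orthogonal[of e0 \<omega>], of f] by simp
qed

lemma perp_measure_base:
  fixes \<omega> :: "real^'n"
  assumes \<omega>: "norm \<omega> = 1"
  shows "perp_measure \<omega> = distr \<rho> borel (\<lambda>\<zeta>. householder e0 \<omega> *v \<zeta>)"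
proof -
  interpret w: axis_vec2 \<omega> by (rule axis_vec2I) (simp add: \<omega>)
  show ?thesis
    by (rule distr_eqI_nn_integral[symmetric]) (auto simp: nn_integral_perp_base[OF \<omega>])
qed

lemma cap_nn_perp:
  fixes \<omega> :: "real^'n"
  assumes \<omega>: "norm \<omega> = 1" and [measurable]: "f \<in> borel_measurable borel"
  shows "cap_nn v f \<omega> = (\<integral>\<^sup>+\<xi>. f (v *\<^sub>R \<omega> + sqrt (1 - v\<^sup>2) *\<^sub>R \<xi>) \<partial>perp_measure \<omega>)"
  unfolding cap_nn_def cap_point_def by (subst nn_integral_perp_base[OF \<omega>]) auto

lemma cap_mean_perp:
  fixes \<omega> :: "real^'n"
  assumes \<omega>: "norm \<omega> = 1" and [measurable]: "f \<in> borel_measurable borel"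
  shows "cap_mean v f \<omega> = (\<integral>\<xi>. f (v *\<^sub>R \<omega> + sqrt (1 - v\<^sup>2) *\<^sub>R \<xi>) \<partial>perp_measure \<omega>)"
  unfolding cap_mean_def cap_point_def perp_measure_base[OF \<omega>] by (subst integral_distr) auto

lemma AE_base_perp:
  fixes \<omega> :: "real^'n"
  assumes \<omega>: "norm \<omega> = 1"
  shows "AE \<zeta> in \<rho>. norm (householder e0 \<omega> *v \<zeta>) = 1 \<and> (householder e0 \<omega> *v \<zeta>) \<bullet> \<omega> = 0"
  using base.AE_perp
proof eventually_elim
  fix \<zeta> :: "real^'n" assume z: "norm \<zeta> = 1 \<and> \<zeta> \<bullet> e0 = 0"
  have "householder e0 \<omega> *v e0 = \<omega>" using \<omega> by (simp add: householder_swap norm_e0)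
  then have "(householder e0 \<omega> *v \<zeta>) \<bullet> \<omega> = \<zeta> \<bullet> e0" using orthogonal_matrix_inner[OF householder_orthogonal[of e0 \<omega>], of \<zeta> e0] by simp
  then show "norm (householder e0 \<omega> *v \<zeta>) = 1 \<and> (householder e0 \<omega> *v \<zeta>) \<bullet> \<omega> = 0"
    using z by (simp add: orthogonal_matrix_norm[OF householder_orthogonal])
qed

lemma norm_circle:
  assumes "norm \<omega> = 1" "norm \<xi> = 1" "\<xi> \<bullet> \<omega> = 0" "\<bar>v\<bar> \<le> 1"
  shows "norm (v *\<^sub>R \<omega> + sqrt (1 - v\<^sup>2) *\<^sub>R \<xi>) = 1" "(v *\<^sub>R \<omega> + sqrt (1 - v\<^sup>2) *\<^sub>R \<xi>) \<bullet> \<omega> = v"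
proof -
  have v: "v\<^sup>2 \<le> 1" using assms(4) by (simp add: abs_square_le_1)
  have "(norm (v *\<^sub>R \<omega> + sqrt (1 - v\<^sup>2) *\<^sub>R \<xi>))\<^sup>2 = v\<^sup>2 * (\<omega> \<bullet> \<omega>) + (sqrt (1 - v\<^sup>2))\<^sup>2 * (\<xi> \<bullet> \<xi>)"
    unfolding power2_norm_eq_inner using assms(3)
    by (simp add: inner_add_left inner_add_right inner_commute[of \<omega> \<xi>] power2_eq_square)
  also have "\<dots> = 1" using assms v by (simp add: power2_norm_eq_inner[symmetric])
  finally show "norm (v *\<^sub>R \<omega> + sqrt (1 - v\<^sup>2) *\<^sub>R \<xi>) = 1" by (simp add: power2_eq_1_iff) (smt (verit) norm_ge_zero)
  show "(v *\<^sub>R \<omega> + sqrt (1 - v\<^sup>2) *\<^sub>R \<xi>) \<bullet> \<omega> = v"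
    using assms by (simp add: inner_add_left power2_norm_eq_inner[symmetric])
qed

lemma AE_cap_point:
  fixes \<omega> :: "real^'n"
  assumes \<omega>: "norm \<omega> = 1" "\<bar>v\<bar> \<le> 1"
  shows "AE \<zeta> in \<rho>. norm (cap_point v \<omega> \<zeta>) = 1 \<and> cap_point v \<omega> \<zeta> \<bullet> \<omega> = v"
  using AE_base_perp[OF \<omega>(1)] by eventually_elim (simp add: cap_point_def norm_circle[OF \<omega>(1) _ _ \<omega>(2)])

lemma zero_stab: "orthogonal_matrix (B :: real^'n^'n) \<Longrightarrow> B \<in> stabilizer 0"
  by (simp add: stabilizer_0)

text \<open>Both sides integrate over a uniformly distributed orthonormal pair. Rotating the inner
  measure back to the fixed vector \<open>a\<close> leaves the pair of \<open>A *v a\<close> and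
  \<open>A *v \<xi>\<close>, and right invariance under rotations about \<open>a\<close> replaces
  \<xi> by \<open>b\<close>.\<close>

lemma nn_integral_orthonormal_pair:
  fixes a b :: "real^'n" and G :: "real^'n \<Rightarrow> real^'n \<Rightarrow> ennreal"
  assumes a: "norm a = 1" and b: "norm b = 1" "b \<bullet> a = 0"
    and [measurable]: "(\<lambda>(x, y). G x y) \<in> borel_measurable (borel \<Otimes>\<^sub>M borel)"
  shows "(\<integral>\<^sup>+\<omega>. \<integral>\<^sup>+\<zeta>. G \<omega> (householder e0 \<omega> *v \<zeta>) \<partial>\<rho> \<partial>\<sigma>) = (\<integral>\<^sup>+A. G (A *v a) (A *v b) \<partial>haar 0)"
proof -
  interpret a: axis_vec2 a by (rule axis_vec2I) (simp add: a)
  interpret ha: pair_prob_space "haar (0::real^'n)" "perp_measure a" ..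
  have "(\<integral>\<^sup>+\<omega>. \<integral>\<^sup>+\<zeta>. G \<omega> (householder e0 \<omega> *v \<zeta>) \<partial>\<rho> \<partial>\<sigma>) = (\<integral>\<^sup>+A. \<integral>\<^sup>+\<zeta>. G (A *v a) (householder e0 (A *v a) *v \<zeta>) \<partial>\<rho> \<partial>haar 0)"
    using a by (intro zero.nn_integral_perp) auto
  also have "\<dots> = (\<integral>\<^sup>+A. \<integral>\<^sup>+\<xi>. G (A *v a) (A *v \<xi>) \<partial>perp_measure a \<partial>haar 0)"
  proof (rule nn_integral_cong_AE, use zero.AE_haar in eventually_elim)
    fix A :: "real^'n^'n" assume "A \<in> stabilizer 0"
    then have A: "orthogonal_matrix A" by (simp add: stabilizer_0)
    have "(\<integral>\<^sup>+\<zeta>. G (A *v a) (householder e0 (A *v a) *v \<zeta>) \<partial>\<rho>) = (\<integral>\<^sup>+\<xi>. G (A *v a) \<xi> \<partial>perp_measure (A *v a))"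
      using a by (intro nn_integral_perp_base[symmetric]) (auto simp: orthogonal_matrix_norm[OF A])
    also have "\<dots> = (\<integral>\<^sup>+\<xi>. G (A *v a) (A *v \<xi>) \<partial>perp_measure a)"
      by (rule a.nn_integral_perp_rotate[OF A]) measurable
    finally show "(\<integral>\<^sup>+\<zeta>. G (A *v a) (householder e0 (A *v a) *v \<zeta>) \<partial>\<rho>) = (\<integral>\<^sup>+\<xi>. G (A *v a) (A *v \<xi>) \<partial>perp_measure a)" .
  qed
  also have "\<dots> = (\<integral>\<^sup>+\<xi>. \<integral>\<^sup>+A. G (A *v a) (A *v \<xi>) \<partial>haar 0 \<partial>perp_measure a)"
    by (rule ha.Fubini'[symmetric]) measurable
  also have "\<dots> = (\<integral>\<^sup>+\<xi>. \<integral>\<^sup>+A. G (A *v a) (A *v b) \<partial>haar 0 \<partial>perp_measure a)"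
  proof (rule nn_integral_cong_AE, use a.AE_perp in eventually_elim)
    fix \<xi> :: "real^'n" assume x: "norm \<xi> = 1 \<and> \<xi> \<bullet> a = 0"
    obtain B where B: "B \<in> stabilizer a" "B *v b = \<xi>"
      using a.stabilizer_transitive[of b \<xi>] b x by auto
    have "(\<integral>\<^sup>+A. G ((A ** B) *v a) ((A ** B) *v b) \<partial>haar 0) = (\<integral>\<^sup>+A. G (A *v a) (A *v b) \<partial>haar 0)"
      by (rule zero.haar_right[OF zero_stab[OF stabilizerD(1)[OF B(1)]], of "\<lambda>A. G (A *v a) (A *v b)"]) measurable
    then show "(\<integral>\<^sup>+A. G (A *v a) (A *v \<xi>) \<partial>haar 0) = (\<integral>\<^sup>+A. G (A *v a) (A *v b) \<partial>haar 0)"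
      using B stabilizerD(2)[OF B(1)] by (simp flip: matrix_vector_mul_assoc)
  qed
  also have "\<dots> = (\<integral>\<^sup>+A. G (A *v a) (A *v b) \<partial>haar 0)"
    using a.perp.emeasure_space_1 by simp
  finally show ?thesis .
qed

text \<open>A uniform \<omega> and a random point of level \<open>v\<close> over it form an
  exchangeable pair: the pair is \<open>A *v a\<close>, \<open>A *v y\<close> with Haar distributed
  \<open>A\<close>, and the reflection that swaps \<open>a\<close> and \<open>y\<close> is absorbed
  by right invariance.\<close>

lemma cap_self_adjoint:
  fixes G :: "real^'n \<Rightarrow> real^'n \<Rightarrow> ennreal"
  assumes v: "\<bar>v\<bar> \<le> 1" and G[measurable]: "(\<lambda>(x, y). G x y) \<in> borel_measurable (borel \<Otimes>\<^sub>M borel)"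
  shows "(\<integral>\<^sup>+\<omega>. \<integral>\<^sup>+\<zeta>. G \<omega> (cap_point v \<omega> \<zeta>) \<partial>\<rho> \<partial>\<sigma>) = (\<integral>\<^sup>+\<omega>. \<integral>\<^sup>+\<zeta>. G (cap_point v \<omega> \<zeta>) \<omega> \<partial>\<rho> \<partial>\<sigma>)"
proof -
  define a :: "real^'n" where "a = e0"
  define b where "b = unit_perp a"
  define y where "y = v *\<^sub>R a + sqrt (1 - v\<^sup>2) *\<^sub>R b"
  have a: "norm a = 1" by (simp add: a_def norm_e0)
  interpret a: axis_vec2 a by (rule axis_vec2I) (simp add: a)
  have b: "norm b = 1" "b \<bullet> a = 0" using a.unit_perp by (auto simp: b_def)
  have y: "norm y = 1" unfolding y_def by (rule norm_circle(1)[OF a b v])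
  have lin: "v *\<^sub>R (A *v a) + sqrt (1 - v\<^sup>2) *\<^sub>R (A *v b) = A *v y" for A :: "real^'n^'n"
    by (simp add: y_def matrix_vector_right_distrib matrix_vector_mult_scaleR)
  have 1: "(\<integral>\<^sup>+\<omega>. \<integral>\<^sup>+\<zeta>. H \<omega> (cap_point v \<omega> \<zeta>) \<partial>\<rho> \<partial>\<sigma>) = (\<integral>\<^sup>+A. H (A *v a) (A *v y) \<partial>haar 0)"
    if [measurable]: "(\<lambda>(x, y). H x y) \<in> borel_measurable (borel \<Otimes>\<^sub>M borel)" for H :: "real^'n \<Rightarrow> real^'n \<Rightarrow> ennreal"
    unfolding cap_point_def
    using nn_integral_orthonormal_pair[OF a b, of "\<lambda>x z. H x (v *\<^sub>R x + sqrt (1 - v\<^sup>2) *\<^sub>R z)"] by (simp add: lin)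
  have B: "householder a y *v a = y" "householder a y *v y = a" using householder_swap[of y a] a y by auto
  have "(\<integral>\<^sup>+\<omega>. \<integral>\<^sup>+\<zeta>. G \<omega> (cap_point v \<omega> \<zeta>) \<partial>\<rho> \<partial>\<sigma>) = (\<integral>\<^sup>+A. G (A *v a) (A *v y) \<partial>haar 0)" by (rule 1) fact
  also have "\<dots> = (\<integral>\<^sup>+A. G ((A ** householder a y) *v a) ((A ** householder a y) *v y) \<partial>haar 0)"
    by (rule zero.haar_right[OF zero_stab[OF householder_orthogonal], of "\<lambda>A. G (A *v a) (A *v y)", symmetric]) measurable
  also have "\<dots> = (\<integral>\<^sup>+A. G (A *v y) (A *v a) \<partial>haar 0)" by (simp add: B flip: matrix_vector_mul_assoc)
  also have "\<dots> = (\<integral>\<^sup>+\<omega>. \<integral>\<^sup>+\<zeta>. G (cap_point v \<omega> \<zeta>) \<omega> \<partial>\<rho> \<partial>\<sigma>)"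
    by (rule 1[of "\<lambda>x y. G y x", symmetric]) measurable
  finally show ?thesis .
qed

lemma nn_integral_cap_nn:
  assumes "\<bar>v\<bar> \<le> 1" and [measurable]: "f \<in> borel_measurable borel"
  shows "(\<integral>\<^sup>+\<omega>. cap_nn v f \<omega> \<partial>\<sigma>) = (\<integral>\<^sup>+\<omega>. f \<omega> \<partial>\<sigma>)"
  unfolding cap_nn_def
  using cap_self_adjoint[OF assms(1), of "\<lambda>x y. f y"] base.perp.emeasure_space_1 by simp

lemma circle_decomposition:
  fixes \<omega> \<theta> :: "real^'n"
  assumes \<omega>: "norm \<omega> = 1" and \<theta>: "norm \<theta> = 1"
  obtains \<xi> where "norm \<xi> = 1" "\<xi> \<bullet> \<omega> = 0" "\<theta> = (\<theta> \<bullet> \<omega>) *\<^sub>R \<omega> + sqrt (1 - (\<theta> \<bullet> \<omega>)\<^sup>2) *\<^sub>R \<xi>"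
proof -
  interpret w: axis_vec2 \<omega> by (rule axis_vec2I) (simp add: \<omega>)
  define v where "v = \<theta> \<bullet> \<omega>"
  define d where "d = \<theta> - v *\<^sub>R \<omega>"
  have d\<omega>: "d \<bullet> \<omega> = 0" using \<omega> by (simp add: d_def v_def inner_diff_left power2_norm_eq_inner[symmetric])
  have "d \<bullet> d = 1 - v\<^sup>2"
  proof -
    have "\<theta> \<bullet> \<theta> = 1" "\<omega> \<bullet> \<omega> = 1" using \<omega> \<theta> by (simp_all add: norm_eq_1)
    then show ?thesis
      by (simp add: d_def inner_diff_left inner_diff_right inner_commute[of \<omega> \<theta>] v_def[symmetric] power2_eq_square)
  qed
  then have nd: "norm d = sqrt (1 - v\<^sup>2)" by (simp add: norm_eq_sqrt_inner)
  define \<xi> where "\<xi> = (if d = 0 then unit_perp \<omega> else sgn d)"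
  have "norm \<xi> = 1" "\<xi> \<bullet> \<omega> = 0" using w.unit_perp d\<omega> by (auto simp: \<xi>_def norm_sgn sgn_div_norm)
  moreover have "d = sqrt (1 - v\<^sup>2) *\<^sub>R \<xi>" unfolding nd[symmetric] by (auto simp: \<xi>_def sgn_div_norm)
  then have "\<theta> = v *\<^sub>R \<omega> + sqrt (1 - v\<^sup>2) *\<^sub>R \<xi>" by (simp add: d_def algebra_simps)
  ultimately show ?thesis using that by (simp add: v_def)
qed

lemma haar_orbit_cap_nn:
  fixes \<omega> \<theta> :: "real^'n"
  assumes \<omega>: "norm \<omega> = 1" and \<theta>: "norm \<theta> = 1" and [measurable]: "f \<in> borel_measurable borel"
  shows "(\<integral>\<^sup>+k. f (k *v \<theta>) \<partial>haar \<omega>) = cap_nn (\<theta> \<bullet> \<omega>) f \<omega>"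
proof -
  interpret w: axis_vec2 \<omega> by (rule axis_vec2I) (simp add: \<omega>)
  define v where "v = \<theta> \<bullet> \<omega>"
  obtain \<xi> where \<xi>: "norm \<xi> = 1" "\<xi> \<bullet> \<omega> = 0" and \<theta>_eq: "\<theta> = v *\<^sub>R \<omega> + sqrt (1 - v\<^sup>2) *\<^sub>R \<xi>"
    using circle_decomposition[OF \<omega> \<theta>] unfolding v_def by blast
  have "(\<integral>\<^sup>+k. f (k *v \<theta>) \<partial>haar \<omega>) = (\<integral>\<^sup>+k. f (v *\<^sub>R \<omega> + sqrt (1 - v\<^sup>2) *\<^sub>R (k *v \<xi>)) \<partial>haar \<omega>)"
    by (rule nn_integral_cong_AE, use w.AE_haar in eventually_elim)
       (subst \<theta>_eq, simp add: matrix_vector_right_distrib matrix_vector_mult_scaleR stabilizerD)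
  also have "\<dots> = (\<integral>\<^sup>+\<xi>. f (v *\<^sub>R \<omega> + sqrt (1 - v\<^sup>2) *\<^sub>R \<xi>) \<partial>perp_measure \<omega>)"
    by (rule w.nn_integral_perp[OF \<xi>, symmetric]) measurable
  also have "\<dots> = cap_nn v f \<omega>" by (rule cap_nn_perp[OF \<omega>, symmetric]) measurable
  finally show ?thesis by (simp add: v_def)
qed

lemma nn_integral_proj:
  fixes \<omega> u :: "real^'n"
  assumes "\<omega> = 0 \<or> norm \<omega> = 1" "norm u = 1" "u \<bullet> \<omega> = 0" and [measurable]: "g \<in> borel_measurable borel"
  shows "(\<integral>\<^sup>+x. g (x \<bullet> u) \<partial>perp_measure \<omega>) = (\<integral>\<^sup>+s. ennreal (proj_density (CARD('n) - (if \<omega> = 0 then 0 else 1)) s) * g s \<partial>lborel)"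
proof -
  interpret w: axis_vec2 \<omega> by (rule axis_vec2I) fact
  have m: "w.perp_dim \<ge> 2" using card_ge_3 by (auto simp: w.perp_dim_def)
  have "(\<integral>\<^sup>+x. g (x \<bullet> u) \<partial>perp_measure \<omega>) = (\<integral>\<^sup>+s. g s \<partial>distr (perp_measure \<omega>) borel (\<lambda>x. x \<bullet> u))"
    by (subst nn_integral_distr) auto
  also have "\<dots> = (\<integral>\<^sup>+s. ennreal (proj_density w.perp_dim s) * g s \<partial>lborel)"
    unfolding w.proj_law[OF assms(2,3) m] by (subst nn_integral_density) auto
  finally show ?thesis by (simp add: w.perp_dim_def)
qed

text \<open>Polar coordinates about the axis \<omega>: averaging over the rotations that fix
  \<omega> turns \<open>f\<close> into a function of \<open>\<theta> \<bullet> \<omega>\<close>,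
  whose law is the projection density in the full dimension.\<close>

lemma nn_integral_slice:
  fixes \<omega> :: "real^'n"
  assumes \<omega>: "norm \<omega> = 1" and [measurable]: "f \<in> borel_measurable borel"
  shows "(\<integral>\<^sup>+\<theta>. f \<theta> \<partial>\<sigma>) = (\<integral>\<^sup>+s. ennreal (proj_density CARD('n) s) * cap_nn s f \<omega> \<partial>lborel)"
proof -
  interpret w: axis_vec2 \<omega> by (rule axis_vec2I) (simp add: \<omega>)
  interpret hz: pair_prob_space "haar \<omega>" "perp_measure (0::real^'n)" ..
  have "(\<integral>\<^sup>+\<theta>. f \<theta> \<partial>\<sigma>) = (\<integral>\<^sup>+k. \<integral>\<^sup>+\<theta>. f \<theta> \<partial>\<sigma> \<partial>haar \<omega>)" using w.haar.emeasure_space_1 by simp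
  also have "\<dots> = (\<integral>\<^sup>+k. \<integral>\<^sup>+\<theta>. f (k *v \<theta>) \<partial>\<sigma> \<partial>haar \<omega>)"
    by (rule nn_integral_cong_AE, use w.AE_haar in eventually_elim)
       (rule zero.perp_inv[OF zero_stab, symmetric], auto dest: stabilizerD)
  also have "\<dots> = (\<integral>\<^sup>+\<theta>. \<integral>\<^sup>+k. f (k *v \<theta>) \<partial>haar \<omega> \<partial>\<sigma>)" by (rule hz.Fubini'[symmetric]) measurable
  also have "\<dots> = (\<integral>\<^sup>+\<theta>. cap_nn (\<theta> \<bullet> \<omega>) f \<omega> \<partial>\<sigma>)"
    by (rule nn_integral_cong_AE, use zero.AE_perp in eventually_elim) (simp add: haar_orbit_cap_nn[OF \<omega>])
  also have "\<dots> = (\<integral>\<^sup>+s. ennreal (proj_density CARD('n) s) * cap_nn s f \<omega> \<partial>lborel)"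
    using nn_integral_proj[of 0 \<omega> "\<lambda>s. cap_nn s f \<omega>"] \<omega> by simp
  finally show ?thesis .
qed

text \<open>A random point of level sqrt (1 - s^2) over \<omega> is a random rotation about \<omega>
  of one fixed \<theta>, and its great subsphere is the rotated great subsphere of \<theta>.
  Averaging over the rotations first leaves a mean that depends on \<eta> only through
  \<open>\<eta> \<bullet> \<omega> = s * (\<eta> \<bullet> e)\<close>, and
  \<open>\<eta> \<bullet> e\<close> follows the projection law in dimension n - 1.\<close>

lemma nn_integral_cap_compose:
  fixes \<omega> :: "real^'n"
  assumes \<omega>: "norm \<omega> = 1" and s: "0 < s" "s < 1" and [measurable]: "f \<in> borel_measurable borel"
  shows "cap_nn (sqrt (1 - s\<^sup>2)) (cap_nn 0 f) \<omega> = (\<integral>\<^sup>+v. ennreal (proj_density (CARD('n) - 1) v) * cap_nn (s * v) f \<omega> \<partial>lborel)"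
proof -
  interpret w: axis_vec2 \<omega> by (rule axis_vec2I) (simp add: \<omega>)
  define c where "c = sqrt (1 - s\<^sup>2)"
  define \<theta> where "\<theta> = c *\<^sub>R \<omega> + s *\<^sub>R unit_perp \<omega>"
  have s2: "s\<^sup>2 < 1" using s by (simp add: power_less_one_iff)
  have c: "\<bar>c\<bar> \<le> 1" "sqrt (1 - c\<^sup>2) = s" "c\<^sup>2 = 1 - s\<^sup>2" using s s2 by (auto simp: c_def)
  have \<theta>1: "norm \<theta> = 1" "\<theta> \<bullet> \<omega> = c"
    using norm_circle[OF \<omega> w.unit_perp c(1)] by (auto simp: \<theta>_def c(2))
  interpret t: axis_vec2 \<theta> by (rule axis_vec2I) (simp add: \<theta>1)
  interpret ht: pair_prob_space "haar \<omega>" "perp_measure \<theta>" ..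
  \<comment> \<open>The unit vector along the component of \<omega> orthogonal to \<theta>; that
    component has length \<open>s\<close>.\<close>
  define e where "e = (1 / s) *\<^sub>R (\<omega> - c *\<^sub>R \<theta>)"
  have \<omega>\<theta>: "\<omega> \<bullet> \<omega> = 1" "\<theta> \<bullet> \<theta> = 1" "\<omega> \<bullet> \<theta> = c" using \<omega> \<theta>1 by (auto simp: norm_eq_1 inner_commute)
  have "(\<omega> - c *\<^sub>R \<theta>) \<bullet> (\<omega> - c *\<^sub>R \<theta>) = s\<^sup>2"
    using \<omega>\<theta> c(3) by (simp add: inner_diff_left inner_diff_right inner_commute[of \<theta> \<omega>] power2_eq_square)
  then have "norm (\<omega> - c *\<^sub>R \<theta>) = s" using s by (simp add: norm_eq_sqrt_inner)
  then have e: "norm e = 1" "e \<bullet> \<theta> = 0" using s \<omega>\<theta> by (auto simp: e_def inner_diff_left)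
  have "cap_nn c (cap_nn 0 f) \<omega> = (\<integral>\<^sup>+\<xi>. cap_nn 0 f (c *\<^sub>R \<omega> + s *\<^sub>R \<xi>) \<partial>perp_measure \<omega>)"
    using cap_nn_perp[OF \<omega>, of "cap_nn 0 f" c] by (simp add: c(2))
  also have "\<dots> = (\<integral>\<^sup>+k. cap_nn 0 f (c *\<^sub>R \<omega> + s *\<^sub>R (k *v unit_perp \<omega>)) \<partial>haar \<omega>)"
    by (rule w.nn_integral_perp[OF w.unit_perp]) measurable
  also have "\<dots> = (\<integral>\<^sup>+k. \<integral>\<^sup>+\<eta>. f (k *v \<eta>) \<partial>perp_measure \<theta> \<partial>haar \<omega>)"
  proof (rule nn_integral_cong_AE, use w.AE_haar in eventually_elim)
    fix k assume k: "k \<in> stabilizer \<omega>"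
    have "c *\<^sub>R \<omega> + s *\<^sub>R (k *v unit_perp \<omega>) = k *v \<theta>"
      by (simp add: \<theta>_def matrix_vector_right_distrib matrix_vector_mult_scaleR stabilizerD[OF k])
    moreover have "cap_nn 0 f (k *v \<theta>) = (\<integral>\<^sup>+\<eta>. f \<eta> \<partial>perp_measure (k *v \<theta>))"
      using \<theta>1 by (subst cap_nn_perp) (auto simp: orthogonal_matrix_norm[OF stabilizerD(1)[OF k]])
    moreover have "\<dots> = (\<integral>\<^sup>+\<eta>. f (k *v \<eta>) \<partial>perp_measure \<theta>)"
      by (rule t.nn_integral_perp_rotate[OF stabilizerD(1)[OF k]]) measurable
    ultimately show "cap_nn 0 f (c *\<^sub>R \<omega> + s *\<^sub>R (k *v unit_perp \<omega>)) = (\<integral>\<^sup>+\<eta>. f (k *v \<eta>) \<partial>perp_measure \<theta>)" by simp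
  qed
  also have "\<dots> = (\<integral>\<^sup>+\<eta>. \<integral>\<^sup>+k. f (k *v \<eta>) \<partial>haar \<omega> \<partial>perp_measure \<theta>)" by (rule ht.Fubini'[symmetric]) measurable
  also have "\<dots> = (\<integral>\<^sup>+\<eta>. cap_nn (s * (\<eta> \<bullet> e)) f \<omega> \<partial>perp_measure \<theta>)"
  proof (rule nn_integral_cong_AE, use t.AE_perp in eventually_elim)
    fix \<eta> :: "real^'n" assume \<eta>: "norm \<eta> = 1 \<and> \<eta> \<bullet> \<theta> = 0"
    have "\<eta> \<bullet> \<omega> = s * (\<eta> \<bullet> e)" using s \<eta> by (simp add: e_def inner_diff_right)
    then show "(\<integral>\<^sup>+k. f (k *v \<eta>) \<partial>haar \<omega>) = cap_nn (s * (\<eta> \<bullet> e)) f \<omega>"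
      using haar_orbit_cap_nn[OF \<omega>, of \<eta> f] \<eta> by simp
  qed
  also have "\<dots> = (\<integral>\<^sup>+v. ennreal (proj_density (CARD('n) - 1) v) * cap_nn (s * v) f \<omega> \<partial>lborel)"
    using nn_integral_proj[of \<theta> e "\<lambda>v. cap_nn (s * v) f \<omega>"] \<theta>1 e by auto
  finally show ?thesis by (simp add: c_def)
qed

lemma prob_proj_density: "m \<ge> 2 \<Longrightarrow> prob_space (density lborel (\<lambda>v. ennreal (proj_density m v)))"
proof (rule prob_spaceI)
  assume m: "m \<ge> 2"
  have "emeasure (density lborel (\<lambda>v. ennreal (proj_density m v))) (space (density lborel (\<lambda>v. ennreal (proj_density m v)))) =
    (\<integral>\<^sup>+s. ennreal (proj_const m) * (ennreal ((1 - s\<^sup>2) powr ((real m - 3) / 2)) * indicator {-1<..<1} s) \<partial>lborel)"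
    using proj_const_pos[OF m]
    by (subst emeasure_density) (auto intro!: nn_integral_cong simp: proj_density_def indicator_def ennreal_mult)
  also have "\<dots> = ennreal (proj_const m) * ennreal (1 / proj_const m)"
    unfolding nn_integral_proj_density[OF m, symmetric] by (rule nn_integral_cmult) measurable
  also have "\<dots> = 1" using proj_const_pos[OF m] by (subst ennreal_mult[symmetric]) auto
  finally show "emeasure (density lborel (\<lambda>v. ennreal (proj_density m v))) (space (density lborel (\<lambda>v. ennreal (proj_density m v)))) = 1" .
qed

text \<open>Signed functions are reached through laws: applied to indicators, the preceding identity
  says that the random points \<open>X\<close> and \<open>Y\<close> have the same distribution.
  Integrability, given on the side of \<open>Y\<close>, passes to \<open>X\<close>, where Fubini
  yields the iterated mean.\<close>

lemma cap_mean_compose: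
  fixes \<omega> :: "real^'n"
  assumes \<omega>: "norm \<omega> = 1" and s: "0 < s" "s < 1" and [measurable]: "f \<in> borel_measurable borel"
    and fin: "(\<integral>\<^sup>+v. ennreal (proj_density (CARD('n) - 1) v) * cap_nn (s * v) (\<lambda>x. ennreal \<bar>f x\<bar>) \<omega> \<partial>lborel) < \<infinity>"
  shows "cap_mean (sqrt (1 - s\<^sup>2)) (cap_mean 0 f) \<omega> = (\<integral>v. proj_density (CARD('n) - 1) v * cap_mean (s * v) f \<omega> \<partial>lborel)"
proof -
  define m where "m = CARD('n) - 1"
  have m: "m \<ge> 2" using card_ge_3 by (simp add: m_def)
  define \<delta> where "\<delta> = density lborel (\<lambda>v. ennreal (proj_density m v))"
  interpret \<delta>: prob_space \<delta> unfolding \<delta>_def by (rule prob_proj_density[OF m])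
  have [measurable_cong]: "sets \<delta> = sets borel" by (simp add: \<delta>_def)
  interpret B\<delta>: pair_prob_space \<delta> "\<rho>" ..
  define c where "c = sqrt (1 - s\<^sup>2)"
  define X where "X = (\<lambda>(\<zeta>, \<zeta>'). cap_point 0 (cap_point c \<omega> \<zeta>) (\<zeta>' :: real^'n))"
  define Y where "Y = (\<lambda>(v, \<zeta>). cap_point (s * v) \<omega> (\<zeta> :: real^'n))"
  have [measurable]: "X \<in> borel_measurable (\<rho> \<Otimes>\<^sub>M \<rho>)" "Y \<in> borel_measurable (\<delta> \<Otimes>\<^sub>M \<rho>)"
    unfolding X_def Y_def by measurable
  have X: "(\<integral>\<^sup>+z. g (X z) \<partial>(\<rho> \<Otimes>\<^sub>M \<rho>)) = cap_nn c (cap_nn 0 g) \<omega>" if [measurable]: "g \<in> borel_measurable borel" for g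
    unfolding cap_nn_def X_def by (subst base.perp.nn_integral_fst[symmetric]) auto
  have Y: "(\<integral>\<^sup>+z. g (Y z) \<partial>(\<delta> \<Otimes>\<^sub>M \<rho>)) = (\<integral>\<^sup>+v. ennreal (proj_density m v) * cap_nn (s * v) g \<omega> \<partial>lborel)"
    if [measurable]: "g \<in> borel_measurable borel" for g
  proof -
    have "(\<integral>\<^sup>+z. g (Y z) \<partial>(\<delta> \<Otimes>\<^sub>M \<rho>)) = (\<integral>\<^sup>+v. cap_nn (s * v) g \<omega> \<partial>\<delta>)"
      unfolding cap_nn_def Y_def by (subst base.perp.nn_integral_fst[symmetric]) auto
    then show ?thesis unfolding \<delta>_def by (subst (asm) nn_integral_density) auto
  qed
  have eq: "distr (\<rho> \<Otimes>\<^sub>M \<rho>) borel X = distr (\<delta> \<Otimes>\<^sub>M \<rho>) borel Y"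
  proof (rule measure_eqI)
    fix A assume "A \<in> sets (distr (\<rho> \<Otimes>\<^sub>M \<rho>) borel X)"
    then have A[measurable]: "A \<in> sets borel" by simp
    have "emeasure (distr (\<rho> \<Otimes>\<^sub>M \<rho>) borel X) A = (\<integral>\<^sup>+x. indicator A x \<partial>distr (\<rho> \<Otimes>\<^sub>M \<rho>) borel X)" by simp
    also have "\<dots> = (\<integral>\<^sup>+z. indicator A (X z) \<partial>(\<rho> \<Otimes>\<^sub>M \<rho>))" by (rule nn_integral_distr) measurable
    also have "\<dots> = (\<integral>\<^sup>+z. indicator A (Y z) \<partial>(\<delta> \<Otimes>\<^sub>M \<rho>))"
      using X[of "indicator A"] Y[of "indicator A"] nn_integral_cap_compose[OF \<omega> s, of "indicator A"] by (simp add: c_def m_def)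
    also have "\<dots> = (\<integral>\<^sup>+x. indicator A x \<partial>distr (\<delta> \<Otimes>\<^sub>M \<rho>) borel Y)" by (rule nn_integral_distr[symmetric]) measurable
    also have "\<dots> = emeasure (distr (\<delta> \<Otimes>\<^sub>M \<rho>) borel Y) A" by simp
    finally show "emeasure (distr (\<rho> \<Otimes>\<^sub>M \<rho>) borel X) A = emeasure (distr (\<delta> \<Otimes>\<^sub>M \<rho>) borel Y) A" .
  qed simp
  have intY: "integrable (\<delta> \<Otimes>\<^sub>M \<rho>) (\<lambda>z. f (Y z))"
    using Y[of "\<lambda>x. ennreal \<bar>f x\<bar>"] fin by (intro integrableI_bounded) (auto simp: m_def)
  then have "integrable (distr (\<delta> \<Otimes>\<^sub>M \<rho>) borel Y) f" by (subst integrable_distr_eq) auto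
  then have intX: "integrable (\<rho> \<Otimes>\<^sub>M \<rho>) (\<lambda>z. f (X z))"
    unfolding eq[symmetric] by (subst (asm) integrable_distr_eq) auto
  have "cap_mean c (cap_mean 0 f) \<omega> = (\<integral>z. f (X z) \<partial>(\<rho> \<Otimes>\<^sub>M \<rho>))"
    unfolding cap_mean_def using bb.integral_fst'[OF intX] by (simp add: X_def)
  also have "\<dots> = integral\<^sup>L (distr (\<rho> \<Otimes>\<^sub>M \<rho>) borel X) f" by (rule integral_distr[symmetric]) measurable
  also have "\<dots> = (\<integral>z. f (Y z) \<partial>(\<delta> \<Otimes>\<^sub>M \<rho>))" unfolding eq by (rule integral_distr) measurable
  also have "\<dots> = (\<integral>v. cap_mean (s * v) f \<omega> \<partial>\<delta>)"
    unfolding cap_mean_def using B\<delta>.integral_fst'[OF intY] by (simp add: Y_def)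
  also have "\<dots> = (\<integral>v. proj_density m v * cap_mean (s * v) f \<omega> \<partial>lborel)"
    unfolding \<delta>_def using proj_density_nonneg[OF m] by (subst integral_density) auto
  finally show ?thesis by (simp add: c_def m_def)
qed

end

section \<open>Almost everywhere equality over completed measures\<close>

text \<open>On the exceptional set the preimages under \<open>g\<close> are arbitrary subsets of a
  null set, and the completion contains all of these.\<close>

lemma measurable_completion_cong_AE:
  assumes f: "f \<in> measurable (completion M) N" and AE: "AE x in completion M. f x = g x" and sp: "\<And>x. x \<in> space M \<Longrightarrow> g x \<in> space N"
  shows "g \<in> measurable (completion M) N"
proof (rule measurableI)
  fix B assume B: "B \<in> sets N"
  obtain Z where Z: "{x \<in> space (completion M). f x \<noteq> g x} \<subseteq> Z" "Z \<in> null_sets (completion M)"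
    using AE by (auto simp: eventually_ae_filter)
  have eq: "g -` B \<inter> space (completion M) = (f -` B \<inter> space (completion M) - Z) \<union> (g -` B \<inter> space (completion M) \<inter> Z)"
    using Z(1) by auto
  have "g -` B \<inter> space (completion M) \<inter> Z \<in> null_sets (completion M)"
    by (rule null_sets_completion_subset[OF _ Z(2)]) auto
  then show "g -` B \<inter> space (completion M) \<in> sets (completion M)"
    using measurable_sets[OF f B] Z(2) by (subst eq) (intro sets.Un sets.Diff; auto)
qed (use sp in auto)

text \<open>Over a complete measure either both functions are measurable or neither is, and then both integrals are 0.\<close>

lemma integral_completion_cong_AE:
  fixes f g :: "'a \<Rightarrow> 'b::{banach, second_countable_topology}"
  assumes AE: "AE x in completion M. f x = g x"
  shows "integral\<^sup>L (completion M) f = integral\<^sup>L (completion M) g"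
proof (cases "f \<in> borel_measurable (completion M)")
  case True
  then have "g \<in> borel_measurable (completion M)" using AE by (rule measurable_completion_cong_AE) simp
  with True show ?thesis using AE by (intro integral_cong_AE) auto
next
  case False
  have "g \<notin> borel_measurable (completion M)"
  proof
    assume "g \<in> borel_measurable (completion M)"
    moreover have "AE x in completion M. g x = f x" using AE by eventually_elim simp
    ultimately have "f \<in> borel_measurable (completion M)" by (rule measurable_completion_cong_AE) simp
    with False show False by simp
  qed
  with False show ?thesis
    by (metis borel_measurable_integrable not_integrable_integral_eq)
qed

lemma integrable_completion_cong_AE:
  fixes f g :: "'a \<Rightarrow> 'b::{banach, second_countable_topology}"
  assumes AE: "AE x in completion M. f x = g x" and f: "integrable (completion M) f"
  shows "integrable (completion M) g"
proof -
  have "g \<in> borel_measurable (completion M)"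
    using borel_measurable_integrable[OF f] AE by (rule measurable_completion_cong_AE) simp
  then show ?thesis using f AE by (subst integrable_cong_AE[where g = f]) (auto elim: AE_mp)
qed

lemma integrable_mult_cancel:
  fixes f :: "'a \<Rightarrow> real"
  assumes "integrable M (\<lambda>x. c * f x)" "c \<noteq> 0" shows "integrable M f"
  using integrable_mult_right[OF assms(1), of "1 / c"] assms(2) by simp

section \<open>Erdelyi-Kober integrals\<close>

text \<open>The substitution x = (s^2 - t^2) / (r^2 - t^2) turns the product of the two kernels into
  a Beta integral.\<close>

lemma nn_integral_Beta_kernel:
  assumes ab: "a > 0" "b > 0" and t: "0 < t" "t < r"
  shows "(\<integral>\<^sup>+s. ennreal (indicator {t<..<r} s * ((r\<^sup>2 - s\<^sup>2) powr (a - 1) * (s\<^sup>2 - t\<^sup>2) powr (b - 1) * s)) \<partial>lborel) =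
    ennreal (Beta a b / 2 * (r\<^sup>2 - t\<^sup>2) powr (a + b - 1))"
proof -
  define L where "L = r\<^sup>2 - t\<^sup>2"
  have L: "L > 0" using t by (simp add: L_def power_strict_mono)
  define F where "F x = x powr (b - 1) * (1 - x) powr (a - 1)" for x :: real
  have [measurable]: "F \<in> borel_measurable borel" unfolding F_def[abs_def] by measurable
  define g where "g s = (s\<^sup>2 - t\<^sup>2) / L" for s
  have g01: "g t = 0" "g r = 1" using L by (auto simp: g_def L_def)
  have "(F has_integral Beta b a) {0..1}"
    unfolding F_def[abs_def] using ab by (intro has_integral_Beta_real) auto
  then have "ennreal (Beta b a) = (\<integral>\<^sup>+x. ennreal (F x) * indicator {0..1} x \<partial>lborel)"
    by (rule nn_integral_has_integral_lebesgue'[symmetric, rotated]) (simp add: F_def)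
  also have "\<dots> = (\<integral>\<^sup>+x. ennreal (F x * indicator {g t..g r} x) \<partial>lborel)"
    by (intro nn_integral_cong) (auto simp: indicator_def g01)
  also have "\<dots> = (\<integral>\<^sup>+s. ennreal (F (g s) * (2 * s / L) * indicator {t..r} s) \<partial>lborel)"
    by (rule nn_integral_substitution)
       (use t L in \<open>auto simp: set_borel_measurable_def g_def[abs_def] intro!: derivative_eq_intros continuous_intros\<close>)
  finally have *: "(\<integral>\<^sup>+s. ennreal (F (g s) * (2 * s / L) * indicator {t..r} s) \<partial>lborel) = ennreal (Beta b a)" ..
  have "(\<integral>\<^sup>+s. ennreal (indicator {t<..<r} s * ((r\<^sup>2 - s\<^sup>2) powr (a - 1) * (s\<^sup>2 - t\<^sup>2) powr (b - 1) * s)) \<partial>lborel) =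
    (\<integral>\<^sup>+s. ennreal (L powr (a + b - 1) / 2) * ennreal (F (g s) * (2 * s / L) * indicator {t..r} s) \<partial>lborel)"
  proof (rule nn_integral_cong_AE)
    have "AE s in lborel. s \<noteq> t \<and> s \<noteq> r"
      using AE_lborel_singleton[of t] AE_lborel_singleton[of r] by auto
    then show "AE s in lborel. ennreal (indicator {t<..<r} s * ((r\<^sup>2 - s\<^sup>2) powr (a - 1) * (s\<^sup>2 - t\<^sup>2) powr (b - 1) * s)) =
       ennreal (L powr (a + b - 1) / 2) * ennreal (F (g s) * (2 * s / L) * indicator {t..r} s)"
    proof eventually_elim
      fix s assume ne: "s \<noteq> t \<and> s \<noteq> r"
      show "ennreal (indicator {t<..<r} s * ((r\<^sup>2 - s\<^sup>2) powr (a - 1) * (s\<^sup>2 - t\<^sup>2) powr (b - 1) * s)) =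
       ennreal (L powr (a + b - 1) / 2) * ennreal (F (g s) * (2 * s / L) * indicator {t..r} s)"
      proof (cases "t < s \<and> s < r")
        case True
        define u where "u = s\<^sup>2 - t\<^sup>2"
        define w where "w = r\<^sup>2 - s\<^sup>2"
        have uw: "u > 0" "w > 0" using True t by (auto simp: u_def w_def power_strict_mono)
        have "g s = u / L" "1 - g s = w / L" using L by (auto simp: g_def u_def w_def field_simps L_def)
        then have "F (g s) = (u powr (b - 1) / L powr (b - 1)) * (w powr (a - 1) / L powr (a - 1))"
          using uw L by (simp add: F_def powr_divide)
        moreover have "L powr (a + b - 1) = L powr (b - 1) * L powr (a - 1) * L"
        proof -
          have "L powr (a + b - 1) = L powr ((b - 1) + (a - 1) + 1)" by (simp add: algebra_simps)
          also have "\<dots> = L powr (b - 1) * L powr (a - 1) * L" using L by (simp only: powr_add powr_one)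
          finally show ?thesis .
        qed
        moreover have "L powr (b - 1) > 0" "L powr (a - 1) > 0" using L by auto
        ultimately have "w powr (a - 1) * u powr (b - 1) * s = L powr (a + b - 1) / 2 * (F (g s) * (2 * s / L))"
          using L by (simp add: field_simps)
        moreover have "F (g s) * (2 * s / L) \<ge> 0" using True t L by (simp add: F_def)
        ultimately show ?thesis using True by (simp add: ennreal_mult[symmetric] u_def w_def)
      qed (use ne in \<open>auto simp: indicator_def\<close>)
    qed
  qed
  also have "\<dots> = ennreal (L powr (a + b - 1) / 2) * ennreal (Beta b a)"
    unfolding *[symmetric] by (rule nn_integral_cmult) (simp add: g_def)
  also have "\<dots> = ennreal (Beta a b / 2 * (r\<^sup>2 - t\<^sup>2) powr (a + b - 1))"
    by (subst ennreal_mult'[symmetric]) (simp_all add: L_def Beta_commute[of b a] mult.commute)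
  finally show ?thesis .
qed

lemma borel_measurable_indicator_Ioo[measurable]:
  assumes [measurable]: "f \<in> borel_measurable M" "g \<in> borel_measurable M" "h \<in> borel_measurable M"
  shows "(\<lambda>x. indicator {f x<..<g x :: real} (h x) :: real) \<in> borel_measurable M"
    and "(\<lambda>x. indicator {f x<..<g x :: real} (h x) :: ennreal) \<in> borel_measurable M"
  unfolding indicator_def greaterThanLessThan_iff by measurable

lemma EK_integral_lborel:
  assumes [measurable]: "\<eta> \<in> borel_measurable borel"
  shows "EK_integral b \<eta> s = 2 / Gamma b * (\<integral>t. indicator {0<..<s} t * ((s\<^sup>2 - t\<^sup>2) powr (b - 1) * \<eta> t * t) \<partial>lborel)"
  unfolding EK_integral_def set_lebesgue_integral_def by (subst integral_completion) simp_all

lemma borel_measurable_EK_integral[measurable]: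
  assumes [measurable]: "\<eta> \<in> borel_measurable borel"
  shows "EK_integral b \<eta> \<in> borel_measurable borel"
  unfolding EK_integral_lborel[OF assms, abs_def] by measurable

lemma EK_integral_cong_AE:
  assumes "AE t in lebesgue. 0 < t \<and> t < r \<longrightarrow> g t = h t"
  shows "EK_integral a g r = EK_integral a h r"
proof -
  have *: "AE t in lebesgue. indicator {0<..<r} t *\<^sub>R ((r\<^sup>2 - t\<^sup>2) powr (a - 1) * g t * t) = indicator {0<..<r} t *\<^sub>R ((r\<^sup>2 - t\<^sup>2) powr (a - 1) * h t * t)"
    using assms by eventually_elim (auto simp: indicator_def)
  then show ?thesis unfolding EK_integral_def set_lebesgue_integral_def
    by (simp only: integral_completion_cong_AE[OF *])
qed

text \<open>Fubini together with the Beta integral of the kernels. The condition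
  \<open>a + b \<ge> 1\<close> bounds the composed kernel, so that integrability of
  \<open>\<eta> t * t\<close> alone gives the identity at every \<open>r\<close>, even though the
  inner integral may exist only for almost every \<open>s\<close>.\<close>

lemma EK_integral_semigroup:
  assumes ab: "a > 0" "b > 0" "a + b \<ge> 1" and r: "r > 0"
    and [measurable]: "\<eta> \<in> borel_measurable borel"
    and int: "integrable lborel (\<lambda>t. indicator {0<..<r} t * (\<eta> t * t))"
  shows "AE s in lborel. 0 < s \<and> s < r \<longrightarrow> integrable lborel (\<lambda>t. indicator {0<..<s} t * ((s\<^sup>2 - t\<^sup>2) powr (b - 1) * \<eta> t * t))"
    and "integrable lborel (\<lambda>s. indicator {0<..<r} s * ((r\<^sup>2 - s\<^sup>2) powr (a - 1) * EK_integral b \<eta> s * s))"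
    and "EK_integral a (EK_integral b \<eta>) r = EK_integral (a + b) \<eta> r"
proof -
  define K where "K s t = indicator {0<..<r} s * indicator {0<..<s} t * ((r\<^sup>2 - s\<^sup>2) powr (a - 1) * s * ((s\<^sup>2 - t\<^sup>2) powr (b - 1) * \<eta> t * t))" for s t
  have [measurable]: "(\<lambda>(s, t). K s t) \<in> borel_measurable (lborel \<Otimes>\<^sub>M lborel)" unfolding K_def[abs_def] by measurable
  define k where "k t s = indicator {t<..<r} s * ((r\<^sup>2 - s\<^sup>2) powr (a - 1) * (s\<^sup>2 - t\<^sup>2) powr (b - 1) * s)" for t s
  have [measurable]: "(\<lambda>s. k t s) \<in> borel_measurable borel" for t unfolding k_def by measurable
  have Kk: "K s t = (indicator {0<..<r} t * (\<eta> t * t)) * k t s" for s t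
    by (auto simp: K_def k_def indicator_def)
  have k_nonneg: "indicator {0<..<r} t * k t s \<ge> 0" for t s by (auto simp: k_def indicator_def)
  have knn: "(\<integral>\<^sup>+s. ennreal (k t s) \<partial>lborel) = ennreal (Beta a b / 2 * (r\<^sup>2 - t\<^sup>2) powr (a + b - 1))" if "0 < t" "t < r" for t
    unfolding k_def using nn_integral_Beta_kernel[OF ab(1,2) that] by simp
  have k_int: "integrable lborel (k t)" "integral\<^sup>L lborel (k t) = Beta a b / 2 * (r\<^sup>2 - t\<^sup>2) powr (a + b - 1)" if t: "0 < t" "t < r" for t
  proof -
    have "k t s \<ge> 0" for s using k_nonneg[of t s] t by simp
    moreover have "Beta a b / 2 * (r\<^sup>2 - t\<^sup>2) powr (a + b - 1) \<ge> 0"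
      using ab Gamma_real_pos[of a] Gamma_real_pos[of b] Gamma_real_pos[of "a + b"] by (simp add: Beta_def)
    ultimately have "has_bochner_integral lborel (k t) (Beta a b / 2 * (r\<^sup>2 - t\<^sup>2) powr (a + b - 1))"
      using knn[OF t] by (intro has_bochner_integral_nn_integral) auto
    then show "integrable lborel (k t)" "integral\<^sup>L lborel (k t) = Beta a b / 2 * (r\<^sup>2 - t\<^sup>2) powr (a + b - 1)"
      by (auto simp: has_bochner_integral_iff)
  qed
  have int_K_s: "(\<integral>s. K s t \<partial>lborel) = Beta a b / 2 * (indicator {0<..<r} t * ((r\<^sup>2 - t\<^sup>2) powr (a + b - 1) * \<eta> t * t))" for t
    unfolding Kk using k_int[of t] by (cases "0 < t \<and> t < r") auto
  have "integrable (lborel \<Otimes>\<^sub>M lborel) (\<lambda>(s, t). K s t)"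
  proof (rule integrableI_bounded)
    have "(\<integral>\<^sup>+z. ennreal (norm (case z of (s, t) \<Rightarrow> K s t)) \<partial>(lborel \<Otimes>\<^sub>M lborel)) = (\<integral>\<^sup>+t. \<integral>\<^sup>+s. ennreal \<bar>K s t\<bar> \<partial>lborel \<partial>lborel)"
      by (subst lborel_pair.nn_integral_snd[symmetric]) (auto simp: split_beta')
    also have "\<dots> = (\<integral>\<^sup>+t. ennreal (Beta a b / 2 * (r\<^sup>2 - t\<^sup>2) powr (a + b - 1)) * ennreal \<bar>indicator {0<..<r} t * (\<eta> t * t)\<bar> \<partial>lborel)"
    proof (rule nn_integral_cong)
      fix t :: real
      show "(\<integral>\<^sup>+s. ennreal \<bar>K s t\<bar> \<partial>lborel) = ennreal (Beta a b / 2 * (r\<^sup>2 - t\<^sup>2) powr (a + b - 1)) * ennreal \<bar>indicator {0<..<r} t * (\<eta> t * t)\<bar>"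
      proof (cases "0 < t \<and> t < r")
        case True
        have "ennreal \<bar>K s t\<bar> = ennreal \<bar>\<eta> t * t\<bar> * ennreal (k t s)" for s
          using True k_nonneg[of t s] by (simp add: Kk abs_mult ennreal_mult[symmetric])
        then have "(\<integral>\<^sup>+s. ennreal \<bar>K s t\<bar> \<partial>lborel) = (\<integral>\<^sup>+s. ennreal \<bar>\<eta> t * t\<bar> * ennreal (k t s) \<partial>lborel)" by (simp only:)
        also have "\<dots> = ennreal \<bar>\<eta> t * t\<bar> * (\<integral>\<^sup>+s. ennreal (k t s) \<partial>lborel)" by (rule nn_integral_cmult) measurable
        finally show ?thesis using True knn[of t] by (simp add: mult.commute)
      qed (simp add: Kk)
    qed
    also have "\<dots> \<le> (\<integral>\<^sup>+t. ennreal (Beta a b / 2 * (r\<^sup>2) powr (a + b - 1)) * ennreal \<bar>indicator {0<..<r} t * (\<eta> t * t)\<bar> \<partial>lborel)"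
    proof (rule nn_integral_mono)
      fix t :: real
      have "Beta a b \<ge> 0" using ab Gamma_real_pos[of a] Gamma_real_pos[of b] Gamma_real_pos[of "a + b"] by (simp add: Beta_def)
      moreover have "(r\<^sup>2 - t\<^sup>2) powr (a + b - 1) \<le> (r\<^sup>2) powr (a + b - 1)" if "0 < t" "t < r"
        using ab that by (intro powr_mono2) (auto simp: power_mono)
      ultimately show "ennreal (Beta a b / 2 * (r\<^sup>2 - t\<^sup>2) powr (a + b - 1)) * ennreal \<bar>indicator {0<..<r} t * (\<eta> t * t)\<bar> \<le>
        ennreal (Beta a b / 2 * (r\<^sup>2) powr (a + b - 1)) * ennreal \<bar>indicator {0<..<r} t * (\<eta> t * t)\<bar>"
        by (cases "0 < t \<and> t < r") (auto intro!: mult_right_mono ennreal_leI mult_left_mono)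
    qed
    also have "\<dots> = ennreal (Beta a b / 2 * (r\<^sup>2) powr (a + b - 1)) * (\<integral>\<^sup>+t. ennreal \<bar>indicator {0<..<r} t * (\<eta> t * t)\<bar> \<partial>lborel)"
      by (rule nn_integral_cmult) measurable
    also have "\<dots> < \<infinity>"
      using int by (auto simp: integrable_iff_bounded ennreal_mult_less_top)
    finally show "(\<integral>\<^sup>+z. ennreal (norm (case z of (s, t) \<Rightarrow> K s t)) \<partial>(lborel \<Otimes>\<^sub>M lborel)) < \<infinity>" .
  qed simp
  note K_int = this
  have K_t: "(\<integral>t. K s t \<partial>lborel) = Gamma b / 2 * (indicator {0<..<r} s * ((r\<^sup>2 - s\<^sup>2) powr (a - 1) * EK_integral b \<eta> s * s))" for s
  proof -
    have "(\<integral>t. K s t \<partial>lborel) = (\<integral>t. (indicator {0<..<r} s * ((r\<^sup>2 - s\<^sup>2) powr (a - 1) * s)) * (indicator {0<..<s} t * ((s\<^sup>2 - t\<^sup>2) powr (b - 1) * \<eta> t * t)) \<partial>lborel)"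
      by (rule Bochner_Integration.integral_cong) (auto simp: K_def mult_ac)
    then show ?thesis using Gamma_real_pos[OF ab(2)] by (simp add: EK_integral_lborel)
  qed
  have "AE s in lborel. integrable lborel (\<lambda>t. K s t)"
    using lborel_pair.AE_integrable_fst'[OF K_int] by simp
  then show "AE s in lborel. 0 < s \<and> s < r \<longrightarrow> integrable lborel (\<lambda>t. indicator {0<..<s} t * ((s\<^sup>2 - t\<^sup>2) powr (b - 1) * \<eta> t * t))"
  proof eventually_elim
    fix s assume K: "integrable lborel (\<lambda>t. K s t)"
    show "0 < s \<and> s < r \<longrightarrow> integrable lborel (\<lambda>t. indicator {0<..<s} t * ((s\<^sup>2 - t\<^sup>2) powr (b - 1) * \<eta> t * t))"
    proof
      assume s: "0 < s \<and> s < r"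
      then have "r\<^sup>2 - s\<^sup>2 > 0" by (simp add: power_strict_mono)
      then have nz: "(r\<^sup>2 - s\<^sup>2) powr (a - 1) * s \<noteq> 0" using s by simp
      have "(\<lambda>t. K s t) = (\<lambda>t. ((r\<^sup>2 - s\<^sup>2) powr (a - 1) * s) * (indicator {0<..<s} t * ((s\<^sup>2 - t\<^sup>2) powr (b - 1) * \<eta> t * t)))"
        using s by (auto simp: K_def fun_eq_iff)
      with K have "integrable lborel (\<lambda>t. ((r\<^sup>2 - s\<^sup>2) powr (a - 1) * s) * (indicator {0<..<s} t * ((s\<^sup>2 - t\<^sup>2) powr (b - 1) * \<eta> t * t)))"
        by (simp only:)
      then show "integrable lborel (\<lambda>t. indicator {0<..<s} t * ((s\<^sup>2 - t\<^sup>2) powr (b - 1) * \<eta> t * t))"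
        using nz by (rule integrable_mult_cancel)
    qed
  qed
  have "integrable lborel (\<lambda>s. \<integral>t. K s t \<partial>lborel)"
    using lborel_pair.integrable_fst'[OF K_int] by simp
  then show "integrable lborel (\<lambda>s. indicator {0<..<r} s * ((r\<^sup>2 - s\<^sup>2) powr (a - 1) * EK_integral b \<eta> s * s))"
    unfolding K_t by (rule integrable_mult_cancel) (use Gamma_real_pos[OF ab(2)] in simp)
  have "(\<integral>s. \<integral>t. K s t \<partial>lborel \<partial>lborel) = (\<integral>t. \<integral>s. K s t \<partial>lborel \<partial>lborel)"
    by (rule lborel_pair.Fubini_integral[symmetric]) (rule K_int)
  then have "Gamma b / 2 * (\<integral>s. indicator {0<..<r} s * ((r\<^sup>2 - s\<^sup>2) powr (a - 1) * EK_integral b \<eta> s * s) \<partial>lborel) =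
    Beta a b / 2 * (\<integral>t. indicator {0<..<r} t * ((r\<^sup>2 - t\<^sup>2) powr (a + b - 1) * \<eta> t * t) \<partial>lborel)"
    unfolding K_t int_K_s by simp
  then have I: "(\<integral>s. indicator {0<..<r} s * ((r\<^sup>2 - s\<^sup>2) powr (a - 1) * EK_integral b \<eta> s * s) \<partial>lborel) =
    Beta a b / Gamma b * (\<integral>t. indicator {0<..<r} t * ((r\<^sup>2 - t\<^sup>2) powr (a + b - 1) * \<eta> t * t) \<partial>lborel)"
    using Gamma_real_pos[OF ab(2)] by (simp add: field_simps)
  have "2 / Gamma a * (Beta a b / Gamma b) = 2 / Gamma (a + b)"
    using Gamma_real_pos[OF ab(1)] Gamma_real_pos[OF ab(2)] by (simp add: Beta_def)
  moreover have "EK_integral a (EK_integral b \<eta>) r = 2 / Gamma a * (Beta a b / Gamma b * (\<integral>t. indicator {0<..<r} t * ((r\<^sup>2 - t\<^sup>2) powr (a + b - 1) * \<eta> t * t) \<partial>lborel))"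
    unfolding I[symmetric] by (rule EK_integral_lborel) measurable
  moreover have "EK_integral (a + b) \<eta> r = 2 / Gamma (a + b) * (\<integral>t. indicator {0<..<r} t * ((r\<^sup>2 - t\<^sup>2) powr (a + b - 1) * \<eta> t * t) \<partial>lborel)"
    by (rule EK_integral_lborel) measurable
  ultimately show "EK_integral a (EK_integral b \<eta>) r = EK_integral (a + b) \<eta> r"
    by (simp only: mult.assoc[symmetric])
qed

section \<open>Primitives and Lebesgue differentiation on the line\<close>

definition primitive :: "(real \<Rightarrow> real) \<Rightarrow> real \<Rightarrow> real" where
  "primitive p r = (\<integral>t. indicator {0<..<r} t * p t \<partial>lborel)"

lemma EK_integral_1:
  assumes "\<eta> \<in> borel_measurable borel"
  shows "EK_integral 1 \<eta> r = 2 * primitive (\<lambda>t. \<eta> t * t) r"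
proof -
  have "(\<integral>t. indicator {0<..<r} t * ((r\<^sup>2 - t\<^sup>2) powr (1 - 1) * \<eta> t * t) \<partial>lborel) = primitive (\<lambda>t. \<eta> t * t) r"
    unfolding primitive_def
  proof (rule Bochner_Integration.integral_cong)
    fix t :: real
    have "r\<^sup>2 \<noteq> t\<^sup>2" if "0 < t" "t < r" using power_strict_mono[of t r 2] that by simp
    then show "indicator {0<..<r} t * ((r\<^sup>2 - t\<^sup>2) powr (1 - 1) * \<eta> t * t) = indicator {0<..<r} t * (\<eta> t * t)"
      by (auto simp: indicator_def)
  qed simp
  then show ?thesis by (simp add: EK_integral_lborel[OF assms])
qed

lemma integrable_primitive_mono:
  fixes p :: "real \<Rightarrow> real"
  assumes "integrable lborel (\<lambda>t. indicator {0<..<R} t * p t)" "r \<le> R"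
  shows "integrable lborel (\<lambda>t. indicator {0<..<r} t * p t)"
proof -
  have "integrable lborel (\<lambda>t. indicator {0<..<r} t *\<^sub>R (indicator {0<..<R} t * p t))"
    using assms(1) by (intro integrable_mult_indicator) auto
  moreover have "indicator {0<..<r} t *\<^sub>R (indicator {0<..<R} t * p t) = indicator {0<..<r} t * p t" for t
    using assms(2) by (auto simp: indicator_def)
  ultimately show ?thesis by (simp only:)
qed

text \<open>Links the Lebesgue integral from 0 to the gauge integral over a compact interval, for
  which continuity and differentiation in the upper limit are at hand. The base point
  \<open>a > 0\<close> keeps the interval inside the domain of integrability.\<close>

lemma primitive_split:
  assumes int: "integrable lborel (\<lambda>t. indicator {0<..<R} t * p t)" and a: "0 < a" "a \<le> x" "x < R"
  shows "p integrable_on {a..x}" "primitive p x = primitive p a + integral {a..x} p"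
proof -
  have 1: "set_integrable lborel {a..x} p"
  proof -
    have "integrable lborel (\<lambda>t. indicator {a..x} t *\<^sub>R (indicator {0<..<R} t * p t))"
      using int by (intro integrable_mult_indicator) auto
    moreover have "indicator {a..x} t *\<^sub>R (indicator {0<..<R} t * p t) = indicator {a..x} t *\<^sub>R p t" for t
      using a by (auto simp: indicator_def)
    ultimately show ?thesis by (simp only: set_integrable_def)
  qed
  show "p integrable_on {a..x}" by (rule set_borel_integral_eq_integral(1)[OF 1])
  have "primitive p x = (\<integral>t. indicator {0<..<a} t * p t + indicator {a..x} t *\<^sub>R p t \<partial>lborel)"
    unfolding primitive_def
  proof (rule integral_cong_AE)
    show "(\<lambda>t. indicator {0<..<x} t * p t) \<in> borel_measurable lborel"
      using integrable_primitive_mono[OF int] a by (intro borel_measurable_integrable) auto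
    show "(\<lambda>t. indicator {0<..<a} t * p t + indicator {a..x} t *\<^sub>R p t) \<in> borel_measurable lborel"
      using integrable_primitive_mono[OF int] a 1 unfolding set_integrable_def
      by (intro borel_measurable_add borel_measurable_integrable) auto
    show "AE t in lborel. indicator {0<..<x} t * p t = indicator {0<..<a} t * p t + indicator {a..x} t *\<^sub>R p t"
      using AE_lborel_singleton[of x] by eventually_elim (use a in \<open>auto simp: indicator_def\<close>)
  qed
  also have "\<dots> = primitive p a + (LINT t:{a..x}|lborel. p t)"
    unfolding primitive_def set_lebesgue_integral_def
    using integrable_primitive_mono[OF int] a 1 unfolding set_integrable_def
    by (intro Bochner_Integration.integral_add) auto
  also have "(LINT t:{a..x}|lborel. p t) = integral {a..x} p" by (rule set_borel_integral_eq_integral(2)[OF 1])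
  finally show "primitive p x = primitive p a + integral {a..x} p" .
qed

lemma continuous_on_primitive:
  assumes int: "integrable lborel (\<lambda>t. indicator {0<..<R} t * p t)"
  shows "continuous_on {0<..<R} (primitive p)"
proof (rule continuous_at_imp_continuous_on, rule ballI)
  fix r assume "r \<in> {0<..<R}"
  then have r: "0 < r" "r < R" by auto
  define a b where "a = r / 2" and "b = (r + R) / 2"
  have ab: "0 < a" "a < r" "r < b" "b < R" using r by (auto simp: a_def b_def)
  have "p integrable_on {a..b}" using primitive_split(1)[OF int, of a b] ab by simp
  then have "continuous_on {a..b} (\<lambda>x. primitive p a + integral {a..x} p)"
    by (intro continuous_intros indefinite_integral_continuous_1)
  then have "continuous_on {a..b} (primitive p)"
    by (rule continuous_on_eq) (rule primitive_split(2)[OF int ab(1), symmetric], use ab in auto)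
  moreover have "r \<in> interior {a..b}" using ab by (simp add: interior_atLeastAtMost_real)
  ultimately show "isCont (primitive p) r" by (rule continuous_on_interior)
qed

lemma primitive_has_derivative:
  assumes int: "integrable lborel (\<lambda>t. indicator {0<..<R} t * p t)" and c: "continuous_on {0<..<R} p"
    and r: "0 < r" "r < R"
  shows "(primitive p has_real_derivative p r) (at r)"
proof -
  define a b where "a = r / 2" and "b = (r + R) / 2"
  have ab: "0 < a" "a < r" "r < b" "b < R" using r by (auto simp: a_def b_def)
  have "continuous_on {a..b} p" by (rule continuous_on_subset[OF c]) (use ab in auto)
  then have "((\<lambda>x. integral {a..x} p) has_real_derivative p r) (at r within {a..b})"
    using ab by (intro integral_has_real_derivative) auto
  moreover have "r \<in> interior {a..b}" using ab by (simp add: interior_atLeastAtMost_real)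
  ultimately have "((\<lambda>x. integral {a..x} p) has_real_derivative p r) (at r)" using at_within_interior[of r "{a..b}"] by simp
  from DERIV_add[OF DERIV_const[of "primitive p a"] this]
  have "((\<lambda>x. primitive p a + integral {a..x} p) has_real_derivative p r) (at r)" by simp
  moreover have "\<forall>\<^sub>F x in nhds r. primitive p a + integral {a..x} p = primitive p x"
  proof -
    have "\<forall>\<^sub>F x in nhds r. a < x \<and> x < b" using eventually_nhds_in_open[of "{a<..<b}" r] ab by auto
    then show ?thesis
      by eventually_elim (rule primitive_split(2)[OF int ab(1), symmetric], use ab in auto)
  qed
  ultimately show ?thesis by (simp add: DERIV_cong_ev)
qed

text \<open>\<open>integrable_ccontinuous_explicit\<close> controls the averages over intervals to
  the right of a point. Applied to the reflected function it controls those to the left, with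
  exceptional set the mirror image of \<open>N2\<close>.\<close>

lemma AE_primitive_has_derivative:
  assumes int: "integrable lborel (\<lambda>t. indicator {0<..<R} t * p t)"
  shows "AE r in lborel. 0 < r \<and> r < R \<longrightarrow> (primitive p has_real_derivative p r) (at r)"
proof -
  define q where "q t = indicator {0<..<R} t * p t" for t
  have qint: "q integrable_on S" if "S \<in> sets borel" for S
  proof -
    have "set_integrable lborel S q" unfolding set_integrable_def
      using int that by (intro integrable_mult_indicator) (auto simp: q_def)
    then show ?thesis by (rule set_borel_integral_eq_integral(1))
  qed
  have q': "(\<lambda>t. q (- t)) integrable_on {- b.. - a}" for a b
    using qint[of "{a..b}"] by simp
  obtain N1 where N1: "negligible N1" "\<And>x e. \<lbrakk>x \<notin> N1; 0 < e\<rbrakk> \<Longrightarrow>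
       \<exists>d>0. \<forall>h. 0 < h \<and> h < d \<longrightarrow> norm (integral (cbox x (x + h *\<^sub>R One)) q /\<^sub>R h ^ DIM(real) - q x) < e"
    by (rule integrable_ccontinuous_explicit[of q]) (use qint in auto)
  obtain N2 where N2: "negligible N2" "\<And>x e. \<lbrakk>x \<notin> N2; 0 < e\<rbrakk> \<Longrightarrow>
       \<exists>d>0. \<forall>h. 0 < h \<and> h < d \<longrightarrow> norm (integral (cbox x (x + h *\<^sub>R One)) (\<lambda>t. q (- t)) /\<^sub>R h ^ DIM(real) - q (- x)) < e"
  proof (rule integrable_ccontinuous_explicit[of "\<lambda>t. q (- t)"])
    show "(\<lambda>t. q (- t)) integrable_on cbox a b" for a b using q'[of "- a" "- b"] by simp
  qed blast
  have "negligible (uminus ` N2)"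
  proof (rule negligible_locally_Lipschitz_image[OF _ N2(1)])
    fix x :: real
    show "\<exists>T B. open T \<and> x \<in> T \<and> (\<forall>y\<in>N2 \<inter> T. norm (- y - - x) \<le> B * norm (y - x))"
      by (intro exI[of _ UNIV] exI[of _ "1::real"]) (auto simp: abs_minus_commute)
  qed simp
  then have "N1 \<union> uminus ` N2 \<in> null_sets lebesgue"
    using N1(1) by (simp add: negligible_iff_null_sets null_sets.Un)
  then have "AE r in lborel. r \<notin> N1 \<union> uminus ` N2"
    by (subst AE_completion_iff[symmetric]) (rule AE_not_in)
  then show ?thesis
  proof eventually_elim
    fix r assume N: "r \<notin> N1 \<union> uminus ` N2"
    show "0 < r \<and> r < R \<longrightarrow> (primitive p has_real_derivative p r) (at r)"
    proof
      assume r: "0 < r \<and> r < R"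
      have "- r \<notin> N2" using N by force
      have qr: "q r = p r" using r by (simp add: q_def)
      have eqI: "integral S q = integral S p" if "S \<subseteq> {0<..<R}" for S
        using that by (intro integral_cong) (auto simp: q_def)
      have "(\<lambda>h. (primitive p (r + h) - primitive p r) / h) \<midarrow>0\<rightarrow> p r"
      proof (rule LIM_I)
        fix e :: real assume "0 < e"
        obtain d1 where d1: "d1 > 0" "\<And>h. 0 < h \<Longrightarrow> h < d1 \<Longrightarrow> \<bar>integral {r..r + h} q / h - q r\<bar> < e"
          using N1(2)[of r e] N \<open>0 < e\<close> by (auto simp: divide_inverse mult.commute)
        obtain d2 where d2: "d2 > 0" "\<And>h. 0 < h \<Longrightarrow> h < d2 \<Longrightarrow> \<bar>integral {- r..- r + h} (\<lambda>t. q (- t)) / h - q r\<bar> < e"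
          using N2(2)[of "- r" e] \<open>- r \<notin> N2\<close> \<open>0 < e\<close> by (auto simp: divide_inverse mult.commute)
        define d where "d = Min {d1, d2, r, R - r}"
        have d: "d > 0" "d \<le> d1" "d \<le> d2" "d \<le> r" "d \<le> R - r" using d1 d2 r by (auto simp: d_def)
        show "\<exists>s>0. \<forall>h. h \<noteq> 0 \<and> norm (h - 0) < s \<longrightarrow> norm ((primitive p (r + h) - primitive p r) / h - p r) < e"
        proof (intro exI[of _ d] conjI allI impI)
          fix h :: real assume h: "h \<noteq> 0 \<and> norm (h - 0) < d"
          show "norm ((primitive p (r + h) - primitive p r) / h - p r) < e"
          proof (cases "h > 0")
            case True
            have "primitive p (r + h) - primitive p r = integral {r..r + h} q"
              using primitive_split(2)[OF int, of r "r + h"] True h d r by (subst eqI) auto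
            then show ?thesis using d1(2)[of h] True h d qr by auto
          next
            case False
            then have "h < 0" using h by simp
            have "primitive p r - primitive p (r + h) = integral {r + h..r} q"
              using primitive_split(2)[OF int, of "r + h" r] \<open>h < 0\<close> h d r by (subst eqI) auto
            also have "\<dots> = integral {- r..- r + - h} (\<lambda>t. q (- t))"
            proof -
              have "(q has_integral integral {r + h..r} q) {r + h..r}" by (rule integrable_integral[OF qint]) simp
              then have "((\<lambda>t. q (- t)) has_integral integral {r + h..r} q) {- r..- (r + h)}"
                by (simp only: has_integral_reflect_real)
              then have "integral {- r..- (r + h)} (\<lambda>t. q (- t)) = integral {r + h..r} q" by (rule integral_unique)
              then show ?thesis by simp
            qed
            finally have "(primitive p (r + h) - primitive p r) / h = integral {- r..- r + - h} (\<lambda>t. q (- t)) / (- h)"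
              using \<open>h < 0\<close> by (simp add: field_simps)
            then show ?thesis using d2(2)[of "- h"] \<open>h < 0\<close> h d qr by auto
          qed
        qed (fact d)
      qed
      then show "(primitive p has_real_derivative p r) (at r)" by (simp add: DERIV_def)
    qed
  qed
qed

section \<open>Iterated derivatives of Erdelyi-Kober integrals\<close>

text \<open>Order \<open>k + 1\<close> is order 1 applied to order \<open>k\<close>, and order 1 is
  twice a primitive. Hence from order 1 on the integrals are continuous, which makes the next one
  differentiable at every point and not just at almost every one.\<close>

lemma EK_integral_tower:
  fixes k :: nat
  assumes \<eta>: "\<eta> \<in> borel_measurable borel" and int: "integrable lborel (\<lambda>t. indicator {0<..<R} t * (\<eta> t * t))"
    and k: "k \<ge> 1"
  shows "continuous_on {0<..<R} (EK_integral (real k) \<eta>)"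
    and "0 < r \<Longrightarrow> r < R \<Longrightarrow> (EK_integral (real (Suc k)) \<eta> has_real_derivative 2 * r * EK_integral (real k) \<eta> r) (at r)"
proof -
  have *: "EK_integral 1 (EK_integral (real j) \<eta>) r = EK_integral (real (Suc j)) \<eta> r" if "j \<ge> 1" "r < R" for j r
  proof (cases "r > 0")
    case True
    have "EK_integral 1 (EK_integral (real j) \<eta>) r = EK_integral (1 + real j) \<eta> r"
      using that True by (intro EK_integral_semigroup(3) \<eta> integrable_primitive_mono[OF int]) auto
    then show ?thesis by simp
  qed (simp add: EK_integral_def set_lebesgue_integral_def)
  have p: "integrable lborel (\<lambda>t. indicator {0<..<r} t * (EK_integral (real j) \<eta> t * t))" if "j \<ge> 1" "r < R" for j r
  proof (cases "r > 0")
    case True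
    have "integrable lborel (\<lambda>s. indicator {0<..<r} s * ((r\<^sup>2 - s\<^sup>2) powr (1 - 1) * EK_integral (real j) \<eta> s * s))"
      using that True by (intro EK_integral_semigroup(2) \<eta> integrable_primitive_mono[OF int]) auto
    moreover have "indicator {0<..<r} s * ((r\<^sup>2 - s\<^sup>2) powr (1 - 1) * EK_integral (real j) \<eta> s * s) = indicator {0<..<r} s * (EK_integral (real j) \<eta> s * s)" for s
    proof -
      have "r\<^sup>2 \<noteq> s\<^sup>2" if "0 < s" "s < r" using power_strict_mono[of s r 2] that by simp
      then show ?thesis by (auto simp: indicator_def)
    qed
    ultimately show ?thesis by (simp only:)
  qed simp
  have step: "EK_integral (real (Suc j)) \<eta> r = 2 * primitive (\<lambda>t. EK_integral (real j) \<eta> t * t) r" if "j \<ge> 1" "r < R" for j r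
    using *[OF that] EK_integral_1[OF borel_measurable_EK_integral[OF \<eta>]] by simp
  have cont: "continuous_on {0<..<R} (EK_integral (real k) \<eta>)" if k1: "k \<ge> 1" for k
  proof (cases "k = 1")
    case True
    show ?thesis unfolding True by (simp add: EK_integral_1[OF \<eta>, abs_def] continuous_intros continuous_on_primitive[OF int])
  next
    case False
    then obtain j where j: "k = Suc j" "j \<ge> 1" using k1 by (cases k) auto
    \<comment> \<open>The recursion is available for radii strictly below \<open>R\<close>;
      continuity is therefore shown on each \<open>{0<..<x}\<close> with
      \<open>x < R\<close>.\<close>
    show ?thesis
    proof (rule continuous_on_open_UN[of "{0<..<R}" "\<lambda>x. {0<..<x}", THEN continuous_on_subset])
      show "continuous_on {0<..<x} (EK_integral (real k) \<eta>)" if "x \<in> {0<..<R}" for x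
      proof (rule continuous_on_eq)
        show "continuous_on {0<..<x} (\<lambda>r. 2 * primitive (\<lambda>t. EK_integral (real j) \<eta> t * t) r)"
          using that by (intro continuous_intros continuous_on_primitive p j) auto
      qed (use that j step in auto)
      show "{0<..<R} \<subseteq> (\<Union>x\<in>{0<..<R}. {0<..<x})"
      proof
        fix y assume "y \<in> {0<..<R}"
        then show "y \<in> (\<Union>x\<in>{0<..<R}. {0<..<x})" by (intro UN_I[of "(y + R) / 2"]) auto
      qed
    qed auto
  qed
  show "continuous_on {0<..<R} (EK_integral (real k) \<eta>)" by (rule cont[OF k])
  assume r: "0 < r" "r < R"
  define b where "b = (r + R) / 2"
  have b: "r < b" "b < R" using r by (auto simp: b_def)
  have "(primitive (\<lambda>t. EK_integral (real k) \<eta> t * t) has_real_derivative EK_integral (real k) \<eta> r * r) (at r)"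
    by (rule primitive_has_derivative[OF p[OF k b(2)] _ r(1) b(1)])
       (use b in \<open>intro continuous_intros continuous_on_subset[OF cont[OF k]]; auto\<close>)
  from DERIV_cmult[OF this, of 2]
  have "((\<lambda>r. 2 * primitive (\<lambda>t. EK_integral (real k) \<eta> t * t) r) has_real_derivative 2 * r * EK_integral (real k) \<eta> r) (at r)"
    by (simp add: mult_ac)
  moreover have "\<forall>\<^sub>F x in nhds r. 2 * primitive (\<lambda>t. EK_integral (real k) \<eta> t * t) x = EK_integral (real (Suc k)) \<eta> x"
    using eventually_nhds_in_open[of "{0<..<R}" r] r step[OF k] by (auto elim!: eventually_mono)
  ultimately show "(EK_integral (real (Suc k)) \<eta> has_real_derivative 2 * r * EK_integral (real k) \<eta> r) (at r)"
    by (simp add: DERIV_cong_ev)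
qed

lemma sq_deriv_tower:
  fixes k :: nat
  assumes \<eta>: "\<eta> \<in> borel_measurable borel" and int: "integrable lborel (\<lambda>t. indicator {0<..<R} t * (\<eta> t * t))"
    and F: "\<And>r. 0 < r \<Longrightarrow> r < R \<Longrightarrow> F r = EK_integral (real k) \<eta> r" and k: "k \<ge> 1"
  shows "j < k \<Longrightarrow> 0 < r \<Longrightarrow> r < R \<Longrightarrow> (sq_deriv ^^ j) F r = EK_integral (real (k - j)) \<eta> r \<and> sq_differentiable j F r"
proof (induction j arbitrary: r)
  case 0
  then show ?case using F by simp
next
  case (Suc j)
  have IH: "(sq_deriv ^^ j) F s = EK_integral (real (k - j)) \<eta> s \<and> sq_differentiable j F s" if "0 < s" "s < R" for s
    using Suc.IH[OF _ that] Suc.prems by simp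
  have kj: "k - j = Suc (k - Suc j)" "k - Suc j \<ge> 1" using Suc.prems by auto
  have nh: "\<forall>\<^sub>F s in nhds r. 0 < s \<and> s < R"
    using eventually_nhds_in_open[of "{0<..<R}" r] Suc.prems by auto
  have "(EK_integral (real (k - j)) \<eta> has_real_derivative 2 * r * EK_integral (real (k - Suc j)) \<eta> r) (at r)"
    unfolding kj(1) using EK_integral_tower(2)[OF \<eta> int kj(2)] Suc.prems by simp
  moreover have "\<forall>\<^sub>F s in nhds r. EK_integral (real (k - j)) \<eta> s = (sq_deriv ^^ j) F s"
    using nh by eventually_elim (simp add: IH)
  ultimately have D: "((sq_deriv ^^ j) F has_real_derivative 2 * r * EK_integral (real (k - Suc j)) \<eta> r) (at r)"
    by (simp add: DERIV_cong_ev)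
  have "\<forall>\<^sub>F s in nhds r. sq_differentiable j F s" using nh by eventually_elim (simp add: IH)
  moreover have "(sq_deriv ^^ j) F differentiable (at r)" using D by (auto simp: real_differentiable_def)
  moreover have "sq_deriv ((sq_deriv ^^ j) F) r = EK_integral (real (k - Suc j)) \<eta> r"
    unfolding sq_deriv_def DERIV_imp_deriv[OF D] using Suc.prems by simp
  ultimately show ?case by simp
qed

text \<open>The first \<open>k - 1\<close> derivatives lead down to order 1 and exist throughout (0,
  R). Only the last one differentiates a primitive of a possibly discontinuous function; its
  existence at the single point \<open>r\<close> is the hypothesis \<open>D\<close>, which is all
  that \<open>sq_differentiable\<close> asks of the last step.\<close>

lemma sq_deriv_EK_integral:
  fixes k :: nat
  assumes \<eta>: "\<eta> \<in> borel_measurable borel" and int: "integrable lborel (\<lambda>t. indicator {0<..<R} t * (\<eta> t * t))"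
    and F: "\<And>r. 0 < r \<Longrightarrow> r < R \<Longrightarrow> F r = EK_integral (real k) \<eta> r" and k: "k \<ge> 1"
    and r: "0 < r" "r < R" and D: "(primitive (\<lambda>t. \<eta> t * t) has_real_derivative \<eta> r * r) (at r)"
  shows "sq_differentiable k F r" "(sq_deriv ^^ k) F r = \<eta> r"
proof -
  obtain j where j: "k = Suc j" using k by (cases k) auto
  note T = sq_deriv_tower[OF \<eta> int F k, of j]
  have kj: "real (k - j) = 1" using j by simp
  have nh: "\<forall>\<^sub>F s in nhds r. 0 < s \<and> s < R"
    using eventually_nhds_in_open[of "{0<..<R}" r] r by auto
  have "((\<lambda>r. 2 * primitive (\<lambda>t. \<eta> t * t) r) has_real_derivative 2 * r * \<eta> r) (at r)"
    using DERIV_cmult[OF D, of 2] by (simp add: mult_ac)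
  moreover have "\<forall>\<^sub>F s in nhds r. 2 * primitive (\<lambda>t. \<eta> t * t) s = (sq_deriv ^^ j) F s"
    using nh by eventually_elim (use T kj j in \<open>simp add: EK_integral_1[OF \<eta>]\<close>)
  ultimately have D': "((sq_deriv ^^ j) F has_real_derivative 2 * r * \<eta> r) (at r)"
    by (simp add: DERIV_cong_ev)
  have "\<forall>\<^sub>F s in nhds r. sq_differentiable j F s" using nh by eventually_elim (use T j in simp)
  moreover have "(sq_deriv ^^ j) F differentiable (at r)" using D' by (auto simp: real_differentiable_def)
  ultimately show "sq_differentiable k F r" by (simp add: j)
  show "(sq_deriv ^^ k) F r = \<eta> r"
    unfolding j funpow.simps comp_def sq_deriv_def DERIV_imp_deriv[OF D'] using r by simp
qed

lemma borel_cball[measurable]: "cball (a::'a::{metric_space, second_countable_topology}) r \<in> sets borel"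
  by simp

section \<open>Differentiation and boundary limits of means\<close>

text \<open>Induction over integrable functions; the base case combines inner regularity by compact
  sets with cutoff functions. Boundedness is part of the claim because it makes every spherical mean
  of the approximant exist.\<close>

lemma continuous_L1_dense:
  fixes M :: "(real^'n) measure" and f :: "real^'n \<Rightarrow> real"
  assumes M: "finite_measure M" and sM[measurable_cong]: "sets M = sets borel"
    and f: "integrable M f"
  shows "\<forall>e>0. \<exists>g. continuous_on UNIV g \<and> bounded (range g) \<and> (\<integral>\<^sup>+x. ennreal \<bar>f x - g x\<bar> \<partial>M) < ennreal e"
  using f
proof (induction rule: integrable_induct)
  case (base A c)
  interpret finite_measure M by fact
  have A: "A \<in> sets borel" using base sM by simp
  have spM: "space M = UNIV" using sets_eq_imp_space_eq[OF sM] by simp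
  show ?case
  proof (intro allI impI)
    fix e :: real assume "e > 0"
    \<comment> \<open>Adding 1 keeps the denominator of \<open>d\<close> positive when
      \<open>c = 0\<close> and leaves the final estimate strict.\<close>
    define X where "X = \<bar>c\<bar> + 1"
    define d where "d = e / (2 * X)"
    have X: "X > 0" "\<bar>c\<bar> < X" by (auto simp: X_def)
    have d: "d > 0" using \<open>e > 0\<close> X by (simp add: d_def)
    have "emeasure M A = (SUP K\<in>{K. K \<subseteq> A \<and> compact K}. emeasure M K)"
      by (rule inner_regular) (use A sM emeasure_finite in auto)
    moreover have "emeasure M A < emeasure M A + ennreal d"
      using d by (simp add: emeasure_eq_measure ennreal_plus[symmetric] ennreal_less_iff del: ennreal_plus)
    ultimately obtain K where K: "K \<subseteq> A" "compact K" "emeasure M A < emeasure M K + ennreal d"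
    proof -
      have "\<exists>K\<in>{K. K \<subseteq> A \<and> compact K}. emeasure M A < emeasure M K + ennreal d"
        by (rule SUP_approx_ennreal[OF d _ \<open>emeasure M A = _\<close>]) (use emeasure_finite in auto)
      then show ?thesis using that by blast
    qed
    have Kb: "K \<in> sets borel" using K by (simp add: compact_imp_closed)
    have AK: "emeasure M (A - K) < ennreal d"
    proof -
      have "emeasure M A = emeasure M K + emeasure M (A - K)"
        using K A Kb sM by (subst plus_emeasure) (auto simp: Un_absorb1)
      then show ?thesis using K(3) emeasure_finite[of K] by (simp add: ennreal_add_left_cancel_less)
    qed
    \<comment> \<open>Cutoffs of slope \<open>k\<close> that equal 1 on \<open>K\<close> and tend to
      its indicator, since \<open>K\<close> is closed. The empty set is treated apart because the
      distance to it is 0 by convention.\<close>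
    define g where "g k x = (if K = {} then 0 else max 0 (1 - real k * infdist x K))" for k :: nat and x
    have g_cont: "continuous_on UNIV (g k)" for k
      unfolding g_def[abs_def] by (cases "K = {}") (auto intro!: continuous_intros)
    have g_meas[measurable]: "g k \<in> borel_measurable borel" for k
      by (rule borel_measurable_continuous_onI[OF g_cont])
    have g01: "0 \<le> g k x" "g k x \<le> 1" for k x by (auto simp: g_def infdist_nonneg)
    have lim: "(\<lambda>k. \<integral>\<^sup>+x. ennreal \<bar>indicator K x - g k x\<bar> \<partial>M) \<longlonglongrightarrow> (\<integral>\<^sup>+x. 0 \<partial>M)"
    proof (rule nn_integral_dominated_convergence[where w = "\<lambda>_. 1"])
      show "AE x in M. (\<lambda>k. ennreal \<bar>indicator K x - g k x\<bar>) \<longlonglongrightarrow> 0"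
      proof (rule AE_I2)
        fix x
        have "eventually (\<lambda>k. \<bar>indicator K x - g k x\<bar> = 0) sequentially"
        proof (cases "x \<in> K")
          case True
          then show ?thesis by (auto simp: g_def)
        next
          case False
          show ?thesis
          proof (cases "K = {}")
            case K: False
            have "infdist x K > 0" using False K \<open>compact K\<close> compact_imp_closed in_closed_iff_infdist_zero infdist_nonneg
              by (metis order_le_less)
            then obtain N :: nat where N: "1 / infdist x K \<le> real N" using real_arch_simple by blast
            show ?thesis
            proof (rule eventually_sequentiallyI[of N])
              fix k assume "N \<le> k"
              then have "1 / infdist x K \<le> real k" using N by linarith
              then have "1 \<le> real k * infdist x K" using \<open>infdist x K > 0\<close> by (simp add: field_simps)
              then show "\<bar>indicator K x - g k x\<bar> = 0" using False by (simp add: g_def)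
            qed
          qed (simp add: g_def)
        qed
        then have "eventually (\<lambda>k. ennreal \<bar>indicator K x - g k x\<bar> = 0) sequentially" by eventually_elim simp
        then show "(\<lambda>k. ennreal \<bar>indicator K x - g k x\<bar>) \<longlonglongrightarrow> 0" by (rule tendsto_eventually)
      qed
      show "(\<integral>\<^sup>+x. 1 \<partial>M) < \<infinity>" using emeasure_finite[of "space M"] by (simp add: less_top[symmetric])
      show "AE x in M. ennreal \<bar>indicator K x - g k x\<bar> \<le> 1" for k
      proof (rule AE_I2)
        fix x show "ennreal \<bar>indicator K x - g k x\<bar> \<le> 1" using g01[of k x] by (auto simp: indicator_def)
      qed
    qed (use Kb in measurable)
    then have "eventually (\<lambda>k. (\<integral>\<^sup>+x. ennreal \<bar>indicator K x - g k x\<bar> \<partial>M) < ennreal d) sequentially"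
      using d by (intro order_tendstoD(2)) auto
    then obtain k where k: "(\<integral>\<^sup>+x. ennreal \<bar>indicator K x - g k x\<bar> \<partial>M) < ennreal d"
      by (auto simp: eventually_sequentially)
    have "(\<integral>\<^sup>+x. ennreal \<bar>indicator A x *\<^sub>R c - c * g k x\<bar> \<partial>M) \<le>
      (\<integral>\<^sup>+x. ennreal \<bar>c\<bar> * (indicator (A - K) x + ennreal \<bar>indicator K x - g k x\<bar>) \<partial>M)"
    proof (rule nn_integral_mono)
      fix x
      have "indicator A x *\<^sub>R c - c * g k x = c * (indicator (A - K) x + (indicator K x - g k x))"
        using K(1) by (auto simp: indicator_def algebra_simps)
      then have "\<bar>indicator A x *\<^sub>R c - c * g k x\<bar> \<le> \<bar>c\<bar> * (indicator (A - K) x + \<bar>indicator K x - g k x\<bar>)"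
        by (simp add: abs_mult) (smt (verit, best) mult_left_mono abs_ge_zero indicator_pos_le)
      then have "ennreal \<bar>indicator A x *\<^sub>R c - c * g k x\<bar> \<le> ennreal (\<bar>c\<bar> * (indicator (A - K) x + \<bar>indicator K x - g k x\<bar>))"
        by (rule ennreal_leI)
      also have "\<dots> = ennreal \<bar>c\<bar> * (indicator (A - K) x + ennreal \<bar>indicator K x - g k x\<bar>)"
        by (simp add: ennreal_mult ennreal_plus[symmetric] ennreal_indicator[symmetric] del: ennreal_plus)
      finally show "ennreal \<bar>indicator A x *\<^sub>R c - c * g k x\<bar> \<le> ennreal \<bar>c\<bar> * (indicator (A - K) x + ennreal \<bar>indicator K x - g k x\<bar>)" .
    qed
    also have "\<dots> = ennreal \<bar>c\<bar> * (emeasure M (A - K) + (\<integral>\<^sup>+x. ennreal \<bar>indicator K x - g k x\<bar> \<partial>M))"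
      using A Kb sM by (subst nn_integral_cmult, measurable, subst nn_integral_add) auto
    also have "\<dots> \<le> ennreal \<bar>c\<bar> * (ennreal d + ennreal d)"
      using AK k by (intro mult_left_mono add_mono) auto
    also have "\<dots> = ennreal (\<bar>c\<bar> * (d + d))" using d by (simp add: ennreal_mult ennreal_plus[symmetric] del: ennreal_plus)
    also have "\<dots> < ennreal e"
    proof (rule ennreal_lessI[OF \<open>e > 0\<close>])
      have "\<bar>c\<bar> * (d + d) = e * (\<bar>c\<bar> / X)" by (simp add: d_def)
      also have "\<dots> < e * 1" using \<open>e > 0\<close> X by (intro mult_strict_left_mono) auto
      finally show "\<bar>c\<bar> * (d + d) < e" by simp
    qed
    finally have "(\<integral>\<^sup>+x. ennreal \<bar>indicator A x *\<^sub>R c - c * g k x\<bar> \<partial>M) < ennreal e" .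
    moreover have "bounded (range (\<lambda>x. c * g k x))"
    proof (rule boundedI)
      fix y assume "y \<in> range (\<lambda>x. c * g k x)"
      then show "norm y \<le> \<bar>c\<bar>" using g01[of k] by (auto simp: abs_mult intro!: mult_left_le)
    qed
    moreover have "continuous_on UNIV (\<lambda>x. c * g k x)" by (intro continuous_intros g_cont)
    ultimately show "\<exists>g. continuous_on UNIV g \<and> bounded (range g) \<and> (\<integral>\<^sup>+x. ennreal \<bar>indicator A x *\<^sub>R c - g x\<bar> \<partial>M) < ennreal e"
      by blast
  qed
next
  case (add f1 f2)
  show ?case
  proof (intro allI impI)
    fix e :: real assume "e > 0"
    obtain g1 where g1: "continuous_on UNIV g1" "bounded (range g1)" "(\<integral>\<^sup>+x. ennreal \<bar>f1 x - g1 x\<bar> \<partial>M) < ennreal (e / 2)"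
      using add \<open>e > 0\<close> by (meson half_gt_zero)
    obtain g2 where g2: "continuous_on UNIV g2" "bounded (range g2)" "(\<integral>\<^sup>+x. ennreal \<bar>f2 x - g2 x\<bar> \<partial>M) < ennreal (e / 2)"
      using add \<open>e > 0\<close> by (meson half_gt_zero)
    have [measurable]: "g1 \<in> borel_measurable borel" "g2 \<in> borel_measurable borel"
      using g1 g2 by (auto intro: borel_measurable_continuous_onI)
    note [measurable] = borel_measurable_integrable[OF add(1)] borel_measurable_integrable[OF add(2)]
    have "(\<integral>\<^sup>+x. ennreal \<bar>(f1 x + f2 x) - (g1 x + g2 x)\<bar> \<partial>M) \<le> (\<integral>\<^sup>+x. ennreal \<bar>f1 x - g1 x\<bar> + ennreal \<bar>f2 x - g2 x\<bar> \<partial>M)"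
      by (intro nn_integral_mono) (simp add: ennreal_plus[symmetric] ennreal_leI del: ennreal_plus)
    also have "\<dots> = (\<integral>\<^sup>+x. ennreal \<bar>f1 x - g1 x\<bar> \<partial>M) + (\<integral>\<^sup>+x. ennreal \<bar>f2 x - g2 x\<bar> \<partial>M)"
      by (rule nn_integral_add) measurable
    also have "\<dots> < ennreal (e / 2) + ennreal (e / 2)" by (rule add_strict_mono[OF g1(3) g2(3)])
    also have "\<dots> = ennreal e" using \<open>e > 0\<close> by (subst ennreal_plus[symmetric]) auto
    finally have "(\<integral>\<^sup>+x. ennreal \<bar>(f1 x + f2 x) - (g1 x + g2 x)\<bar> \<partial>M) < ennreal e" .
    then show "\<exists>g. continuous_on UNIV g \<and> bounded (range g) \<and> (\<integral>\<^sup>+x. ennreal \<bar>(f1 x + f2 x) - g x\<bar> \<partial>M) < ennreal e"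
      using g1 g2 by (intro exI[of _ "\<lambda>x. g1 x + g2 x"]) (auto intro!: continuous_intros bounded_plus_comp)
  qed
next
  case (lim f s)
  show ?case
  proof (intro allI impI)
    fix e :: real assume "e > 0"
    note [measurable] = borel_measurable_integrable[OF lim(1)] borel_measurable_integrable[OF lim(4)]
    have "(\<lambda>i. \<integral>\<^sup>+x. norm (f x - s i x) \<partial>M) \<longlonglongrightarrow> (\<integral>\<^sup>+x. 0 \<partial>M)"
    proof (rule nn_integral_dominated_convergence[where w = "\<lambda>x. ennreal (3 * norm (f x))"])
      show "(\<integral>\<^sup>+x. ennreal (3 * norm (f x)) \<partial>M) < \<infinity>"
        using lim(4) by (simp add: ennreal_mult nn_integral_cmult integrable_iff_bounded ennreal_mult_less_top)
      show "AE x in M. ennreal (norm (f x - s i x)) \<le> ennreal (3 * norm (f x))" for i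
      proof (rule AE_I2)
        fix x assume "x \<in> space M"
        have "norm (f x - s i x) \<le> norm (f x) + norm (s i x)" by (rule norm_triangle_ineq4)
        then show "ennreal (norm (f x - s i x)) \<le> ennreal (3 * norm (f x))"
          using lim(3)[OF \<open>x \<in> space M\<close>, of i] by (intro ennreal_leI) linarith
      qed
      show "AE x in M. (\<lambda>i. ennreal (norm (f x - s i x))) \<longlonglongrightarrow> 0"
      proof (rule AE_I2)
        fix x assume "x \<in> space M"
        have "(\<lambda>i. norm (f x - s i x)) \<longlonglongrightarrow> norm (f x - f x)"
          by (intro tendsto_intros lim(2)[OF \<open>x \<in> space M\<close>])
        then show "(\<lambda>i. ennreal (norm (f x - s i x))) \<longlonglongrightarrow> 0"
          by (metis diff_self ennreal_0 norm_zero tendsto_ennrealI)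
      qed
    qed measurable
    then have "eventually (\<lambda>i. (\<integral>\<^sup>+x. norm (f x - s i x) \<partial>M) < ennreal (e / 2)) sequentially"
      using \<open>e > 0\<close> by (intro order_tendstoD(2)) auto
    then obtain i where i: "(\<integral>\<^sup>+x. norm (f x - s i x) \<partial>M) < ennreal (e / 2)"
      by (auto simp: eventually_sequentially)
    obtain g where g: "continuous_on UNIV g" "bounded (range g)" "(\<integral>\<^sup>+x. ennreal \<bar>s i x - g x\<bar> \<partial>M) < ennreal (e / 2)"
      using lim(5)[of i] \<open>e > 0\<close> by (meson half_gt_zero)
    have [measurable]: "g \<in> borel_measurable borel"
      using g by (auto intro: borel_measurable_continuous_onI)
    have "(\<integral>\<^sup>+x. ennreal \<bar>f x - g x\<bar> \<partial>M) \<le> (\<integral>\<^sup>+x. ennreal (norm (f x - s i x)) + ennreal \<bar>s i x - g x\<bar> \<partial>M)"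
      by (intro nn_integral_mono) (simp add: ennreal_plus[symmetric] ennreal_leI del: ennreal_plus)
    also have "\<dots> = (\<integral>\<^sup>+x. norm (f x - s i x) \<partial>M) + (\<integral>\<^sup>+x. ennreal \<bar>s i x - g x\<bar> \<partial>M)"
      by (rule nn_integral_add) measurable
    also have "\<dots> < ennreal (e / 2) + ennreal (e / 2)" by (rule add_strict_mono[OF i g(3)])
    also have "\<dots> = ennreal e" using \<open>e > 0\<close> by (subst ennreal_plus[symmetric]) auto
    finally show "\<exists>g. continuous_on UNIV g \<and> bounded (range g) \<and> (\<integral>\<^sup>+x. ennreal \<bar>f x - g x\<bar> \<partial>M) < ennreal e"
      using g by blast
  qed
qed

text \<open>The pointwise half of the differentiation theorem: smallness of the mean oscillation
  over symmetric intervals about one given \<open>t\<close> yields the derivative at that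
  \<open>t\<close>. It is applied at a prescribed level, where an almost everywhere statement in
  \<open>t\<close> would not help.\<close>

lemma lebesgue_point_has_derivative:
  assumes int: "integrable lborel (\<lambda>t. indicator {0<..<R} t * p t)" and [measurable]: "p \<in> borel_measurable borel"
    and t: "0 < t" "t < R"
    and pt: "\<And>m::nat. \<exists>d>0. \<forall>h. 0 < h \<and> h < d \<longrightarrow> (\<integral>\<^sup>+v. indicator {t - h<..<t + h} v * ennreal \<bar>p v - p t\<bar> \<partial>lborel) \<le> ennreal (h / real (Suc m))"
  shows "(primitive p has_real_derivative p t) (at t)"
proof -
  have "(\<lambda>h. (primitive p (t + h) - primitive p t) / h) \<midarrow>0\<rightarrow> p t"
  proof (rule LIM_I)
    fix e :: real assume "e > 0"
    \<comment> \<open>An interval of length \<open>\<bar>h\<bar>\<close> with endpoint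
      \<open>t\<close> lies in the symmetric one of radius \<open>2 * \<bar>h\<bar>\<close>; the
      resulting error \<open>2 * \<bar>h\<bar> / Suc m\<close> has to stay below
      \<open>e * \<bar>h\<bar>\<close>.\<close>
    obtain m :: nat where m: "2 / e < real m" using reals_Archimedean2 by blast
    obtain d where d: "d > 0" "\<And>h. 0 < h \<Longrightarrow> h < d \<Longrightarrow> (\<integral>\<^sup>+v. indicator {t - h<..<t + h} v * ennreal \<bar>p v - p t\<bar> \<partial>lborel) \<le> ennreal (h / real (Suc m))"
      using pt[of m] by blast
    define d' where "d' = min (d / 2) (min t (R - t))"
    have d': "d' > 0" "d' \<le> d / 2" "d' \<le> t" "d' \<le> R - t"
      unfolding d'_def using d t by (simp_all only: min_less_iff_conj min_le_iff_disj) auto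
    have key: "\<bar>integral {a..b} p - p t * (b - a)\<bar> < e * h"
      if ab: "0 < a" "a \<le> b" "b < R" "{a..b} \<subseteq> {t - 2 * h<..<t + 2 * h}" and h: "0 < h" "2 * h < d" for a b h
    proof -
      have pint: "p integrable_on {a..b}" by (rule primitive_split(1)[OF int ab(1-3)])
      have "set_integrable lborel {a..b} p"
      proof -
        have "integrable lborel (\<lambda>t. indicator {a..b} t *\<^sub>R (indicator {0<..<R} t * p t))"
          using int by (intro integrable_mult_indicator) auto
        moreover have "indicator {a..b} t *\<^sub>R (indicator {0<..<R} t * p t) = indicator {a..b} t *\<^sub>R p t" for t
          using ab by (auto simp: indicator_def)
        ultimately show ?thesis by (simp only: set_integrable_def)
      qed
      then have si: "set_integrable lborel {a..b} (\<lambda>v. p v - p t)"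
        using integrable_real_indicator[of "{a..b}" lborel] ab
        by (intro set_integral_diff) (auto simp: set_integrable_def)
      have "integral {a..b} p - p t * (b - a) = integral {a..b} (\<lambda>v. p v - p t)"
        using pint ab by (subst integral_diff) (auto simp: content_real)
      also have "\<dots> = (LINT v:{a..b}|lborel. p v - p t)" by (rule set_borel_integral_eq_integral(2)[OF si, symmetric])
      finally have "ennreal \<bar>integral {a..b} p - p t * (b - a)\<bar> \<le> (\<integral>\<^sup>+v. norm (indicator {a..b} v *\<^sub>R (p v - p t)) \<partial>lborel)"
        using integral_norm_bound_ennreal[OF si[unfolded set_integrable_def]] by (simp add: set_lebesgue_integral_def)
      also have "\<dots> \<le> (\<integral>\<^sup>+v. indicator {t - 2 * h<..<t + 2 * h} v * ennreal \<bar>p v - p t\<bar> \<partial>lborel)"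
        using ab(4) by (intro nn_integral_mono) (auto simp: indicator_def)
      also have "\<dots> \<le> ennreal (2 * h / real (Suc m))" using h by (intro d(2)) auto
      finally have "\<bar>integral {a..b} p - p t * (b - a)\<bar> \<le> 2 * h / real (Suc m)" using h by (simp add: ennreal_le_iff)
      also have "\<dots> < e * h"
      proof -
        have "2 / e < real (Suc m)" using m by simp
        then have "2 < e * real (Suc m)" using \<open>e > 0\<close> by (simp add: field_simps del: of_nat_Suc)
        then have "2 * h < (e * real (Suc m)) * h" using h by (intro mult_strict_right_mono)
        then show ?thesis by (simp add: field_simps del: of_nat_Suc)
      qed
      finally show ?thesis .
    qed
    show "\<exists>s>0. \<forall>h. h \<noteq> 0 \<and> norm (h - 0) < s \<longrightarrow> norm ((primitive p (t + h) - primitive p t) / h - p t) < e"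
    proof (intro exI[of _ d'] conjI allI impI)
      fix h :: real assume h: "h \<noteq> 0 \<and> norm (h - 0) < d'"
      define a b where "a = min t (t + h)" and "b = max t (t + h)"
      have ab: "0 < a" "a \<le> b" "b < R" "b - a = \<bar>h\<bar>" using h d' t by (auto simp: a_def b_def min_def max_def)
      have "{a..b} \<subseteq> {t - 2 * \<bar>h\<bar><..<t + 2 * \<bar>h\<bar>}" using h by (auto simp: a_def b_def min_def max_def)
      then have k: "\<bar>integral {a..b} p - p t * \<bar>h\<bar>\<bar> < e * \<bar>h\<bar>"
        using key[OF ab(1-3), of "\<bar>h\<bar>"] ab(4) h d' by auto
      have "primitive p b - primitive p a = integral {a..b} p" using primitive_split(2)[OF int ab(1-3)] by simp
      then have "(primitive p (t + h) - primitive p t) / h = integral {a..b} p / \<bar>h\<bar>"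
        using h by (cases "h > 0") (auto simp: a_def b_def min_def max_def field_simps)
      moreover have "integral {a..b} p / \<bar>h\<bar> - p t = (integral {a..b} p - p t * \<bar>h\<bar>) / \<bar>h\<bar>" using h by (simp add: field_simps)
      ultimately show "norm ((primitive p (t + h) - primitive p t) / h - p t) < e"
        using k h by (simp add: divide_less_eq)
    qed (fact d')
  qed
  then show ?thesis by (simp add: DERIV_def)
qed

lemma tendsto_0_if_eventually_le:
  fixes f :: "'a \<Rightarrow> ennreal"
  assumes "\<And>e. e > 0 \<Longrightarrow> \<forall>\<^sub>F x in F. f x \<le> ennreal e"
  shows "(f \<longlongrightarrow> 0) F"
proof (rule order_tendstoI)
  fix a :: ennreal assume "0 < a"
  then obtain b where b: "0 < b" "b < a" using dense by blast
  then have "b \<noteq> \<infinity>" by auto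
  then obtain e where e: "b = ennreal e" "e \<ge> 0" by (cases b) auto
  have "\<forall>\<^sub>F x in F. f x \<le> ennreal e" by (rule assms) (use b e in simp)
  then show "\<forall>\<^sub>F x in F. f x < a" by eventually_elim (use b e in auto)
qed simp

context sphere_dim
begin

section \<open>Bounds and continuity of the means\<close>

lemma cap_mean_le_nn:
  fixes \<omega> :: "real^'n"
  assumes [measurable]: "f \<in> borel_measurable borel"
  shows "ennreal \<bar>cap_mean v f \<omega>\<bar> \<le> cap_nn v (\<lambda>x. ennreal \<bar>f x\<bar>) \<omega>"
proof (cases "integrable \<rho> (\<lambda>\<zeta>. f (cap_point v \<omega> \<zeta>))")
  case True
  then show ?thesis using integral_norm_bound_ennreal[OF True] by (simp add: cap_mean_def cap_nn_def)
qed (simp add: cap_mean_def not_integrable_integral_eq)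

lemma integrable_cap:
  fixes \<omega> :: "real^'n"
  assumes [measurable]: "f \<in> borel_measurable borel" and "cap_nn v (\<lambda>x. ennreal \<bar>f x\<bar>) \<omega> < \<infinity>"
  shows "integrable \<rho> (\<lambda>\<zeta>. f (cap_point v \<omega> \<zeta>))"
  using assms(2) by (intro integrableI_bounded) (auto simp: cap_nn_def)

lemma cap_mean_split:
  fixes \<omega> :: "real^'n"
  assumes [measurable]: "f \<in> borel_measurable borel" "g \<in> borel_measurable borel"
    and "cap_nn v (\<lambda>x. ennreal \<bar>f x\<bar>) \<omega> < \<infinity>" and g: "bounded (range g)"
  shows "cap_mean v f \<omega> = cap_mean v g \<omega> + cap_mean v (\<lambda>x. f x - g x) \<omega>"
proof -
  obtain B where B: "\<And>x. \<bar>g x\<bar> \<le> B" using g by (auto simp: bounded_iff)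
  have gi: "integrable \<rho> (\<lambda>\<zeta>. g (cap_point v \<omega> \<zeta>))"
    by (rule base.perp.integrable_const_bound[of _ B]) (use B in auto)
  show ?thesis unfolding cap_mean_def
    by (subst Bochner_Integration.integral_diff[OF integrable_cap[OF assms(1,3)] gi]) simp
qed

text \<open>Moving from level \<open>v\<close> to level \<open>u\<close> displaces the points by at
  most \<open>\<bar>u - v\<bar>\<close> plus the difference of the square roots, whatever the axis
  \<omega> is; uniform continuity of \<open>g\<close> on the unit ball does the rest. The endpoint
  \<open>v = 1\<close> is included for the boundary limit.\<close>

lemma cap_mean_uniformly_continuous:
  fixes g :: "real^'n \<Rightarrow> real"
  assumes g: "continuous_on UNIV g" "bounded (range g)" and v: "\<bar>v\<bar> \<le> 1" and e: "e > 0"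
  obtains d where "d > 0" "\<And>u \<omega>. \<bar>u\<bar> \<le> 1 \<Longrightarrow> \<bar>u - v\<bar> < d \<Longrightarrow> norm \<omega> = 1 \<Longrightarrow> \<bar>cap_mean u g \<omega> - cap_mean v g \<omega>\<bar> \<le> e"
proof -
  have [measurable]: "g \<in> borel_measurable borel" using g(1) by (rule borel_measurable_continuous_onI)
  have "uniformly_continuous_on (cball 0 1) g"
    by (rule compact_uniformly_continuous) (auto intro: continuous_on_subset[OF g(1)])
  then obtain d1 where d1: "d1 > 0" "\<And>x y. norm x \<le> 1 \<Longrightarrow> norm y \<le> 1 \<Longrightarrow> dist x y < d1 \<Longrightarrow> dist (g x) (g y) < e"
    using e unfolding uniformly_continuous_on_def by (metis mem_cball_0)
  have "isCont (\<lambda>u. \<bar>u - v\<bar> + \<bar>sqrt (1 - u\<^sup>2) - sqrt (1 - v\<^sup>2)\<bar>) v" by (intro continuous_intros)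
  then have "\<exists>d>0. \<forall>u. dist u v < d \<longrightarrow> dist (\<bar>u - v\<bar> + \<bar>sqrt (1 - u\<^sup>2) - sqrt (1 - v\<^sup>2)\<bar>) (\<bar>v - v\<bar> + \<bar>sqrt (1 - v\<^sup>2) - sqrt (1 - v\<^sup>2)\<bar>) < d1"
    using d1(1) unfolding continuous_at_eps_delta by blast
  then obtain d where d: "d > 0" "\<And>u. \<bar>u - v\<bar> < d \<Longrightarrow> \<bar>u - v\<bar> + \<bar>sqrt (1 - u\<^sup>2) - sqrt (1 - v\<^sup>2)\<bar> < d1"
    by (auto simp: dist_real_def)
  obtain B where B: "\<And>x. \<bar>g x\<bar> \<le> B" using g(2) by (auto simp: bounded_iff)
  have gi: "integrable \<rho> (\<lambda>\<zeta>. g (cap_point w \<omega> \<zeta>))" for w and \<omega> :: "real^'n"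
    by (rule base.perp.integrable_const_bound[of _ B]) (use B in auto)
  show ?thesis
  proof (rule that[OF d(1)])
    fix u and \<omega> :: "real^'n" assume u: "\<bar>u\<bar> \<le> 1" "\<bar>u - v\<bar> < d" and \<omega>: "norm \<omega> = 1"
    have ae: "AE \<zeta> in \<rho>. \<bar>g (cap_point u \<omega> \<zeta>) - g (cap_point v \<omega> \<zeta>)\<bar> \<le> e"
      using AE_cap_point[OF \<omega> u(1)] AE_cap_point[OF \<omega> v] AE_base_perp[OF \<omega>]
    proof eventually_elim
      fix \<zeta> assume z: "norm (cap_point u \<omega> \<zeta>) = 1 \<and> cap_point u \<omega> \<zeta> \<bullet> \<omega> = u" "norm (cap_point v \<omega> \<zeta>) = 1 \<and> cap_point v \<omega> \<zeta> \<bullet> \<omega> = v"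
        "norm (householder e0 \<omega> *v \<zeta>) = 1 \<and> (householder e0 \<omega> *v \<zeta>) \<bullet> \<omega> = 0"
      have "cap_point u \<omega> \<zeta> - cap_point v \<omega> \<zeta> = (u - v) *\<^sub>R \<omega> + (sqrt (1 - u\<^sup>2) - sqrt (1 - v\<^sup>2)) *\<^sub>R (householder e0 \<omega> *v \<zeta>)"
        by (simp add: cap_point_def scaleR_diff_left)
      then have "dist (cap_point u \<omega> \<zeta>) (cap_point v \<omega> \<zeta>) \<le> \<bar>u - v\<bar> + \<bar>sqrt (1 - u\<^sup>2) - sqrt (1 - v\<^sup>2)\<bar>"
        using norm_triangle_ineq[of "(u - v) *\<^sub>R \<omega>" "(sqrt (1 - u\<^sup>2) - sqrt (1 - v\<^sup>2)) *\<^sub>R (householder e0 \<omega> *v \<zeta>)"] z(3) \<omega>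
        by (simp add: dist_norm)
      then have "dist (cap_point u \<omega> \<zeta>) (cap_point v \<omega> \<zeta>) < d1" using d(2)[OF u(2)] by linarith
      then have "dist (g (cap_point u \<omega> \<zeta>)) (g (cap_point v \<omega> \<zeta>)) < e" using z by (intro d1(2)) auto
      then show "\<bar>g (cap_point u \<omega> \<zeta>) - g (cap_point v \<omega> \<zeta>)\<bar> \<le> e" by (simp add: dist_real_def)
    qed
    have "cap_mean u g \<omega> - cap_mean v g \<omega> = (\<integral>\<zeta>. g (cap_point u \<omega> \<zeta>) - g (cap_point v \<omega> \<zeta>) \<partial>\<rho>)"
      unfolding cap_mean_def using gi by (intro Bochner_Integration.integral_diff[symmetric])
    also have "\<bar>\<dots>\<bar> \<le> (\<integral>\<zeta>. \<bar>g (cap_point u \<omega> \<zeta>) - g (cap_point v \<omega> \<zeta>)\<bar> \<partial>\<rho>)" by (rule integral_abs_bound)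
    also have "\<dots> \<le> (\<integral>\<zeta>. e \<partial>\<rho>)" using gi ae by (intro integral_mono_AE) auto
    also have "\<dots> = e" using base.perp.prob_space by simp
    finally show "\<bar>cap_mean u g \<omega> - cap_mean v g \<omega>\<bar> \<le> e" .
  qed
qed

section \<open>A weak type maximal inequality for shells\<close>

text \<open>Distance at most \<open>R\<close> means
  \<open>x \<bullet> \<omega> \<ge> 1 - R\<^sup>2 / 2\<close>; on this interval of length at most
  R^2/2 below 1 the density is at most of order R^(n-3).\<close>

lemma cap_measure_le:
  fixes \<omega> :: "real^'n"
  assumes \<omega>: "norm \<omega> = 1" and R: "R > 0"
  shows "emeasure \<sigma> (cball \<omega> R) \<le> ennreal (proj_const CARD('n) * R ^ (CARD('n) - 1))"
proof -
  define c where "c = proj_const CARD('n)"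
  have c: "c > 0" using card_ge_3 by (simp add: c_def proj_const_pos)
  have [measurable]: "cball \<omega> R \<in> sets borel" by simp
  have "emeasure \<sigma> (cball \<omega> R) = (\<integral>\<^sup>+x. indicator (cball \<omega> R) x \<partial>\<sigma>)" by simp
  also have "\<dots> \<le> (\<integral>\<^sup>+x. indicator {1 - R\<^sup>2 / 2..} (x \<bullet> \<omega>) \<partial>\<sigma>)"
  proof (rule nn_integral_mono_AE, use zero.AE_perp in eventually_elim)
    fix x :: "real^'n" assume x: "norm x = 1 \<and> x \<bullet> 0 = 0"
    have "x \<bullet> \<omega> \<ge> 1 - R\<^sup>2 / 2" if "x \<in> cball \<omega> R"
    proof -
      have "norm (\<omega> - x) \<le> R" using that by (simp add: dist_norm)
      then have "(norm (\<omega> - x))\<^sup>2 \<le> R\<^sup>2" by (simp add: power_mono)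
      moreover have "(norm (\<omega> - x))\<^sup>2 = \<omega> \<bullet> \<omega> + x \<bullet> x - 2 * (x \<bullet> \<omega>)"
        by (simp add: power2_norm_eq_inner inner_diff_left inner_diff_right inner_commute)
      moreover have "\<omega> \<bullet> \<omega> = 1" "x \<bullet> x = 1" using \<omega> x by (auto simp: norm_eq_1)
      ultimately show ?thesis by simp
    qed
    then show "indicator (cball \<omega> R) x \<le> (indicator {1 - R\<^sup>2 / 2..} (x \<bullet> \<omega>) :: ennreal)" by (auto simp: indicator_def)
  qed
  also have "\<dots> = (\<integral>\<^sup>+s. ennreal (proj_density CARD('n) s) * indicator {1 - R\<^sup>2 / 2..} s \<partial>lborel)"
    using nn_integral_proj[of 0 \<omega> "indicator {1 - R\<^sup>2 / 2..}"] \<omega> by simp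
  also have "\<dots> \<le> (\<integral>\<^sup>+s. ennreal (c * R ^ (CARD('n) - 3)) * indicator {1 - R\<^sup>2 / 2..1} s \<partial>lborel)"
  proof (rule nn_integral_mono)
    fix s :: real
    show "ennreal (proj_density CARD('n) s) * indicator {1 - R\<^sup>2 / 2..} s \<le> ennreal (c * R ^ (CARD('n) - 3)) * indicator {1 - R\<^sup>2 / 2..1} s"
    proof (cases "s \<in> {-1<..<1} \<and> 1 - R\<^sup>2 / 2 \<le> s")
      case True
      have "1 - s\<^sup>2 = (1 - s) * (1 + s)" by (simp add: power2_eq_square algebra_simps)
      also have "\<dots> \<le> (R\<^sup>2 / 2) * 2" using True by (intro mult_mono) auto
      finally have "1 - s\<^sup>2 \<le> R\<^sup>2" by simp
      then have "(1 - s\<^sup>2) powr ((real CARD('n) - 3) / 2) \<le> (R\<^sup>2) powr ((real CARD('n) - 3) / 2)"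
        using True card_ge_3 by (intro powr_mono2) (auto simp: abs_square_le_1)
      also have "(R\<^sup>2) powr ((real CARD('n) - 3) / 2) = R ^ (CARD('n) - 3)"
      proof -
        have "(R\<^sup>2) powr ((real CARD('n) - 3) / 2) = (R powr 2) powr ((real CARD('n) - 3) / 2)" using R by (simp add: powr_numeral)
        also have "\<dots> = R powr (2 * ((real CARD('n) - 3) / 2))" by (rule powr_powr)
        also have "2 * ((real CARD('n) - 3) / 2) = real (CARD('n) - 3)" using card_ge_3 by (simp add: of_nat_diff field_simps)
        finally show ?thesis using R by (simp add: powr_realpow)
      qed
      finally show ?thesis using True c by (auto simp: proj_density_def c_def[symmetric] intro!: ennreal_leI mult_left_mono)
    qed (auto simp: proj_density_def indicator_def)
  qed
  also have "\<dots> = ennreal (c * R ^ (CARD('n) - 3)) * ennreal (R\<^sup>2 / 2)"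
    using R by (simp add: nn_integral_cmult_indicator)
  also have "\<dots> = ennreal (c * R ^ (CARD('n) - 3) * (R\<^sup>2 / 2))" using c R by (subst ennreal_mult) auto
  also have "\<dots> \<le> ennreal (c * R ^ (CARD('n) - 1))"
  proof (rule ennreal_leI)
    have "CARD('n) - 1 = (CARD('n) - 3) + 2" using card_ge_3 by simp
    then have "R ^ (CARD('n) - 1) = R ^ (CARD('n) - 3) * R\<^sup>2" by (simp only: power_add)
    then show "c * R ^ (CARD('n) - 3) * (R\<^sup>2 / 2) \<le> c * R ^ (CARD('n) - 1)" using c R by (simp add: mult_ac)
  qed
  finally show ?thesis by (simp add: c_def)
qed

text \<open>The density behaves like 1 - s^2 to the power p = (n - 4)/2 and may vanish or blow up at
  the pole. Only 1 - h^2/2 < s < 1 - h^2/4 is kept, where 1 - s^2 lies between h^2/4 and h^2, which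
  gives the right order for either sign of \<open>p\<close>. The length h^2/4 and the worst factor,
  4 to the power -|p|, make up \<kappa>.\<close>

lemma perp_cap_measure_ge:
  obtains \<kappa> where "\<kappa> > 0" "\<And>\<eta> \<xi>0 h. norm \<eta> = 1 \<Longrightarrow> norm \<xi>0 = 1 \<Longrightarrow> \<xi>0 \<bullet> \<eta> = 0 \<Longrightarrow> 0 < h \<Longrightarrow> h < 1 \<Longrightarrow>
    ennreal (\<kappa> * h ^ (CARD('n) - 2)) \<le> emeasure (perp_measure (\<eta>::real^'n)) (cball \<xi>0 h)"
proof -
  define m where "m = CARD('n) - 1"
  define p where "p = (real m - 3) / 2"
  define c where "c = proj_const m"
  have m: "m \<ge> 2" using card_ge_3 by (simp add: m_def)
  have c: "c > 0" unfolding c_def by (rule proj_const_pos[OF m])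
  define \<kappa> where "\<kappa> = c * 4 powr (- \<bar>p\<bar>) / 4"
  have "\<kappa> > 0" using c by (simp add: \<kappa>_def)
  moreover have "ennreal (\<kappa> * h ^ (CARD('n) - 2)) \<le> emeasure (perp_measure \<eta>) (cball \<xi>0 h)"
    if \<eta>: "norm \<eta> = 1" and \<xi>0: "norm \<xi>0 = 1" "\<xi>0 \<bullet> \<eta> = 0" and h: "0 < h" "h < 1" for \<eta> \<xi>0 :: "real^'n" and h
  proof -
    interpret e: axis_vec2 \<eta> by (rule axis_vec2I) (simp add: \<eta>)
    have [measurable]: "cball \<xi>0 h \<in> sets borel" by simp
    have h2: "h\<^sup>2 < 1" using h by (simp add: power_less_one_iff)
    have hp: "h\<^sup>2 powr p = h powr (2 * p)"
    proof -
      have "h\<^sup>2 powr p = (h powr 2) powr p" using h by (simp add: powr_numeral)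
      then show ?thesis by (simp add: powr_powr)
    qed
    have dens: "c * 4 powr (- \<bar>p\<bar>) * h powr (2 * p) \<le> proj_density m s" if s: "1 - h\<^sup>2 / 2 < s" "s < 1 - h\<^sup>2 / 4" for s
    proof -
      have s0: "0 < s" "s < 1" using s h2 h by (auto simp: field_simps)
      have eq: "1 - s\<^sup>2 = (1 - s) * (1 + s)" by (simp add: power2_eq_square algebra_simps)
      have "(h\<^sup>2 / 4) * 1 \<le> (1 - s) * (1 + s)" using s s0 by (intro mult_mono) auto
      then have lo: "h\<^sup>2 / 4 \<le> 1 - s\<^sup>2" by (simp add: eq)
      have "0 < h\<^sup>2 / 4" using h by simp
      then have pos: "0 < 1 - s\<^sup>2" using lo by linarith
      have "(1 - s) * (1 + s) \<le> (h\<^sup>2 / 2) * 2" using s s0 by (intro mult_mono) auto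
      then have hi: "1 - s\<^sup>2 \<le> h\<^sup>2" by (simp add: eq)
      have "4 powr (- \<bar>p\<bar>) * h powr (2 * p) \<le> (1 - s\<^sup>2) powr p"
      proof (cases "p \<ge> 0")
        case True
        have "4 powr (- \<bar>p\<bar>) * h powr (2 * p) = (h\<^sup>2 / 4) powr p"
          using True h by (simp add: powr_divide hp powr_minus inverse_eq_divide)
        also have "\<dots> \<le> (1 - s\<^sup>2) powr p" using True lo h by (intro powr_mono2) auto
        finally show ?thesis .
      next
        case False
        have "4 powr (- \<bar>p\<bar>) * h powr (2 * p) \<le> 1 * h powr (2 * p)"
          by (intro mult_right_mono) (auto simp: powr_le_one_le powr_minus intro!: inverse_le_1_iff[THEN iffD2] ge_one_powr_ge_zero)
        also have "\<dots> = (h\<^sup>2) powr p" by (simp add: hp)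
        also have "\<dots> \<le> (1 - s\<^sup>2) powr p" using False hi pos by (intro powr_mono2') auto
        finally show ?thesis .
      qed
      then show ?thesis using c s0 by (simp add: proj_density_def c_def[symmetric] p_def[symmetric] mult.assoc)
    qed
    have "ennreal (\<kappa> * h ^ (CARD('n) - 2)) = ennreal (c * 4 powr (- \<bar>p\<bar>) * h powr (2 * p)) * ennreal (h\<^sup>2 / 4)"
    proof -
      have e: "2 * p + 2 = real (CARD('n) - 2)" using card_ge_3 by (simp add: p_def m_def of_nat_diff field_simps)
      have "h ^ (CARD('n) - 2) = h powr (2 * p + 2)" unfolding e using h by (simp add: powr_realpow)
      also have "\<dots> = h powr (2 * p) * h\<^sup>2" using h by (simp add: powr_add powr_numeral)
      finally show ?thesis using c h by (subst ennreal_mult[symmetric]) (auto simp: \<kappa>_def)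
    qed
    also have "\<dots> = (\<integral>\<^sup>+s. ennreal (c * 4 powr (- \<bar>p\<bar>) * h powr (2 * p)) * indicator {1 - h\<^sup>2 / 2<..<1 - h\<^sup>2 / 4} s \<partial>lborel)"
      using h by (simp add: nn_integral_cmult_indicator)
    also have "\<dots> \<le> (\<integral>\<^sup>+s. ennreal (proj_density m s) * indicator {1 - h\<^sup>2 / 2..} s \<partial>lborel)"
      using dens by (intro nn_integral_mono) (auto simp: indicator_def intro!: ennreal_leI)
    also have "\<dots> = (\<integral>\<^sup>+x. indicator {1 - h\<^sup>2 / 2..} (x \<bullet> \<xi>0) \<partial>perp_measure \<eta>)"
      using nn_integral_proj[of \<eta> \<xi>0 "indicator {1 - h\<^sup>2 / 2..}"] \<eta> \<xi>0 by (auto simp: m_def)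
    also have "\<dots> \<le> (\<integral>\<^sup>+x. indicator (cball \<xi>0 h) x \<partial>perp_measure \<eta>)"
    proof (rule nn_integral_mono_AE, use e.AE_perp in eventually_elim)
      fix x :: "real^'n" assume x: "norm x = 1 \<and> x \<bullet> \<eta> = 0"
      have "x \<in> cball \<xi>0 h" if "1 - h\<^sup>2 / 2 \<le> x \<bullet> \<xi>0"
      proof -
        have "(norm (\<xi>0 - x))\<^sup>2 = \<xi>0 \<bullet> \<xi>0 + x \<bullet> x - 2 * (x \<bullet> \<xi>0)"
          by (simp add: power2_norm_eq_inner inner_diff_left inner_diff_right inner_commute)
        moreover have "\<xi>0 \<bullet> \<xi>0 = 1" "x \<bullet> x = 1" using \<xi>0 x by (auto simp: norm_eq_1)
        ultimately have "(norm (\<xi>0 - x))\<^sup>2 \<le> h\<^sup>2" using that by simp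
        then show ?thesis using h by (simp add: dist_norm power2_le_iff_abs_le)
      qed
      then show "indicator {1 - h\<^sup>2 / 2..} (x \<bullet> \<xi>0) \<le> (indicator (cball \<xi>0 h) x :: ennreal)" by (auto simp: indicator_def)
    qed
    also have "\<dots> = emeasure (perp_measure \<eta>) (cball \<xi>0 h)" by simp
    finally show ?thesis .
  qed
  ultimately show ?thesis by (rule that)
qed

text \<open>If \<open>\<eta> \<bullet> \<omega>\<close> is within \<open>h\<close> of
  \<open>t\<close>, then a point of the sphere of level \<open>t\<close> about \<eta> lies at
  distance of order \<open>h\<close> from \<omega>. A neighbourhood of size \<open>h\<close> of that
  point in the (n-2)-dimensional sphere falls into the ball about \<omega>, which explains the
  exponent.\<close>

lemma shell_covering:
  assumes t: "0 < t" "t < 1"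
  obtains \<kappa> c where "\<kappa> > 0" "c > 0" "\<And>\<eta> \<omega> h. norm \<eta> = 1 \<Longrightarrow> norm \<omega> = 1 \<Longrightarrow> 0 < h \<Longrightarrow> h < 1 \<Longrightarrow> \<bar>\<eta> \<bullet> \<omega> - t\<bar> < h \<Longrightarrow>
    ennreal (\<kappa> * h ^ (CARD('n) - 2)) \<le> cap_nn t (indicator (cball \<omega> (c * h))) (\<eta> :: real^'n)"
proof -
  obtain \<kappa> where \<kappa>: "\<kappa> > 0" "\<And>\<eta> \<xi>0 h. norm \<eta> = 1 \<Longrightarrow> norm \<xi>0 = 1 \<Longrightarrow> \<xi>0 \<bullet> \<eta> = 0 \<Longrightarrow> 0 < h \<Longrightarrow> h < 1 \<Longrightarrow>
    ennreal (\<kappa> * h ^ (CARD('n) - 2)) \<le> emeasure (perp_measure (\<eta>::real^'n)) (cball \<xi>0 h)"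
    by (rule perp_cap_measure_ge) blast
  \<comment> \<open>One unit comes from \<open>v - t\<close>, one from
    \<open>\<xi>0 - \<xi>\<close>, and 2 / sqrt (1 - t^2) from the difference of the two radii;
    \<open>t < 1\<close> keeps the last one finite.\<close>
  define c where "c = 2 + 2 / sqrt (1 - t\<^sup>2)"
  have t2: "1 - t\<^sup>2 > 0" using t by (simp add: power_less_one_iff)
  have "c > 0" using t2 by (simp add: c_def add_pos_pos)
  moreover have "ennreal (\<kappa> * h ^ (CARD('n) - 2)) \<le> cap_nn t (indicator (cball \<omega> (c * h))) \<eta>"
    if \<eta>: "norm \<eta> = 1" and \<omega>: "norm \<omega> = 1" and h: "0 < h" "h < 1" and v: "\<bar>\<eta> \<bullet> \<omega> - t\<bar> < h" for \<eta> \<omega> :: "real^'n" and h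
  proof -
    interpret e: axis_vec2 \<eta> by (rule axis_vec2I) (simp add: \<eta>)
    define v where "v = \<omega> \<bullet> \<eta>"
    have vt: "\<bar>v - t\<bar> < h" using v by (simp add: v_def inner_commute)
    have v1: "\<bar>v\<bar> \<le> 1" using Cauchy_Schwarz_ineq2[of \<omega> \<eta>] \<omega> \<eta> by (simp add: v_def)
    have v2: "1 - v\<^sup>2 \<ge> 0" using v1 by (simp add: abs_square_le_1)
    obtain \<xi>0 where \<xi>0: "norm \<xi>0 = 1" "\<xi>0 \<bullet> \<eta> = 0" "\<omega> = v *\<^sub>R \<eta> + sqrt (1 - v\<^sup>2) *\<^sub>R \<xi>0"
      using circle_decomposition[OF \<eta> \<omega>] unfolding v_def by blast
    have sq: "\<bar>sqrt (1 - t\<^sup>2) - sqrt (1 - v\<^sup>2)\<bar> \<le> 2 / sqrt (1 - t\<^sup>2) * h"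
    proof -
      let ?A = "sqrt (1 - t\<^sup>2)" and ?B = "sqrt (1 - v\<^sup>2)"
      have A: "?A > 0" "?B \<ge> 0" using t2 v2 by auto
      have "(?A - ?B) * (?A + ?B) = ?A\<^sup>2 - ?B\<^sup>2" by (simp add: power2_eq_square algebra_simps)
      also have "\<dots> = (v - t) * (v + t)" using t2 v2 by (simp add: power2_eq_square algebra_simps)
      finally have "\<bar>?A - ?B\<bar> * (?A + ?B) = \<bar>v - t\<bar> * \<bar>v + t\<bar>"
        using A by (metis abs_mult abs_of_nonneg add_nonneg_nonneg less_imp_le)
      also have "\<dots> \<le> h * 2" using vt v1 t by (intro mult_mono) auto
      finally have "\<bar>?A - ?B\<bar> * (?A + ?B) \<le> h * 2" .
      moreover have "\<bar>?A - ?B\<bar> * ?A \<le> \<bar>?A - ?B\<bar> * (?A + ?B)" using A by (intro mult_left_mono) auto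
      ultimately have "\<bar>?A - ?B\<bar> * ?A \<le> 2 * h" by linarith
      then show ?thesis using A by (simp add: field_simps)
    qed
    have "ennreal (\<kappa> * h ^ (CARD('n) - 2)) \<le> (\<integral>\<^sup>+\<xi>. indicator (cball \<xi>0 h) \<xi> \<partial>perp_measure \<eta>)"
      using \<kappa>(2)[OF \<eta> \<xi>0(1,2) h] by simp
    also have "\<dots> \<le> (\<integral>\<^sup>+\<xi>. indicator (cball \<omega> (c * h)) (t *\<^sub>R \<eta> + sqrt (1 - t\<^sup>2) *\<^sub>R \<xi>) \<partial>perp_measure \<eta>)"
    proof (rule nn_integral_mono)
      fix \<xi> :: "real^'n"
      have "dist \<omega> (t *\<^sub>R \<eta> + sqrt (1 - t\<^sup>2) *\<^sub>R \<xi>) \<le> c * h" if "\<xi> \<in> cball \<xi>0 h"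
      proof -
        have "\<omega> - (t *\<^sub>R \<eta> + sqrt (1 - t\<^sup>2) *\<^sub>R \<xi>) = (v - t) *\<^sub>R \<eta> + ((sqrt (1 - v\<^sup>2) - sqrt (1 - t\<^sup>2)) *\<^sub>R \<xi>0 + sqrt (1 - t\<^sup>2) *\<^sub>R (\<xi>0 - \<xi>))"
          by (subst \<xi>0(3)) (simp add: algebra_simps)
        also have "norm \<dots> \<le> norm ((v - t) *\<^sub>R \<eta>) + (norm ((sqrt (1 - v\<^sup>2) - sqrt (1 - t\<^sup>2)) *\<^sub>R \<xi>0) + norm (sqrt (1 - t\<^sup>2) *\<^sub>R (\<xi>0 - \<xi>)))"
          by (intro order_trans[OF norm_triangle_ineq] add_left_mono norm_triangle_ineq)
        also have "\<dots> \<le> h + (2 / sqrt (1 - t\<^sup>2) * h + 1 * h)"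
        proof (intro add_mono)
          show "norm ((v - t) *\<^sub>R \<eta>) \<le> h" using vt \<eta> by simp
          show "norm ((sqrt (1 - v\<^sup>2) - sqrt (1 - t\<^sup>2)) *\<^sub>R \<xi>0) \<le> 2 / sqrt (1 - t\<^sup>2) * h" using sq \<xi>0 by (simp add: abs_minus_commute)
          have "sqrt (1 - t\<^sup>2) \<le> 1" by simp
          then show "norm (sqrt (1 - t\<^sup>2) *\<^sub>R (\<xi>0 - \<xi>)) \<le> 1 * h"
            using that t2 unfolding norm_scaleR by (intro mult_mono) (auto simp: dist_norm)
        qed
        also have "\<dots> = c * h" by (simp add: c_def algebra_simps)
        finally show ?thesis by (simp add: dist_norm)
      qed
      then show "indicator (cball \<xi>0 h) \<xi> \<le> (indicator (cball \<omega> (c * h)) (t *\<^sub>R \<eta> + sqrt (1 - t\<^sup>2) *\<^sub>R \<xi>) :: ennreal)"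
        by (auto simp: indicator_def)
    qed
    also have "\<dots> = cap_nn t (indicator (cball \<omega> (c * h))) \<eta>"
      by (rule cap_nn_perp[OF \<eta>, symmetric]) measurable
    finally show ?thesis .
  qed
  ultimately show ?thesis using \<kappa>(1) that by blast
qed

lemma cap_nn_restrict:
  fixes \<omega> :: "real^'n"
  assumes \<omega>: "norm \<omega> = 1" and v: "\<bar>v\<bar> \<le> 1" and [measurable]: "b \<in> borel_measurable borel" "S \<in> sets borel"
  shows "cap_nn v (\<lambda>\<eta>. b \<eta> * indicator S (\<eta> \<bullet> \<omega>)) \<omega> = indicator S v * cap_nn v b \<omega>"
proof -
  have "cap_nn v (\<lambda>\<eta>. b \<eta> * indicator S (\<eta> \<bullet> \<omega>)) \<omega> = (\<integral>\<^sup>+\<zeta>. indicator S v * b (cap_point v \<omega> \<zeta>) \<partial>\<rho>)"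
    unfolding cap_nn_def
    by (rule nn_integral_cong_AE, use AE_cap_point[OF \<omega> v] in eventually_elim) (simp add: mult.commute)
  also have "\<dots> = indicator S v * cap_nn v b \<omega>" unfolding cap_nn_def by (rule nn_integral_cmult) measurable
  finally show ?thesis .
qed

text \<open>The integral of \<open>b\<close> over a shell of width \<open>h\<close> is dominated, up
  to the factor h^(n-2), by the integral of \<open>g = cap_nn t b\<close> over a ball of radius
  \<open>c * h\<close> about \<omega>. Thus the shell averages are controlled by the
  Hardy-Littlewood averages of \<open>g\<close>, to which the Vitali covering argument applies, and
  \<open>g\<close> has the same integral as \<open>b\<close>.\<close>

lemma maximal_inequality:
  assumes t: "0 < t" "t < 1"
  obtains C h0 where "C > 0" "h0 > 0"
    "\<And>b l. b \<in> borel_measurable borel \<Longrightarrow> l > 0 \<Longrightarrow>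
      \<exists>E\<in>sets borel. {\<omega>::real^'n. norm \<omega> = 1 \<and> (\<exists>h. 0 < h \<and> h < h0 \<and> (\<integral>\<^sup>+v. indicator {t - h<..<t + h} v * cap_nn v b \<omega> \<partial>lborel) > ennreal (l * h))} \<subseteq> E \<and>
        emeasure \<sigma> E \<le> ennreal (C / l) * (\<integral>\<^sup>+\<omega>. b \<omega> \<partial>\<sigma>)"
proof -
  obtain \<kappa> c where \<kappa>: "\<kappa> > 0" "c > 0" "\<And>\<eta> \<omega> h. norm \<eta> = 1 \<Longrightarrow> norm \<omega> = 1 \<Longrightarrow> 0 < h \<Longrightarrow> h < 1 \<Longrightarrow> \<bar>\<eta> \<bullet> \<omega> - t\<bar> < h \<Longrightarrow>
    ennreal (\<kappa> * h ^ (CARD('n) - 2)) \<le> cap_nn t (indicator (cball \<omega> (c * h))) (\<eta> :: real^'n)"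
    by (rule shell_covering[OF t]) blast
  define N where "N = CARD('n) - 2"
  have N: "CARD('n) - 1 = Suc N" using card_ge_3 by (simp add: N_def)
  \<comment> \<open>Shells of half-width below \<open>h0\<close> stay at levels between 0 and
    \<open>t + h0 < 1\<close>, where the density is at least the constant \<open>a\<close>.\<close>
  define h0 where "h0 = min t (1 - t) / 2"
  have h0: "h0 > 0" "t + h0 < 1" "t - h0 > 0" "h0 < 1" using t by (auto simp: h0_def min_def field_simps)
  define a where "a = proj_const CARD('n) * (1 - (t + h0)\<^sup>2) powr ((real CARD('n) - 3) / 2)"
  have q: "1 - (t + h0)\<^sup>2 > 0" using h0 by (simp add: power_less_one_iff)
  have pc: "proj_const CARD('n) > 0" using card_ge_3 by (simp add: proj_const_pos)
  have a: "a > 0" using q pc by (simp add: a_def)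
  have dens: "a \<le> proj_density CARD('n) v" if "t - h < v" "v < t + h" "h < h0" for v h
  proof -
    have v: "0 < v" "v < t + h0" using that h0 by auto
    then have "v\<^sup>2 \<le> (t + h0)\<^sup>2" by (intro power_mono) auto
    then have "(1 - (t + h0)\<^sup>2) powr ((real CARD('n) - 3) / 2) \<le> (1 - v\<^sup>2) powr ((real CARD('n) - 3) / 2)"
      using q card_ge_3 by (intro powr_mono2) auto
    then show ?thesis using v h0 pc by (simp add: a_def proj_density_def)
  qed
  \<comment> \<open>The constant of the upper ball bound at radius \<open>5 * c * h\<close>, divided
    by the lower bounds \<open>a\<close> for the density and \<kappa> for the covering.\<close>
  define C where "C = proj_const CARD('n) * (5 * c) ^ Suc N / (a * \<kappa>)"
  have C: "C > 0" using pc \<kappa> a by (simp add: C_def)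
  have main: "\<exists>E\<in>sets borel. {\<omega>::real^'n. norm \<omega> = 1 \<and> (\<exists>h. 0 < h \<and> h < h0 \<and> (\<integral>\<^sup>+v. indicator {t - h<..<t + h} v * cap_nn v b \<omega> \<partial>lborel) > ennreal (l * h))} \<subseteq> E \<and>
        emeasure \<sigma> E \<le> ennreal (C / l) * (\<integral>\<^sup>+\<omega>. b \<omega> \<partial>\<sigma>)"
    if [measurable]: "b \<in> borel_measurable borel" and l: "l > 0" for b and l :: real
  proof -
    define g where "g = cap_nn t b"
    have [measurable]: "g \<in> borel_measurable borel" unfolding g_def by measurable
    have t1: "\<bar>t\<bar> \<le> 1" using t by auto
    \<comment> \<open>Two estimates are multiplied: the density bound passes from levels to the
      shell, and the covering property passes from the shell to the ball.\<close>
    have bound: "ennreal (a * \<kappa> * h ^ N) * (\<integral>\<^sup>+v. indicator {t - h<..<t + h} v * cap_nn v b \<omega> \<partial>lborel) \<le> (\<integral>\<^sup>+x. g x * indicator (cball \<omega> (c * h)) x \<partial>\<sigma>)"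
      if \<omega>: "norm \<omega> = 1" and h: "0 < h" "h < h0" for \<omega> :: "real^'n" and h
    proof -
      have "ennreal a * (\<integral>\<^sup>+v. indicator {t - h<..<t + h} v * cap_nn v b \<omega> \<partial>lborel) = (\<integral>\<^sup>+v. ennreal a * (indicator {t - h<..<t + h} v * cap_nn v b \<omega>) \<partial>lborel)"
        by (rule nn_integral_cmult[symmetric]) measurable
      also have "\<dots> \<le> (\<integral>\<^sup>+v. ennreal (proj_density CARD('n) v) * cap_nn v (\<lambda>\<eta>. b \<eta> * indicator {t - h<..<t + h} (\<eta> \<bullet> \<omega>)) \<omega> \<partial>lborel)"
      proof (rule nn_integral_mono)
        fix v
        show "ennreal a * (indicator {t - h<..<t + h} v * cap_nn v b \<omega>) \<le> ennreal (proj_density CARD('n) v) * cap_nn v (\<lambda>\<eta>. b \<eta> * indicator {t - h<..<t + h} (\<eta> \<bullet> \<omega>)) \<omega>"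
        proof (cases "v \<in> {t - h<..<t + h}")
          case True
          then have v1: "\<bar>v\<bar> \<le> 1" using h h0 by auto
          show ?thesis unfolding cap_nn_restrict[OF \<omega> v1 \<open>b \<in> _\<close>, of "{t - h<..<t + h}", simplified]
            using True h dens[of h v] by (intro mult_right_mono ennreal_leI) auto
        qed simp
      qed
      also have "\<dots> = (\<integral>\<^sup>+\<eta>. b \<eta> * indicator {t - h<..<t + h} (\<eta> \<bullet> \<omega>) \<partial>\<sigma>)"
        by (rule nn_integral_slice[OF \<omega>, symmetric]) measurable
      finally have 1: "ennreal a * (\<integral>\<^sup>+v. indicator {t - h<..<t + h} v * cap_nn v b \<omega> \<partial>lborel) \<le> (\<integral>\<^sup>+\<eta>. b \<eta> * indicator {t - h<..<t + h} (\<eta> \<bullet> \<omega>) \<partial>\<sigma>)" .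
      have [measurable]: "cball \<omega> (c * h) \<in> sets borel" by simp
      have "ennreal (\<kappa> * h ^ N) * (\<integral>\<^sup>+\<eta>. b \<eta> * indicator {t - h<..<t + h} (\<eta> \<bullet> \<omega>) \<partial>\<sigma>) = (\<integral>\<^sup>+\<eta>. ennreal (\<kappa> * h ^ N) * (b \<eta> * indicator {t - h<..<t + h} (\<eta> \<bullet> \<omega>)) \<partial>\<sigma>)"
        by (rule nn_integral_cmult[symmetric]) measurable
      also have "\<dots> \<le> (\<integral>\<^sup>+\<eta>. b \<eta> * cap_nn t (indicator (cball \<omega> (c * h))) \<eta> \<partial>\<sigma>)"
      proof (rule nn_integral_mono_AE, use zero.AE_perp in eventually_elim)
        fix \<eta> :: "real^'n" assume \<eta>: "norm \<eta> = 1 \<and> \<eta> \<bullet> 0 = 0"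
        show "ennreal (\<kappa> * h ^ N) * (b \<eta> * indicator {t - h<..<t + h} (\<eta> \<bullet> \<omega>)) \<le> b \<eta> * cap_nn t (indicator (cball \<omega> (c * h))) \<eta>"
        proof (cases "\<eta> \<bullet> \<omega> \<in> {t - h<..<t + h}")
          case True
          then have "ennreal (\<kappa> * h ^ N) \<le> cap_nn t (indicator (cball \<omega> (c * h))) \<eta>"
            unfolding N_def using \<eta> \<omega> h h0 by (intro \<kappa>(3)) (auto simp: abs_less_iff)
          then show ?thesis using True by (simp add: mult.commute mult_left_mono)
        qed simp
      qed
      also have "\<dots> = (\<integral>\<^sup>+\<eta>. \<integral>\<^sup>+\<zeta>. b \<eta> * indicator (cball \<omega> (c * h)) (cap_point t \<eta> \<zeta>) \<partial>\<rho> \<partial>\<sigma>)"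
        unfolding cap_nn_def by (intro nn_integral_cong nn_integral_cmult[symmetric]) measurable
      \<comment> \<open>Self-adjointness moves the mean from the indicator of the ball over to
        \<open>b\<close>, which produces \<open>g\<close>.\<close>
      also have "\<dots> = (\<integral>\<^sup>+\<eta>. \<integral>\<^sup>+\<zeta>. b (cap_point t \<eta> \<zeta>) * indicator (cball \<omega> (c * h)) \<eta> \<partial>\<rho> \<partial>\<sigma>)"
        by (rule cap_self_adjoint[OF t1, of "\<lambda>x y. b x * indicator (cball \<omega> (c * h)) y"]) measurable
      also have "\<dots> = (\<integral>\<^sup>+x. g x * indicator (cball \<omega> (c * h)) x \<partial>\<sigma>)"
        unfolding g_def cap_nn_def by (intro nn_integral_cong nn_integral_multc) measurable
      finally have 2: "ennreal (\<kappa> * h ^ N) * (\<integral>\<^sup>+\<eta>. b \<eta> * indicator {t - h<..<t + h} (\<eta> \<bullet> \<omega>) \<partial>\<sigma>) \<le> (\<integral>\<^sup>+x. g x * indicator (cball \<omega> (c * h)) x \<partial>\<sigma>)" .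
      have "ennreal (a * \<kappa> * h ^ N) = ennreal (\<kappa> * h ^ N) * ennreal a"
        using a \<kappa> h by (subst ennreal_mult[symmetric]) (auto simp: mult_ac)
      then have "ennreal (a * \<kappa> * h ^ N) * (\<integral>\<^sup>+v. indicator {t - h<..<t + h} v * cap_nn v b \<omega> \<partial>lborel) =
        ennreal (\<kappa> * h ^ N) * (ennreal a * (\<integral>\<^sup>+v. indicator {t - h<..<t + h} v * cap_nn v b \<omega> \<partial>lborel))"
        by (simp only: mult.assoc)
      also have "\<dots> \<le> ennreal (\<kappa> * h ^ N) * (\<integral>\<^sup>+\<eta>. b \<eta> * indicator {t - h<..<t + h} (\<eta> \<bullet> \<omega>) \<partial>\<sigma>)"
        using 1 by (rule mult_left_mono) simp
      finally show ?thesis using 2 by (rule order_trans)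
    qed
    define bad where "bad \<omega> h \<longleftrightarrow> 0 < h \<and> h < h0 \<and> (\<integral>\<^sup>+v. indicator {t - h<..<t + h} v * cap_nn v b \<omega> \<partial>lborel) > ennreal (l * h)" for \<omega> :: "real^'n" and h
    define K where "K = {\<omega>. norm \<omega> = 1 \<and> (\<exists>h. bad \<omega> h)}"
    define r where "r \<omega> = (SOME h. bad \<omega> h)" for \<omega>
    have r: "bad \<omega> (r \<omega>)" if "\<omega> \<in> K" for \<omega>
      using that unfolding K_def r_def by (auto intro: someI_ex)
    have r0: "0 < r \<omega>" "r \<omega> < h0" if "\<omega> \<in> K" for \<omega> using r[OF that] by (auto simp: bad_def)
    define R where "R \<omega> = c * r \<omega>" for \<omega>
    have R: "0 < R \<omega> \<and> R \<omega> \<le> c * h0" if "\<omega> \<in> K" for \<omega>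
      using r0[OF that] \<kappa>(2) by (auto simp: R_def)
    have "K \<subseteq> (\<Union>\<omega>\<in>K. cball \<omega> (R \<omega>))" using R by fastforce
    \<comment> \<open>The radii are bounded by \<open>c * h0\<close>, so a disjoint subfamily exists
      whose fivefold enlargements cover \<open>K\<close>. Disjointness lets the local integrals of
      \<open>g\<close> add up to at most the full one.\<close>
    from Vitali_covering_lemma_cballs[OF this R]
    obtain D where D: "countable D" "D \<subseteq> K" "pairwise (\<lambda>i j. disjnt (cball i (R i)) (cball j (R j))) D" "K \<subseteq> (\<Union>\<omega>\<in>D. cball \<omega> (5 * R \<omega>))"
      by blast
    \<comment> \<open>A countable union of balls is Borel, whereas the set of bad directions is
      given by an uncountable family of radii; hence the claim is about a Borel superset.\<close>
    define E where "E = (\<Union>\<omega>\<in>D. cball \<omega> (5 * R \<omega>))"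
    have E: "E \<in> sets borel" unfolding E_def using D(1) by (intro sets.countable_UN') auto
    have one: "emeasure \<sigma> (cball \<omega> (5 * R \<omega>)) \<le> ennreal (C / l) * (\<integral>\<^sup>+x. g x * indicator (cball \<omega> (R \<omega>)) x \<partial>\<sigma>)" if "\<omega> \<in> D" for \<omega>
    proof -
      have \<omega>K: "\<omega> \<in> K" using that D by auto
      then have \<omega>: "norm \<omega> = 1" by (simp add: K_def)
      let ?h = "r \<omega>"
      note h = r0[OF \<omega>K]
      have "ennreal (a * \<kappa> * ?h ^ N) * ennreal (l * ?h) \<le> ennreal (a * \<kappa> * ?h ^ N) * (\<integral>\<^sup>+v. indicator {t - ?h<..<t + ?h} v * cap_nn v b \<omega> \<partial>lborel)"
        using r[OF \<omega>K] by (intro mult_left_mono) (auto simp: bad_def)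
      also have "\<dots> \<le> (\<integral>\<^sup>+x. g x * indicator (cball \<omega> (R \<omega>)) x \<partial>\<sigma>)" unfolding R_def by (rule bound[OF \<omega> h])
      finally have 1: "ennreal (a * \<kappa> * ?h ^ N) * ennreal (l * ?h) \<le> (\<integral>\<^sup>+x. g x * indicator (cball \<omega> (R \<omega>)) x \<partial>\<sigma>)" .
      have "emeasure \<sigma> (cball \<omega> (5 * R \<omega>)) \<le> ennreal (proj_const CARD('n) * (5 * R \<omega>) ^ Suc N)"
        using cap_measure_le[OF \<omega>, of "5 * R \<omega>", unfolded N] R[OF \<omega>K] by simp
      also have "proj_const CARD('n) * (5 * R \<omega>) ^ Suc N = (C / l) * ((a * \<kappa> * ?h ^ N) * (l * ?h))"
        using l a \<kappa> by (simp add: C_def R_def power_mult_distrib)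
      also have "ennreal \<dots> = ennreal (C / l) * (ennreal (a * \<kappa> * ?h ^ N) * ennreal (l * ?h))"
        using C l a \<kappa> h by (subst ennreal_mult) (auto simp: ennreal_mult[symmetric])
      also have "\<dots> \<le> ennreal (C / l) * (\<integral>\<^sup>+x. g x * indicator (cball \<omega> (R \<omega>)) x \<partial>\<sigma>)"
        using 1 by (rule mult_left_mono) simp
      finally show ?thesis .
    qed
    have "emeasure \<sigma> E = (\<integral>\<^sup>+x. indicator E x \<partial>\<sigma>)" using E by simp
    also have "\<dots> \<le> (\<integral>\<^sup>+x. \<integral>\<^sup>+\<omega>. indicator (cball \<omega> (5 * R \<omega>)) x \<partial>count_space D \<partial>\<sigma>)"
    proof (rule nn_integral_mono)
      fix x :: "real^'n"
      show "indicator E x \<le> (\<integral>\<^sup>+\<omega>. indicator (cball \<omega> (5 * R \<omega>)) x \<partial>count_space D)"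
      proof (cases "x \<in> E")
        case True
        then obtain \<omega> where \<omega>: "\<omega> \<in> D" "x \<in> cball \<omega> (5 * R \<omega>)" by (auto simp: E_def)
        have "(\<lambda>\<omega>. indicator (cball \<omega> (5 * R \<omega>)) x :: ennreal) \<omega> \<le> (\<integral>\<^sup>+\<omega>. indicator (cball \<omega> (5 * R \<omega>)) x \<partial>count_space D)"
          by (rule nn_integral_ge_point[OF \<omega>(1)])
        then show ?thesis using True \<omega> by simp
      qed simp
    qed
    also have "\<dots> = (\<integral>\<^sup>+\<omega>. emeasure \<sigma> (cball \<omega> (5 * R \<omega>)) \<partial>count_space D)"
      using D(1) by (subst nn_integral_count_space_nn_integral) (auto intro!: borel_measurable_indicator)
    also have "\<dots> \<le> (\<integral>\<^sup>+\<omega>. ennreal (C / l) * (\<integral>\<^sup>+x. g x * indicator (cball \<omega> (R \<omega>)) x \<partial>\<sigma>) \<partial>count_space D)"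
      by (rule nn_integral_mono) (simp add: one)
    also have "\<dots> = ennreal (C / l) * (\<integral>\<^sup>+\<omega>. \<integral>\<^sup>+x. g x * indicator (cball \<omega> (R \<omega>)) x \<partial>\<sigma> \<partial>count_space D)"
      by (rule nn_integral_cmult) simp
    also have "(\<integral>\<^sup>+\<omega>. \<integral>\<^sup>+x. g x * indicator (cball \<omega> (R \<omega>)) x \<partial>\<sigma> \<partial>count_space D) = (\<integral>\<^sup>+x. \<integral>\<^sup>+\<omega>. g x * indicator (cball \<omega> (R \<omega>)) x \<partial>count_space D \<partial>\<sigma>)"
      using D(1) by (intro nn_integral_count_space_nn_integral[symmetric]) (auto intro!: borel_measurable_times borel_measurable_indicator)
    also have "\<dots> \<le> (\<integral>\<^sup>+x. g x \<partial>\<sigma>)"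
    proof (rule nn_integral_mono)
      fix x :: "real^'n"
      show "(\<integral>\<^sup>+\<omega>. g x * indicator (cball \<omega> (R \<omega>)) x \<partial>count_space D) \<le> g x"
      proof (cases "\<exists>\<omega>\<in>D. x \<in> cball \<omega> (R \<omega>)")
        case True
        then obtain \<omega> where \<omega>: "\<omega> \<in> D" "x \<in> cball \<omega> (R \<omega>)" by blast
        have "(\<integral>\<^sup>+\<omega>. g x * indicator (cball \<omega> (R \<omega>)) x \<partial>count_space D) = (\<integral>\<^sup>+\<omega>'. g x * indicator {\<omega>} \<omega>' \<partial>count_space D)"
        proof (rule nn_integral_cong)
          fix \<omega>' assume "\<omega>' \<in> space (count_space D)"
          then have "\<omega>' \<in> D" by simp
          then have "x \<in> cball \<omega>' (R \<omega>') \<longleftrightarrow> \<omega>' = \<omega>"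
            using pairwiseD[OF D(3) \<omega>(1), of \<omega>'] \<omega> unfolding disjnt_iff by blast
          then show "g x * indicator (cball \<omega>' (R \<omega>')) x = g x * indicator {\<omega>} \<omega>'" by (simp add: indicator_def del: mem_cball)
        qed
        also have "\<dots> \<le> g x" using \<omega>(1) by (simp add: nn_integral_cmult)
        finally show ?thesis .
      next
        case False
        then have "(\<integral>\<^sup>+\<omega>. g x * indicator (cball \<omega> (R \<omega>)) x \<partial>count_space D) = (\<integral>\<^sup>+\<omega>. 0 \<partial>count_space D)"
          by (intro nn_integral_cong) (auto simp: indicator_def simp del: mem_cball)
        then show ?thesis by simp
      qed
    qed
    also have "(\<integral>\<^sup>+x. g x \<partial>\<sigma>) = (\<integral>\<^sup>+x. b x \<partial>\<sigma>)" unfolding g_def by (rule nn_integral_cap_nn[OF t1]) measurable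
    finally have "emeasure \<sigma> E \<le> ennreal (C / l) * (\<integral>\<^sup>+x. b x \<partial>\<sigma>)" by (simp add: mult_left_mono)
    moreover have "{\<omega>::real^'n. norm \<omega> = 1 \<and> (\<exists>h. 0 < h \<and> h < h0 \<and> (\<integral>\<^sup>+v. indicator {t - h<..<t + h} v * cap_nn v b \<omega> \<partial>lborel) > ennreal (l * h))} \<subseteq> E"
      using D(4) by (simp add: K_def bad_def E_def)
    ultimately show ?thesis using E by blast
  qed
  show ?thesis by (rule that[OF C h0(1) main])
qed

section \<open>Differentiation of the means in the level, and their boundary limit\<close>

lemma AE_cap_nn_finite:
  fixes f :: "real^'n \<Rightarrow> ennreal"
  assumes v: "\<bar>v\<bar> \<le> 1" and [measurable]: "f \<in> borel_measurable borel" and fin: "(\<integral>\<^sup>+x. f x \<partial>\<sigma>) < \<infinity>"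
  shows "AE \<omega> in \<sigma>. cap_nn v f \<omega> < \<infinity>"
proof -
  have "(\<integral>\<^sup>+\<omega>. cap_nn v f \<omega> \<partial>\<sigma>) \<noteq> \<infinity>" using nn_integral_cap_nn[OF v, of f] fin by simp
  from nn_integral_PInf_AE[OF _ this] show ?thesis by (simp add: less_top)
qed

lemma AE_cap_nn_integral_finite:
  fixes f :: "real^'n \<Rightarrow> ennreal"
  assumes [measurable]: "f \<in> borel_measurable borel" and fin: "(\<integral>\<^sup>+x. f x \<partial>\<sigma>) < \<infinity>"
  shows "AE \<omega> in \<sigma>. (\<integral>\<^sup>+v. indicator {0<..<1} v * cap_nn v f \<omega> \<partial>lborel) < \<infinity>"
proof -
  interpret zl: pair_sigma_finite "lborel :: real measure" "perp_measure (0::real^'n)" ..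
  have "(\<integral>\<^sup>+\<omega>. \<integral>\<^sup>+v. indicator {0<..<1} v * cap_nn v f \<omega> \<partial>lborel \<partial>\<sigma>) = (\<integral>\<^sup>+v. \<integral>\<^sup>+\<omega>. indicator {0<..<1} v * cap_nn v f \<omega> \<partial>\<sigma> \<partial>lborel)"
    by (rule zl.Fubini') measurable
  also have "\<dots> = (\<integral>\<^sup>+v. indicator {0<..<1} (v::real) * (\<integral>\<^sup>+x. f x \<partial>\<sigma>) \<partial>lborel)"
  proof (rule nn_integral_cong)
    fix v :: real
    have "(\<integral>\<^sup>+\<omega>. indicator {0<..<1} v * cap_nn v f \<omega> \<partial>\<sigma>) = indicator {0<..<1} v * (\<integral>\<^sup>+\<omega>. cap_nn v f \<omega> \<partial>\<sigma>)"
      by (rule nn_integral_cmult) measurable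
    then show "(\<integral>\<^sup>+\<omega>. indicator {0<..<1} v * cap_nn v f \<omega> \<partial>\<sigma>) = indicator {0<..<1} v * (\<integral>\<^sup>+x. f x \<partial>\<sigma>)"
      by (cases "v \<in> {0<..<1}") (auto simp: nn_integral_cap_nn)
  qed
  also have "\<dots> = (\<integral>\<^sup>+x. f x \<partial>\<sigma>)" by (simp add: nn_integral_multc)
  finally have "(\<integral>\<^sup>+\<omega>. \<integral>\<^sup>+v. indicator {0<..<1} v * cap_nn v f \<omega> \<partial>lborel \<partial>\<sigma>) \<noteq> \<infinity>" using fin by simp
  from nn_integral_PInf_AE[OF _ this] show ?thesis by (simp add: less_top)
qed

text \<open>The set \<open>B\<close> need not be measurable: the intersection of the enclosing Borel
  sets is a null set.\<close>

lemma borel_subset_null: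
  assumes "\<And>k::nat. \<exists>E\<in>sets borel. B \<subseteq> E \<and> emeasure \<sigma> E \<le> ennreal (1 / real (Suc k))"
  shows "AE \<omega> in \<sigma>. \<omega> \<notin> B"
proof -
  obtain E where E: "\<And>k. E k \<in> sets borel" "\<And>k. B \<subseteq> E k" "\<And>k::nat. emeasure \<sigma> (E k) \<le> ennreal (1 / real (Suc k))"
    using assms by metis
  have "emeasure \<sigma> (\<Inter>k. E k) \<le> 0"
  proof (rule ennreal_le_epsilon)
    fix e :: real assume "e > 0"
    then obtain k :: nat where k: "1 / real (Suc k) < e" using nat_approx_posE by blast
    have "emeasure \<sigma> (\<Inter>k. E k) \<le> emeasure \<sigma> (E k)" using E(1) by (intro emeasure_mono) auto
    also have "\<dots> \<le> ennreal (1 / real (Suc k))" by (rule E(3))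
    also have "\<dots> \<le> ennreal e" using k by (intro ennreal_leI) simp
    finally show "emeasure \<sigma> (\<Inter>k. E k) \<le> 0 + ennreal e" by simp
  qed
  moreover have "(\<Inter>k. E k) \<in> sets borel" using E(1) by (intro sets.countable_INT) auto
  ultimately have "(\<Inter>k. E k) \<in> null_sets \<sigma>" by (auto simp: null_sets_def)
  from AE_not_in[OF this] show ?thesis by eventually_elim (use E(2) in blast)
qed

text \<open>The classical proof of Lebesgue differentiation with the level \<open>t\<close> fixed
  and the exceptional set in \<omega>: \<open>f\<close> is approximated by a continuous
  \<open>g\<close>, whose means vary little, and the remainder is small in mean outside
  \<open>E1\<close>, by the maximal inequality, and small at the level \<open>t\<close> itself
  outside \<open>E2\<close>, by Chebyshev.\<close>

lemma AE_cap_lebesgue_point: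
  fixes f :: "real^'n \<Rightarrow> real"
  assumes f[measurable]: "f \<in> borel_measurable borel" and int: "integrable \<sigma> f" and t: "0 < t" "t < 1"
  shows "AE \<omega> in \<sigma>. \<forall>m::nat. \<exists>d>0. \<forall>h. 0 < h \<and> h < d \<longrightarrow>
    (\<integral>\<^sup>+v. indicator {t - h<..<t + h} v * ennreal \<bar>cap_mean v f \<omega> - cap_mean t f \<omega>\<bar> \<partial>lborel) \<le> ennreal (h / real (Suc m))"
proof -
  have fin: "(\<integral>\<^sup>+x. ennreal \<bar>f x\<bar> \<partial>\<sigma>) < \<infinity>" using int by (auto simp: integrable_iff_bounded)
  have t1: "\<bar>t\<bar> \<le> 1" using t by auto
  define good where "good \<omega> \<longleftrightarrow> norm \<omega> = 1 \<and> cap_nn t (\<lambda>x. ennreal \<bar>f x\<bar>) \<omega> < \<infinity> \<and>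
    (\<integral>\<^sup>+v. indicator {0<..<1} v * cap_nn v (\<lambda>x. ennreal \<bar>f x\<bar>) \<omega> \<partial>lborel) < \<infinity>" for \<omega>
  have AE_good: "AE \<omega> in \<sigma>. good \<omega>"
    using zero.AE_perp AE_cap_nn_finite[OF t1 _ fin] AE_cap_nn_integral_finite[OF _ fin]
    by (auto simp: good_def)
  obtain C h0 where C: "C > 0" "h0 > 0" and max:
    "\<And>b l. b \<in> borel_measurable borel \<Longrightarrow> l > 0 \<Longrightarrow>
      \<exists>E\<in>sets borel. {\<omega>::real^'n. norm \<omega> = 1 \<and> (\<exists>h. 0 < h \<and> h < h0 \<and> (\<integral>\<^sup>+v. indicator {t - h<..<t + h} v * cap_nn v b \<omega> \<partial>lborel) > ennreal (l * h))} \<subseteq> E \<and>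
        emeasure \<sigma> E \<le> ennreal (C / l) * (\<integral>\<^sup>+\<omega>. b \<omega> \<partial>\<sigma>)"
    by (rule maximal_inequality[OF t]) blast
  have "AE \<omega> in \<sigma>. \<omega> \<notin> {\<omega>. good \<omega> \<and> \<not> (\<exists>d>0. \<forall>h. 0 < h \<and> h < d \<longrightarrow>
    (\<integral>\<^sup>+v. indicator {t - h<..<t + h} v * ennreal \<bar>cap_mean v f \<omega> - cap_mean t f \<omega>\<bar> \<partial>lborel) \<le> ennreal (h / real (Suc m)))}" (is "AE \<omega> in \<sigma>. \<omega> \<notin> ?B") for m :: nat
  proof (rule borel_subset_null)
    fix k :: nat
    define \<epsilon> where "\<epsilon> = 1 / real (Suc m)"
    have \<epsilon>: "\<epsilon> > 0" by (simp add: \<epsilon>_def)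
    \<comment> \<open>The oscillation of the means of \<open>g\<close> and the mean of
      \<open>f - g\<close> at level \<open>t\<close>, each at most \<open>l\<close> on an interval
      of length \<open>2 * h\<close>, together with \<open>l * h\<close> from the maximal
      inequality, add up to \<open>5 * l * h\<close>, which is below
      \<open>\<epsilon> * h\<close>.\<close>
    define l where "l = \<epsilon> / 8"
    have l: "l > 0" using \<epsilon> by (simp add: l_def)
    \<comment> \<open>Chosen so that \<open>E1\<close> and \<open>E2\<close> together have measure
      at most \<open>1 / Suc k\<close>.\<close>
    define \<delta> where "\<delta> = 1 / real (Suc k) / (C / l + 1 / l)"
    have Cl: "C / l + 1 / l > 0" using C l by (intro add_pos_pos) auto
    have \<delta>: "\<delta> > 0" using Cl by (simp add: \<delta>_def)
    obtain g where g: "continuous_on UNIV g" "bounded (range g)" "(\<integral>\<^sup>+x. ennreal \<bar>f x - g x\<bar> \<partial>\<sigma>) < ennreal \<delta>"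
      using continuous_L1_dense[OF zero.perp.finite_measure_axioms zero.sets_perp int] \<delta> by blast
    have [measurable]: "g \<in> borel_measurable borel" using g(1) by (rule borel_measurable_continuous_onI)
    define b where "b x = ennreal \<bar>f x - g x\<bar>" for x
    have [measurable]: "b \<in> borel_measurable borel" unfolding b_def by measurable
    obtain E1 where E1: "E1 \<in> sets borel" "emeasure \<sigma> E1 \<le> ennreal (C / l) * (\<integral>\<^sup>+\<omega>. b \<omega> \<partial>\<sigma>)"
      "{\<omega>. norm \<omega> = 1 \<and> (\<exists>h. 0 < h \<and> h < h0 \<and> (\<integral>\<^sup>+v. indicator {t - h<..<t + h} v * cap_nn v b \<omega> \<partial>lborel) > ennreal (l * h))} \<subseteq> E1"
      using max[OF \<open>b \<in> _\<close> l] by blast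
    define E2 where "E2 = {\<omega>. ennreal l \<le> cap_nn t b \<omega>}"
    have E2: "E2 \<in> sets borel" unfolding E2_def by measurable
    have E2m: "emeasure \<sigma> E2 \<le> ennreal (1 / l) * (\<integral>\<^sup>+\<omega>. b \<omega> \<partial>\<sigma>)"
    proof -
      have "emeasure \<sigma> E2 = (\<integral>\<^sup>+\<omega>. indicator E2 \<omega> \<partial>\<sigma>)" using E2 by simp
      also have "\<dots> \<le> (\<integral>\<^sup>+\<omega>. ennreal (1 / l) * cap_nn t b \<omega> \<partial>\<sigma>)"
      proof (rule nn_integral_mono)
        fix \<omega>
        show "indicator E2 \<omega> \<le> ennreal (1 / l) * cap_nn t b \<omega>"
        proof (cases "\<omega> \<in> E2")
          case True
          have "1 = ennreal (1 / l) * ennreal l" using l by (simp add: ennreal_mult[symmetric])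
          also have "\<dots> \<le> ennreal (1 / l) * cap_nn t b \<omega>" using True by (intro mult_left_mono) (auto simp: E2_def)
          finally show ?thesis using True by simp
        qed simp
      qed
      also have "\<dots> = ennreal (1 / l) * (\<integral>\<^sup>+\<omega>. cap_nn t b \<omega> \<partial>\<sigma>)" by (rule nn_integral_cmult) measurable
      finally show ?thesis using nn_integral_cap_nn[OF t1, of b] by simp
    qed
    have "emeasure \<sigma> (E1 \<union> E2) \<le> ennreal (C / l) * (\<integral>\<^sup>+\<omega>. b \<omega> \<partial>\<sigma>) + ennreal (1 / l) * (\<integral>\<^sup>+\<omega>. b \<omega> \<partial>\<sigma>)"
      using E1 E2 E2m by (intro order_trans[OF emeasure_subadditive] add_mono) auto
    also have "\<dots> = ennreal (C / l + 1 / l) * (\<integral>\<^sup>+\<omega>. b \<omega> \<partial>\<sigma>)"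
      using C l by (subst ennreal_plus) (auto simp: distrib_right)
    also have "\<dots> \<le> ennreal (C / l + 1 / l) * ennreal \<delta>" using g(3) by (intro mult_left_mono) (auto simp: b_def)
    also have "\<dots> = ennreal (1 / real (Suc k))"
      using Cl \<delta> by (subst ennreal_mult[symmetric]) (simp_all add: \<delta>_def del: of_nat_Suc)
    finally have small: "emeasure \<sigma> (E1 \<union> E2) \<le> ennreal (1 / real (Suc k))" .
    have "?B \<subseteq> E1 \<union> E2"
    proof
      fix \<omega> assume B: "\<omega> \<in> ?B"
      then have G: "good \<omega>" and nd: "\<not> (\<exists>d>0. \<forall>h. 0 < h \<and> h < d \<longrightarrow>
        (\<integral>\<^sup>+v. indicator {t - h<..<t + h} v * ennreal \<bar>cap_mean v f \<omega> - cap_mean t f \<omega>\<bar> \<partial>lborel) \<le> ennreal (h / real (Suc m)))" by auto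
      have \<omega>: "norm \<omega> = 1" using G by (simp add: good_def)
      show "\<omega> \<in> E1 \<union> E2"
      proof (rule ccontr)
        assume nE: "\<omega> \<notin> E1 \<union> E2"
        obtain d0 where d0: "d0 > 0" "\<And>u \<omega>. \<bar>u\<bar> \<le> 1 \<Longrightarrow> \<bar>u - t\<bar> < d0 \<Longrightarrow> norm \<omega> = 1 \<Longrightarrow> \<bar>cap_mean u g \<omega> - cap_mean t g \<omega>\<bar> \<le> l"
          by (rule cap_mean_uniformly_continuous[OF g(1,2) t1 l]) blast
        define d where "d = min (min d0 h0) (min t (1 - t))"
        have d: "d > 0" "d \<le> d0" "d \<le> h0" "d \<le> t" "d \<le> 1 - t" using d0 C t by (auto simp: d_def)
        have "(\<integral>\<^sup>+v. indicator {t - h<..<t + h} v * ennreal \<bar>cap_mean v f \<omega> - cap_mean t f \<omega>\<bar> \<partial>lborel) \<le> ennreal (h / real (Suc m))"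
          if h: "0 < h" "h < d" for h
        proof -
          have split: "cap_mean v f \<omega> = cap_mean v g \<omega> + cap_mean v (\<lambda>x. f x - g x) \<omega>" if "cap_nn v (\<lambda>x. ennreal \<bar>f x\<bar>) \<omega> < \<infinity>" for v
            by (rule cap_mean_split[OF _ _ that g(2)]) measurable
          have bt: "ennreal \<bar>cap_mean t (\<lambda>x. f x - g x) \<omega>\<bar> \<le> ennreal l"
            using cap_mean_le_nn[of "\<lambda>x. f x - g x" t \<omega>] nE by (auto simp: E2_def b_def[symmetric])
          have aev: "AE v in lborel. v \<in> {0<..<1} \<longrightarrow> cap_nn v (\<lambda>x. ennreal \<bar>f x\<bar>) \<omega> < \<infinity>"
          proof -
            have "AE v in lborel. indicator {0<..<1} v * cap_nn v (\<lambda>x. ennreal \<bar>f x\<bar>) \<omega> \<noteq> \<infinity>"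
              using G by (intro nn_integral_PInf_AE) (auto simp: good_def)
            then show ?thesis by eventually_elim (auto simp: less_top)
          qed
          have "(\<integral>\<^sup>+v. indicator {t - h<..<t + h} v * ennreal \<bar>cap_mean v f \<omega> - cap_mean t f \<omega>\<bar> \<partial>lborel) \<le>
            (\<integral>\<^sup>+v. ennreal (2 * l) * indicator {t - h<..<t + h} v + indicator {t - h<..<t + h} v * cap_nn v b \<omega> \<partial>lborel)"
          proof (rule nn_integral_mono_AE, use aev in eventually_elim)
            fix v assume v: "v \<in> {0<..<1} \<longrightarrow> cap_nn v (\<lambda>x. ennreal \<bar>f x\<bar>) \<omega> < \<infinity>"
            show "indicator {t - h<..<t + h} v * ennreal \<bar>cap_mean v f \<omega> - cap_mean t f \<omega>\<bar> \<le>
              ennreal (2 * l) * indicator {t - h<..<t + h} v + indicator {t - h<..<t + h} v * cap_nn v b \<omega>"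
            proof (cases "v \<in> {t - h<..<t + h}")
              case True
              then have v01: "v \<in> {0<..<1}" "\<bar>v\<bar> \<le> 1" "\<bar>v - t\<bar> < d0" using h d by auto
              have eq: "cap_mean v f \<omega> - cap_mean t f \<omega> = (cap_mean v g \<omega> - cap_mean t g \<omega>) + cap_mean v (\<lambda>x. f x - g x) \<omega> - cap_mean t (\<lambda>x. f x - g x) \<omega>"
                using split[of v] split[of t] v v01(1) G by (simp add: good_def)
              have "\<bar>cap_mean t (\<lambda>x. f x - g x) \<omega>\<bar> \<le> l" using bt l by (simp add: ennreal_le_iff)
              then have "\<bar>cap_mean v f \<omega> - cap_mean t f \<omega>\<bar> \<le> 2 * l + \<bar>cap_mean v (\<lambda>x. f x - g x) \<omega>\<bar>"
                unfolding eq using d0(2)[OF v01(2,3) \<omega>] by linarith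
              then have "ennreal \<bar>cap_mean v f \<omega> - cap_mean t f \<omega>\<bar> \<le> ennreal (2 * l + \<bar>cap_mean v (\<lambda>x. f x - g x) \<omega>\<bar>)" by (rule ennreal_leI)
              also have "\<dots> = ennreal (2 * l) + ennreal \<bar>cap_mean v (\<lambda>x. f x - g x) \<omega>\<bar>" using l by (intro ennreal_plus) auto
              also have "\<dots> \<le> ennreal (2 * l) + cap_nn v b \<omega>"
                using cap_mean_le_nn[of "\<lambda>x. f x - g x" v \<omega>] by (intro add_left_mono) (simp add: b_def[abs_def])
              finally show ?thesis using True by simp
            qed simp
          qed
          also have "\<dots> = ennreal (2 * l) * ennreal (2 * h) + (\<integral>\<^sup>+v. indicator {t - h<..<t + h} v * cap_nn v b \<omega> \<partial>lborel)"
            using h by (subst nn_integral_add) (auto simp: nn_integral_cmult_indicator)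
          also have "\<dots> \<le> ennreal (2 * l) * ennreal (2 * h) + ennreal (l * h)"
          proof (rule add_left_mono)
            have "h < h0" using h d by simp
            then have "\<not> ennreal (l * h) < (\<integral>\<^sup>+v. indicator {t - h<..<t + h} v * cap_nn v b \<omega> \<partial>lborel)"
              using nE E1(3) \<omega> h(1) by blast
            then show "(\<integral>\<^sup>+v. indicator {t - h<..<t + h} v * cap_nn v b \<omega> \<partial>lborel) \<le> ennreal (l * h)" by (simp add: not_less)
          qed
          also have "\<dots> = ennreal (5 * (l * h))" using l h by (simp add: ennreal_mult[symmetric] ennreal_plus[symmetric] del: ennreal_plus)
          also have "\<dots> \<le> ennreal (h / real (Suc m))"
            using h \<epsilon> by (intro ennreal_leI) (simp add: l_def \<epsilon>_def field_simps del: of_nat_Suc)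
          finally show ?thesis .
        qed
        then show False using nd d(1) by blast
      qed
    qed
    then show "\<exists>E\<in>sets borel. ?B \<subseteq> E \<and> emeasure \<sigma> E \<le> ennreal (1 / real (Suc k))"
      using small E1(1) E2 by (intro bexI[of _ "E1 \<union> E2"]) auto
  qed
  then have "AE \<omega> in \<sigma>. \<forall>m. \<omega> \<notin> {\<omega>. good \<omega> \<and> \<not> (\<exists>d>0. \<forall>h. 0 < h \<and> h < d \<longrightarrow>
    (\<integral>\<^sup>+v. indicator {t - h<..<t + h} v * ennreal \<bar>cap_mean v f \<omega> - cap_mean t f \<omega>\<bar> \<partial>lborel) \<le> ennreal (h / real (Suc m)))}"
    by (subst AE_all_countable) simp
  then show ?thesis using AE_good by eventually_elim blast
qed

lemma integrable_cap_mean_unit_interval: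
  fixes \<omega> :: "real^'n"
  assumes [measurable]: "f \<in> borel_measurable borel"
    and fin: "(\<integral>\<^sup>+v. indicator {0<..<1} v * cap_nn v (\<lambda>x. ennreal \<bar>f x\<bar>) \<omega> \<partial>lborel) < \<infinity>"
  shows "integrable lborel (\<lambda>v. indicator {0<..<1} v * cap_mean v f \<omega>)"
proof (rule integrableI_bounded)
  have "(\<integral>\<^sup>+v. ennreal (norm (indicator {0<..<1} v * cap_mean v f \<omega>)) \<partial>lborel) \<le> (\<integral>\<^sup>+v. indicator {0<..<1} v * cap_nn v (\<lambda>x. ennreal \<bar>f x\<bar>) \<omega> \<partial>lborel)"
    using cap_mean_le_nn[of f _ \<omega>] by (intro nn_integral_mono) (auto simp: indicator_def)
  then show "(\<integral>\<^sup>+v. ennreal (norm (indicator {0<..<1} v * cap_mean v f \<omega>)) \<partial>lborel) < \<infinity>"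
    using fin by (rule le_less_trans)
qed measurable

text \<open>The null set of directions depends on \<open>t\<close>, but no \<open>t\<close> in (0,
  1) has to be discarded; a limit along all \<open>t\<close> near 1 requires this order of
  quantifiers.\<close>

lemma AE_cap_mean_primitive:
  fixes f :: "real^'n \<Rightarrow> real"
  assumes f[measurable]: "f \<in> borel_measurable borel" and int: "integrable \<sigma> f" and t: "0 < t" "t < 1"
  shows "AE \<omega> in \<sigma>. (primitive (\<lambda>v. cap_mean v f \<omega>) has_real_derivative cap_mean t f \<omega>) (at t)"
proof -
  have fin: "(\<integral>\<^sup>+x. ennreal \<bar>f x\<bar> \<partial>\<sigma>) < \<infinity>" using int by (auto simp: integrable_iff_bounded)
  have "AE \<omega> in \<sigma>. (\<integral>\<^sup>+v. indicator {0<..<1} v * cap_nn v (\<lambda>x. ennreal \<bar>f x\<bar>) \<omega> \<partial>lborel) < \<infinity>"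
    by (rule AE_cap_nn_integral_finite[OF _ fin]) measurable
  with AE_cap_lebesgue_point[OF f int t] show ?thesis
  proof eventually_elim
    fix \<omega> assume L: "\<forall>m::nat. \<exists>d>0. \<forall>h. 0 < h \<and> h < d \<longrightarrow>
      (\<integral>\<^sup>+v. indicator {t - h<..<t + h} v * ennreal \<bar>cap_mean v f \<omega> - cap_mean t f \<omega>\<bar> \<partial>lborel) \<le> ennreal (h / real (Suc m))"
      and F: "(\<integral>\<^sup>+v. indicator {0<..<1} v * cap_nn v (\<lambda>x. ennreal \<bar>f x\<bar>) \<omega> \<partial>lborel) < \<infinity>"
    show "(primitive (\<lambda>v. cap_mean v f \<omega>) has_real_derivative cap_mean t f \<omega>) (at t)"
      by (rule lebesgue_point_has_derivative[OF integrable_cap_mean_unit_interval[OF f F] _ t]) (measurable, use L in blast)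
  qed
qed

text \<open>Means do not increase the norm, so replacing \<open>f\<close> by a continuous
  \<open>g\<close> costs at most \<delta> before and \<delta> after taking the mean. For
  \<open>g\<close> the means tend uniformly to the mean at level 1, which is evaluation.\<close>

lemma cap_mean_L1_limit:
  fixes f :: "real^'n \<Rightarrow> real"
  assumes f[measurable]: "f \<in> borel_measurable borel" and int: "integrable \<sigma> f"
  shows "((\<lambda>t. \<integral>\<^sup>+\<omega>. ennreal \<bar>cap_mean t f \<omega> - f \<omega>\<bar> \<partial>\<sigma>) \<longlongrightarrow> 0) (at_left 1)"
proof (rule tendsto_0_if_eventually_le)
  fix e :: real assume e: "e > 0"
  have fin: "(\<integral>\<^sup>+x. ennreal \<bar>f x\<bar> \<partial>\<sigma>) < \<infinity>" using int by (auto simp: integrable_iff_bounded)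
  define \<delta> where "\<delta> = e / 3"
  have \<delta>: "\<delta> > 0" using e by (simp add: \<delta>_def)
  obtain g where g: "continuous_on UNIV g" "bounded (range g)" "(\<integral>\<^sup>+x. ennreal \<bar>f x - g x\<bar> \<partial>\<sigma>) < ennreal \<delta>"
    using continuous_L1_dense[OF zero.perp.finite_measure_axioms zero.sets_perp int] \<delta> by blast
  have [measurable]: "g \<in> borel_measurable borel" using g(1) by (rule borel_measurable_continuous_onI)
  obtain d where d: "d > 0" "\<And>u \<omega>. \<bar>u\<bar> \<le> 1 \<Longrightarrow> \<bar>u - 1\<bar> < d \<Longrightarrow> norm \<omega> = 1 \<Longrightarrow> \<bar>cap_mean u g \<omega> - cap_mean 1 g \<omega>\<bar> \<le> \<delta>"
    by (rule cap_mean_uniformly_continuous[OF g(1,2) _ \<delta>, of 1]) auto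
  have one: "cap_mean 1 g \<omega> = g \<omega>" for \<omega> :: "real^'n"
    using base.perp.prob_space by (simp add: cap_mean_def cap_point_def)
  have "\<forall>\<^sub>F t in at_left 1. t \<in> {max 0 (1 - d)<..<1}"
    using d(1) by (intro eventually_at_leftI[of "max 0 (1 - d)"]) auto
  then show "\<forall>\<^sub>F t in at_left 1. (\<integral>\<^sup>+\<omega>. ennreal \<bar>cap_mean t f \<omega> - f \<omega>\<bar> \<partial>\<sigma>) \<le> ennreal e"
  proof eventually_elim
    fix t assume t: "t \<in> {max 0 (1 - d)<..<1}"
    then have t1: "\<bar>t\<bar> \<le> 1" "\<bar>t - 1\<bar> < d" by auto
    have aeF: "AE \<omega> in \<sigma>. cap_nn t (\<lambda>x. ennreal \<bar>f x\<bar>) \<omega> < \<infinity>" by (rule AE_cap_nn_finite[OF t1(1) _ fin]) measurable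
    have "(\<integral>\<^sup>+\<omega>. ennreal \<bar>cap_mean t f \<omega> - f \<omega>\<bar> \<partial>\<sigma>) \<le> (\<integral>\<^sup>+\<omega>. (cap_nn t (\<lambda>x. ennreal \<bar>f x - g x\<bar>) \<omega> + ennreal \<bar>f \<omega> - g \<omega>\<bar>) + ennreal \<delta> \<partial>\<sigma>)"
    proof (rule nn_integral_mono_AE, use aeF zero.AE_perp in eventually_elim)
      fix \<omega> :: "real^'n" assume F: "cap_nn t (\<lambda>x. ennreal \<bar>f x\<bar>) \<omega> < \<infinity>" and \<omega>: "norm \<omega> = 1 \<and> \<omega> \<bullet> 0 = 0"
      have "cap_mean t f \<omega> = cap_mean t g \<omega> + cap_mean t (\<lambda>x. f x - g x) \<omega>"
        by (rule cap_mean_split[OF _ _ F g(2)]) measurable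
      then have "\<bar>cap_mean t f \<omega> - f \<omega>\<bar> \<le> (\<bar>cap_mean t (\<lambda>x. f x - g x) \<omega>\<bar> + \<bar>f \<omega> - g \<omega>\<bar>) + \<delta>"
        using d(2)[OF t1, of \<omega>] \<omega> unfolding one by linarith
      then have "ennreal \<bar>cap_mean t f \<omega> - f \<omega>\<bar> \<le> ennreal ((\<bar>cap_mean t (\<lambda>x. f x - g x) \<omega>\<bar> + \<bar>f \<omega> - g \<omega>\<bar>) + \<delta>)" by (rule ennreal_leI)
      also have "\<dots> = (ennreal \<bar>cap_mean t (\<lambda>x. f x - g x) \<omega>\<bar> + ennreal \<bar>f \<omega> - g \<omega>\<bar>) + ennreal \<delta>"
        using \<delta> by (simp add: ennreal_plus)
      also have "\<dots> \<le> (cap_nn t (\<lambda>x. ennreal \<bar>f x - g x\<bar>) \<omega> + ennreal \<bar>f \<omega> - g \<omega>\<bar>) + ennreal \<delta>"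
        by (intro add_right_mono cap_mean_le_nn) measurable
      finally show "ennreal \<bar>cap_mean t f \<omega> - f \<omega>\<bar> \<le> (cap_nn t (\<lambda>x. ennreal \<bar>f x - g x\<bar>) \<omega> + ennreal \<bar>f \<omega> - g \<omega>\<bar>) + ennreal \<delta>" .
    qed
    also have "\<dots> = ((\<integral>\<^sup>+\<omega>. cap_nn t (\<lambda>x. ennreal \<bar>f x - g x\<bar>) \<omega> \<partial>\<sigma>) + (\<integral>\<^sup>+\<omega>. ennreal \<bar>f \<omega> - g \<omega>\<bar> \<partial>\<sigma>)) + ennreal \<delta>"
      using zero.perp.emeasure_space_1 by (simp add: nn_integral_add)
    also have "\<dots> = ((\<integral>\<^sup>+\<omega>. ennreal \<bar>f \<omega> - g \<omega>\<bar> \<partial>\<sigma>) + (\<integral>\<^sup>+\<omega>. ennreal \<bar>f \<omega> - g \<omega>\<bar> \<partial>\<sigma>)) + ennreal \<delta>"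
      by (subst nn_integral_cap_nn[OF t1(1)]) auto
    also have "\<dots> \<le> (ennreal \<delta> + ennreal \<delta>) + ennreal \<delta>" using g(3) by (intro add_mono) auto
    also have "\<dots> = ennreal e" using \<delta> by (simp add: \<delta>_def ennreal_plus[symmetric] del: ennreal_plus)
    finally show "(\<integral>\<^sup>+\<omega>. ennreal \<bar>cap_mean t f \<omega> - f \<omega>\<bar> \<partial>\<sigma>) \<le> ennreal e" .
  qed
qed

end

declare One_nat_def [simp del]

section \<open>Completed measures and Borel measures\<close>

lemma AE_completion_restrict_iff:
  assumes "X \<in> sets M" "space M = UNIV"
  shows "(AE x in completion (restrict_space M X). P x) \<longleftrightarrow> (AE x in M. x \<in> X \<longrightarrow> P x)"
  using assms by (simp add: AE_completion_iff AE_restrict_space_iff)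

text \<open>The definitions integrate functions controlled only on \<open>X\<close> and up to null
  sets, over a completed measure on \<open>X\<close>. Each such integral is exchanged for that of a
  Borel function over the full space.\<close>

lemma completion_restrict_transfer:
  fixes f g :: "'a::topological_space \<Rightarrow> real"
  assumes sM[measurable_cong]: "sets M = sets borel" and X[measurable]: "X \<in> sets borel" and AE_X: "AE x in M. x \<in> X"
    and g[measurable]: "g \<in> borel_measurable borel" and fg: "AE x in M. x \<in> X \<longrightarrow> f x = g x"
  shows "integral\<^sup>L (completion (restrict_space M X)) f = integral\<^sup>L M g"
    and "integrable M g \<Longrightarrow> integrable (completion (restrict_space M X)) f"
proof -
  have spM: "space M = UNIV" using sets_eq_imp_space_eq[OF sM] by simp
  have XM: "X \<inter> space M \<in> sets M" using X sM spM by simp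
  have gm: "g \<in> borel_measurable (restrict_space M X)" by (rule measurable_restrict_space1) measurable
  have ae: "AE x in completion (restrict_space M X). g x = f x"
    using fg X by (subst AE_completion_restrict_iff) (auto simp: sM spM elim: eventually_mono)
  have "integral\<^sup>L (completion (restrict_space M X)) f = integral\<^sup>L (completion (restrict_space M X)) g"
    by (rule integral_completion_cong_AE[OF ae, symmetric])
  also have "\<dots> = integral\<^sup>L (restrict_space M X) g" by (rule integral_completion[OF gm])
  also have "\<dots> = (\<integral>x. indicator X x *\<^sub>R g x \<partial>M)" by (rule integral_restrict_space[OF XM])
  also have "\<dots> = integral\<^sup>L M g"
    using AE_X by (intro integral_cong_AE) (auto elim: eventually_mono)
  finally show "integral\<^sup>L (completion (restrict_space M X)) f = integral\<^sup>L M g" .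
  assume "integrable M g"
  then have "integrable M (\<lambda>x. indicator X x *\<^sub>R g x)" by (intro integrable_mult_indicator) auto
  then have "integrable (restrict_space M X) g" by (subst integrable_restrict_space[OF XM])
  then have "integrable (completion (restrict_space M X)) g" by (subst integrable_completion[OF gm])
  then show "integrable (completion (restrict_space M X)) f" by (rule integrable_completion_cong_AE[OF ae])
qed

text \<open>In \<open>locally_integrable\<close> the first factor of the product is itself a
  completion. Splitting a completed measurable set into its main part and its null part shows that
  this enlarges the product only by sets which the completion of the plain product already contains,
  with the same measure on rectangles.\<close>

lemma distr_completion_pair:
  assumes A: "prob_space A" and B: "sigma_finite_measure B"
  shows "(\<lambda>x. x) \<in> measurable (completion (A \<Otimes>\<^sub>M B)) (completion A \<Otimes>\<^sub>M B)"
    and "distr (completion (A \<Otimes>\<^sub>M B)) (completion A \<Otimes>\<^sub>M B) (\<lambda>x. x) = completion A \<Otimes>\<^sub>M B"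
proof -
  interpret A: prob_space A by fact
  interpret B: sigma_finite_measure B by fact
  interpret cA: sigma_finite_measure "completion A"
    by (intro prob_space_imp_sigma_finite prob_spaceI) (simp add: A.emeasure_space_1)
  have rect: "E \<times> F \<in> sets (completion (A \<Otimes>\<^sub>M B)) \<and> emeasure (completion (A \<Otimes>\<^sub>M B)) (E \<times> F) = emeasure (completion A) E * emeasure B F"
    if E: "E \<in> sets (completion A)" and F: "F \<in> sets B" for E F
  proof -
    define E1 E2 where "E1 = main_part A E" and "E2 = null_part A E"
    have E1: "E1 \<in> sets A" using E by (simp add: E1_def)
    obtain N where N: "N \<in> null_sets A" "E2 \<subseteq> N" using null_part[OF E] unfolding E2_def by blast
    have EE: "E = E1 \<union> E2" using E by (simp add: E1_def E2_def main_part_null_part_Un)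
    have NF: "N \<times> F \<in> null_sets (A \<Otimes>\<^sub>M B)"
      using N F by (auto simp: null_sets_def B.emeasure_pair_measure_Times)
    have 1: "E1 \<times> F \<in> sets (A \<Otimes>\<^sub>M B)" using E1 F by auto
    have 2: "E2 \<times> F \<in> null_sets (completion (A \<Otimes>\<^sub>M B))"
      using N(2) by (intro null_sets_completion_subset[OF _ null_sets_completionI[OF NF]]) auto
    have eq: "E \<times> F = (E1 \<times> F) \<union> (E2 \<times> F)" by (subst EE) auto
    have "emeasure (completion (A \<Otimes>\<^sub>M B)) (E \<times> F) = emeasure (completion (A \<Otimes>\<^sub>M B)) (E1 \<times> F)"
      unfolding eq using 1 2 by (intro emeasure_Un_null_set) auto
    also have "\<dots> = emeasure (A \<Otimes>\<^sub>M B) (E1 \<times> F)" using 1 by simp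
    also have "\<dots> = emeasure A E1 * emeasure B F" using E1 F by (rule B.emeasure_pair_measure_Times)
    also have "emeasure A E1 = emeasure (completion A) E" using E by (simp add: E1_def emeasure_completion)
    finally show ?thesis unfolding eq using 1 2 by auto
  qed
  show m: "(\<lambda>x. x) \<in> measurable (completion (A \<Otimes>\<^sub>M B)) (completion A \<Otimes>\<^sub>M B)"
  proof (rule measurable_pair_measureI)
    show "(\<lambda>x. x) \<in> space (completion (A \<Otimes>\<^sub>M B)) \<rightarrow> space (completion A) \<times> space B"
      by (simp add: space_pair_measure)
    fix E F assume E: "E \<in> sets (completion A)" and F: "F \<in> sets B"
    have "E \<times> F \<subseteq> space (A \<Otimes>\<^sub>M B)" using sets.sets_into_space[OF E] sets.sets_into_space[OF F] by (auto simp: space_pair_measure)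
    then have "(\<lambda>x. x) -` (E \<times> F) \<inter> space (completion (A \<Otimes>\<^sub>M B)) = E \<times> F" by auto
    then show "(\<lambda>x. x) -` (E \<times> F) \<inter> space (completion (A \<Otimes>\<^sub>M B)) \<in> sets (completion (A \<Otimes>\<^sub>M B))"
      using rect[OF E F] by simp
  qed
  show "distr (completion (A \<Otimes>\<^sub>M B)) (completion A \<Otimes>\<^sub>M B) (\<lambda>x. x) = completion A \<Otimes>\<^sub>M B"
  proof (rule pair_measure_eqI[OF cA.sigma_finite_measure_axioms B, symmetric])
    fix E F assume E: "E \<in> sets (completion A)" and F: "F \<in> sets B"
    have "E \<times> F \<subseteq> space (A \<Otimes>\<^sub>M B)" using sets.sets_into_space[OF E] sets.sets_into_space[OF F] by (auto simp: space_pair_measure)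
    then have "(\<lambda>x. x) -` (E \<times> F) \<inter> space (completion (A \<Otimes>\<^sub>M B)) = E \<times> F" by auto
    then have "emeasure (distr (completion (A \<Otimes>\<^sub>M B)) (completion A \<Otimes>\<^sub>M B) (\<lambda>x. x)) (E \<times> F) = emeasure (completion (A \<Otimes>\<^sub>M B)) (E \<times> F)"
      using E F by (subst emeasure_distr[OF m]) auto
    then show "emeasure (completion A) E * emeasure B F = emeasure (distr (completion (A \<Otimes>\<^sub>M B)) (completion A \<Otimes>\<^sub>M B) (\<lambda>x. x)) (E \<times> F)"
      using rect[OF E F] by simp
  qed simp
qed

lemma integrable_completion_pair:
  fixes f :: "'a \<times> 'b \<Rightarrow> real"
  assumes A: "prob_space A" and B: "sigma_finite_measure B"
    and f: "integrable (completion (completion A \<Otimes>\<^sub>M B)) f"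
  shows "integrable (completion (A \<Otimes>\<^sub>M B)) f"
proof -
  obtain g where g: "g \<in> borel_measurable (completion A \<Otimes>\<^sub>M B)" "AE x in completion A \<Otimes>\<^sub>M B. f x = g x"
    using completion_ex_borel_measurable_real[OF borel_measurable_integrable[OF f]] by blast
  have "integrable (completion (completion A \<Otimes>\<^sub>M B)) g"
    using g(2) by (intro integrable_completion_cong_AE[OF _ f]) (simp add: AE_completion_iff)
  then have "integrable (completion A \<Otimes>\<^sub>M B) g" by (subst (asm) integrable_completion[OF g(1)])
  then have "integrable (completion (A \<Otimes>\<^sub>M B)) g"
    using integrable_distr_eq[OF distr_completion_pair(1)[OF A B], of g] g(1)
    unfolding distr_completion_pair(2)[OF A B] by simp
  moreover have "AE x in completion (A \<Otimes>\<^sub>M B). g x = f x"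
  proof -
    have "AE x in distr (completion (A \<Otimes>\<^sub>M B)) (completion A \<Otimes>\<^sub>M B) (\<lambda>x. x). f x = g x"
      unfolding distr_completion_pair(2)[OF A B] by (rule g(2))
    from AE_distrD[OF distr_completion_pair(1)[OF A B] this] show ?thesis by eventually_elim simp
  qed
  ultimately show ?thesis by (rule integrable_completion_cong_AE[rotated])
qed

section \<open>Averages against the projection density as Erdelyi-Kober integrals\<close>

text \<open>Reflection gives the integrable case. Without integrability on the half line both sides
  take the default value 0, so no integrability hypothesis has to be carried along.\<close>

lemma integral_even_real:
  fixes k :: "real \<Rightarrow> real"
  assumes [measurable]: "k \<in> borel_measurable borel" and even: "\<And>v. k (- v) = k v"
  shows "(\<integral>v. k v \<partial>lborel) = 2 * (\<integral>v. indicator {0<..} v * k v \<partial>lborel)"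
proof -
  define h where "h v = indicator {0<..} v * k v" for v
  have [measurable]: "h \<in> borel_measurable borel" unfolding h_def[abs_def] by measurable
  have refl: "(\<integral>v. h (- v) \<partial>lborel) = (\<integral>v. h v \<partial>lborel)"
    using lborel_integral_real_affine[of "-1" h 0] by simp
  have ae: "AE v in lborel. k v = h v + h (- v)"
    using AE_lborel_singleton[of "0::real"] by eventually_elim (auto simp: h_def indicator_def even)
  show ?thesis
  proof (cases "integrable lborel h")
    case True
    then have "integrable lborel (\<lambda>v. h (- v))"
      using lborel_integrable_real_affine[of h "-1" 0] by simp
    have "(\<integral>v. k v \<partial>lborel) = (\<integral>v. h v + h (- v) \<partial>lborel)"
      using ae by (intro integral_cong_AE) auto
    also have "\<dots> = (\<integral>v. h v \<partial>lborel) + (\<integral>v. h (- v) \<partial>lborel)"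
      by (rule Bochner_Integration.integral_add) fact+
    finally have "(\<integral>v. k v \<partial>lborel) = 2 * (\<integral>v. h v \<partial>lborel)" unfolding refl by simp
    then show ?thesis by (simp only: h_def)
  next
    case False
    have "\<not> integrable lborel k"
    proof
      assume "integrable lborel k"
      then have "integrable lborel (\<lambda>v. indicator {0<..} v *\<^sub>R k v)" by (intro integrable_mult_indicator) auto
      then show False using False by (simp add: h_def[abs_def])
    qed
    then show ?thesis using False by (simp add: not_integrable_integral_eq h_def[abs_def])
  qed
qed

lemma scaled_kernel:
  fixes s :: real
  assumes s: "s > 0" and v: "0 < v" "v < 1"
  shows "(s\<^sup>2 - (s * v)\<^sup>2) powr p = s powr (2 * p) * (1 - v\<^sup>2) powr p"
proof -
  have "(s\<^sup>2 - (s * v)\<^sup>2) powr p = (s powr 2 * (1 - v\<^sup>2)) powr p" using s by (simp add: powr_numeral power_mult_distrib algebra_simps)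
  also have "\<dots> = (s powr 2) powr p * (1 - v\<^sup>2) powr p"
    by (rule powr_mult)
  finally show ?thesis by (simp add: powr_powr)
qed

text \<open>The substitution t = s v gives the factor s^(n-3); the factor t in the Erdelyi-Kober
  kernel is compensated by dividing \<open>g\<close> by \<open>t\<close>. The Gamma factors of the
  projection constant and of the Erdelyi-Kober integral combine to the constant shown. The formula
  serves both the mean value of the dual Radon transform and the Funk bracket.\<close>

lemma integral_proj_density_scaled:
  fixes g :: "real \<Rightarrow> real"
  assumes n: "n \<ge> 3" and [measurable]: "g \<in> borel_measurable borel" and even: "\<And>v. g (- v) = g v" and s: "s > 0"
  shows "(\<integral>v. proj_density (n - 1) v * g (s * v) \<partial>lborel) =
    Gamma ((real n - 1) / 2) / sqrt pi / s ^ (n - 3) * EK_integral (real n / 2 - 1) (\<lambda>t. g t / t) s"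
proof -
  define p where "p = (real n - 4) / 2"
  define c where "c = proj_const (n - 1)"
  have rn: "real (n - 1) = real n - 1" "real (n - 3) = real n - 3" using n by (auto simp: of_nat_diff)
  have dens: "proj_density (n - 1) v = c * (1 - v\<^sup>2) powr p * indicator {-1<..<1} v" for v
  proof -
    have "(real (n - 1) - 3) / 2 = p" by (simp add: p_def rn)
    then show ?thesis unfolding proj_density_def c_def by simp
  qed
  have "(\<integral>v. proj_density (n - 1) v * g (s * v) \<partial>lborel) = 2 * (\<integral>v. indicator {0<..} v * (proj_density (n - 1) v * g (s * v)) \<partial>lborel)"
    by (rule integral_even_real) (auto simp: dens even indicator_def)
  also have "(\<integral>v. indicator {0<..} v * (proj_density (n - 1) v * g (s * v)) \<partial>lborel) = c * (\<integral>v. indicator {0<..<1} v * ((1 - v\<^sup>2) powr p * g (s * v)) \<partial>lborel)"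
    by (subst integral_mult_right_zero[symmetric]) (rule Bochner_Integration.integral_cong, auto simp: dens indicator_def)
  also have "(\<integral>v. indicator {0<..<1} v * ((1 - v\<^sup>2) powr p * g (s * v)) \<partial>lborel) =
    (\<integral>t. indicator {0<..<s} t * ((s\<^sup>2 - t\<^sup>2) powr p * g t) \<partial>lborel) / s ^ (n - 3)"
  proof -
    have "(\<integral>t. indicator {0<..<s} t * ((s\<^sup>2 - t\<^sup>2) powr p * g t) \<partial>lborel) = \<bar>s\<bar> *\<^sub>R (\<integral>v. indicator {0<..<s} (0 + s * v) * ((s\<^sup>2 - (0 + s * v)\<^sup>2) powr p * g (0 + s * v)) \<partial>lborel)"
      using s by (intro lborel_integral_real_affine) auto
    also have "(\<integral>v. indicator {0<..<s} (0 + s * v) * ((s\<^sup>2 - (0 + s * v)\<^sup>2) powr p * g (0 + s * v)) \<partial>lborel) =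
      (\<integral>v. s powr (2 * p) * (indicator {0<..<1} v * ((1 - v\<^sup>2) powr p * g (s * v))) \<partial>lborel)"
    proof (rule Bochner_Integration.integral_cong)
      fix v :: real
      show "indicator {0<..<s} (0 + s * v) * ((s\<^sup>2 - (0 + s * v)\<^sup>2) powr p * g (0 + s * v)) = s powr (2 * p) * (indicator {0<..<1} v * ((1 - v\<^sup>2) powr p * g (s * v)))"
        using s scaled_kernel[OF s, of v p] by (auto simp: indicator_def zero_less_mult_iff mult_less_cancel_left1)
    qed simp
    also have "\<bar>s\<bar> *\<^sub>R \<dots> = (s powr 1 * s powr (2 * p)) * (\<integral>v. indicator {0<..<1} v * ((1 - v\<^sup>2) powr p * g (s * v)) \<partial>lborel)"
      using s by simp
    also have "s powr 1 * s powr (2 * p) = s ^ (n - 3)"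
    proof -
      have "s powr 1 * s powr (2 * p) = s powr (1 + 2 * p)" by (simp only: powr_add)
      also have "1 + 2 * p = real (n - 3)" by (simp add: p_def rn field_simps)
      finally show ?thesis using s by (simp add: powr_realpow)
    qed
    finally show ?thesis using s by (simp add: field_simps)
  qed
  also have "(\<integral>t. indicator {0<..<s} t * ((s\<^sup>2 - t\<^sup>2) powr p * g t) \<partial>lborel) = Gamma (real n / 2 - 1) / 2 * EK_integral (real n / 2 - 1) (\<lambda>t. g t / t) s"
  proof -
    have "(\<integral>t. indicator {0<..<s} t * ((s\<^sup>2 - t\<^sup>2) powr p * g t) \<partial>lborel) = (\<integral>t. indicator {0<..<s} t * ((s\<^sup>2 - t\<^sup>2) powr (real n / 2 - 1 - 1) * (g t / t) * t) \<partial>lborel)"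
    proof (rule Bochner_Integration.integral_cong)
      fix t :: real
      have "real n / 2 - 1 - 1 = p" by (simp add: p_def field_simps)
      then show "indicator {0<..<s} t * ((s\<^sup>2 - t\<^sup>2) powr p * g t) = indicator {0<..<s} t * ((s\<^sup>2 - t\<^sup>2) powr (real n / 2 - 1 - 1) * (g t / t) * t)"
        by (auto simp: indicator_def)
    qed simp
    moreover have "Gamma (real n / 2 - 1) > 0" using n by (intro Gamma_real_pos) auto
    ultimately show ?thesis by (subst EK_integral_lborel) auto
  qed
  finally have *: "(\<integral>v. proj_density (n - 1) v * g (s * v) \<partial>lborel) = 2 * (c * (Gamma (real n / 2 - 1) / 2 * EK_integral (real n / 2 - 1) (\<lambda>t. g t / t) s / s ^ (n - 3)))" .
  have "Gamma (real n / 2 - 1) > 0" using n by (intro Gamma_real_pos) auto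
  moreover have "c = Gamma ((real n - 1) / 2) / (sqrt pi * Gamma (real n / 2 - 1))"
  proof -
    have "(real n - 1 - 1) / 2 = real n / 2 - 1" by (simp add: field_simps)
    then show ?thesis unfolding c_def proj_const_def rn by (simp only:)
  qed
  moreover define G where "G = Gamma (real n / 2 - 1)"
  ultimately have "G > 0" "c = Gamma ((real n - 1) / 2) / (sqrt pi * G)" by (simp_all only:)
  then show ?thesis unfolding * G_def[symmetric] using s by (simp add: divide_simps mult_ac)
qed

text \<open>For \<open>n = 3\<close> the density is unbounded and finiteness can only hold almost everywhere.\<close>

lemma proj_density_scaled_finite:
  fixes q :: "real \<Rightarrow> ennreal"
  assumes n: "n \<ge> 3" and [measurable]: "q \<in> borel_measurable borel" and even: "\<And>v. q (- v) = q v"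
    and fin: "(\<integral>\<^sup>+t. indicator {0<..<R} t * q t \<partial>lborel) < \<infinity>"
  shows "AE s in lborel. 0 < s \<and> s < R \<longrightarrow> (\<integral>\<^sup>+v. ennreal (proj_density (n - 1) v) * q (s * v) \<partial>lborel) < \<infinity>"
    and "n \<ge> 4 \<Longrightarrow> 0 < s \<Longrightarrow> s < R \<Longrightarrow> (\<integral>\<^sup>+v. ennreal (proj_density (n - 1) v) * q (s * v) \<partial>lborel) < \<infinity>"
proof -
  define p where "p = (real n - 4) / 2"
  define c where "c = proj_const (n - 1)"
  have rn: "real (n - 1) = real n - 1" using n by (auto simp: of_nat_diff)
  have c: "c > 0" unfolding c_def using n by (intro proj_const_pos) auto
  have dens: "proj_density (n - 1) v = c * (1 - v\<^sup>2) powr p * indicator {-1<..<1} v" for v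
  proof -
    have "(real (n - 1) - 3) / 2 = p" by (simp add: p_def rn)
    then show ?thesis unfolding proj_density_def c_def by simp
  qed
  define I where "I s = (\<integral>\<^sup>+t. indicator {0<..<s} t * (ennreal ((s\<^sup>2 - t\<^sup>2) powr p) * q t) \<partial>lborel)" for s
  have red: "(\<integral>\<^sup>+v. ennreal (proj_density (n - 1) v) * q (s * v) \<partial>lborel) < \<infinity>" if s: "0 < s" and I: "I s < \<infinity>" for s
  proof -
    define h where "h v = indicator {0<..<1} v * (ennreal ((1 - v\<^sup>2) powr p) * q (s * v))" for v :: real
    have [measurable]: "h \<in> borel_measurable borel" unfolding h_def[abs_def] by measurable
    have "I s = ennreal \<bar>s\<bar> * (\<integral>\<^sup>+v. indicator {0<..<s} (0 + s * v) * (ennreal ((s\<^sup>2 - (0 + s * v)\<^sup>2) powr p) * q (0 + s * v)) \<partial>lborel)"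
      unfolding I_def using s by (intro nn_integral_real_affine) auto
    also have "(\<integral>\<^sup>+v. indicator {0<..<s} (0 + s * v) * (ennreal ((s\<^sup>2 - (0 + s * v)\<^sup>2) powr p) * q (0 + s * v)) \<partial>lborel) = (\<integral>\<^sup>+v. ennreal (s powr (2 * p)) * h v \<partial>lborel)"
    proof (rule nn_integral_cong)
      fix v :: real
      show "indicator {0<..<s} (0 + s * v) * (ennreal ((s\<^sup>2 - (0 + s * v)\<^sup>2) powr p) * q (0 + s * v)) = ennreal (s powr (2 * p)) * h v"
        using s scaled_kernel[OF s, of v p]
        by (auto simp: h_def indicator_def zero_less_mult_iff mult_less_cancel_left1 ennreal_mult mult.assoc)
    qed
    also have "\<dots> = ennreal (s powr (2 * p)) * (\<integral>\<^sup>+v. h v \<partial>lborel)" by (rule nn_integral_cmult) measurable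
    finally have "(\<integral>\<^sup>+v. h v \<partial>lborel) \<noteq> \<infinity>" using I s by (auto simp: ennreal_mult_eq_top_iff ennreal_mult_top)
    moreover have "(\<integral>\<^sup>+v. h (- v) \<partial>lborel) = (\<integral>\<^sup>+v. h v \<partial>lborel)" using nn_integral_real_affine[of h "-1" 0] by simp
    moreover have "(\<integral>\<^sup>+v. ennreal (proj_density (n - 1) v) * q (s * v) \<partial>lborel) = (\<integral>\<^sup>+v. ennreal c * (h v + h (- v)) \<partial>lborel)"
    proof (rule nn_integral_cong_AE)
      show "AE v in lborel. ennreal (proj_density (n - 1) v) * q (s * v) = ennreal c * (h v + h (- v))"
        using AE_lborel_singleton[of "0::real"]
      proof eventually_elim
        fix v :: real assume "v \<noteq> 0"
        have "q (- (s * v)) = q (s * v)" by (rule even)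
        then show "ennreal (proj_density (n - 1) v) * q (s * v) = ennreal c * (h v + h (- v))"
          using \<open>v \<noteq> 0\<close> c by (auto simp: h_def dens indicator_def ennreal_mult mult.assoc)
      qed
    qed
    moreover have "(\<integral>\<^sup>+v. ennreal c * (h v + h (- v)) \<partial>lborel) = ennreal c * ((\<integral>\<^sup>+v. h v \<partial>lborel) + (\<integral>\<^sup>+v. h (- v) \<partial>lborel))"
      by (subst nn_integral_cmult, measurable, subst nn_integral_add) auto
    ultimately show ?thesis by (simp add: ennreal_mult_less_top less_top)
  qed
  have fin': "(\<integral>\<^sup>+t. indicator {0<..<R} t * q t \<partial>lborel) \<noteq> \<infinity>" using fin by simp
  show "(\<integral>\<^sup>+v. ennreal (proj_density (n - 1) v) * q (s * v) \<partial>lborel) < \<infinity>" if n4: "n \<ge> 4" and s: "0 < s" "s < R" for s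
  proof (rule red[OF s(1)])
    have "I s \<le> (\<integral>\<^sup>+t. ennreal ((s\<^sup>2) powr p) * (indicator {0<..<R} t * q t) \<partial>lborel)"
      unfolding I_def
    proof (rule nn_integral_mono)
      fix t :: real
      have "(s\<^sup>2 - t\<^sup>2) powr p \<le> (s\<^sup>2) powr p" if "0 < t" "t < s"
        using n4 that by (intro powr_mono2) (auto simp: p_def power_mono)
      then show "indicator {0<..<s} t * (ennreal ((s\<^sup>2 - t\<^sup>2) powr p) * q t) \<le> ennreal ((s\<^sup>2) powr p) * (indicator {0<..<R} t * q t)"
        using s by (auto simp: indicator_def intro!: mult_right_mono ennreal_leI)
    qed
    also have "\<dots> = ennreal ((s\<^sup>2) powr p) * (\<integral>\<^sup>+t. indicator {0<..<R} t * q t \<partial>lborel)" by (rule nn_integral_cmult) measurable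
    also have "\<dots> < \<infinity>" using fin by (simp add: ennreal_mult_less_top)
    finally show "I s < \<infinity>" .
  qed
  show "AE s in lborel. 0 < s \<and> s < R \<longrightarrow> (\<integral>\<^sup>+v. ennreal (proj_density (n - 1) v) * q (s * v) \<partial>lborel) < \<infinity>"
  proof (cases "R > 0")
    case R: True
    have p1: "p + 1 > 0" using n by (simp add: p_def field_simps)
    \<comment> \<open>Finiteness at almost every \<open>s\<close> follows from finiteness of the
      integral of \<open>s * I s\<close>. Its inner integral over \<open>s\<close> is the Beta
      kernel with first exponent 1, bounded because \<open>p + 1 > 0\<close>.\<close>
    define J where "J s = indicator {0<..<R} s * (ennreal s * I s)" for s
    have [measurable]: "I \<in> borel_measurable borel" unfolding I_def[abs_def] by measurable
    have "(\<integral>\<^sup>+s. J s \<partial>lborel) = (\<integral>\<^sup>+s. \<integral>\<^sup>+t. (indicator {0<..<R} s * ennreal s) * (indicator {0<..<s} t * (ennreal ((s\<^sup>2 - t\<^sup>2) powr p) * q t)) \<partial>lborel \<partial>lborel)"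
      unfolding J_def I_def by (intro nn_integral_cong) (simp add: nn_integral_cmult mult.assoc)
    also have "\<dots> = (\<integral>\<^sup>+t. \<integral>\<^sup>+s. (indicator {0<..<R} s * ennreal s) * (indicator {0<..<s} t * (ennreal ((s\<^sup>2 - t\<^sup>2) powr p) * q t)) \<partial>lborel \<partial>lborel)"
      by (rule lborel_pair.Fubini') measurable
    also have "\<dots> \<le> (\<integral>\<^sup>+t. ennreal (Beta 1 (p + 1) / 2 * (R\<^sup>2) powr (p + 1)) * (indicator {0<..<R} t * q t) \<partial>lborel)"
    proof (rule nn_integral_mono)
      fix t :: real
      show "(\<integral>\<^sup>+s. (indicator {0<..<R} s * ennreal s) * (indicator {0<..<s} t * (ennreal ((s\<^sup>2 - t\<^sup>2) powr p) * q t)) \<partial>lborel) \<le>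
        ennreal (Beta 1 (p + 1) / 2 * (R\<^sup>2) powr (p + 1)) * (indicator {0<..<R} t * q t)"
      proof (cases "0 < t \<and> t < R")
        case True
        have "(\<integral>\<^sup>+s. (indicator {0<..<R} s * ennreal s) * (indicator {0<..<s} t * (ennreal ((s\<^sup>2 - t\<^sup>2) powr p) * q t)) \<partial>lborel) =
          (\<integral>\<^sup>+s. ennreal (indicator {t<..<R} s * ((R\<^sup>2 - s\<^sup>2) powr (1 - 1) * (s\<^sup>2 - t\<^sup>2) powr (p + 1 - 1) * s)) * q t \<partial>lborel)"
        proof (rule nn_integral_cong)
          fix s :: real
          have "R\<^sup>2 \<noteq> s\<^sup>2" if "0 < s" "s < R" using power_strict_mono[of s R 2] that by simp
          then show "(indicator {0<..<R} s * ennreal s) * (indicator {0<..<s} t * (ennreal ((s\<^sup>2 - t\<^sup>2) powr p) * q t)) =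
            ennreal (indicator {t<..<R} s * ((R\<^sup>2 - s\<^sup>2) powr (1 - 1) * (s\<^sup>2 - t\<^sup>2) powr (p + 1 - 1) * s)) * q t"
            using True by (auto simp: indicator_def ennreal_mult mult_ac)
        qed
        also have "\<dots> = (\<integral>\<^sup>+s. ennreal (indicator {t<..<R} s * ((R\<^sup>2 - s\<^sup>2) powr (1 - 1) * (s\<^sup>2 - t\<^sup>2) powr (p + 1 - 1) * s)) \<partial>lborel) * q t"
          by (rule nn_integral_multc) measurable
        also have "\<dots> = ennreal (Beta 1 (p + 1) / 2 * (R\<^sup>2 - t\<^sup>2) powr (1 + (p + 1) - 1)) * q t"
          using True p1 by (subst nn_integral_Beta_kernel) auto
        also have "\<dots> \<le> ennreal (Beta 1 (p + 1) / 2 * (R\<^sup>2) powr (p + 1)) * q t"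
        proof (intro mult_right_mono ennreal_leI mult_left_mono)
          have "t\<^sup>2 \<le> R\<^sup>2" using True by (intro power_mono) auto
          then show "(R\<^sup>2 - t\<^sup>2) powr (1 + (p + 1) - 1) \<le> (R\<^sup>2) powr (p + 1)"
            using p1 True by (auto simp: add.commute intro!: powr_mono2)
          show "0 \<le> Beta 1 (p + 1) / 2" using p1 Gamma_real_pos[OF p1] Gamma_real_pos[of "1 + (p + 1)"] by (simp add: Beta_def)
        qed simp
        finally show ?thesis using True by simp
      next
        case False
        have "(\<integral>\<^sup>+s. (indicator {0<..<R} s * ennreal s) * (indicator {0<..<s} t * (ennreal ((s\<^sup>2 - t\<^sup>2) powr p) * q t)) \<partial>lborel) = (\<integral>\<^sup>+s. 0 * ennreal s \<partial>lborel)"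
          by (rule nn_integral_cong) (use False in \<open>auto simp: indicator_def\<close>)
        then show ?thesis by simp
      qed
    qed
    also have "\<dots> = ennreal (Beta 1 (p + 1) / 2 * (R\<^sup>2) powr (p + 1)) * (\<integral>\<^sup>+t. indicator {0<..<R} t * q t \<partial>lborel)" by (rule nn_integral_cmult) measurable
    also have "\<dots> < \<infinity>" using fin by (simp add: ennreal_mult_less_top)
    finally have "(\<integral>\<^sup>+s. J s \<partial>lborel) \<noteq> \<infinity>" by simp
    moreover have "J \<in> borel_measurable lborel" unfolding J_def[abs_def] by measurable
    ultimately have "AE s in lborel. J s \<noteq> \<infinity>" by (intro nn_integral_PInf_AE)
    then show ?thesis
    proof eventually_elim
      fix s assume J: "J s \<noteq> \<infinity>"
      show "0 < s \<and> s < R \<longrightarrow> (\<integral>\<^sup>+v. ennreal (proj_density (n - 1) v) * q (s * v) \<partial>lborel) < \<infinity>"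
      proof
        assume s: "0 < s \<and> s < R"
        then have "I s < \<infinity>" using J by (auto simp: J_def ennreal_mult_eq_top_iff less_top)
        then show "(\<integral>\<^sup>+v. ennreal (proj_density (n - 1) v) * q (s * v) \<partial>lborel) < \<infinity>" using red s by simp
      qed
    qed
  qed auto
qed

section \<open>Inversion of the Funk transform\<close>

lemma Gamma_duplication_real:
  assumes x: "(x::real) > 0"
  shows "Gamma x * Gamma (x + 1/2) = 2 powr (1 - 2 * x) * sqrt pi * Gamma (2 * x)"
proof -
  have "complex_of_real x \<notin> \<int>\<^sub>\<le>\<^sub>0" "complex_of_real x + 1/2 \<notin> \<int>\<^sub>\<le>\<^sub>0"
    using x by (auto elim!: nonpos_Ints_cases simp: complex_eq_iff)
  from Gamma_legendre_duplication[OF this]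
  have "complex_of_real (Gamma x * Gamma (x + 1/2)) = complex_of_real (exp ((1 - 2 * x) * ln 2) * sqrt pi * Gamma (2 * x))"
    by (simp add: Gamma_complex_of_real[symmetric] exp_of_real[symmetric])
  then have "Gamma x * Gamma (x + 1/2) = exp ((1 - 2 * x) * ln 2) * sqrt pi * Gamma (2 * x)" by (simp only: of_real_eq_iff)
  then show ?thesis by (simp add: powr_def)
qed

text \<open>The factor in front of the Funk bracket is exactly the reciprocal of the constant from
  the projection density times the one from the Erdelyi-Kober integral; this is Legendre duplication
  at n/2 - 1.\<close>

lemma Funk_constant:
  assumes n: "n \<ge> 3"
  shows "2 ^ (n - 2) / fact (n - 3) * (Gamma ((real n - 1) / 2) / sqrt pi) * (Gamma (real n / 2 - 1) / 2) = 1"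
proof -
  have x: "real n / 2 - 1 > 0" using n by simp
  have e: "real n / 2 - 1 + 1/2 = (real n - 1) / 2" "2 * (real n / 2 - 1) = real (n - 2)"
    using n by (auto simp: of_nat_diff field_simps)
  have G: "Gamma (real (n - 2)) = fact (n - 3)"
  proof -
    have "n - 2 = Suc (n - 3)" using n by simp
    then show ?thesis using Gamma_fact[of "n - 3", where 'a = real] by (simp add: add.commute)
  qed
  have "Gamma (real n / 2 - 1) * Gamma ((real n - 1) / 2) = 2 powr (1 - real (n - 2)) * sqrt pi * fact (n - 3)"
    using Gamma_duplication_real[OF x] unfolding e G .
  moreover have "2 powr (1 - real (n - 2)) = 2 / 2 ^ (n - 2)" by (simp add: powr_diff powr_realpow)
  ultimately have "Gamma (real n / 2 - 1) * Gamma ((real n - 1) / 2) = 2 / 2 ^ (n - 2) * sqrt pi * fact (n - 3)" by simp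
  then have "Gamma ((real n - 1) / 2) * Gamma (real n / 2 - 1) = 2 * sqrt pi * fact (n - 3) / 2 ^ (n - 2)" by (simp add: mult.commute)
  moreover have "2 ^ (n - 2) / fact (n - 3) * (Gamma ((real n - 1) / 2) / sqrt pi) * (Gamma (real n / 2 - 1) / 2) =
    2 ^ (n - 2) / fact (n - 3) / sqrt pi / 2 * (Gamma ((real n - 1) / 2) * Gamma (real n / 2 - 1))" by simp
  ultimately have "2 ^ (n - 2) / fact (n - 3) * (Gamma ((real n - 1) / 2) / sqrt pi) * (Gamma (real n / 2 - 1) / 2) =
    2 ^ (n - 2) / fact (n - 3) / sqrt pi / 2 * (2 * sqrt pi * fact (n - 3) / 2 ^ (n - 2))" by (simp only:)
  also have "\<dots> = 1" by simp
  finally show ?thesis .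
qed

context sphere_dim
begin

text \<open>The full sphere is the subsphere orthogonal to 0, whose stabilizer is the whole
  orthogonal group.\<close>

lemma sphere_measure_eq: "(sphere_measure :: (real^'n) measure) = completion (restrict_space \<sigma> (sphere 0 1))"
proof -
  have "perp_sphere_measure (0::real^'n) = sphere_measure"
    by (simp add: perp_sphere_measure_def sphere_measure_def stabilizer_0 del: mem_sphere mem_sphere_0)
  then show ?thesis using zero.perp_sphere_measure_eq by (simp del: mem_sphere mem_sphere_0)
qed

lemma sphere_borel: "sphere (0::real^'n) 1 \<in> sets borel" by simp

lemma AE_sphere: "AE x in \<sigma>. x \<in> sphere 0 1" using zero.AE_perp by simp

lemma AE_sphere_measure_iff: "(AE x in (sphere_measure :: (real^'n) measure). P x) \<longleftrightarrow> (AE x in \<sigma>. norm x = 1 \<longrightarrow> P x)"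
  unfolding sphere_measure_eq by (subst AE_completion_restrict_iff) auto

lemma integral_perp_sphere_measure:
  fixes \<omega> :: "real^'n" and f g :: "real^'n \<Rightarrow> real"
  assumes \<omega>: "norm \<omega> = 1" and "g \<in> borel_measurable borel" "AE x in perp_measure \<omega>. norm x = 1 \<and> x \<bullet> \<omega> = 0 \<longrightarrow> f x = g x"
  shows "integral\<^sup>L (perp_sphere_measure \<omega>) f = integral\<^sup>L (perp_measure \<omega>) g"
proof -
  interpret w: axis_vec2 \<omega> by (rule axis_vec2I) (simp add: \<omega>)
  have "{\<theta>::real^'n. norm \<theta> = 1 \<and> \<theta> \<bullet> \<omega> = 0} \<in> sets borel" by measurable
  then have X: "{\<theta>::real^'n. \<theta> \<in> sphere 0 1 \<and> \<theta> \<bullet> \<omega> = 0} \<in> sets borel" by simp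
  show ?thesis unfolding w.perp_sphere_measure_eq
  proof (rule completion_restrict_transfer(1)[OF _ X])
    show "AE x in perp_measure \<omega>. x \<in> {\<theta> \<in> sphere 0 1. \<theta> \<bullet> \<omega> = 0}" using w.AE_perp by simp
    show "AE x in perp_measure \<omega>. x \<in> {\<theta> \<in> sphere 0 1. \<theta> \<bullet> \<omega> = 0} \<longrightarrow> f x = g x" using assms(3) by simp
  qed (use assms in simp_all)
qed

text \<open>Negation itself does not fix \<open>e0\<close>, but on the vectors orthogonal to
  \<open>e0\<close> it agrees with \<open>B\<close>, minus the reflection along \<open>e0\<close>,
  and \<open>B\<close> does fix \<open>e0\<close>.\<close>

lemma distr_base_neg: "distr \<rho> borel uminus = \<rho>"
proof (rule distr_eqI_nn_integral)
  fix f :: "real^'n \<Rightarrow> ennreal" assume [measurable]: "f \<in> borel_measurable borel"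
  define B :: "real^'n^'n" where "B = - householder e0 (- e0)"
  have Bv: "B *v x = - (householder e0 (- e0) *v x)" for x
    by (simp add: B_def matrix_vector_mult_def vec_eq_iff sum_negf)
  have ee: "(e0::real^'n) \<bullet> e0 = 1" by (simp add: norm_eq_1[symmetric] norm_e0)
  have d: "- e0 - (e0::real^'n) = - 2 *\<^sub>R e0" by (simp add: vec_eq_iff)
  have householder: "householder e0 (- e0) *v x = x - (2 * (x \<bullet> e0)) *\<^sub>R e0" for x :: "real^'n"
    unfolding householder_mult d by (simp add: ee inner_commute)
  have "transpose B ** B = transpose (householder e0 (- e0)) ** householder e0 (- e0 :: real^'n)"
    by (simp add: B_def matrix_matrix_mult_def transpose_def vec_eq_iff)
  then have "orthogonal_matrix B" using householder_orthogonal[of e0 "- e0 :: real^'n"] by (simp add: orthogonal_matrix)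
  moreover have "B *v e0 = e0" unfolding Bv householder ee by (simp add: vec_eq_iff)
  ultimately have B: "B \<in> stabilizer e0" by (simp add: stabilizer_def)
  have "(\<integral>\<^sup>+\<zeta>. f (- \<zeta>) \<partial>\<rho>) = (\<integral>\<^sup>+\<zeta>. f (B *v \<zeta>) \<partial>\<rho>)"
  proof (rule nn_integral_cong_AE)
    show "AE \<zeta> in \<rho>. f (- \<zeta>) = f (B *v \<zeta>)"
      using base.AE_perp by eventually_elim (simp add: Bv householder)
  qed
  then show "(\<integral>\<^sup>+\<zeta>. f (- \<zeta>) \<partial>\<rho>) = (\<integral>\<^sup>+\<zeta>. f \<zeta> \<partial>\<rho>)" using base.perp_inv[OF B, of f] by simp
qed auto

lemma cap_point_neg: "cap_point (- v) \<omega> (- \<zeta>) = - cap_point v \<omega> (\<zeta> :: real^'n)"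
  unfolding cap_point_def by (simp add: vec.neg algebra_simps)

lemma cap_nn_even:
  fixes \<omega> :: "real^'n"
  assumes [measurable]: "f \<in> borel_measurable borel" and even: "\<And>x. f (- x) = f x"
  shows "cap_nn (- v) f \<omega> = cap_nn v f \<omega>"
  using nn_integral_distr_inv[OF distr_base_neg, of "\<lambda>\<zeta>. f (cap_point (- v) \<omega> \<zeta>)"]
  by (simp add: cap_nn_def cap_point_neg even)

lemma cap_mean_even:
  fixes \<omega> :: "real^'n"
  assumes [measurable]: "f \<in> borel_measurable borel" and even: "\<And>x. f (- x) = f x"
  shows "cap_mean (- v) f \<omega> = cap_mean v f \<omega>"
  using integral_distr[of uminus \<rho> borel "\<lambda>\<zeta>. f (cap_point (- v) \<omega> \<zeta>)"]
  by (simp add: cap_mean_def cap_point_neg even distr_base_neg)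

text \<open>In \<open>Funk_mean\<close> the parameter \<open>s\<close> is the radius of the
  subsphere, not its level: the points have inner product c = sqrt (1 - s^2) with \<omega>. As
  \<psi> is known only off \<open>N\<close>, the subsphere in question has to meet \<open>N\<close>
  in a null set.\<close>

lemma Funk_mean_eq_cap_mean:
  fixes \<omega> :: "real^'n"
  assumes \<omega>: "norm \<omega> = 1" and s: "0 < s" "s < 1" and h[measurable]: "h \<in> borel_measurable borel"
    and N[measurable]: "N \<in> sets borel" and eq: "\<And>x. norm x = 1 \<Longrightarrow> x \<notin> N \<Longrightarrow> \<psi> x = h x"
    and null: "cap_nn (sqrt (1 - s\<^sup>2)) (indicator N) \<omega> = 0"
  shows "Funk_mean \<psi> \<omega> s = cap_mean (sqrt (1 - s\<^sup>2)) h \<omega>"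
proof -
  define c where "c = sqrt (1 - s\<^sup>2)"
  have s2: "s\<^sup>2 < 1" using s by (simp add: power_less_one_iff)
  have c: "sqrt (1 - c\<^sup>2) = s" "\<bar>c\<bar> \<le> 1" using s s2 by (auto simp: c_def)
  have "(\<integral>\<^sup>+\<xi>. indicator N (c *\<^sub>R \<omega> + sqrt (1 - c\<^sup>2) *\<^sub>R \<xi>) \<partial>perp_measure \<omega>) = 0"
    using null cap_nn_perp[OF \<omega>, of "indicator N" c] by (simp add: c_def)
  then have "AE \<xi> in perp_measure \<omega>. (indicator N (c *\<^sub>R \<omega> + sqrt (1 - c\<^sup>2) *\<^sub>R \<xi>) :: ennreal) = 0"
    by (subst (asm) nn_integral_0_iff_AE) (simp_all add: perp_measure_base[OF \<omega>])
  then have ae: "AE \<xi> in perp_measure \<omega>. norm \<xi> = 1 \<and> \<xi> \<bullet> \<omega> = 0 \<longrightarrow> \<psi> (s *\<^sub>R \<xi> + c *\<^sub>R \<omega>) = h (c *\<^sub>R \<omega> + s *\<^sub>R \<xi>)"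
  proof eventually_elim
    fix \<xi> assume nN: "(indicator N (c *\<^sub>R \<omega> + sqrt (1 - c\<^sup>2) *\<^sub>R \<xi>) :: ennreal) = 0"
    show "norm \<xi> = 1 \<and> \<xi> \<bullet> \<omega> = 0 \<longrightarrow> \<psi> (s *\<^sub>R \<xi> + c *\<^sub>R \<omega>) = h (c *\<^sub>R \<omega> + s *\<^sub>R \<xi>)"
    proof
      assume "norm \<xi> = 1 \<and> \<xi> \<bullet> \<omega> = 0"
      then have "norm (c *\<^sub>R \<omega> + s *\<^sub>R \<xi>) = 1" using norm_circle(1)[of \<omega> \<xi> c] \<omega> c by simp
      moreover have "c *\<^sub>R \<omega> + s *\<^sub>R \<xi> \<notin> N" using nN c by (auto simp: indicator_def split: if_splits)
      ultimately show "\<psi> (s *\<^sub>R \<xi> + c *\<^sub>R \<omega>) = h (c *\<^sub>R \<omega> + s *\<^sub>R \<xi>)" using eq by (simp add: add.commute)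
    qed
  qed
  have "Funk_mean \<psi> \<omega> s = (\<integral>\<xi>. h (c *\<^sub>R \<omega> + s *\<^sub>R \<xi>) \<partial>perp_measure \<omega>)"
    unfolding Funk_mean_def c_def[symmetric]
    by (rule integral_perp_sphere_measure[OF \<omega> _ ae]) measurable
  also have "\<dots> = cap_mean c h \<omega>" unfolding cap_mean_perp[OF \<omega> h] c(1) ..
  finally show ?thesis by (simp add: c_def)
qed

text \<open>Up to powers of \<open>s\<close>, the Funk mean is an Erdelyi-Kober integral of order a
  = n/2 - 1, and the kernel of the bracket contributes another one of the same order. The total
  order 2a = n - 2 is the integer number of derivatives in the inversion formula, and as it is at
  least 1 the result holds at every \<open>t\<close>, although the formula for the Funk mean is used
  for almost every \<open>s\<close>.\<close>

lemma Funk_bracket_eq_EK_integral: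
  fixes \<omega> :: "real^'n"
  assumes \<omega>: "norm \<omega> = 1" and f[measurable]: "f \<in> borel_measurable borel" and even: "\<And>x. f (- x) = f x"
    and N: "N \<in> sets borel" and eq: "\<And>x. norm x = 1 \<Longrightarrow> x \<notin> N \<Longrightarrow> \<psi> x = cap_mean 0 f x"
    and null: "AE s in lborel. 0 < s \<and> s < 1 \<longrightarrow> cap_nn (sqrt (1 - s\<^sup>2)) (indicator N) \<omega> = 0"
    and fin: "(\<integral>\<^sup>+v. indicator {0<..<1} v * cap_nn v (\<lambda>x. ennreal \<bar>f x\<bar>) \<omega> \<partial>lborel) < \<infinity>"
    and t: "0 < t" "t < 1"
  shows "Funk_bracket \<psi> \<omega> t = EK_integral (real (CARD('n) - 2)) (\<lambda>v. cap_mean v f \<omega> / v) t"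
proof -
  define n where "n = CARD('n)"
  have n: "n \<ge> 3" using card_ge_3 by (simp add: n_def)
  define a where "a = real n / 2 - 1"
  have a: "a > 0" "a + a \<ge> 1" "a + a = real (n - 2)" using n by (auto simp: a_def of_nat_diff field_simps)
  define \<eta> where "\<eta> v = cap_mean v f \<omega> / v" for v
  have \<eta>[measurable]: "\<eta> \<in> borel_measurable borel" unfolding \<eta>_def[abs_def] by measurable
  define C where "C = Gamma ((real n - 1) / 2) / sqrt pi"
  define F where "F s = Funk_mean \<psi> \<omega> s * s ^ (n - 3)" for s
  have G: "Gamma a > 0" using a by (intro Gamma_real_pos) auto
  have "AE s in lborel. 0 < s \<and> s < 1 \<longrightarrow> (\<integral>\<^sup>+v. ennreal (proj_density (n - 1) v) * cap_nn (s * v) (\<lambda>x. ennreal \<bar>f x\<bar>) \<omega> \<partial>lborel) < \<infinity>"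
    by (rule proj_density_scaled_finite(1)[OF n _ _ fin]) (auto intro!: cap_nn_even simp: even)
  with null have "AE s in lborel. 0 < s \<and> s < t \<longrightarrow> F s = C * EK_integral a \<eta> s"
  proof eventually_elim
    fix s assume 1: "0 < s \<and> s < 1 \<longrightarrow> cap_nn (sqrt (1 - s\<^sup>2)) (indicator N) \<omega> = 0"
      and 2: "0 < s \<and> s < 1 \<longrightarrow> (\<integral>\<^sup>+v. ennreal (proj_density (n - 1) v) * cap_nn (s * v) (\<lambda>x. ennreal \<bar>f x\<bar>) \<omega> \<partial>lborel) < \<infinity>"
    show "0 < s \<and> s < t \<longrightarrow> F s = C * EK_integral a \<eta> s"
    proof
      assume "0 < s \<and> s < t"
      then have s: "0 < s" "s < 1" using t by auto
      have "Funk_mean \<psi> \<omega> s = cap_mean (sqrt (1 - s\<^sup>2)) (cap_mean 0 f) \<omega>"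
        by (rule Funk_mean_eq_cap_mean[OF \<omega> s _ N eq]) (use 1 s in auto)
      also have "\<dots> = (\<integral>v. proj_density (n - 1) v * cap_mean (s * v) f \<omega> \<partial>lborel)"
        unfolding n_def by (rule cap_mean_compose[OF \<omega> s f]) (use 2 s in \<open>simp add: n_def\<close>)
      also have "\<dots> = C / s ^ (n - 3) * EK_integral a \<eta> s"
        unfolding C_def a_def \<eta>_def
        by (rule integral_proj_density_scaled[OF n, of "\<lambda>v. cap_mean v f \<omega>"]) (use s even in \<open>auto intro!: cap_mean_even\<close>)
      finally show "F s = C * EK_integral a \<eta> s" using s by (simp add: F_def)
    qed
  qed
  then have ae: "AE s in lebesgue. 0 < s \<and> s < t \<longrightarrow> F s = C * EK_integral a \<eta> s" by (rule AE_completion)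
  have 1: "Funk_bracket \<psi> \<omega> t = 2 ^ (n - 2) / fact (n - 3) * (Gamma a / 2) * EK_integral a F t"
  proof -
    have e: "real n / 2 - 2 = a - 1" "n - 2 = Suc (n - 3)" using n by (auto simp: a_def)
    have pw: "(t\<^sup>2 - s\<^sup>2) powr (a - 1) * Funk_mean \<psi> \<omega> s * s ^ Suc (n - 3) = (t\<^sup>2 - s\<^sup>2) powr (a - 1) * F s * s" for s
      by (simp add: F_def)
    have "(LINT s:{0<..<t}|lebesgue. (t\<^sup>2 - s\<^sup>2) powr (real n / 2 - 2) * Funk_mean \<psi> \<omega> s * s ^ (n - 2)) =
      (LINT s:{0<..<t}|lebesgue. (t\<^sup>2 - s\<^sup>2) powr (a - 1) * F s * s)"
      unfolding e pw ..
    also have "\<dots> = Gamma a / 2 * EK_integral a F t" using G by (simp add: EK_integral_def)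
    finally show ?thesis unfolding Funk_bracket_def n_def by (simp only: mult.assoc)
  qed
  have "EK_integral a F t = EK_integral a (\<lambda>s. C * EK_integral a \<eta> s) t" by (rule EK_integral_cong_AE[OF ae])
  also have "\<dots> = C * EK_integral a (EK_integral a \<eta>) t"
  proof -
    have "(\<integral>s. indicator {0<..<t} s * ((t\<^sup>2 - s\<^sup>2) powr (a - 1) * (C * EK_integral a \<eta> s) * s) \<partial>lborel) =
      (\<integral>s. C * (indicator {0<..<t} s * ((t\<^sup>2 - s\<^sup>2) powr (a - 1) * EK_integral a \<eta> s * s)) \<partial>lborel)"
      by (simp add: mult_ac)
    also have "\<dots> = C * (\<integral>s. indicator {0<..<t} s * ((t\<^sup>2 - s\<^sup>2) powr (a - 1) * EK_integral a \<eta> s * s) \<partial>lborel)"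
      by (rule integral_mult_right_zero)
    finally show ?thesis by (subst (1 3) EK_integral_lborel) auto
  qed
  also have "EK_integral a (EK_integral a \<eta>) t = EK_integral (a + a) \<eta> t"
  proof (rule EK_integral_semigroup(3)[OF a(1) a(1) a(2) t(1) \<eta>])
    have "integrable lborel (\<lambda>v. indicator {0<..<t} v * cap_mean v f \<omega>)"
      by (rule integrable_primitive_mono[OF integrable_cap_mean_unit_interval[OF f fin]]) (use t in simp)
    moreover have "indicator {0<..<t} v * (\<eta> v * v) = indicator {0<..<t} v * cap_mean v f \<omega>" for v :: real
      by (auto simp: \<eta>_def indicator_def)
    ultimately show "integrable lborel (\<lambda>v. indicator {0<..<t} v * (\<eta> v * v))" by (simp only:)
  qed
  finally have "Funk_bracket \<psi> \<omega> t = (2 ^ (n - 2) / fact (n - 3) * C * (Gamma a / 2)) * EK_integral (a + a) \<eta> t"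
    unfolding 1 by simp
  also have "2 ^ (n - 2) / fact (n - 3) * C * (Gamma a / 2) = 1" unfolding C_def a_def by (rule Funk_constant[OF n])
  finally show ?thesis unfolding a(3) by (simp add: \<eta>_def[abs_def] n_def)
qed

text \<open>Means preserve the integral, so at each level the indicator of a null set has mean 0
  over almost every axis; Tonelli exchanges level and axis.\<close>

lemma AE_cap_nn_null:
  fixes N :: "(real^'n) set"
  assumes [measurable]: "N \<in> sets borel" and null: "emeasure \<sigma> N = 0"
  shows "AE \<omega> in \<sigma>. AE s in lborel. 0 < s \<and> s < 1 \<longrightarrow> cap_nn (sqrt (1 - s\<^sup>2)) (indicator N) \<omega> = 0"
proof -
  interpret ls: pair_sigma_finite "lborel :: real measure" "perp_measure (0::real^'n)" ..
  define k where "k s \<omega> = indicator {0<..<1} s * cap_nn (sqrt (1 - s\<^sup>2)) (indicator N) \<omega>" for s :: real and \<omega> :: "real^'n"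
  have [measurable]: "(\<lambda>(s, \<omega>). k s \<omega>) \<in> borel_measurable (lborel \<Otimes>\<^sub>M \<sigma>)" unfolding k_def[abs_def] by measurable
  have [measurable]: "(\<lambda>s. k s \<omega>) \<in> borel_measurable borel" for \<omega> unfolding k_def[abs_def] by measurable
  have "(\<integral>\<^sup>+\<omega>. \<integral>\<^sup>+s. k s \<omega> \<partial>lborel \<partial>\<sigma>) = (\<integral>\<^sup>+s. \<integral>\<^sup>+\<omega>. k s \<omega> \<partial>\<sigma> \<partial>lborel)"
    by (rule ls.Fubini') measurable
  also have "\<dots> = (\<integral>\<^sup>+s. 0 \<partial>(lborel::real measure))"
  proof (rule nn_integral_cong)
    fix s :: real
    show "(\<integral>\<^sup>+\<omega>. k s \<omega> \<partial>\<sigma>) = 0"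
    proof (cases "0 < s \<and> s < 1")
      case True
      have "\<bar>sqrt (1 - s\<^sup>2)\<bar> \<le> 1" using True by (simp add: power_le_one)
      then have "(\<integral>\<^sup>+\<omega>. cap_nn (sqrt (1 - s\<^sup>2)) (indicator N) \<omega> \<partial>\<sigma>) = 0"
        using null by (subst nn_integral_cap_nn) auto
      then show ?thesis using True by (simp add: k_def)
    qed (auto simp: k_def)
  qed
  finally have "(\<integral>\<^sup>+\<omega>. \<integral>\<^sup>+s. k s \<omega> \<partial>lborel \<partial>\<sigma>) = 0" by simp
  then have "AE \<omega> in \<sigma>. (\<integral>\<^sup>+s. k s \<omega> \<partial>lborel) = 0" by (subst (asm) nn_integral_0_iff_AE) auto
  then show ?thesis
  proof eventually_elim
    fix \<omega> assume "(\<integral>\<^sup>+s. k s \<omega> \<partial>lborel) = 0"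
    then have "AE s in lborel. k s \<omega> = 0" by (subst (asm) nn_integral_0_iff_AE) auto
    then show "AE s in lborel. 0 < s \<and> s < 1 \<longrightarrow> cap_nn (sqrt (1 - s\<^sup>2)) (indicator N) \<omega> = 0"
      by eventually_elim (auto simp: k_def)
  qed
qed

lemma integrable_cap_mean:
  fixes f :: "real^'n \<Rightarrow> real"
  assumes f[measurable]: "f \<in> borel_measurable borel" and int: "integrable \<sigma> f" and v: "\<bar>v\<bar> \<le> 1"
  shows "integrable \<sigma> (cap_mean v f)"
proof (rule integrableI_bounded)
  have "(\<integral>\<^sup>+\<omega>. ennreal (norm (cap_mean v f \<omega>)) \<partial>\<sigma>) \<le> (\<integral>\<^sup>+\<omega>. cap_nn v (\<lambda>x. ennreal \<bar>f x\<bar>) \<omega> \<partial>\<sigma>)"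
    by (intro nn_integral_mono) (simp add: cap_mean_le_nn)
  also have "\<dots> = (\<integral>\<^sup>+x. ennreal \<bar>f x\<bar> \<partial>\<sigma>)" by (rule nn_integral_cap_nn[OF v]) measurable
  also have "\<dots> < \<infinity>" using int by (auto simp: integrable_iff_bounded)
  finally show "(\<integral>\<^sup>+\<omega>. ennreal (norm (cap_mean v f \<omega>)) \<partial>\<sigma>) < \<infinity>" .
qed measurable

text \<open>The derivative of order n - 2 of the bracket is
  \<open>cap_mean t f \<omega> / t\<close>, and the division by \<open>t\<close> disappears in the
  limit at 1. Both \<psi> and \<open>g\<close> are prescribed only almost everywhere on the sphere,
  as the Erdelyi-Kober derivative and \<phi> are.\<close>

theorem has_inverse_Funk_cap_mean:
  fixes f g \<psi> :: "real^'n \<Rightarrow> real"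
  assumes f[measurable]: "f \<in> borel_measurable borel" and even: "\<And>x. f (- x) = f x" and int: "integrable \<sigma> f"
    and \<psi>: "AE \<omega> in \<sigma>. norm \<omega> = 1 \<longrightarrow> \<psi> \<omega> = cap_mean 0 f \<omega>" and g: "AE x in \<sigma>. norm x = 1 \<longrightarrow> g x = f x"
  shows "has_inverse_Funk \<psi> g"
proof -
  define k where "k = CARD('n) - 2"
  have k: "k \<ge> 1" using card_ge_3 by (simp add: k_def)
  define A where "A t \<omega> = (sq_deriv ^^ k) (Funk_bracket \<psi> \<omega>) t" for t \<omega>
  \<comment> \<open>A Borel null set containing all directions where \<psi> deviates; almost every
    subsphere about almost every axis meets it in a null set.\<close>
  obtain N where N: "{x \<in> space \<sigma>. \<not> (norm x = 1 \<longrightarrow> \<psi> x = cap_mean 0 f x)} \<subseteq> N" "emeasure \<sigma> N = 0" "N \<in> sets \<sigma>"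
    using AE_E[OF \<psi>] by blast
  have Nb: "N \<in> sets borel" using N(3) by simp
  have eq: "\<psi> x = cap_mean 0 f x" if "norm x = 1" "x \<notin> N" for x using N(1) that by auto
  have finf: "(\<integral>\<^sup>+x. ennreal \<bar>f x\<bar> \<partial>\<sigma>) < \<infinity>" using int by (auto simp: integrable_iff_bounded)
  have "AE \<omega> in \<sigma>. (\<integral>\<^sup>+v. indicator {0<..<1} v * cap_nn v (\<lambda>x. ennreal \<bar>f x\<bar>) \<omega> \<partial>lborel) < \<infinity>"
    by (rule AE_cap_nn_integral_finite[OF _ finf]) measurable
  note good = this AE_cap_nn_null[OF Nb N(2)] zero.AE_perp
  have main: "AE \<omega> in \<sigma>. norm \<omega> = 1 \<longrightarrow> sq_differentiable k (Funk_bracket \<psi> \<omega>) t \<and> A t \<omega> = cap_mean t f \<omega> / t"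
    if t: "0 < t" "t < 1" for t
    using good AE_cap_mean_primitive[OF f int t]
  proof eventually_elim
    fix \<omega> :: "real^'n" assume fin: "(\<integral>\<^sup>+v. indicator {0<..<1} v * cap_nn v (\<lambda>x. ennreal \<bar>f x\<bar>) \<omega> \<partial>lborel) < \<infinity>"
      and null: "AE s in lborel. 0 < s \<and> s < 1 \<longrightarrow> cap_nn (sqrt (1 - s\<^sup>2)) (indicator N) \<omega> = 0"
      and u: "norm \<omega> = 1 \<and> \<omega> \<bullet> 0 = 0" and D: "(primitive (\<lambda>v. cap_mean v f \<omega>) has_real_derivative cap_mean t f \<omega>) (at t)"
    have \<omega>: "norm \<omega> = 1" using u by simp
    define \<eta> where "\<eta> v = cap_mean v f \<omega> / v" for v
    have \<eta>: "\<eta> \<in> borel_measurable borel" unfolding \<eta>_def[abs_def] by measurable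
    have e: "indicator {0<..<R} v * (\<eta> v * v) = indicator {0<..<R} v * cap_mean v f \<omega>" for v R :: real
      by (auto simp: \<eta>_def indicator_def)
    have i: "integrable lborel (\<lambda>v. indicator {0<..<1} v * (\<eta> v * v))"
      unfolding e by (rule integrable_cap_mean_unit_interval[OF f fin])
    have "primitive (\<lambda>v. \<eta> v * v) = primitive (\<lambda>v. cap_mean v f \<omega>)" unfolding primitive_def[abs_def] e ..
    then have D': "(primitive (\<lambda>v. \<eta> v * v) has_real_derivative \<eta> t * t) (at t)" using D t by (simp add: \<eta>_def)
    have F: "Funk_bracket \<psi> \<omega> r = EK_integral (real k) \<eta> r" if "0 < r" "r < 1" for r
      unfolding k_def \<eta>_def using Funk_bracket_eq_EK_integral[OF \<omega> f even Nb eq null fin that] .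
    show "norm \<omega> = 1 \<longrightarrow> sq_differentiable k (Funk_bracket \<psi> \<omega>) t \<and> A t \<omega> = cap_mean t f \<omega> / t"
      using sq_deriv_EK_integral[OF \<eta> i F k t D'] by (simp add: A_def \<eta>_def)
  qed
  have fs: "integrable sphere_measure g" "integrable sphere_measure (A t)"
    "(\<integral>\<omega>. \<bar>A t \<omega> - g \<omega>\<bar> \<partial>sphere_measure) = (\<integral>\<omega>. \<bar>cap_mean t f \<omega> / t - f \<omega>\<bar> \<partial>\<sigma>)"
    if t: "0 < t" "t < 1" for t
  proof -
    note tr = completion_restrict_transfer[OF zero.sets_perp sphere_borel AE_sphere]
    show "integrable sphere_measure g" unfolding sphere_measure_eq
      by (rule tr(2)[OF f _ int]) (use g in simp)
    show "integrable sphere_measure (A t)" unfolding sphere_measure_eq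
    proof (rule tr(2)[of "\<lambda>\<omega>. cap_mean t f \<omega> / t"])
      show "AE x in \<sigma>. x \<in> sphere 0 1 \<longrightarrow> A t x = cap_mean t f x / t" using main[OF t] by eventually_elim simp
      show "integrable \<sigma> (\<lambda>\<omega>. cap_mean t f \<omega> / t)" using integrable_cap_mean[OF f int, of t] t by simp
    qed measurable
    show "(\<integral>\<omega>. \<bar>A t \<omega> - g \<omega>\<bar> \<partial>sphere_measure) = (\<integral>\<omega>. \<bar>cap_mean t f \<omega> / t - f \<omega>\<bar> \<partial>\<sigma>)" unfolding sphere_measure_eq
    proof (rule tr(1)[of "\<lambda>\<omega>. \<bar>cap_mean t f \<omega> / t - f \<omega>\<bar>"])
      show "AE x in \<sigma>. x \<in> sphere 0 1 \<longrightarrow> \<bar>A t x - g x\<bar> = \<bar>cap_mean t f x / t - f x\<bar>"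
        using main[OF t] g by eventually_elim simp
    qed measurable
  qed
  have ev: "\<forall>\<^sub>F t in at_left (1::real). 0 < t \<and> t < 1"
    by (rule eventually_at_leftI[of 0]) auto
  define L where "L t = enn2real (\<integral>\<^sup>+\<omega>. ennreal \<bar>cap_mean t f \<omega> - f \<omega>\<bar> \<partial>\<sigma>)" for t
  have "(L \<longlongrightarrow> 0) (at_left 1)" unfolding L_def
    using tendsto_enn2real[of "\<lambda>t. \<integral>\<^sup>+\<omega>. ennreal \<bar>cap_mean t f \<omega> - f \<omega>\<bar> \<partial>\<sigma>" 0 "at_left 1"] cap_mean_L1_limit[OF f int] by simp
  then have lim: "((\<lambda>t. 1 / t * L t + (1 / t - 1) * (\<integral>\<omega>. \<bar>f \<omega>\<bar> \<partial>\<sigma>)) \<longlongrightarrow> 1 / 1 * 0 + (1 / 1 - 1) * (\<integral>\<omega>. \<bar>f \<omega>\<bar> \<partial>\<sigma>)) (at_left (1::real))"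
    by (intro tendsto_intros) auto
  \<comment> \<open>With m the mean at level t, this splits m/t - f into (m - f)/t and (1/t - 1)
    f.\<close>
  have bound: "(\<integral>\<omega>. \<bar>A t \<omega> - g \<omega>\<bar> \<partial>sphere_measure) \<le> 1 / t * L t + (1 / t - 1) * (\<integral>\<omega>. \<bar>f \<omega>\<bar> \<partial>\<sigma>)" if t: "0 < t" "t < 1" for t
  proof -
    have i: "integrable \<sigma> (cap_mean t f)" by (rule integrable_cap_mean[OF f int]) (use t in auto)
    have L: "L t = (\<integral>\<omega>. \<bar>cap_mean t f \<omega> - f \<omega>\<bar> \<partial>\<sigma>)" unfolding L_def
      by (rule integral_eq_nn_integral[symmetric]) auto
    have "(\<integral>\<omega>. \<bar>cap_mean t f \<omega> / t - f \<omega>\<bar> \<partial>\<sigma>) \<le> (\<integral>\<omega>. 1 / t * \<bar>cap_mean t f \<omega> - f \<omega>\<bar> + (1 / t - 1) * \<bar>f \<omega>\<bar> \<partial>\<sigma>)"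
    proof (rule integral_mono)
      fix \<omega>
      have "cap_mean t f \<omega> / t - f \<omega> = 1 / t * (cap_mean t f \<omega> - f \<omega>) + (1 / t - 1) * f \<omega>" using t by (simp add: field_simps)
      also have "\<bar>\<dots>\<bar> \<le> \<bar>1 / t * (cap_mean t f \<omega> - f \<omega>)\<bar> + \<bar>(1 / t - 1) * f \<omega>\<bar>" by (rule abs_triangle_ineq)
      also have "\<dots> = 1 / t * \<bar>cap_mean t f \<omega> - f \<omega>\<bar> + (1 / t - 1) * \<bar>f \<omega>\<bar>" using t by (simp add: abs_mult)
      finally show "\<bar>cap_mean t f \<omega> / t - f \<omega>\<bar> \<le> 1 / t * \<bar>cap_mean t f \<omega> - f \<omega>\<bar> + (1 / t - 1) * \<bar>f \<omega>\<bar>" .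
    qed (use i int in auto)
    also have "\<dots> = (\<integral>\<omega>. 1 / t * \<bar>cap_mean t f \<omega> - f \<omega>\<bar> \<partial>\<sigma>) + (\<integral>\<omega>. (1 / t - 1) * \<bar>f \<omega>\<bar> \<partial>\<sigma>)"
      using i int by (intro Bochner_Integration.integral_add) auto
    also have "\<dots> = 1 / t * L t + (1 / t - 1) * (\<integral>\<omega>. \<bar>f \<omega>\<bar> \<partial>\<sigma>)" unfolding L by simp
    finally show ?thesis unfolding fs(3)[OF t] .
  qed
  have "((\<lambda>t. \<integral>\<omega>. \<bar>A t \<omega> - g \<omega>\<bar> \<partial>sphere_measure) \<longlongrightarrow> 0) (at_left 1)"
  proof (rule tendsto_sandwich[OF _ _ tendsto_const])
    show "((\<lambda>t. 1 / t * L t + (1 / t - 1) * (\<integral>\<omega>. \<bar>f \<omega>\<bar> \<partial>\<sigma>)) \<longlongrightarrow> 0) (at_left (1::real))" using lim by simp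
    show "\<forall>\<^sub>F t in at_left 1. (\<integral>\<omega>. \<bar>A t \<omega> - g \<omega>\<bar> \<partial>sphere_measure) \<le> 1 / t * L t + (1 / t - 1) * (\<integral>\<omega>. \<bar>f \<omega>\<bar> \<partial>\<sigma>)"
      using ev by eventually_elim (use bound in auto)
    show "\<forall>\<^sub>F t in at_left 1. 0 \<le> (\<integral>\<omega>. \<bar>A t \<omega> - g \<omega>\<bar> \<partial>sphere_measure)" by (simp add: integral_nonneg_AE)
  qed
  moreover have "\<forall>\<^sub>F t in at_left 1. (AE \<omega> in sphere_measure. sq_differentiable k (Funk_bracket \<psi> \<omega>) t) \<and> integrable sphere_measure (A t)"
    using ev
  proof eventually_elim
    fix t :: real assume t: "0 < t \<and> t < 1"
    show "(AE \<omega> in sphere_measure. sq_differentiable k (Funk_bracket \<psi> \<omega>) t) \<and> integrable sphere_measure (A t)"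
      using fs(2)[of t] t main[of t] unfolding AE_sphere_measure_iff by (auto elim!: eventually_mono)
  qed
  moreover have "integrable sphere_measure g" using fs(1)[of "1/2"] by simp
  ultimately show ?thesis unfolding has_inverse_Funk_def Let_def A_def[abs_def] k_def by simp
qed

end

section \<open>Mean values of the dual Radon transform\<close>

context sphere_dim
begin

lemma cap_nn_0: "norm \<omega> = 1 \<Longrightarrow> f \<in> borel_measurable borel \<Longrightarrow> cap_nn 0 f \<omega> = (\<integral>\<^sup>+\<xi>. f \<xi> \<partial>perp_measure (\<omega>::real^'n))"
  by (simp add: cap_nn_perp)

lemma cap_mean_0: "norm \<omega> = 1 \<Longrightarrow> f \<in> borel_measurable borel \<Longrightarrow> cap_mean 0 f \<omega> = (\<integral>\<xi>. f \<xi> \<partial>perp_measure (\<omega>::real^'n))"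
  by (simp add: cap_mean_perp)

text \<open>For fixed \<theta> the law of \<open>\<theta> \<bullet> y\<close> does not depend on
  \<theta>, so it is independent of \<theta> in the pair.\<close>

lemma distr_inner_pair:
  fixes \<omega> :: "real^'n"
  assumes \<omega>: "norm \<omega> = 1"
  defines "P \<equiv> perp_measure \<omega>" and "\<delta> \<equiv> density lborel (\<lambda>v. ennreal (proj_density (CARD('n) - 1) v))"
  shows "distr (P \<Otimes>\<^sub>M P) (borel \<Otimes>\<^sub>M borel) (\<lambda>(\<theta>, y). (\<theta>, \<theta> \<bullet> y)) = P \<Otimes>\<^sub>M \<delta>"
proof -
  interpret w: axis_vec2 \<omega> by (rule axis_vec2I) (simp add: \<omega>)
  interpret \<delta>: prob_space \<delta> unfolding \<delta>_def by (rule prob_proj_density) (use card_ge_3 in simp)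
  have sP[measurable_cong]: "sets P = sets borel" by (simp add: P_def)
  have s\<delta>[measurable_cong]: "sets \<delta> = sets borel" by (simp add: \<delta>_def)
  interpret P: prob_space P unfolding P_def by (rule w.perp.prob_space_axioms)
  show ?thesis
  proof (rule distr_eqI_nn_integral)
    fix F :: "(real^'n) \<times> real \<Rightarrow> ennreal" assume [measurable]: "F \<in> borel_measurable (borel \<Otimes>\<^sub>M borel)"
    have "(\<integral>\<^sup>+z. F (case z of (\<theta>, y) \<Rightarrow> (\<theta>, \<theta> \<bullet> y)) \<partial>(P \<Otimes>\<^sub>M P)) = (\<integral>\<^sup>+\<theta>. \<integral>\<^sup>+y. F (\<theta>, \<theta> \<bullet> y) \<partial>P \<partial>P)"
      by (subst P.nn_integral_fst[symmetric]) (auto simp: split_beta')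
    also have "\<dots> = (\<integral>\<^sup>+\<theta>. \<integral>\<^sup>+s. F (\<theta>, s) \<partial>\<delta> \<partial>P)"
    proof (rule nn_integral_cong_AE)
      show "AE \<theta> in P. (\<integral>\<^sup>+y. F (\<theta>, \<theta> \<bullet> y) \<partial>P) = (\<integral>\<^sup>+s. F (\<theta>, s) \<partial>\<delta>)"
        unfolding P_def using w.AE_perp
      proof eventually_elim
        fix \<theta> :: "real^'n" assume "norm \<theta> = 1 \<and> \<theta> \<bullet> \<omega> = 0"
        then have "(\<integral>\<^sup>+y. F (\<theta>, y \<bullet> \<theta>) \<partial>perp_measure \<omega>) = (\<integral>\<^sup>+s. ennreal (proj_density (CARD('n) - 1) s) * F (\<theta>, s) \<partial>lborel)"
          using \<omega> by (subst nn_integral_proj) auto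
        also have "\<dots> = (\<integral>\<^sup>+s. F (\<theta>, s) \<partial>\<delta>)" unfolding \<delta>_def by (rule nn_integral_density[symmetric]) auto
        finally show "(\<integral>\<^sup>+y. F (\<theta>, \<theta> \<bullet> y) \<partial>perp_measure \<omega>) = (\<integral>\<^sup>+s. F (\<theta>, s) \<partial>\<delta>)" by (simp add: inner_commute)
      qed
    qed
    also have "\<dots> = (\<integral>\<^sup>+z. F z \<partial>(P \<Otimes>\<^sub>M \<delta>))" by (rule \<delta>.nn_integral_fst) measurable
    finally show "(\<integral>\<^sup>+z. F (case z of (\<theta>, y) \<Rightarrow> (\<theta>, \<theta> \<bullet> y)) \<partial>(P \<Otimes>\<^sub>M P)) = (\<integral>\<^sup>+z. F z \<partial>(P \<Otimes>\<^sub>M \<delta>))" .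
  qed (use sP s\<delta> in \<open>auto intro: sets_pair_measure_cong\<close>)
qed

text \<open>The rotated unit vector \<open>y\<close> is uniform on the subsphere, so the mean value
  is a double integral of \<phi> at (\<theta>, r (\<theta> \<bullet> y)), and the law of (\<theta>,
  \<theta> \<bullet> y) is known. Integrating over \<theta> first produces the mean of \<phi> over
  the great subsphere orthogonal to \<omega>.\<close>

lemma mean_value_dual_Radon:
  fixes \<omega> :: "real^'n" and \<phi>' :: "(real^'n) \<times> real \<Rightarrow> real"
  assumes \<omega>: "norm \<omega> = 1" and m[measurable]: "\<phi>' \<in> borel_measurable (borel \<Otimes>\<^sub>M borel)" and Z[measurable]: "Z \<in> sets (borel \<Otimes>\<^sub>M borel)"
    and eq: "\<And>x t. norm x = 1 \<Longrightarrow> (x, t) \<notin> Z \<Longrightarrow> \<phi> (x, t) = \<phi>' (x, t)"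
    and null: "AE \<theta> in perp_measure \<omega>. AE t in lborel. (\<theta>, t) \<notin> Z" and r: "r > 0"
    and fin: "(\<integral>\<^sup>+v. ennreal (proj_density (CARD('n) - 1) v) * cap_nn 0 (\<lambda>x. ennreal \<bar>\<phi>' (x, r * v)\<bar>) \<omega> \<partial>lborel) < \<infinity>"
  shows "mean_value \<omega> (dual_Radon \<phi>) r = (\<integral>v. proj_density (CARD('n) - 1) v * cap_mean 0 (\<lambda>x. \<phi>' (x, r * v)) \<omega> \<partial>lborel)"
proof -
  interpret w: axis_vec2 \<omega> by (rule axis_vec2I) (simp add: \<omega>)
  define P where "P = perp_measure \<omega>"
  define \<delta> where "\<delta> = density lborel (\<lambda>v. ennreal (proj_density (CARD('n) - 1) v))"
  interpret \<delta>: prob_space \<delta> unfolding \<delta>_def by (rule prob_proj_density) (use card_ge_3 in simp)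
  interpret P: prob_space P unfolding P_def by (rule w.perp.prob_space_axioms)
  interpret PP: pair_sigma_finite P P ..
  interpret PD: pair_sigma_finite P \<delta> ..
  have sP[measurable_cong]: "sets P = sets borel" by (simp add: P_def)
  have s\<delta>[measurable_cong]: "sets \<delta> = sets borel" by (simp add: \<delta>_def)
  have law: "distr (P \<Otimes>\<^sub>M P) (borel \<Otimes>\<^sub>M borel) (\<lambda>(\<theta>, y). (\<theta>, \<theta> \<bullet> y)) = P \<Otimes>\<^sub>M \<delta>"
    unfolding P_def \<delta>_def by (rule distr_inner_pair[OF \<omega>])
  define H where "H z = \<phi>' (fst z, r * snd z)" for z
  have [measurable]: "H \<in> borel_measurable (borel \<Otimes>\<^sub>M borel)" unfolding H_def[abs_def] by measurable
  have Hint: "integrable (P \<Otimes>\<^sub>M \<delta>) H"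
  proof (rule integrableI_bounded)
    have "(\<integral>\<^sup>+z. ennreal (norm (H z)) \<partial>(P \<Otimes>\<^sub>M \<delta>)) = (\<integral>\<^sup>+s. \<integral>\<^sup>+\<theta>. ennreal (norm (H (\<theta>, s))) \<partial>P \<partial>\<delta>)"
      by (rule PD.nn_integral_snd[symmetric]) measurable
    also have "\<dots> = (\<integral>\<^sup>+s. ennreal (proj_density (CARD('n) - 1) s) * (\<integral>\<^sup>+\<theta>. ennreal (norm (H (\<theta>, s))) \<partial>P) \<partial>lborel)"
      unfolding \<delta>_def by (rule nn_integral_density) measurable
    also have "\<dots> < \<infinity>" using fin by (simp add: H_def P_def cap_nn_0[OF \<omega>])
    finally show "(\<integral>\<^sup>+z. ennreal (norm (H z)) \<partial>(P \<Otimes>\<^sub>M \<delta>)) < \<infinity>" .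
  qed measurable
  \<comment> \<open>Scaling by \<open>r > 0\<close> and passing to a measure with a density both
    preserve null sets, so the exceptional set remains negligible.\<close>
  have AE1: "AE z in P \<Otimes>\<^sub>M \<delta>. (fst z, r * snd z) \<notin> Z"
  proof (rule PD.AE_pair_measure)
    show "{z \<in> space (P \<Otimes>\<^sub>M \<delta>). (fst z, r * snd z) \<notin> Z} \<in> sets (P \<Otimes>\<^sub>M \<delta>)" by measurable
    show "AE \<theta> in P. AE s in \<delta>. (fst (\<theta>, s), r * snd (\<theta>, s)) \<notin> Z"
      unfolding P_def using null
    proof eventually_elim
      fix \<theta> :: "real^'n" assume "AE t in lborel. (\<theta>, t) \<notin> Z"
      then have "AE s in lborel. (\<theta>, 0 + r * s) \<notin> Z"
        using r by (intro AE_borel_affine[of r "\<lambda>t. (\<theta>, t) \<notin> Z" 0]) auto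
      then show "AE s in \<delta>. (fst (\<theta>, s), r * snd (\<theta>, s)) \<notin> Z"
        unfolding \<delta>_def by (subst AE_density) (auto elim: eventually_mono)
    qed
  qed
  have AE2: "AE z in P \<Otimes>\<^sub>M P. (fst z, r * (fst z \<bullet> snd z)) \<notin> Z"
  proof -
    have "AE z in distr (P \<Otimes>\<^sub>M P) (borel \<Otimes>\<^sub>M borel) (\<lambda>(\<theta>, y). (\<theta>, \<theta> \<bullet> y)). (fst z, r * snd z) \<notin> Z"
      unfolding law by (rule AE1)
    from AE_distrD[OF _ this] show ?thesis by (simp add: split_beta')
  qed
  \<comment> \<open>The dual Radon transform integrates over \<theta> for a given \<open>y\<close>,
    so the null sets are needed in the opposite order from the one in which they arise.\<close>
  have AE3: "AE y in P. AE \<theta> in P. (\<theta>, r * (\<theta> \<bullet> y)) \<notin> Z"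
  proof -
    have "AE \<theta> in P. AE y in P. (\<theta>, r * (\<theta> \<bullet> y)) \<notin> Z" using PP.AE_pair[OF AE2] by simp
    then show ?thesis by (subst PP.AE_commute[symmetric]) auto
  qed
  have dR: "dual_Radon \<phi> \<omega> (r *\<^sub>R y) = (\<integral>\<theta>. H (\<theta>, \<theta> \<bullet> y) \<partial>P)" if "AE \<theta> in P. (\<theta>, r * (\<theta> \<bullet> y)) \<notin> Z" for y
    unfolding dual_Radon_def P_def
  proof (rule integral_perp_sphere_measure[OF \<omega>])
    show "AE x in perp_measure \<omega>. norm x = 1 \<and> x \<bullet> \<omega> = 0 \<longrightarrow> \<phi> (x, x \<bullet> r *\<^sub>R y) = H (x, x \<bullet> y)"
      using that unfolding P_def by eventually_elim (simp add: H_def eq)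
  qed measurable
  have Pd: "P = distr (haar \<omega>) borel (\<lambda>A. A *v unit_perp \<omega>)" by (simp add: P_def perp_measure_def)
  have mm: "(\<lambda>A. A *v unit_perp \<omega>) \<in> measurable (haar \<omega>) borel" by measurable
  have AE4: "AE A in haar \<omega>. AE \<theta> in P. (\<theta>, r * (\<theta> \<bullet> (A *v unit_perp \<omega>))) \<notin> Z"
  proof (rule AE_distrD[OF mm])
    show "AE y in distr (haar \<omega>) borel (\<lambda>A. A *v unit_perp \<omega>). AE \<theta> in P. (\<theta>, r * (\<theta> \<bullet> y)) \<notin> Z"
      unfolding Pd[symmetric] by (rule AE3)
  qed
  have up: "(SOME u. norm u = 1 \<and> u \<bullet> \<omega> = 0) = unit_perp \<omega>" by (simp add: unit_perp_def)
  have [measurable]: "stabilizer \<omega> \<in> sets borel" by (rule sets_stabilizer)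
  have "mean_value \<omega> (dual_Radon \<phi>) r = (\<integral>A. dual_Radon \<phi> \<omega> (r *\<^sub>R (A *v unit_perp \<omega>)) \<partial>haar_measure \<omega>)"
    unfolding mean_value_def Let_def up ..
  also have "\<dots> = (\<integral>A. (\<integral>\<theta>. H (\<theta>, \<theta> \<bullet> (A *v unit_perp \<omega>)) \<partial>P) \<partial>haar \<omega>)"
    unfolding w.haar_measure_eq
  proof (rule completion_restrict_transfer(1))
    show "AE A in haar \<omega>. A \<in> stabilizer \<omega> \<longrightarrow> dual_Radon \<phi> \<omega> (r *\<^sub>R (A *v unit_perp \<omega>)) = (\<integral>\<theta>. H (\<theta>, \<theta> \<bullet> (A *v unit_perp \<omega>)) \<partial>P)"
      using AE4 by eventually_elim (simp add: dR)
    show "(\<lambda>A. \<integral>\<theta>. H (\<theta>, \<theta> \<bullet> (A *v unit_perp \<omega>)) \<partial>P) \<in> borel_measurable borel" by measurable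
  qed (use w.AE_haar in auto)
  also have "\<dots> = (\<integral>y. (\<integral>\<theta>. H (\<theta>, \<theta> \<bullet> y) \<partial>P) \<partial>distr (haar \<omega>) borel (\<lambda>A. A *v unit_perp \<omega>))"
    by (rule integral_distr[symmetric, OF mm]) measurable
  also have "\<dots> = (\<integral>y. (\<integral>\<theta>. H (\<theta>, \<theta> \<bullet> y) \<partial>P) \<partial>P)" unfolding Pd[symmetric] ..
  also have "\<dots> = (\<integral>z. H (fst z, fst z \<bullet> snd z) \<partial>(P \<Otimes>\<^sub>M P))"
  proof -
    have "integrable (distr (P \<Otimes>\<^sub>M P) (borel \<Otimes>\<^sub>M borel) (\<lambda>(\<theta>, y). (\<theta>, \<theta> \<bullet> y))) H" unfolding law by (rule Hint)
    then have "integrable (P \<Otimes>\<^sub>M P) (\<lambda>(\<theta>, y). H (\<theta>, \<theta> \<bullet> y))"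
      by (subst (asm) integrable_distr_eq) (auto simp: split_beta')
    from PP.integral_snd[OF this] show ?thesis by (simp add: split_beta')
  qed
  also have "\<dots> = (\<integral>z. H z \<partial>(P \<Otimes>\<^sub>M \<delta>))"
    unfolding law[symmetric] by (subst integral_distr) (auto simp: split_beta')
  also have "\<dots> = (\<integral>s. (\<integral>\<theta>. H (\<theta>, s) \<partial>P) \<partial>\<delta>)"
    using PD.integral_snd[of "\<lambda>\<theta> s. H (\<theta>, s)"] Hint by simp
  also have "\<dots> = (\<integral>v. proj_density (CARD('n) - 1) v * (\<integral>\<theta>. H (\<theta>, v) \<partial>P) \<partial>lborel)"
    unfolding \<delta>_def by (subst integral_density) (use card_ge_3 in \<open>auto intro!: AE_I2 proj_density_nonneg\<close>)
  also have "\<dots> = (\<integral>v. proj_density (CARD('n) - 1) v * cap_mean 0 (\<lambda>x. \<phi>' (x, r * v)) \<omega> \<partial>lborel)"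
    by (simp add: H_def P_def cap_mean_0[OF \<omega>])
  finally show ?thesis .
qed

end

section \<open>The Erdelyi-Kober derivative of an almost everywhere representation\<close>

text \<open>For even \<open>n\<close> the derivative acts on \<open>F\<close> directly, so the
  representation is needed at every radius; then \<open>n \<ge> 4\<close> and \<open>F4\<close>
  applies. For odd \<open>n\<close> the integral of order 1/2 is taken first, which sees
  \<open>F\<close> only up to null sets and raises the order n/2 - 1 to the integer (n -
  1)/2.\<close>

lemma EK_deriv_eq:
  assumes n: "n \<ge> 3" and [measurable]: "\<psi> \<in> borel_measurable borel"
    and int: "integrable lborel (\<lambda>t. indicator {0<..<R} t * \<psi> t)"
    and F: "AE r in lborel. 0 < r \<and> r < R \<longrightarrow> F r = EK_integral (real n / 2 - 1) (\<lambda>t. \<psi> t / t) r"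
    and F4: "\<And>r. n \<ge> 4 \<Longrightarrow> 0 < r \<Longrightarrow> r < R \<Longrightarrow> F r = EK_integral (real n / 2 - 1) (\<lambda>t. \<psi> t / t) r"
    and t: "0 < t" "t < R" and D: "(primitive \<psi> has_real_derivative \<psi> t) (at t)"
  shows "EK_differentiable n F t" "t * EK_deriv n F t = \<psi> t"
proof -
  define \<eta> where "\<eta> t = \<psi> t / t" for t
  have \<eta>: "\<eta> \<in> borel_measurable borel" unfolding \<eta>_def[abs_def] by measurable
  have e: "indicator {0<..<R} v * (\<eta> v * v) = indicator {0<..<R} v * \<psi> v" for v R :: real
    by (auto simp: \<eta>_def indicator_def)
  have i: "integrable lborel (\<lambda>v. indicator {0<..<R} v * (\<eta> v * v))" unfolding e by (rule int)
  have "primitive (\<lambda>v. \<eta> v * v) = primitive \<psi>" unfolding primitive_def[abs_def] e ..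
  then have D': "(primitive (\<lambda>v. \<eta> v * v) has_real_derivative \<eta> t * t) (at t)" using D t by (simp add: \<eta>_def)
  have "EK_differentiable n F t \<and> t * EK_deriv n F t = \<psi> t"
  proof (cases "even n")
    case True
    define k where "k = n div 2 - 1"
    have n4: "n \<ge> 4" using True n by (cases "n = 3") auto
    then have k: "k \<ge> 1" "real k = real n / 2 - 1" using True by (auto simp: k_def of_nat_diff real_of_nat_div)
    have Fk: "F r = EK_integral (real k) \<eta> r" if "0 < r" "r < R" for r
      unfolding k \<eta>_def[abs_def] by (rule F4[OF n4 that])
    show ?thesis using sq_deriv_EK_integral[OF \<eta> i Fk k(1) t D'] True t
      by (simp add: EK_differentiable_def EK_deriv_def k_def[symmetric] \<eta>_def)
  next
    case False
    define k where "k = (n - 1) div 2"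
    have k: "k \<ge> 1" "1/2 + (real n / 2 - 1) = real k" using False n
      by (auto simp: k_def real_of_nat_div of_nat_diff field_simps)
    have Fk: "EK_integral (1/2) F r = EK_integral (real k) \<eta> r" if r: "0 < r" "r < R" for r
    proof -
      have "AE s in lborel. 0 < s \<and> s < r \<longrightarrow> F s = EK_integral (real n / 2 - 1) \<eta> s"
        using F by eventually_elim (use r in \<open>auto simp: \<eta>_def[abs_def]\<close>)
      then have "EK_integral (1/2) F r = EK_integral (1/2) (EK_integral (real n / 2 - 1) \<eta>) r"
        by (intro EK_integral_cong_AE AE_completion)
      also have "\<dots> = EK_integral (1/2 + (real n / 2 - 1)) \<eta> r"
        by (rule EK_integral_semigroup(3)[OF _ _ _ r(1) \<eta>]) (use n r integrable_primitive_mono[OF i, of r] in auto)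
      finally show ?thesis unfolding k(2) .
    qed
    show ?thesis using sq_deriv_EK_integral[OF \<eta> i Fk k(1) t D'] False t
      by (simp add: EK_differentiable_def EK_deriv_def k_def[symmetric] \<eta>_def)
  qed
  then show "EK_differentiable n F t" "t * EK_deriv n F t = \<psi> t" by auto
qed

section \<open>Measurability of differentiability and the exchange of null sets\<close>

lemma continuous_nonpos_from_rat:
  fixes f :: "real \<Rightarrow> real"
  assumes c: "continuous_on {a<..<b} f" and q: "\<And>q::rat. a < of_rat q \<Longrightarrow> of_rat q < b \<Longrightarrow> f (of_rat q) \<le> 0" and x: "a < x" "x < b"
  shows "f x \<le> 0"
proof (rule ccontr)
  assume nx: "\<not> f x \<le> 0"
  have "open (f -` {0<..} \<inter> {a<..<b})" by (rule continuous_open_preimage[OF c, of "{0<..}", unfolded Int_commute[of "{a<..<b}"]]) auto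
  moreover have "x \<in> f -` {0<..} \<inter> {a<..<b}" using nx x by auto
  ultimately obtain e where e: "e > 0" "\<And>y. dist y x < e \<Longrightarrow> y \<in> f -` {0<..} \<inter> {a<..<b}" unfolding open_dist by blast
  obtain q where q': "q \<in> \<rat>" "x < q" "q < x + e" using Rats_dense_in_real[of x "x + e"] e by auto
  then obtain p where p: "q = of_rat p" by (auto elim: Rats_cases)
  have "q \<in> f -` {0<..} \<inter> {a<..<b}" using q' by (intro e(2)) (auto simp: dist_real_def)
  then show False using q[of p] by (auto simp: p)
qed

text \<open>By continuity of \<open>P\<close> the difference quotients need testing only at rational
  increments, and with countable quantifiers the set of differentiability points becomes measurable.
  Multiplying out the increment removes the exception at 0 and keeps both sides continuous in
  it.\<close>

lemma has_real_derivative_iff_rat: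
  fixes P :: "real \<Rightarrow> real"
  assumes c: "continuous_on {0<..} P" and t: "t > 0"
  shows "(P has_real_derivative d) (at t) \<longleftrightarrow>
    (\<forall>m::nat. \<exists>k::nat. \<forall>q::rat. \<bar>of_rat q\<bar> < 1 / real (Suc k) \<longrightarrow> \<bar>P (t + of_rat q) - P t - of_rat q * d\<bar> \<le> \<bar>of_rat q\<bar> / real (Suc m))"
    (is "?L \<longleftrightarrow> ?R")
proof
  assume ?L
  then have lim: "((\<lambda>h. (P (t + h) - P t) / h) \<longlongrightarrow> d) (at 0)" by (simp add: DERIV_def)
  show ?R
  proof
    fix m :: nat
    have "\<forall>\<^sub>F h in at 0. dist ((P (t + h) - P t) / h) d < 1 / real (Suc m)" using tendstoD[OF lim, of "1 / real (Suc m)"] by simp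
    then obtain e where e: "e > 0" "\<And>h. h \<noteq> 0 \<Longrightarrow> dist h 0 < e \<Longrightarrow> dist ((P (t + h) - P t) / h) d < 1 / real (Suc m)"
      unfolding eventually_at by auto
    obtain k where k: "1 / real (Suc k) < e" using nat_approx_posE[OF e(1)] by blast
    have "\<bar>P (t + h) - P t - h * d\<bar> \<le> \<bar>h\<bar> / real (Suc m)" if "\<bar>h\<bar> < 1 / real (Suc k)" for h
    proof (cases "h = 0")
      case False
      have "\<bar>(P (t + h) - P t) / h - d\<bar> \<le> 1 / real (Suc m)" using e(2)[OF False] that k by (simp add: dist_real_def)
      then have "\<bar>h\<bar> * \<bar>(P (t + h) - P t) / h - d\<bar> \<le> \<bar>h\<bar> * (1 / real (Suc m))" by (rule mult_left_mono) simp
      moreover have "\<bar>h\<bar> * \<bar>(P (t + h) - P t) / h - d\<bar> = \<bar>P (t + h) - P t - h * d\<bar>"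
      proof -
        have "h * ((P (t + h) - P t) / h - d) = P (t + h) - P t - h * d" using False by (simp add: field_simps)
        then show ?thesis by (simp only: abs_mult[symmetric])
      qed
      ultimately show ?thesis by simp
    qed simp
    then show "\<exists>k::nat. \<forall>q::rat. \<bar>of_rat q\<bar> < 1 / real (Suc k) \<longrightarrow> \<bar>P (t + of_rat q) - P t - of_rat q * d\<bar> \<le> \<bar>of_rat q\<bar> / real (Suc m)" by blast
  qed
next
  assume R: ?R
  have "((\<lambda>h. (P (t + h) - P t) / h) \<longlongrightarrow> d) (at 0)"
  proof (rule tendstoI)
    fix e :: real assume "e > 0"
    then obtain m where m: "1 / real (Suc m) < e" using nat_approx_posE by blast
    obtain k where k: "\<And>q::rat. \<bar>of_rat q\<bar> < 1 / real (Suc k) \<Longrightarrow> \<bar>P (t + of_rat q) - P t - of_rat q * d\<bar> \<le> \<bar>of_rat q\<bar> / real (Suc m)"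
      using R by blast
    define b where "b = min t (1 / real (Suc k))"
    have b: "b > 0" using t by (simp add: b_def)
    have cP: "continuous_on {- b<..<b} (\<lambda>h. P (t + h))"
      by (rule continuous_on_compose2[OF c]) (auto intro!: continuous_intros simp: b_def)
    have le: "\<bar>P (t + h) - P t - h * d\<bar> - \<bar>h\<bar> / real (Suc m) \<le> 0" if "- b < h" "h < b" for h
    proof (rule continuous_nonpos_from_rat[of "- b" b _ h])
      show "continuous_on {- b<..<b} (\<lambda>h. \<bar>P (t + h) - P t - h * d\<bar> - \<bar>h\<bar> / real (Suc m))"
        by (intro continuous_intros cP) auto
      fix q :: rat assume "- b < of_rat q" "of_rat q < b"
      moreover have "b \<le> 1 / real (Suc k)" unfolding b_def by (rule min.cobounded2)
      ultimately have "\<bar>of_rat q\<bar> < 1 / real (Suc k)" by linarith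
      from k[OF this] show "\<bar>P (t + of_rat q) - P t - of_rat q * d\<bar> - \<bar>of_rat q\<bar> / real (Suc m) \<le> 0"
        by linarith
    qed (use that in auto)
    show "\<forall>\<^sub>F h in at 0. dist ((P (t + h) - P t) / h) d < e"
      unfolding eventually_at
    proof (intro exI[of _ b] conjI ballI impI b)
      fix h :: real assume h: "h \<noteq> 0 \<and> dist h 0 < b"
      have "\<bar>h\<bar> * \<bar>(P (t + h) - P t) / h - d\<bar> = \<bar>P (t + h) - P t - h * d\<bar>"
      proof -
        have "h * ((P (t + h) - P t) / h - d) = P (t + h) - P t - h * d" using h by (simp add: field_simps)
        then show ?thesis by (simp only: abs_mult[symmetric])
      qed
      also have "\<dots> \<le> \<bar>h\<bar> * (1 / real (Suc m))" using le[of h] h by (simp add: dist_real_def abs_less_iff)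
      finally have "\<bar>(P (t + h) - P t) / h - d\<bar> \<le> 1 / real (Suc m)" using h by (subst (asm) mult_le_cancel_left_pos) auto
      then show "dist ((P (t + h) - P t) / h) d < e" using m by (simp add: dist_real_def)
    qed
  qed
  then show ?L by (simp add: DERIV_def)
qed

text \<open>Lebesgue differentiation is a statement about almost every \<open>t\<close> for given
  \<open>x\<close>; Fubini turns it into one about almost every \<open>x\<close> for given
  \<open>t\<close>, once it is phrased through a measurable predicate.\<close>

lemma AE_primitive_has_derivative_swap:
  fixes \<psi> :: "'a \<Rightarrow> real \<Rightarrow> real"
  assumes M: "sigma_finite_measure M" and [measurable]: "(\<lambda>(x, t). \<psi> x t) \<in> borel_measurable (M \<Otimes>\<^sub>M borel)"
    and int: "AE x in M. \<forall>R::nat. integrable lborel (\<lambda>t. indicator {0<..<real R} t * \<psi> x t)"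
  shows "AE t in lborel. AE x in M. 0 < t \<longrightarrow> (primitive (\<psi> x) has_real_derivative \<psi> x t) (at t)"
proof -
  interpret M: sigma_finite_measure M by fact
  interpret MT: pair_sigma_finite M "lborel :: real measure" ..
  define D where "D x t \<longleftrightarrow> (0 < t \<longrightarrow> (\<forall>m::nat. \<exists>k::nat. \<forall>q::rat. \<bar>of_rat q\<bar> < 1 / real (Suc k) \<longrightarrow>
    \<bar>primitive (\<psi> x) (t + of_rat q) - primitive (\<psi> x) t - of_rat q * \<psi> x t\<bar> \<le> \<bar>of_rat q\<bar> / real (Suc m)))" for x t
  have P[measurable]: "(\<lambda>z. primitive (\<psi> (fst z)) (f z)) \<in> borel_measurable (M \<Otimes>\<^sub>M lborel)"
    if [measurable]: "f \<in> borel_measurable (M \<Otimes>\<^sub>M lborel)" for f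
    unfolding primitive_def by measurable
  have meas: "{z \<in> space (M \<Otimes>\<^sub>M lborel). D (fst z) (snd z)} \<in> sets (M \<Otimes>\<^sub>M lborel)"
    unfolding D_def by measurable
  \<comment> \<open>The rational criterion is equivalent to differentiability for continuous
    primitives, hence the integrability premise; \<open>D\<close> itself is measurable in all
    pairs.\<close>
  have eq: "D x t \<longleftrightarrow> (0 < t \<longrightarrow> (primitive (\<psi> x) has_real_derivative \<psi> x t) (at t))"
    if int: "\<forall>R::nat. integrable lborel (\<lambda>t. indicator {0<..<real R} t * \<psi> x t)" for x t
  proof -
    have "continuous_on (\<Union>R::nat. {0<..<real R}) (primitive (\<psi> x))"
      using continuous_on_primitive int by (intro continuous_on_open_UN) auto
    moreover have "(\<Union>R::nat. {0<..<real R}) = {0<..}" using reals_Archimedean2 by auto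
    ultimately show ?thesis unfolding D_def using has_real_derivative_iff_rat[of "primitive (\<psi> x)" t "\<psi> x t"] by simp
  qed
  have "AE x in M. AE t in lborel. D x t"
    using int
  proof eventually_elim
    fix x assume int: "\<forall>R::nat. integrable lborel (\<lambda>t. indicator {0<..<real R} t * \<psi> x t)"
    have "AE t in lborel. \<forall>R::nat. 0 < t \<and> t < real R \<longrightarrow> (primitive (\<psi> x) has_real_derivative \<psi> x t) (at t)"
      unfolding AE_all_countable using int by (intro allI AE_primitive_has_derivative) auto
    then show "AE t in lborel. D x t"
    proof eventually_elim
      fix t assume "\<forall>R::nat. 0 < t \<and> t < real R \<longrightarrow> (primitive (\<psi> x) has_real_derivative \<psi> x t) (at t)"
      then show "D x t" unfolding eq[OF int] using reals_Archimedean2[of t] by blast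
    qed
  qed
  then have "AE t in lborel. AE x in M. D x t" by (subst MT.AE_commute[OF meas, symmetric])
  then show ?thesis
  proof eventually_elim
    fix t assume "AE x in M. D x t"
    with int show "AE x in M. 0 < t \<longrightarrow> (primitive (\<psi> x) has_real_derivative \<psi> x t) (at t)"
      by eventually_elim (simp add: eq)
  qed
qed

section \<open>Recovery of the function\<close>

context sphere_dim
begin

text \<open>Local integrability speaks of a completed product measure over the sphere and says
  nothing about \<phi> off the sphere. The outcome is a Borel function on the full space and a Borel
  exceptional set that is null in \<open>t\<close> for almost every direction.\<close>

lemma borel_representative:
  fixes \<phi> :: "(real^'n) \<times> real \<Rightarrow> real"
  assumes li: "locally_integrable \<phi>"
  obtains \<phi>1 Z1 where "\<phi>1 \<in> borel_measurable (borel \<Otimes>\<^sub>M borel)" "Z1 \<in> sets (borel \<Otimes>\<^sub>M borel)"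
    "AE x in \<sigma>. AE t in lborel. (x, t) \<notin> Z1" "\<And>x t. norm x = 1 \<Longrightarrow> (x, t) \<notin> Z1 \<Longrightarrow> \<phi> (x, t) = \<phi>1 (x, t)"
    "\<And>R::nat. (\<integral>\<^sup>+x. \<integral>\<^sup>+t. indicator {- real R..real R} t * ennreal \<bar>\<phi>1 (x, t)\<bar> \<partial>lborel \<partial>\<sigma>) < \<infinity>"
proof -
  define S :: "(real^'n) set" where "S = sphere 0 1"
  have [measurable]: "S \<in> sets borel" by (simp add: S_def sphere_borel)
  have AES: "AE x in \<sigma>. x \<in> S" unfolding S_def by (rule AE_sphere)
  define A where "A = restrict_space \<sigma> S"
  have spA: "space A = S" by (simp add: A_def space_restrict_space)
  have SA: "S \<inter> space \<sigma> \<in> sets \<sigma>" by simp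
  have A: "prob_space A"
  proof (rule prob_spaceI)
    have "emeasure A (space A) = (\<integral>\<^sup>+x. indicator S x \<partial>\<sigma>)" unfolding spA by (simp add: A_def emeasure_restrict_space)
    also have "\<dots> = (\<integral>\<^sup>+x. 1 \<partial>\<sigma>)" by (rule nn_integral_cong_AE) (use AES in \<open>auto elim: eventually_mono\<close>)
    also have "\<dots> = 1" using zero.perp.emeasure_space_1 by simp
    finally show "emeasure A (space A) = 1" .
  qed
  interpret A: prob_space A by fact
  interpret AL: pair_sigma_finite A "lborel :: real measure" ..
  define K :: "nat \<Rightarrow> ((real^'n) \<times> real) set" where "K R = S \<times> {- real R..real R}" for R
  have int: "integrable (completion (A \<Otimes>\<^sub>M lborel)) (\<lambda>z. indicator (K R) z *\<^sub>R \<phi> z)" for R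
  proof (rule integrable_completion_pair[OF A lborel.sigma_finite_measure_axioms])
    have "compact (K R) \<and> K R \<subseteq> sphere 0 1 \<times> UNIV" unfolding K_def S_def by (auto intro!: compact_Times)
    then have "set_integrable (completion (sphere_measure \<Otimes>\<^sub>M lborel)) (K R) \<phi>" using li unfolding locally_integrable_def by blast
    then show "integrable (completion (completion A \<Otimes>\<^sub>M lborel)) (\<lambda>z. indicator (K R) z *\<^sub>R \<phi> z)"
      unfolding set_integrable_def sphere_measure_eq A_def S_def .
  qed
  \<comment> \<open>\<phi> is the pointwise limit of its truncations to the compact sets
    \<open>K R\<close>, each of which is integrable.\<close>
  have "\<phi> \<in> borel_measurable (completion (A \<Otimes>\<^sub>M lborel))"
  proof (rule borel_measurable_LIMSEQ_real)
    fix z assume "z \<in> space (completion (A \<Otimes>\<^sub>M (lborel :: real measure)))"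
    then obtain x t where z: "z = (x, t)" "x \<in> S" by (auto simp: space_pair_measure spA)
    obtain R0 :: nat where "\<bar>t\<bar> < real R0" using reals_Archimedean2 by blast
    then have "\<forall>\<^sub>F R in sequentially. indicator (K R) z *\<^sub>R \<phi> z = \<phi> z"
      by (intro eventually_sequentiallyI[of R0]) (auto simp: K_def z indicator_def)
    then show "(\<lambda>R. indicator (K R) z *\<^sub>R \<phi> z) \<longlonglongrightarrow> \<phi> z" by (rule tendsto_eventually)
  qed (rule borel_measurable_integrable[OF int])
  from completion_ex_borel_measurable_real[OF this] obtain g
    where g: "g \<in> borel_measurable (A \<Otimes>\<^sub>M lborel)" "AE z in A \<Otimes>\<^sub>M lborel. \<phi> z = g z" by blast
  note [measurable] = g(1)
  obtain Z0 where Z0: "{z \<in> space (A \<Otimes>\<^sub>M lborel). \<phi> z \<noteq> g z} \<subseteq> Z0" "emeasure (A \<Otimes>\<^sub>M lborel) Z0 = 0" "Z0 \<in> sets (A \<Otimes>\<^sub>M lborel)"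
    using AE_E[OF g(2)] by blast
  \<comment> \<open>A Borel retraction of the space onto the sphere: composing with it extends
    functions and sets from the sphere without changing them there.\<close>
  define p where "p z = (if norm (fst z) = 1 then fst z else e0, snd z)" for z :: "(real^'n) \<times> real"
  have p[measurable]: "p \<in> measurable (borel \<Otimes>\<^sub>M borel) (A \<Otimes>\<^sub>M lborel)"
    unfolding p_def[abs_def] A_def
    by (intro measurable_Pair measurable_restrict_space2) (auto simp: S_def norm_e0)
  have p1: "p (x, t) = (x, t)" if "norm x = 1" for x t using that by (simp add: p_def)
  define Z1 where "Z1 = p -` Z0"
  define \<phi>1 where "\<phi>1 z = g (p z)" for z
  show ?thesis
  proof
    show \<phi>1[measurable]: "\<phi>1 \<in> borel_measurable (borel \<Otimes>\<^sub>M borel)" unfolding \<phi>1_def[abs_def] by measurable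
    show "Z1 \<in> sets (borel \<Otimes>\<^sub>M borel)" using measurable_sets[OF p Z0(3)] by (simp add: Z1_def space_pair_measure)
    have "AE z in A \<Otimes>\<^sub>M lborel. z \<notin> Z0" using Z0(2,3) by (intro AE_not_in) auto
    then have "AE x in A. AE t in lborel. (x, t) \<notin> Z0" by (rule AL.AE_pair)
    then have "AE x in \<sigma>. x \<in> S \<longrightarrow> (AE t in lborel. (x, t) \<notin> Z0)" unfolding A_def by (subst (asm) AE_restrict_space_iff) auto
    with AES show "AE x in \<sigma>. AE t in lborel. (x, t) \<notin> Z1"
      by eventually_elim (simp add: Z1_def p1 S_def)
    show "\<phi> (x, t) = \<phi>1 (x, t)" if "norm x = 1" "(x, t) \<notin> Z1" for x t
    proof (rule ccontr)
      assume "\<phi> (x, t) \<noteq> \<phi>1 (x, t)"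
      then have "(x, t) \<in> Z0"
        using that(1) by (intro subsetD[OF Z0(1)]) (simp add: \<phi>1_def p1 space_pair_measure spA S_def)
      then show False using that by (simp add: Z1_def p1)
    qed
    fix R :: nat
    have "integrable (completion (A \<Otimes>\<^sub>M lborel)) (\<lambda>z. indicator (K R) z *\<^sub>R g z)"
    proof (rule integrable_completion_cong_AE[OF _ int[of R]])
      show "AE z in completion (A \<Otimes>\<^sub>M lborel). indicator (K R) z *\<^sub>R \<phi> z = indicator (K R) z *\<^sub>R g z"
        using AE_completion[OF g(2)] by eventually_elim simp
    qed
    moreover have Km: "K R \<in> sets (A \<Otimes>\<^sub>M lborel)" unfolding K_def using sets.top[of A] by (intro pair_measureI) (auto simp: spA)
    then have [measurable]: "(\<lambda>z. indicator (K R) z *\<^sub>R g z) \<in> borel_measurable (A \<Otimes>\<^sub>M lborel)" by (intro borel_measurable_scaleR borel_measurable_indicator g(1))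
    ultimately have "integrable (A \<Otimes>\<^sub>M lborel) (\<lambda>z. indicator (K R) z *\<^sub>R g z)" by (simp add: integrable_completion)
    then have "(\<integral>\<^sup>+z. ennreal (norm (indicator (K R) z *\<^sub>R g z)) \<partial>(A \<Otimes>\<^sub>M lborel)) < \<infinity>" by (simp add: integrable_iff_bounded)
    also have "(\<integral>\<^sup>+z. ennreal (norm (indicator (K R) z *\<^sub>R g z)) \<partial>(A \<Otimes>\<^sub>M lborel)) = (\<integral>\<^sup>+x. \<integral>\<^sup>+t. ennreal (norm (indicator (K R) (x, t) *\<^sub>R g (x, t))) \<partial>lborel \<partial>A)"
      by (rule lborel.nn_integral_fst[symmetric]) measurable
    also have "\<dots> = (\<integral>\<^sup>+x. (\<integral>\<^sup>+t. ennreal (norm (indicator (K R) (x, t) *\<^sub>R g (x, t))) \<partial>lborel) * indicator S x \<partial>\<sigma>)"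
      unfolding A_def by (rule nn_integral_restrict_space[OF SA])
    also have "\<dots> = (\<integral>\<^sup>+x. \<integral>\<^sup>+t. indicator {- real R..real R} t * ennreal \<bar>\<phi>1 (x, t)\<bar> \<partial>lborel \<partial>\<sigma>)"
    proof (rule nn_integral_cong_AE)
      show "AE x in \<sigma>. (\<integral>\<^sup>+t. ennreal (norm (indicator (K R) (x, t) *\<^sub>R g (x, t))) \<partial>lborel) * indicator S x =
        (\<integral>\<^sup>+t. indicator {- real R..real R} t * ennreal \<bar>\<phi>1 (x, t)\<bar> \<partial>lborel)"
        using AES
      proof eventually_elim
        fix x assume x: "x \<in> S"
        have "ennreal (norm (indicator (K R) (x, t) *\<^sub>R g (x, t))) = indicator {- real R..real R} t * ennreal \<bar>\<phi>1 (x, t)\<bar>" for t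
          using x by (auto simp: K_def \<phi>1_def p1 S_def indicator_def)
        then show "(\<integral>\<^sup>+t. ennreal (norm (indicator (K R) (x, t) *\<^sub>R g (x, t))) \<partial>lborel) * indicator S x =
          (\<integral>\<^sup>+t. indicator {- real R..real R} t * ennreal \<bar>\<phi>1 (x, t)\<bar> \<partial>lborel)" using x by simp
      qed
    qed
    finally show "(\<integral>\<^sup>+x. \<integral>\<^sup>+t. indicator {- real R..real R} t * ennreal \<bar>\<phi>1 (x, t)\<bar> \<partial>lborel \<partial>\<sigma>) < \<infinity>" .
  qed
qed

lemma distr_sphere_neg: "distr \<sigma> borel uminus = \<sigma>"
proof (rule distr_eqI_nn_integral)
  fix f :: "real^'n \<Rightarrow> ennreal" assume [measurable]: "f \<in> borel_measurable borel"
  define B :: "real^'n^'n" where "B = - mat 1"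
  have Bv: "B *v x = - (mat 1 *v x)" for x
    by (simp add: B_def matrix_vector_mult_def vec_eq_iff sum_negf)
  have "transpose B ** B = transpose (mat 1) ** mat 1"
    by (simp add: B_def matrix_matrix_mult_def transpose_def vec_eq_iff)
  then have "orthogonal_matrix B" by (simp add: orthogonal_matrix)
  then show "(\<integral>\<^sup>+x. f (- x) \<partial>\<sigma>) = (\<integral>\<^sup>+x. f x \<partial>\<sigma>)"
    using zero.perp_inv[OF zero_stab, of B f] by (simp add: Bv)
qed auto

text \<open>The symmetries are needed at every point, because they are used on subspheres of measure
  zero. Averaging over the four sign changes achieves this, and off the union \<open>Z\<close> of
  the four images of the exceptional set the symmetry of \<phi> shows that nothing has
  changed.\<close>

lemma symmetric_borel_representative:
  fixes \<phi> :: "(real^'n) \<times> real \<Rightarrow> real"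
  assumes li: "locally_integrable \<phi>"
    and sym: "\<And>\<theta> t. norm \<theta> = 1 \<Longrightarrow> \<phi> (\<theta>, t) = \<phi> (\<theta>, -t) \<and> \<phi> (\<theta>, -t) = \<phi> (-\<theta>, t)"
  obtains \<phi>' Z where "\<phi>' \<in> borel_measurable (borel \<Otimes>\<^sub>M borel)" "Z \<in> sets (borel \<Otimes>\<^sub>M borel)"
    "AE x in \<sigma>. AE t in lborel. (x, t) \<notin> Z" "\<And>x t. norm x = 1 \<Longrightarrow> (x, t) \<notin> Z \<Longrightarrow> \<phi> (x, t) = \<phi>' (x, t)"
    "\<And>R::nat. (\<integral>\<^sup>+x. \<integral>\<^sup>+t. indicator {- real R..real R} t * ennreal \<bar>\<phi>' (x, t)\<bar> \<partial>lborel \<partial>\<sigma>) < \<infinity>"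
    "\<And>x t. \<phi>' (x, - t) = \<phi>' (x, t)" "\<And>x t. \<phi>' (- x, t) = \<phi>' (x, t)"
proof -
  obtain \<phi>1 Z1 where m[measurable]: "\<phi>1 \<in> borel_measurable (borel \<Otimes>\<^sub>M borel)" "Z1 \<in> sets (borel \<Otimes>\<^sub>M borel)"
    and ae: "AE x in \<sigma>. AE t in lborel. (x, t) \<notin> Z1" and eq: "\<And>x t. norm x = 1 \<Longrightarrow> (x, t) \<notin> Z1 \<Longrightarrow> \<phi> (x, t) = \<phi>1 (x, t)"
    and fin: "\<And>R::nat. (\<integral>\<^sup>+x. \<integral>\<^sup>+t. indicator {- real R..real R} t * ennreal \<bar>\<phi>1 (x, t)\<bar> \<partial>lborel \<partial>\<sigma>) < \<infinity>"
    using borel_representative[OF li] by blast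
  define Z where "Z = {z. (fst z, snd z) \<in> Z1 \<or> (fst z, - snd z) \<in> Z1 \<or> (- fst z, snd z) \<in> Z1 \<or> (- fst z, - snd z) \<in> Z1}"
  define \<phi>' where "\<phi>' z = (\<phi>1 (fst z, snd z) + \<phi>1 (fst z, - snd z) + \<phi>1 (- fst z, snd z) + \<phi>1 (- fst z, - snd z)) / 4" for z
  have neg_t: "AE t in lborel. P (- t)" if "AE t in (lborel :: real measure). P t" for P
  proof (rule AE_distrD[of uminus lborel borel P])
    show "AE t in distr lborel borel uminus. P t" unfolding lborel_distr_uminus by (rule that)
  qed simp
  have neg_x: "AE x in \<sigma>. P (- x)" if "AE x in \<sigma>. P x" for P
  proof (rule AE_distrD[of uminus \<sigma> borel P])
    show "AE x in distr \<sigma> borel uminus. P x" unfolding distr_sphere_neg by (rule that)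
  qed simp
  have ae': "AE x in \<sigma>. AE t in lborel. (x, t) \<notin> Z"
    using ae neg_x[OF ae]
  proof eventually_elim
    fix x assume 1: "AE t in lborel. (x, t) \<notin> Z1" and 2: "AE t in lborel. (- x, t) \<notin> Z1"
    show "AE t in lborel. (x, t) \<notin> Z"
      using 1 neg_t[OF 1] 2 neg_t[OF 2] by eventually_elim (simp add: Z_def)
  qed
  have eq': "\<phi>1 (x, t) = \<phi>' (x, t) \<and> \<phi> (x, t) = \<phi>' (x, t)" if x: "norm x = 1" and z: "(x, t) \<notin> Z" for x t
  proof -
    have x': "norm (- x) = 1" using x by simp
    have "(x, t) \<notin> Z1" "(x, - t) \<notin> Z1" "(- x, t) \<notin> Z1" "(- x, - t) \<notin> Z1" using z by (simp_all add: Z_def)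
    note e = eq[OF x this(1)] eq[OF x this(2)] eq[OF x' this(3)] eq[OF x' this(4)]
    have "\<phi>1 (x, - t) = \<phi>1 (x, t)" "\<phi>1 (- x, t) = \<phi>1 (x, t)" "\<phi>1 (- x, - t) = \<phi>1 (x, t)"
      using e sym[OF x, of t] sym[OF x', of t] by linarith+
    then have "\<phi>' (x, t) = \<phi>1 (x, t)" by (simp add: \<phi>'_def)
    then show ?thesis using e(1) by simp
  qed
  show ?thesis
  proof
    show [measurable]: "\<phi>' \<in> borel_measurable (borel \<Otimes>\<^sub>M borel)" unfolding \<phi>'_def[abs_def] by measurable
    have "Measurable.pred (borel \<Otimes>\<^sub>M borel) (\<lambda>z. z \<in> Z)" unfolding Z_def mem_Collect_eq by measurable
    then show "Z \<in> sets (borel \<Otimes>\<^sub>M borel)" by (simp add: pred_def space_pair_measure)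
    fix R :: nat
    have "(\<integral>\<^sup>+x. \<integral>\<^sup>+t. indicator {- real R..real R} t * ennreal \<bar>\<phi>' (x, t)\<bar> \<partial>lborel \<partial>\<sigma>) =
      (\<integral>\<^sup>+x. \<integral>\<^sup>+t. indicator {- real R..real R} t * ennreal \<bar>\<phi>1 (x, t)\<bar> \<partial>lborel \<partial>\<sigma>)"
    proof (rule nn_integral_cong_AE)
      show "AE x in \<sigma>. (\<integral>\<^sup>+t. indicator {- real R..real R} t * ennreal \<bar>\<phi>' (x, t)\<bar> \<partial>lborel) =
        (\<integral>\<^sup>+t. indicator {- real R..real R} t * ennreal \<bar>\<phi>1 (x, t)\<bar> \<partial>lborel)"
        using ae' zero.AE_perp
      proof eventually_elim
        fix x :: "real^'n" assume x: "AE t in lborel. (x, t) \<notin> Z" "norm x = 1 \<and> x \<bullet> 0 = 0"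
        show "(\<integral>\<^sup>+t. indicator {- real R..real R} t * ennreal \<bar>\<phi>' (x, t)\<bar> \<partial>lborel) =
          (\<integral>\<^sup>+t. indicator {- real R..real R} t * ennreal \<bar>\<phi>1 (x, t)\<bar> \<partial>lborel)"
          using x(1) by (intro nn_integral_cong_AE, eventually_elim) (use x(2) eq' in simp)
      qed
    qed
    then show "(\<integral>\<^sup>+x. \<integral>\<^sup>+t. indicator {- real R..real R} t * ennreal \<bar>\<phi>' (x, t)\<bar> \<partial>lborel \<partial>\<sigma>) < \<infinity>" using fin by simp
    show "\<phi>' (x, - t) = \<phi>' (x, t)" "\<phi>' (- x, t) = \<phi>' (x, t)" for x t by (simp_all add: \<phi>'_def)
  qed (use ae' eq' in auto)
qed

text \<open>For almost every \<open>t\<close> the Erdelyi-Kober derivative times \<open>t\<close>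
  equals the Funk transform \<psi> of the representative at almost every \<omega>, and the Funk
  inversion is applied to this slice. The powers of \<open>r\<close> and the Gamma factor in \<Phi>
  cancel those of the mean value.\<close>

lemma inverse_Funk_EK_recovery:
  fixes \<phi> :: "(real^'n) \<times> real \<Rightarrow> real" and \<Phi> :: "real^'n \<Rightarrow> real \<Rightarrow> real"
  assumes li: "locally_integrable \<phi>"
    and sym: "\<And>\<theta> t. norm \<theta> = 1 \<Longrightarrow> \<phi> (\<theta>, t) = \<phi> (\<theta>, -t) \<and> \<phi> (\<theta>, -t) = \<phi> (-\<theta>, t)"
    and \<Phi>: "\<And>\<omega> r. norm \<omega> = 1 \<Longrightarrow> r > 0 \<Longrightarrow>
      \<Phi> \<omega> r = r ^ (CARD('n) - 3) * pi powr (1/2) / Gamma ((real CARD('n) - 1) / 2) * mean_value \<omega> (dual_Radon \<phi>) r"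
  shows "has_inverse_Funk_EK \<Phi> \<phi>"
proof -
  define n where "n = CARD('n)"
  have n: "n \<ge> 3" using card_ge_3 by (simp add: n_def)
  interpret sl: pair_sigma_finite "perp_measure (0::real^'n)" "lborel :: real measure" ..
  obtain \<phi>' Z where m[measurable]: "\<phi>' \<in> borel_measurable (borel \<Otimes>\<^sub>M borel)" and Z[measurable]: "Z \<in> sets (borel \<Otimes>\<^sub>M borel)"
    and ae: "AE x in \<sigma>. AE t in lborel. (x, t) \<notin> Z" and eq: "\<And>x t. norm x = 1 \<Longrightarrow> (x, t) \<notin> Z \<Longrightarrow> \<phi> (x, t) = \<phi>' (x, t)"
    and fin: "\<And>R::nat. (\<integral>\<^sup>+x. \<integral>\<^sup>+t. indicator {- real R..real R} t * ennreal \<bar>\<phi>' (x, t)\<bar> \<partial>lborel \<partial>\<sigma>) < \<infinity>"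
    and even_t: "\<And>x t. \<phi>' (x, - t) = \<phi>' (x, t)" and even_x: "\<And>x t. \<phi>' (- x, t) = \<phi>' (x, t)"
    using symmetric_borel_representative[OF li sym] by blast
  define \<psi> where "\<psi> \<omega> t = cap_mean 0 (\<lambda>x. \<phi>' (x, t)) \<omega>" for \<omega> t
  define q where "q \<omega> t = cap_nn 0 (\<lambda>x. ennreal \<bar>\<phi>' (x, t)\<bar>) \<omega>" for \<omega> t
  have \<psi>m[measurable]: "(\<lambda>(\<omega>, t). \<psi> \<omega> t) \<in> borel_measurable (borel \<Otimes>\<^sub>M borel)"
    unfolding \<psi>_def[abs_def] cap_mean_def by measurable
  have qm[measurable]: "(\<lambda>(\<omega>, t). q \<omega> t) \<in> borel_measurable (borel \<Otimes>\<^sub>M borel)"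
    unfolding q_def[abs_def] cap_nn_def by measurable
  have \<psi>1[measurable]: "\<psi> \<omega> \<in> borel_measurable borel" for \<omega> using measurable_Pair2[OF \<psi>m, of \<omega>] by simp
  have q1[measurable]: "q \<omega> \<in> borel_measurable borel" for \<omega> using measurable_Pair2[OF qm, of \<omega>] by simp
  have \<psi>q: "ennreal \<bar>\<psi> \<omega> t\<bar> \<le> q \<omega> t" for \<omega> t unfolding \<psi>_def q_def by (rule cap_mean_le_nn) measurable
  \<comment> \<open>A great subsphere is itself a null set, so negligibility of \<open>Z\<close> has
    to be inherited: the measure of the sections of \<open>Z\<close> integrates to 0 over almost
    every great subsphere, because the mean at level 0 preserves the integral.\<close>
  have null: "AE \<omega> in \<sigma>. norm \<omega> = 1 \<longrightarrow> (AE \<theta> in perp_measure \<omega>. AE t in lborel. (\<theta>, t) \<notin> Z)"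
  proof -
    define z where "z x = (\<integral>\<^sup>+t. indicator Z (x, t) \<partial>lborel)" for x
    have [measurable]: "z \<in> borel_measurable borel" unfolding z_def[abs_def] by measurable
    have z0: "z x = 0 \<longleftrightarrow> (AE t in lborel. (x, t) \<notin> Z)" for x
      unfolding z_def by (subst nn_integral_0_iff_AE) (auto simp: indicator_eq_0_iff)
    have "AE x in \<sigma>. z x = 0" using ae by (simp only: z0)
    then have "(\<integral>\<^sup>+x. z x \<partial>\<sigma>) = 0" by (subst nn_integral_0_iff_AE) auto
    then have "(\<integral>\<^sup>+\<omega>. cap_nn 0 z \<omega> \<partial>\<sigma>) = 0" by (subst nn_integral_cap_nn) auto
    then have "AE \<omega> in \<sigma>. cap_nn 0 z \<omega> = 0" by (subst (asm) nn_integral_0_iff_AE) auto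
    then show ?thesis
    proof eventually_elim
      fix \<omega> assume c: "cap_nn 0 z \<omega> = 0"
      show "norm \<omega> = 1 \<longrightarrow> (AE \<theta> in perp_measure \<omega>. AE t in lborel. (\<theta>, t) \<notin> Z)"
      proof
        assume \<omega>: "norm \<omega> = 1"
        then interpret w: axis_vec2 \<omega> by (intro axis_vec2I) simp
        have "(\<integral>\<^sup>+\<theta>. z \<theta> \<partial>perp_measure \<omega>) = 0" using c cap_nn_0[OF \<omega>, of z] by simp
        then have "AE \<theta> in perp_measure \<omega>. z \<theta> = 0" by (subst (asm) nn_integral_0_iff_AE) auto
        then show "AE \<theta> in perp_measure \<omega>. AE t in lborel. (\<theta>, t) \<notin> Z" by (simp only: z0)
      qed
    qed
  qed
  have qfin: "AE \<omega> in \<sigma>. \<forall>R::nat. (\<integral>\<^sup>+t. indicator {0<..<real R} t * q \<omega> t \<partial>lborel) < \<infinity>"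
    unfolding AE_all_countable
  proof
    fix R :: nat
    define J where "J x = (\<integral>\<^sup>+t. indicator {- real R..real R} t * ennreal \<bar>\<phi>' (x, t)\<bar> \<partial>lborel)" for x
    have [measurable]: "J \<in> borel_measurable borel" unfolding J_def[abs_def] by measurable
    have "AE \<omega> in \<sigma>. cap_nn 0 J \<omega> < \<infinity>" by (rule AE_cap_nn_finite) (use fin[of R] in \<open>simp_all add: J_def\<close>)
    then show "AE \<omega> in \<sigma>. (\<integral>\<^sup>+t. indicator {0<..<real R} t * q \<omega> t \<partial>lborel) < \<infinity>"
    proof eventually_elim
      fix \<omega> assume c: "cap_nn 0 J \<omega> < \<infinity>"
      interpret rl: pair_sigma_finite "perp_measure (e0::real^'n)" "lborel :: real measure" ..
      have "(\<integral>\<^sup>+t. indicator {0<..<real R} t * q \<omega> t \<partial>lborel) \<le> (\<integral>\<^sup>+t. indicator {- real R..real R} t * q \<omega> t \<partial>lborel)"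
        by (intro nn_integral_mono mult_right_mono) (auto simp: indicator_def)
      also have "\<dots> = (\<integral>\<^sup>+t. \<integral>\<^sup>+\<zeta>. indicator {- real R..real R} t * ennreal \<bar>\<phi>' (cap_point 0 \<omega> \<zeta>, t)\<bar> \<partial>\<rho> \<partial>lborel)"
        unfolding q_def cap_nn_def by (subst nn_integral_cmult) auto
      also have "\<dots> = cap_nn 0 J \<omega>" unfolding J_def cap_nn_def by (rule rl.Fubini') measurable
      finally show "(\<integral>\<^sup>+t. indicator {0<..<real R} t * q \<omega> t \<partial>lborel) < \<infinity>" using c by simp
    qed
  qed
  have \<psi>int: "integrable lborel (\<lambda>t. indicator {0<..<R} t * \<psi> \<omega> t)" if "(\<integral>\<^sup>+t. indicator {0<..<R} t * q \<omega> t \<partial>lborel) < \<infinity>" for \<omega> R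
  proof (rule integrableI_bounded)
    have "(\<integral>\<^sup>+t. ennreal (norm (indicator {0<..<R} t * \<psi> \<omega> t)) \<partial>lborel) \<le> (\<integral>\<^sup>+t. indicator {0<..<R} t * q \<omega> t \<partial>lborel)"
      by (intro nn_integral_mono) (use \<psi>q in \<open>auto simp: indicator_def\<close>)
    then show "(\<integral>\<^sup>+t. ennreal (norm (indicator {0<..<R} t * \<psi> \<omega> t)) \<partial>lborel) < \<infinity>" using that by (rule le_less_trans)
  qed measurable
  have \<Phi>_eq: "\<Phi> \<omega> r = EK_integral (real n / 2 - 1) (\<lambda>t. \<psi> \<omega> t / t) r"
    if \<omega>: "norm \<omega> = 1" and r: "r > 0" and nl: "AE \<theta> in perp_measure \<omega>. AE t in lborel. (\<theta>, t) \<notin> Z"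
      and f: "(\<integral>\<^sup>+v. ennreal (proj_density (n - 1) v) * q \<omega> (r * v) \<partial>lborel) < \<infinity>" for \<omega> r
  proof -
    have "mean_value \<omega> (dual_Radon \<phi>) r = (\<integral>v. proj_density (n - 1) v * \<psi> \<omega> (r * v) \<partial>lborel)"
      unfolding n_def \<psi>_def by (rule mean_value_dual_Radon[OF \<omega> m Z eq nl r]) (use f in \<open>simp_all add: n_def q_def\<close>)
    also have "\<dots> = Gamma ((real n - 1) / 2) / sqrt pi / r ^ (n - 3) * EK_integral (real n / 2 - 1) (\<lambda>t. \<psi> \<omega> t / t) r"
      by (rule integral_proj_density_scaled[OF n \<psi>1 _ r]) (simp add: \<psi>_def even_t)
    finally have mv: "mean_value \<omega> (dual_Radon \<phi>) r = Gamma ((real n - 1) / 2) / sqrt pi / r ^ (n - 3) * EK_integral (real n / 2 - 1) (\<lambda>t. \<psi> \<omega> t / t) r" .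
    define G where "G = Gamma ((real n - 1) / 2)"
    have "G > 0" unfolding G_def using n by (intro Gamma_real_pos) auto
    then show ?thesis unfolding \<Phi>[OF \<omega> r] n_def[symmetric] mv G_def[symmetric] powr_half_sqrt[OF pi_ge_zero] using r by simp
  qed
  have deriv: "EK_differentiable n (\<Phi> \<omega>) t \<and> t * EK_deriv n (\<Phi> \<omega>) t = \<psi> \<omega> t"
    if \<omega>: "norm \<omega> = 1" and nl: "AE \<theta> in perp_measure \<omega>. AE t in lborel. (\<theta>, t) \<notin> Z"
      and f: "\<forall>R::nat. (\<integral>\<^sup>+t. indicator {0<..<real R} t * q \<omega> t \<partial>lborel) < \<infinity>"
      and t: "0 < t" and D: "(primitive (\<psi> \<omega>) has_real_derivative \<psi> \<omega> t) (at t)" for \<omega> t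
  proof -
    obtain R :: nat where R: "t < real R" using reals_Archimedean2 by blast
    have qe: "q \<omega> (- v) = q \<omega> v" for v by (simp add: q_def even_t)
    have fR: "(\<integral>\<^sup>+t. indicator {0<..<real R} t * q \<omega> t \<partial>lborel) < \<infinity>" using f by blast
    note F = proj_density_scaled_finite[OF n q1 qe fR]
    have F1: "AE r in lborel. 0 < r \<and> r < real R \<longrightarrow> \<Phi> \<omega> r = EK_integral (real n / 2 - 1) (\<lambda>t. \<psi> \<omega> t / t) r"
      using F(1) by eventually_elim (use \<Phi>_eq[OF \<omega> _ nl] in auto)
    have F2: "\<Phi> \<omega> r = EK_integral (real n / 2 - 1) (\<lambda>t. \<psi> \<omega> t / t) r" if "n \<ge> 4" "0 < r" "r < real R" for r
      using F(2)[of r] \<Phi>_eq[OF \<omega> _ nl] that by auto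
    show ?thesis using EK_deriv_eq[OF n \<psi>1 \<psi>int[OF fR] F1 F2 t R D] by auto
  qed
  \<comment> \<open>The remaining almost everywhere statements have \<open>t\<close> as the outer
    variable, as the inversion on a slice with \<open>t\<close> fixed requires.\<close>
  have "AE t in lborel. AE \<omega> in \<sigma>. 0 < t \<longrightarrow> (primitive (\<psi> \<omega>) has_real_derivative \<psi> \<omega> t) (at t)"
  proof (rule AE_primitive_has_derivative_swap[OF zero.perp.sigma_finite_measure_axioms])
    show "AE \<omega> in \<sigma>. \<forall>R::nat. integrable lborel (\<lambda>t. indicator {0<..<real R} t * \<psi> \<omega> t)"
      using qfin by eventually_elim (auto intro: \<psi>int)
  qed measurable
  moreover have "AE t in lborel. AE x in \<sigma>. (x, t) \<notin> Z"
  proof -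
    have "{z \<in> space (\<sigma> \<Otimes>\<^sub>M lborel). (fst z, snd z) \<notin> Z} \<in> sets (\<sigma> \<Otimes>\<^sub>M lborel)" by measurable
    from sl.AE_commute[of "\<lambda>x t. (x, t) \<notin> Z", OF this] ae show ?thesis by blast
  qed
  moreover have "AE t in lborel. \<forall>R::nat. (\<integral>\<^sup>+x. indicator {- real R..real R} t * ennreal \<bar>\<phi>' (x, t)\<bar> \<partial>\<sigma>) \<noteq> \<infinity>"
    unfolding AE_all_countable
  proof
    fix R :: nat
    have "(\<integral>\<^sup>+t. \<integral>\<^sup>+x. indicator {- real R..real R} t * ennreal \<bar>\<phi>' (x, t)\<bar> \<partial>\<sigma> \<partial>lborel) = (\<integral>\<^sup>+x. \<integral>\<^sup>+t. indicator {- real R..real R} t * ennreal \<bar>\<phi>' (x, t)\<bar> \<partial>lborel \<partial>\<sigma>)"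
      by (rule sl.Fubini') measurable
    also have "\<dots> \<noteq> \<infinity>" using fin[of R] by simp
    finally show "AE t in lborel. (\<integral>\<^sup>+x. indicator {- real R..real R} t * ennreal \<bar>\<phi>' (x, t)\<bar> \<partial>\<sigma>) \<noteq> \<infinity>"
      by (intro nn_integral_PInf_AE) measurable
  qed
  ultimately have "AE t in lborel. 0 < t \<longrightarrow> (AE \<omega> in sphere_measure. EK_differentiable n (\<Phi> \<omega>) t) \<and>
    has_inverse_Funk (\<lambda>\<omega>. t * EK_deriv n (\<Phi> \<omega>) t) (\<lambda>\<theta>. \<phi> (\<theta>, t))"
  proof eventually_elim
    fix t :: real
    assume D: "AE \<omega> in \<sigma>. 0 < t \<longrightarrow> (primitive (\<psi> \<omega>) has_real_derivative \<psi> \<omega> t) (at t)" and Zt: "AE x in \<sigma>. (x, t) \<notin> Z"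
      and I: "\<forall>R::nat. (\<integral>\<^sup>+x. indicator {- real R..real R} t * ennreal \<bar>\<phi>' (x, t)\<bar> \<partial>\<sigma>) \<noteq> \<infinity>"
    show "0 < t \<longrightarrow> (AE \<omega> in sphere_measure. EK_differentiable n (\<Phi> \<omega>) t) \<and> has_inverse_Funk (\<lambda>\<omega>. t * EK_deriv n (\<Phi> \<omega>) t) (\<lambda>\<theta>. \<phi> (\<theta>, t))"
    proof
      assume t: "0 < t"
      have good: "AE \<omega> in \<sigma>. norm \<omega> = 1 \<longrightarrow> EK_differentiable n (\<Phi> \<omega>) t \<and> t * EK_deriv n (\<Phi> \<omega>) t = \<psi> \<omega> t"
        using null qfin D by eventually_elim (use deriv t in blast)
      obtain R :: nat where R: "t < real R" using reals_Archimedean2 by blast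
      have it: "integrable \<sigma> (\<lambda>x. \<phi>' (x, t))"
        using I[rule_format, of R] t R by (intro integrableI_bounded) (auto simp: less_top)
      have "has_inverse_Funk (\<lambda>\<omega>. t * EK_deriv n (\<Phi> \<omega>) t) (\<lambda>\<theta>. \<phi> (\<theta>, t))"
      proof (rule has_inverse_Funk_cap_mean[of "\<lambda>x. \<phi>' (x, t)"])
        show "AE \<omega> in \<sigma>. norm \<omega> = 1 \<longrightarrow> t * EK_deriv n (\<Phi> \<omega>) t = cap_mean 0 (\<lambda>x. \<phi>' (x, t)) \<omega>"
          using good by eventually_elim (simp add: \<psi>_def)
        show "AE x in \<sigma>. norm x = 1 \<longrightarrow> \<phi> (x, t) = \<phi>' (x, t)" using Zt by eventually_elim (simp add: eq)
      qed (use it even_x in simp_all)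
      moreover have "AE \<omega> in sphere_measure. EK_differentiable n (\<Phi> \<omega>) t"
        unfolding AE_sphere_measure_iff using good by eventually_elim simp
      ultimately show "(AE \<omega> in sphere_measure. EK_differentiable n (\<Phi> \<omega>) t) \<and> has_inverse_Funk (\<lambda>\<omega>. t * EK_deriv n (\<Phi> \<omega>) t) (\<lambda>\<theta>. \<phi> (\<theta>, t))" by simp
    qed
  qed
  then show ?thesis unfolding has_inverse_Funk_EK_def n_def .
qed

end

theorem theorem4p3:
  fixes \<phi> :: "(real^'n) \<times> real \<Rightarrow> real" and \<Phi> :: "real^'n \<Rightarrow> real \<Rightarrow> real"
  assumes "CARD('n) \<ge> 3"
    and "locally_integrable \<phi>"
    and "\<And>\<theta> t. \<theta> \<in> sphere 0 1 \<Longrightarrow> \<phi> (\<theta>, t) = \<phi> (\<theta>, -t) \<and> \<phi> (\<theta>, -t) = \<phi> (-\<theta>, t)"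
    and "\<And>\<omega> r. \<omega> \<in> sphere 0 1 \<Longrightarrow> r > 0 \<Longrightarrow>
           \<Phi> \<omega> r = r ^ (CARD('n) - 3) * pi powr (1/2) / Gamma ((real CARD('n) - 1) / 2)
                     * mean_value \<omega> (dual_Radon \<phi>) r"
  shows "\<exists>G. has_inverse_Funk_EK \<Phi> G \<and>
           (AE (\<theta>, t) in sphere_measure \<Otimes>\<^sub>M lborel. t > 0 \<longrightarrow> \<phi> (\<theta>, t) = G (\<theta>, t))"
proof -
  interpret sphere_dim "TYPE('n)" by unfold_locales (rule assms(1))
  have "has_inverse_Funk_EK \<Phi> \<phi>"
  proof (rule inverse_Funk_EK_recovery[OF assms(2)])
    fix \<omega> :: "real^'n" and r :: real assume "norm \<omega> = 1" "r > 0"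
    then show "\<Phi> \<omega> r = r ^ (CARD('n) - 3) * pi powr (1/2) / Gamma ((real CARD('n) - 1) / 2) * mean_value \<omega> (dual_Radon \<phi>) r"
      by (intro assms(4)) simp_all
  next
    fix \<theta> :: "real^'n" and t :: real assume "norm \<theta> = 1"
    then show "\<phi> (\<theta>, t) = \<phi> (\<theta>, -t) \<and> \<phi> (\<theta>, -t) = \<phi> (-\<theta>, t)" by (intro assms(3)) simp
  qed
  \<comment> \<open>The limit in the inverse Funk transform is determined up to null sets, and
    \<phi> is one of its representatives, hence an admissible \<open>G\<close>.\<close>
  then show ?thesis by (intro exI[of _ \<phi>]) simp
qed

end
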